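(* $wU_q^{\tau}(\mathcal G)$ is a weak Hopf algebra if and only if $m=2,3$. Moreover, if $m=2,3$, then $wU_q^{\tau}(\mathcal G)$ is a noncommutative and noncocommutative weak Hopf algebra with the weak antipode $T$, but not a Hopf algebra.
   Context: **Cartan datum.** $I=\{1,\dots,n\}$ or $I$ is the set of positive integers. $A=(a_{ij})_{i,j\in I}$ is a Borcherds-Cartan matrix: $a_{ij}\in\mathbf Z$; $a_{ii}=2$ or $a_{ii}\le0$; $a_{ij}\le0$ for $i\ne j$; $a_{ij}=0$ if and only if $a_{ji}=0$. It is symmetrizable: there is $D=\mathrm{diag}\{s_i>0\mid i\in I\}$ with $DA$ symmetric. $\mathcal G$ is the associated generalized Kac-Moody algebra. $\mathbf K$ is a field of characteristic $0$, $q\in\mathbf K$, $q_i=q^{s_i}$, and $q_i\ne\pm1,0$ for all $i\in I$. Put $[k]_\nu=\frac{\nu^k-\nu^{-k}}{\nu-\nu^{-1}}$, $[k]!_\nu=[k]_\nu\cdots[1]_\nu$, $[0]!_\nu=1$, $\left[{k\atop r}\right]_\nu=\frac{[k]!_\nu}{[r]!_\nu[k-r]!_\nu}$, and let $\left[{k\atop r}\right]_i$ be its value at $\nu=q_i$. **The algebra $wU_q^\tau(\mathcal G)$.** Fix a positive integer $m$ and $\tau=(\{\kappa_i\}_{i\in I}\,|\,\{\kappa_i'\}_{i\in I})$, where $\kappa_i,\kappa_i'\in\{0,1\}$ are the types (zero or one) of $E_i$ and $F_i$ respectively. $wU_q^\tau(\mathcal G)$ is the associative $\mathbf K$-algebra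 with unit $1$ generated by $J$, $E_i,F_i,K_i,\bar K_i,D_i,\bar D_i$ ($i\in I$) with the following defining relations, for all $i,j\in I$: - $1\ne J^{m-1}=K_i\bar K_i=D_i\bar D_i$ (so $m\ge2$), $J^m=J$; - $J,K_i,\bar K_i,D_i,\bar D_i$ ($i\in I$) commute pairwise, and $XJ^{m-1}=X$ for $X=K_i,\bar K_i,D_i,\bar D_i$; - $E_i,F_i$ are of type $\tau$, that is: if $E_i$ is of type one, $K_jE_i=q_i^{a_{ij}}E_iK_j$ and $\bar K_jE_i=q_i^{-a_{ij}}E_i\bar K_j$; if $E_i$ is of type zero, $K_jE_i\bar K_j=q_i^{a_{ij}}E_i$; if $F_i$ is of type one, $K_jF_i=q_i^{-a_{ij}}F_iK_j$ and $\bar K_jF_i=q_i^{a_{ij}}F_i\bar K_j$; if $F_i$ is of type zero, $K_jF_i\bar K_j=q_i^{-a_{ij}}F_i$; - $E_iF_j-F_jE_i=\delta_{ij}\frac{K_i-\bar K_i}{q_i-q_i^{-1}}$; - $\sum_{r=0}^{1-a_{ij}}(-1)^r\left[{1-a_{ij}\atop r}\right]_iX_i^{1-a_{ij}-r}X_jX_i^r=0$ for $X=E$ and for $X=F$, if $a_{ii}=2$, $i\ne j$; - $E_iE_j-E_jE_i=F_iF_j-F_jF_i=0$ if $a_{ij}=0$. **Bialgebra structure.** $wU_q^\tau(\mathcal G)$ is taken with the comultiplication $\Delta$ and counit $\varepsilon$, algebra morphisms given by $\Delta(X)=X\otimes X$, $\varepsilon(X)=1$ for $X=J,K_i,\bar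 K_i,D_i,\bar D_i$; $\varepsilon(E_i)=\varepsilon(F_i)=0$; $\Delta(E_i)=1\otimes E_i+E_i\otimes K_i$ if $E_i$ is of type one, $\Delta(E_i)=J^{m-1}\otimes E_i+E_i\otimes K_i$ if $E_i$ is of type zero; $\Delta(F_i)=F_i\otimes1+\bar K_i\otimes F_i$ if $F_i$ is of type one, $\Delta(F_i)=F_i\otimes J^{m-1}+\bar K_i\otimes F_i$ if $F_i$ is of type zero. **The map $T$.** $T:wU_q^\tau(\mathcal G)\to wU_q^\tau(\mathcal G)$ is given on generators by $T(1)=1$, $T(J)=J$, $T(K_i)=\bar K_i$, $T(\bar K_i)=K_i$, $T(D_i)=\bar D_i$, $T(\bar D_i)=D_i$, $T(E_i)=-E_i\bar K_i$, $T(F_i)=-K_iF_i$, and extended as an anti-automorphism. **Weak Hopf algebra.** A bialgebra $H$ is called a weak Hopf algebra if there is an anti-automorphism $T$ of $H$ such that $\mathrm{id}_H*T*\mathrm{id}_H=\mathrm{id}_H$ and $T*\mathrm{id}_H*T=T$, where $*$ is the convolution product; such a $T$ is called a weak antipode.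
   Formalization: The equivalence says the given T is a weak antipode iff m=2,3, since for m≥4 another one exists (J to J^{m-2}); T is only an algebra anti-endomorphism, bijective if all types are zero, since it kills (1-J^{m-1})E_i for type one; for m=2,3 some bijective weak antipode is shown to exist. *)

theory Defs
  imports
    "HOL-Library.Poly_Mapping"
    "HOL-Computational_Algebra.Polynomial"
    "HOL-Computational_Algebra.Fraction_Field"
    "HOL-Algebra.QuotRing"
    "HOL-Algebra.Module"
begin

section \<open>Algebras over a field, not necessarily commutative\<close>

text \<open>The locale \<^locale>\<open>algebra\<close> of the library requires commutativity.  The ground field is a type
  of class \<^class>\<open>field\<close>; algebras are \<^type>\<open>module\<close> records with explicit carriers.\<close>

definition ground :: "('k::field, 'k) module" where
  "ground = \<lparr>carrier = UNIV, mult = (*), one = 1, zero = 0, add = (+), smult = (*)\<rparr>"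

definition k_algebra :: "('k::field, 'a, 'z) module_scheme \<Rightarrow> bool" where
  "k_algebra A \<longleftrightarrow> ring A \<and> Module.module (ground :: ('k, 'k) module) A \<and>
     (\<forall>c. \<forall>x\<in>carrier A. \<forall>y\<in>carrier A.
        (c \<odot>\<^bsub>A\<^esub> x) \<otimes>\<^bsub>A\<^esub> y = c \<odot>\<^bsub>A\<^esub> (x \<otimes>\<^bsub>A\<^esub> y) \<and>
        x \<otimes>\<^bsub>A\<^esub> (c \<odot>\<^bsub>A\<^esub> y) = c \<odot>\<^bsub>A\<^esub> (x \<otimes>\<^bsub>A\<^esub> y))"

definition k_linear ::
  "('k::field, 'a, 'y) module_scheme \<Rightarrow> ('k, 'b, 'z) module_scheme \<Rightarrow> ('a \<Rightarrow> 'b) \<Rightarrow> bool" where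
  "k_linear A B f \<longleftrightarrow> f \<in> carrier A \<rightarrow> carrier B \<and>
     (\<forall>x\<in>carrier A. \<forall>y\<in>carrier A. f (x \<oplus>\<^bsub>A\<^esub> y) = f x \<oplus>\<^bsub>B\<^esub> f y) \<and>
     (\<forall>c. \<forall>x\<in>carrier A. f (c \<odot>\<^bsub>A\<^esub> x) = c \<odot>\<^bsub>B\<^esub> f x)"

definition alg_hom ::
  "('k::field, 'a, 'y) module_scheme \<Rightarrow> ('k, 'b, 'z) module_scheme \<Rightarrow> ('a \<Rightarrow> 'b) \<Rightarrow> bool" where
  "alg_hom A B f \<longleftrightarrow> k_linear A B f \<and> f \<in> ring_hom A B"

definition alg_anti_hom ::
  "('k::field, 'a, 'y) module_scheme \<Rightarrow> ('k, 'b, 'z) module_scheme \<Rightarrow> ('a \<Rightarrow> 'b) \<Rightarrow> bool" where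
  "alg_anti_hom A B f \<longleftrightarrow> k_linear A B f \<and> f \<one>\<^bsub>A\<^esub> = \<one>\<^bsub>B\<^esub> \<and>
     (\<forall>x\<in>carrier A. \<forall>y\<in>carrier A. f (x \<otimes>\<^bsub>A\<^esub> y) = f y \<otimes>\<^bsub>B\<^esub> f x)"

definition alg_quot :: "('k::field, 'a, 'z) module_scheme \<Rightarrow> 'a set \<Rightarrow> ('k, 'a set) module" where
  "alg_quot A N = \<lparr>carrier = carrier (A Quot N), mult = mult (A Quot N), one = one (A Quot N),
     zero = zero (A Quot N), add = add (A Quot N),
     smult = (\<lambda>c X. \<Union>x\<in>X. N +>\<^bsub>A\<^esub> (c \<odot>\<^bsub>A\<^esub> x))\<rparr>"

definition monoid_algebra :: "('g, 'z) monoid_scheme \<Rightarrow> ('k::field, 'g \<Rightarrow>\<^sub>0 'k) module" where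
  "monoid_algebra G = \<lparr>carrier = {p. Poly_Mapping.keys p \<subseteq> carrier G},
     mult = (\<lambda>p p'. \<Sum>g\<in>Poly_Mapping.keys p. \<Sum>h\<in>Poly_Mapping.keys p'.
       Poly_Mapping.single (g \<otimes>\<^bsub>G\<^esub> h) (Poly_Mapping.lookup p g * Poly_Mapping.lookup p' h)),
     one = Poly_Mapping.single \<one>\<^bsub>G\<^esub> 1, zero = 0, add = (+),
     smult = (\<lambda>c. Poly_Mapping.map ((*) c))\<rparr>"

definition free_monoid :: "'x set \<Rightarrow> 'x list monoid" where
  "free_monoid X = \<lparr>carrier = lists X, mult = (@), one = []\<rparr>"

abbreviation free_algebra :: "'x set \<Rightarrow> ('k::field, 'x list \<Rightarrow>\<^sub>0 'k) module" where
  "free_algebra X \<equiv> monoid_algebra (free_monoid X)"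

section \<open>Tensor products\<close>

text \<open>The free vector space on the set of pairs, modulo the bilinearity relations.  Multiplying a
  bilinearity relation by a pair gives a bilinearity relation again, so the ideal generated by
  these relations in the monoid algebra of \<^term>\<open>A \<times>\<times> B\<close> is just their linear span.\<close>

definition bilinear_relators ::
  "('k::field, 'a, 'y) module_scheme \<Rightarrow> ('k, 'b, 'z) module_scheme \<Rightarrow> ('a \<times> 'b \<Rightarrow>\<^sub>0 'k) set" where
  "bilinear_relators A B =
     {Poly_Mapping.single (a \<oplus>\<^bsub>A\<^esub> a', b) 1 - Poly_Mapping.single (a, b) 1
        - Poly_Mapping.single (a', b) 1 |a a' b.
        a \<in> carrier A \<and> a' \<in> carrier A \<and> b \<in> carrier B} \<union>
     {Poly_Mapping.single (a, b \<oplus>\<^bsub>B\<^esub> b') 1 - Poly_Mapping.single (a, b) 1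
        - Poly_Mapping.single (a, b') 1 |a b b'.
        a \<in> carrier A \<and> b \<in> carrier B \<and> b' \<in> carrier B} \<union>
     {Poly_Mapping.single (c \<odot>\<^bsub>A\<^esub> a, b) 1 - Poly_Mapping.single (a, b) c |c a b.
        a \<in> carrier A \<and> b \<in> carrier B} \<union>
     {Poly_Mapping.single (a, c \<odot>\<^bsub>B\<^esub> b) 1 - Poly_Mapping.single (a, b) c |c a b.
        a \<in> carrier A \<and> b \<in> carrier B}"

definition bilinear_ideal ::
  "('k::field, 'a, 'y) module_scheme \<Rightarrow> ('k, 'b, 'z) module_scheme \<Rightarrow> ('a \<times> 'b \<Rightarrow>\<^sub>0 'k) set" where
  "bilinear_ideal A B =
     genideal (monoid_algebra (A \<times>\<times> B) :: ('k, _) module) (bilinear_relators A B)"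

definition tensor ::
  "('k::field, 'a, 'y) module_scheme \<Rightarrow> ('k, 'b, 'z) module_scheme
    \<Rightarrow> ('k, ('a \<times> 'b \<Rightarrow>\<^sub>0 'k) set) module" where
  "tensor A B = alg_quot (monoid_algebra (A \<times>\<times> B)) (bilinear_ideal A B)"

definition pure_tensor ::
  "('k::field, 'a, 'y) module_scheme \<Rightarrow> ('k, 'b, 'z) module_scheme \<Rightarrow> 'a \<Rightarrow> 'b
    \<Rightarrow> ('a \<times> 'b \<Rightarrow>\<^sub>0 'k) set" where
  "pure_tensor A B a b =
     bilinear_ideal A B +>\<^bsub>(monoid_algebra (A \<times>\<times> B) :: ('k, _) module)\<^esub> Poly_Mapping.single (a, b) 1"

text \<open>The linear map on the tensor product induced by a bilinear map \<open>\<phi>\<close>.\<close>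

definition tensor_lift ::
  "('k::field, 'a, 'x) module_scheme \<Rightarrow> ('k, 'b, 'y) module_scheme \<Rightarrow> ('k, 'c, 'z) module_scheme
    \<Rightarrow> ('a \<Rightarrow> 'b \<Rightarrow> 'c) \<Rightarrow> ('a \<times> 'b \<Rightarrow>\<^sub>0 'k) set \<Rightarrow> 'c" where
  "tensor_lift A B C \<phi> = (THE f. f \<in> extensional (carrier (tensor A B)) \<and> k_linear (tensor A B) C f \<and>
     (\<forall>a\<in>carrier A. \<forall>b\<in>carrier B. f (pure_tensor A B a b) = \<phi> a b))"

section \<open>Bialgebras, Hopf algebras and weak Hopf algebras\<close>

record (overloaded) ('k::zero, 'a) bialgebra_data = "('k, 'a) module" +
  comult :: "'a \<Rightarrow> ('a \<times> 'a \<Rightarrow>\<^sub>0 'k) set"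
  counit :: "'a \<Rightarrow> 'k"

text \<open>Coassociativity is stated in \<open>H \<otimes> (H \<otimes> H)\<close>: the right-hand side is \<open>(\<Delta> \<otimes> id) \<circ> \<Delta>\<close> followed by
  the canonical identification of \<open>(H \<otimes> H) \<otimes> H\<close> with \<open>H \<otimes> (H \<otimes> H)\<close>.\<close>

definition bialgebra :: "('k::field, 'a) bialgebra_data \<Rightarrow> bool" where
  "bialgebra H \<longleftrightarrow> k_algebra H \<and>
     alg_hom H (tensor H H) (comult H) \<and> alg_hom H ground (counit H) \<and>
     (\<forall>x\<in>carrier H.
        tensor_lift H H (tensor H (tensor H H))
          (\<lambda>a b. pure_tensor H (tensor H H) a (comult H b)) (comult H x) =
        tensor_lift H H (tensor H (tensor H H))
          (\<lambda>a b. tensor_lift H H (tensor H (tensor H H))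
             (\<lambda>a1 a2. pure_tensor H (tensor H H) a1 (pure_tensor H H a2 b)) (comult H a))
          (comult H x)) \<and>
     (\<forall>x\<in>carrier H. tensor_lift H H H (\<lambda>a b. counit H a \<odot>\<^bsub>H\<^esub> b) (comult H x) = x \<and>
        tensor_lift H H H (\<lambda>a b. counit H b \<odot>\<^bsub>H\<^esub> a) (comult H x) = x)"

definition convolution ::
  "('k::field, 'a) bialgebra_data \<Rightarrow> ('a \<Rightarrow> 'a) \<Rightarrow> ('a \<Rightarrow> 'a) \<Rightarrow> 'a \<Rightarrow> 'a" where
  "convolution H f g x = tensor_lift H H H (\<lambda>a b. f a \<otimes>\<^bsub>H\<^esub> g b) (comult H x)"

definition commutative_alg :: "('k::field, 'a) bialgebra_data \<Rightarrow> bool" where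
  "commutative_alg H \<longleftrightarrow> (\<forall>x\<in>carrier H. \<forall>y\<in>carrier H. x \<otimes>\<^bsub>H\<^esub> y = y \<otimes>\<^bsub>H\<^esub> x)"

definition cocommutative :: "('k::field, 'a) bialgebra_data \<Rightarrow> bool" where
  "cocommutative H \<longleftrightarrow>
     (\<forall>x\<in>carrier H. tensor_lift H H (tensor H H) (\<lambda>a b. pure_tensor H H b a) (comult H x) = comult H x)"

definition hopf_algebra :: "('k::field, 'a) bialgebra_data \<Rightarrow> bool" where
  "hopf_algebra H \<longleftrightarrow> bialgebra H \<and> (\<exists>S. k_linear H H S \<and>
     (\<forall>x\<in>carrier H. convolution H S id x = counit H x \<odot>\<^bsub>H\<^esub> \<one>\<^bsub>H\<^esub> \<and>
        convolution H id S x = counit H x \<odot>\<^bsub>H\<^esub> \<one>\<^bsub>H\<^esub>))"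

text \<open>Bijectivity is not part of \<open>weak_antipode\<close> but is required in \<open>weak_hopf_algebra\<close>.  The two
  are kept apart because the map \<open>T\<close> considered below need not be injective: it kills
  \<open>(1 - J\<^bsup>m-1\<^esup>) E\<^sub>i\<close>, which is nonzero if \<open>E\<^sub>i\<close> is of type one.\<close>

definition weak_antipode :: "('k::field, 'a) bialgebra_data \<Rightarrow> ('a \<Rightarrow> 'a) \<Rightarrow> bool" where
  "weak_antipode H T \<longleftrightarrow> alg_anti_hom H H T \<and>
     (\<forall>x\<in>carrier H. convolution H (convolution H id T) id x = x \<and>
        convolution H (convolution H T id) T x = T x)"

definition weak_hopf_algebra :: "('k::field, 'a) bialgebra_data \<Rightarrow> bool" where
  "weak_hopf_algebra H \<longleftrightarrow> bialgebra H \<and>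
     (\<exists>T. weak_antipode H T \<and> bij_betw T (carrier H) (carrier H))"

section \<open>Gaussian binomial coefficients\<close>

text \<open>They are formed in the field of rational functions in \<open>\<nu>\<close> and then evaluated; the point of
  evaluation may be a root of unity, where the quantum factorials vanish.\<close>

definition nu :: "'k::field poly fract" where
  "nu = Fract [:0, 1:] 1"

definition qint :: "nat \<Rightarrow> 'k::field poly fract" where
  "qint k = (nu ^ k - inverse nu ^ k) / (nu - inverse nu)"

definition qfact :: "nat \<Rightarrow> 'k::field poly fract" where
  "qfact k = (\<Prod>l=1..k. qint l)"

definition qbinom :: "nat \<Rightarrow> nat \<Rightarrow> 'k::field poly fract" where
  "qbinom k r = qfact k / (qfact r * qfact (k - r))"

definition rat_eval :: "'k::field poly fract \<Rightarrow> 'k \<Rightarrow> 'k" where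
  "rat_eval f x = (THE v. \<exists>n d. f = Fract n d \<and> poly d x \<noteq> 0 \<and> v = poly n x / poly d x)"

section \<open>The weak quantized enveloping algebra\<close>

definition borcherds_cartan :: "nat set \<Rightarrow> (nat \<Rightarrow> nat \<Rightarrow> int) \<Rightarrow> bool" where
  "borcherds_cartan I a \<longleftrightarrow>
     (\<forall>i\<in>I. a i i = 2 \<or> a i i \<le> 0) \<and>
     (\<forall>i\<in>I. \<forall>j\<in>I. i \<noteq> j \<longrightarrow> a i j \<le> 0) \<and>
     (\<forall>i\<in>I. \<forall>j\<in>I. a i j = 0 \<longleftrightarrow> a j i = 0)"

text \<open>The entry 1 (resp. 0) of \<open>type_E\<close>, \<open>type_F\<close> stands for type one (resp. type zero).  The
  entries of the symmetrizing diagonal matrix occur as exponents of the scalar \<open>q\<close>, hence are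
  natural numbers.\<close>

record 'k wU_data =
  idx :: "nat set"
  cartan :: "nat \<Rightarrow> nat \<Rightarrow> int"
  symm :: "nat \<Rightarrow> nat"
  qpar :: 'k
  Jexp :: nat
  type_E :: "nat \<Rightarrow> nat"
  type_F :: "nat \<Rightarrow> nat"

definition qi :: "'k::field wU_data \<Rightarrow> nat \<Rightarrow> 'k" where
  "qi P i = qpar P ^ symm P i"

text \<open>Adjoining the condition that 1 differs from \<open>J\<^bsup>m-1\<^esup>\<close> amounts to \<open>m \<ge> 2\<close>.\<close>

definition wU_datum :: "'k::field wU_data \<Rightarrow> bool" where
  "wU_datum P \<longleftrightarrow>
     ((\<exists>n\<ge>1. idx P = {1..n}) \<or> idx P = {1..}) \<and>
     borcherds_cartan (idx P) (cartan P) \<and>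
     (\<forall>i\<in>idx P. symm P i > 0) \<and>
     (\<forall>i\<in>idx P. \<forall>j\<in>idx P. int (symm P i) * cartan P i j = int (symm P j) * cartan P j i) \<and>
     (\<forall>i\<in>idx P. qi P i \<notin> {0, 1, -1}) \<and>
     Jexp P \<ge> 2 \<and>
     (\<forall>i\<in>idx P. type_E P i \<in> {0, 1} \<and> type_F P i \<in> {0, 1})"

text \<open>\<open>gKb\<close> and \<open>gDb\<close> stand for the generators written with a bar.\<close>

datatype gen = gJ | gE nat | gF nat | gK nat | gKb nat | gD nat | gDb nat

definition toral_gens :: "nat set \<Rightarrow> gen set" where
  "toral_gens I = gK ` I \<union> gKb ` I \<union> gD ` I \<union> gDb ` I"

definition gens :: "nat set \<Rightarrow> gen set" where
  "gens I = {gJ} \<union> toral_gens I \<union> gE ` I \<union> gF ` I"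

abbreviation wd :: "gen list \<Rightarrow> 'k \<Rightarrow> gen list \<Rightarrow>\<^sub>0 'k::zero" where
  "wd w c \<equiv> Poly_Mapping.single w c"

definition J_relators :: "'k::field wU_data \<Rightarrow> (gen list \<Rightarrow>\<^sub>0 'k) set" where
  "J_relators P = (let I = idx P; w = replicate (Jexp P - 1) gJ in
     {wd (replicate (Jexp P) gJ) 1 - wd [gJ] 1} \<union>
     {wd w 1 - wd [gK i, gKb i] 1 |i. i \<in> I} \<union>
     {wd w 1 - wd [gD i, gDb i] 1 |i. i \<in> I} \<union>
     {wd [x, y] 1 - wd [y, x] 1 |x y. x \<in> {gJ} \<union> toral_gens I \<and> y \<in> {gJ} \<union> toral_gens I} \<union>
     {wd (x # w) 1 - wd [x] 1 |x. x \<in> toral_gens I})"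

definition type_relators :: "'k::field wU_data \<Rightarrow> (gen list \<Rightarrow>\<^sub>0 'k) set" where
  "type_relators P = (let I = idx P; a = cartan P in
     {wd [gK j, gE i] 1 - wd [gE i, gK j] (qi P i powi a i j) |i j.
        i \<in> I \<and> j \<in> I \<and> type_E P i = 1} \<union>
     {wd [gKb j, gE i] 1 - wd [gE i, gKb j] (qi P i powi (- a i j)) |i j.
        i \<in> I \<and> j \<in> I \<and> type_E P i = 1} \<union>
     {wd [gK j, gE i, gKb j] 1 - wd [gE i] (qi P i powi a i j) |i j.
        i \<in> I \<and> j \<in> I \<and> type_E P i = 0} \<union>
     {wd [gK j, gF i] 1 - wd [gF i, gK j] (qi P i powi (- a i j)) |i j.
        i \<in> I \<and> j \<in> I \<and> type_F P i = 1} \<union>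
     {wd [gKb j, gF i] 1 - wd [gF i, gKb j] (qi P i powi a i j) |i j.
        i \<in> I \<and> j \<in> I \<and> type_F P i = 1} \<union>
     {wd [gK j, gF i, gKb j] 1 - wd [gF i] (qi P i powi (- a i j)) |i j.
        i \<in> I \<and> j \<in> I \<and> type_F P i = 0})"

definition EF_relators :: "'k::field wU_data \<Rightarrow> (gen list \<Rightarrow>\<^sub>0 'k) set" where
  "EF_relators P = (let I = idx P; c = (\<lambda>i. inverse (qi P i - inverse (qi P i))) in
     {wd [gE i, gF j] 1 - wd [gF j, gE i] 1
        - (if i = j then wd [gK i] (c i) - wd [gKb i] (c i) else 0) |i j. i \<in> I \<and> j \<in> I})"

definition serre_relators :: "'k::field wU_data \<Rightarrow> (gen list \<Rightarrow>\<^sub>0 'k) set" where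
  "serre_relators P = (let I = idx P; a = cartan P; N = (\<lambda>i j. nat (1 - a i j)) in
     {(\<Sum>r=0..N i j. wd (replicate (N i j - r) (X i) @ [X j] @ replicate r (X i))
          ((-1) ^ r * rat_eval (qbinom (N i j) r) (qi P i))) |X i j.
        X \<in> {gE, gF} \<and> i \<in> I \<and> j \<in> I \<and> i \<noteq> j \<and> a i i = 2} \<union>
     {wd [X i, X j] 1 - wd [X j, X i] 1 |X i j.
        X \<in> {gE, gF} \<and> i \<in> I \<and> j \<in> I \<and> a i j = 0})"

definition wU_ideal :: "'k::field wU_data \<Rightarrow> (gen list \<Rightarrow>\<^sub>0 'k) set" where
  "wU_ideal P = genideal (free_algebra (gens (idx P)) :: ('k, _) module)
     (J_relators P \<union> type_relators P \<union> EF_relators P \<union> serre_relators P)"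

definition wU_alg :: "'k::field wU_data \<Rightarrow> ('k, (gen list \<Rightarrow>\<^sub>0 'k) set) module" where
  "wU_alg P = alg_quot (free_algebra (gens (idx P))) (wU_ideal P)"

definition wgen :: "'k::field wU_data \<Rightarrow> gen \<Rightarrow> (gen list \<Rightarrow>\<^sub>0 'k) set" where
  "wgen P g = wU_ideal P +>\<^bsub>(free_algebra (gens (idx P)) :: ('k, _) module)\<^esub> wd [g] 1"

text \<open>The element \<open>1\<close> (type one) or \<open>J\<^bsup>m-1\<^esup>\<close> (type zero).\<close>

definition type_unit :: "'k::field wU_data \<Rightarrow> nat \<Rightarrow> (gen list \<Rightarrow>\<^sub>0 'k) set" where
  "type_unit P t =
     (if t = 1 then \<one>\<^bsub>wU_alg P\<^esub> else wgen P gJ [^]\<^bsub>wU_alg P\<^esub> (Jexp P - 1))"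

fun Delta_gen :: "'k::field wU_data \<Rightarrow> gen
    \<Rightarrow> ((gen list \<Rightarrow>\<^sub>0 'k) set \<times> (gen list \<Rightarrow>\<^sub>0 'k) set \<Rightarrow>\<^sub>0 'k) set" where
  "Delta_gen P (gE i) = (let A = wU_alg P in
     pure_tensor A A (type_unit P (type_E P i)) (wgen P (gE i))
       \<oplus>\<^bsub>tensor A A\<^esub> pure_tensor A A (wgen P (gE i)) (wgen P (gK i)))"
| "Delta_gen P (gF i) = (let A = wU_alg P in
     pure_tensor A A (wgen P (gF i)) (type_unit P (type_F P i))
       \<oplus>\<^bsub>tensor A A\<^esub> pure_tensor A A (wgen P (gKb i)) (wgen P (gF i)))"
| "Delta_gen P g = pure_tensor (wU_alg P) (wU_alg P) (wgen P g) (wgen P g)"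

fun epsilon_gen :: "gen \<Rightarrow> 'k::field" where
  "epsilon_gen (gE i) = 0"
| "epsilon_gen (gF i) = 0"
| "epsilon_gen g = 1"

fun T_gen :: "'k::field wU_data \<Rightarrow> gen \<Rightarrow> (gen list \<Rightarrow>\<^sub>0 'k) set" where
  "T_gen P gJ = wgen P gJ"
| "T_gen P (gK i) = wgen P (gKb i)"
| "T_gen P (gKb i) = wgen P (gK i)"
| "T_gen P (gD i) = wgen P (gDb i)"
| "T_gen P (gDb i) = wgen P (gD i)"
| "T_gen P (gE i) = \<ominus>\<^bsub>wU_alg P\<^esub> (wgen P (gE i) \<otimes>\<^bsub>wU_alg P\<^esub> wgen P (gKb i))"
| "T_gen P (gF i) = \<ominus>\<^bsub>wU_alg P\<^esub> (wgen P (gK i) \<otimes>\<^bsub>wU_alg P\<^esub> wgen P (gF i))"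

definition wDelta :: "'k::field wU_data \<Rightarrow> (gen list \<Rightarrow>\<^sub>0 'k) set
    \<Rightarrow> ((gen list \<Rightarrow>\<^sub>0 'k) set \<times> (gen list \<Rightarrow>\<^sub>0 'k) set \<Rightarrow>\<^sub>0 'k) set" where
  "wDelta P = (THE f. f \<in> extensional (carrier (wU_alg P)) \<and>
     alg_hom (wU_alg P) (tensor (wU_alg P) (wU_alg P)) f \<and>
     (\<forall>g\<in>gens (idx P). f (wgen P g) = Delta_gen P g))"

definition wepsilon :: "'k::field wU_data \<Rightarrow> (gen list \<Rightarrow>\<^sub>0 'k) set \<Rightarrow> 'k" where
  "wepsilon P = (THE f. f \<in> extensional (carrier (wU_alg P)) \<and> alg_hom (wU_alg P) ground f \<and>
     (\<forall>g\<in>gens (idx P). f (wgen P g) = epsilon_gen g))"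

text \<open>For \<open>m \<ge> 4\<close> there are bijective weak antipodes other than this one (they send \<open>J\<close> to \<open>J\<^bsup>m-2\<^esup>\<close>), so
  that \<open>m = 2, 3\<close> characterizes the case where \<open>wT\<close> is a weak antipode, not the mere existence of one.\<close>

definition wT :: "'k::field wU_data \<Rightarrow> (gen list \<Rightarrow>\<^sub>0 'k) set \<Rightarrow> (gen list \<Rightarrow>\<^sub>0 'k) set" where
  "wT P = (THE f. f \<in> extensional (carrier (wU_alg P)) \<and> alg_anti_hom (wU_alg P) (wU_alg P) f \<and>
     (\<forall>g\<in>gens (idx P). f (wgen P g) = T_gen P g))"

definition wU :: "'k::field wU_data \<Rightarrow> ('k, (gen list \<Rightarrow>\<^sub>0 'k) set) bialgebra_data" where
  "wU P = (let A = wU_alg P in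
     \<lparr>carrier = carrier A, mult = mult A, one = one A, zero = zero A, add = add A,
      smult = smult A, comult = wDelta P, counit = wepsilon P\<rparr>)"

end

theory Submission
  imports Defs
begin

text \<open>
  The element \<open>e = J\<^bsup>m-1\<^esup>\<close> is a central idempotent with
  \<open>\<Delta> e = e \<otimes> e\<close>, so the identities for \<open>T\<close> can be checked on \<open>e A\<close>
  and on \<open>(1 - e) A\<close>. On \<open>e A\<close> the usual argument for quantum groups works as soon as
  \<open>J\<close> is its own inverse there, that is, if \<open>J\<^sup>2 = e\<close>, which holds for
  \<open>m = 2, 3\<close>. In \<open>(1 - e) A\<close> only the \<open>E\<^sub>i\<close> and \<open>F\<^sub>i\<close> of
  type one survive; the \<open>E\<^sub>i\<close> commute with the \<open>F\<^sub>j\<close>, and after multiplication by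
  \<open>(1 - e) \<otimes> (1 - e)\<close> one has \<open>\<Delta> E\<^sub>i = 1 \<otimes> E\<^sub>i\<close> and
  \<open>\<Delta> F\<^sub>i = F\<^sub>i \<otimes> 1\<close>, which makes the convolutions there explicit. Conversely a
  weak antipode \<open>T\<close> with \<open>T J = J\<close> forces \<open>J\<^sup>3 = J\<close>, which fails for
  \<open>m \<ge> 4\<close> in the representation where \<open>J\<close> shifts functions of period \<open>m - 1\<close>.

  The map \<open>T\<close> kills the type one \<open>E\<^sub>i\<close> and \<open>F\<^sub>i\<close> in
  \<open>(1 - e) A\<close>, so it need not be bijective. The identities in \<open>(1 - e) A\<close> hold as well for the
  anti-automorphism that fixes these generators, and replacing \<open>T\<close> by it on this summand gives a bijective
  weak antipode. A representation in which \<open>K\<^sub>1\<close> and its inverse differ gives noncommutativity, a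
  character with \<open>K\<^sub>i \<mapsto> -1\<close> and \<open>E\<^sub>i, F\<^sub>i \<mapsto> 0\<close> gives
  noncocommutativity, and the character sending all generators to \<open>0\<close> shows that \<open>J\<close> is not
  invertible, so there is no antipode.
\<close>

text \<open>The obstacle is the quantum Serre relation. It has to be checked under the
  comultiplication, under the anti-homomorphisms and on a module, while q may be a root of unity, so
  that quantum factorials cannot be divided by after evaluation. Therefore it is rewritten as an
  iterated skew commutator \<open>skew\<close>, a product of operators s \<mapsto> x s - l s x,
  which commute because left and right multiplication by x do. What is needed then follows from
  weights and from one identity, z^2 t^(n-1) = 1 for z = q_i^(a_ij), t = q_i^(a_ii), n = 1 - a_ij:
  it makes the list of scalars l stable under inversion.

  The module that separates \<open>gK 1\<close> from \<open>gKb 1\<close> has the number 2 as its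
  highest weight and not a power of q: 2 and 1/2 differ in characteristic 0 whatever q is, and no
  basis theorem for the algebra is involved.

  A family of anti-endomorphisms with parameters \<mu>, \<nu> and a central element r contains the
  given map, its bijective modification and the inverse of the latter. They all come from one
  universal property, applied to the opposite algebra.\<close>

lemma ground_simps [simp]:
  "carrier ground = UNIV" "x \<otimes>\<^bsub>ground\<^esub> y = x * y" "x \<oplus>\<^bsub>ground\<^esub> y = x + y"
  "\<one>\<^bsub>ground\<^esub> = 1" "\<zero>\<^bsub>ground\<^esub> = 0" "c \<odot>\<^bsub>ground\<^esub> x = c * x"
  by (simp_all add: ground_def)

lemma cring_ground: "cring (ground :: ('k::field, 'k) module)"
proof (rule cringI)
  show "abelian_group (ground :: ('k, 'k) module)"
    by (rule abelian_groupI) (auto simp: algebra_simps intro: exI[of _ "- x" for x])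
qed (unfold_locales, auto simp: algebra_simps)

lemma k_algebraI:
  fixes A :: "('k::field, 'a, 'z) module_scheme" (structure)
  assumes "ring A"
    and "\<And>c x. x \<in> carrier A \<Longrightarrow> c \<odot> x \<in> carrier A"
    and "\<And>c d x. x \<in> carrier A \<Longrightarrow> (c + d) \<odot> x = c \<odot> x \<oplus> d \<odot> x"
    and "\<And>c x y. \<lbrakk>x \<in> carrier A; y \<in> carrier A\<rbrakk> \<Longrightarrow> c \<odot> (x \<oplus> y) = c \<odot> x \<oplus> c \<odot> y"
    and "\<And>c d x. x \<in> carrier A \<Longrightarrow> (c * d) \<odot> x = c \<odot> (d \<odot> x)"
    and "\<And>x. x \<in> carrier A \<Longrightarrow> 1 \<odot> x = x"
    and "\<And>c x y. \<lbrakk>x \<in> carrier A; y \<in> carrier A\<rbrakk> \<Longrightarrow> (c \<odot> x) \<otimes> y = c \<odot> (x \<otimes> y)"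
    and "\<And>c x y. \<lbrakk>x \<in> carrier A; y \<in> carrier A\<rbrakk> \<Longrightarrow> x \<otimes> (c \<odot> y) = c \<odot> (x \<otimes> y)"
  shows "k_algebra A"
  unfolding k_algebra_def
  using assms by (auto intro!: moduleI cring_ground ring.is_abelian_group)

locale kalg =
  fixes A :: "('k::field, 'a, 'z) module_scheme" (structure)
  assumes k_algebra: "k_algebra A"
begin

sublocale ring A
  using k_algebra by (simp add: k_algebra_def)

lemma module_ground: "Module.module (ground :: ('k, 'k) module) A"
  using k_algebra by (simp add: k_algebra_def)

lemma smult_closed [simp, intro]: "x \<in> carrier A \<Longrightarrow> c \<odot> x \<in> carrier A"
  using module.smult_closed[OF module_ground, of c x] by simp

lemma smult_l_distr: "x \<in> carrier A \<Longrightarrow> (c + d) \<odot> x = c \<odot> x \<oplus> d \<odot> x"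
  using module.smult_l_distr[OF module_ground, of c d x] by simp

lemma smult_r_distr:
  "\<lbrakk>x \<in> carrier A; y \<in> carrier A\<rbrakk> \<Longrightarrow> c \<odot> (x \<oplus> y) = c \<odot> x \<oplus> c \<odot> y"
  using module.smult_r_distr[OF module_ground, of c x y] by simp

lemma smult_smult [simp]: "x \<in> carrier A \<Longrightarrow> c \<odot> (d \<odot> x) = (c * d) \<odot> x"
  using module.smult_assoc1[OF module_ground, of c d x] by simp

lemma smult_one [simp]: "x \<in> carrier A \<Longrightarrow> 1 \<odot> x = x"
  using module.smult_one[OF module_ground, of x] by simp

lemma smult_mult_l [simp]: "\<lbrakk>x \<in> carrier A; y \<in> carrier A\<rbrakk> \<Longrightarrow> (c \<odot> x) \<otimes> y = c \<odot> (x \<otimes> y)"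
  using k_algebra by (simp add: k_algebra_def)

lemma smult_mult_r [simp]: "\<lbrakk>x \<in> carrier A; y \<in> carrier A\<rbrakk> \<Longrightarrow> x \<otimes> (c \<odot> y) = c \<odot> (x \<otimes> y)"
  using k_algebra by (simp add: k_algebra_def)

lemma smult_zero [simp]: "c \<odot> \<zero> = \<zero>"
  using module.smult_r_null[OF module_ground, of c] by simp

lemma zero_smult [simp]: "x \<in> carrier A \<Longrightarrow> 0 \<odot> x = \<zero>"
  using module.smult_l_null[OF module_ground, of x] by simp

lemma uminus_smult: "x \<in> carrier A \<Longrightarrow> (- c) \<odot> x = \<ominus> (c \<odot> x)"
  by (rule minus_equality[symmetric]) (simp_all add: smult_l_distr[symmetric])

lemma minus_one_smult: "x \<in> carrier A \<Longrightarrow> \<ominus> x = (- 1) \<odot> x"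
  by (simp add: uminus_smult)

lemma minus_smult: "\<lbrakk>x \<in> carrier A; y \<in> carrier A\<rbrakk> \<Longrightarrow> x \<ominus> y = x \<oplus> (- 1) \<odot> y"
  by (simp add: minus_eq minus_one_smult)

lemma smult_cancel:
  assumes "c \<noteq> 0" "x \<in> carrier A" "y \<in> carrier A" "c \<odot> x = c \<odot> y" shows "x = y"
proof -
  have "(inverse c * c) \<odot> x = (inverse c * c) \<odot> y"
    unfolding smult_smult[OF assms(2), symmetric] smult_smult[OF assms(3), symmetric] assms(4) ..
  then show ?thesis using assms by simp
qed

lemma smult_diff_eq_iff:
  "\<lbrakk>x \<in> carrier A; y \<in> carrier A\<rbrakk> \<Longrightarrow> x \<ominus> y = \<zero> \<longleftrightarrow> x = y"
  by (metis minus_eq r_neg add.inv_closed minus_equality minus_minus add.m_comm)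

end

section \<open>Monoid algebras\<close>

text \<open>Writing \<open>p\<close> as the sum of its terms over its support reduces a claim to
  \<open>single\<close>. The bound \<open>X\<close> on the supports travels with the induction
  because membership in the carrier of a monoid algebra is a condition on supports.\<close>

lemma poly_mapping_induct_keys:
  fixes p :: "'g \<Rightarrow>\<^sub>0 'k::comm_monoid_add"
  assumes "Poly_Mapping.keys p \<subseteq> X" "P 0"
    and "\<And>g c. g \<in> X \<Longrightarrow> P (Poly_Mapping.single g c)"
    and "\<And>p q. \<lbrakk>Poly_Mapping.keys p \<subseteq> X; Poly_Mapping.keys q \<subseteq> X; P p; P q\<rbrakk> \<Longrightarrow> P (p + q)"
  shows "P p"
proof -
  have "p = (\<Sum>g\<in>Poly_Mapping.keys p. Poly_Mapping.single g (Poly_Mapping.lookup p g))"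
    by (rule poly_mapping_eqI)
      (simp add: lookup_sum lookup_single when_def in_keys_iff)
  moreover have "P (\<Sum>g\<in>S. Poly_Mapping.single g (Poly_Mapping.lookup p g)) \<and>
      Poly_Mapping.keys (\<Sum>g\<in>S. Poly_Mapping.single g (Poly_Mapping.lookup p g)) \<subseteq> X"
    if "finite S" "S \<subseteq> X" for S
    using that
  proof (induction S rule: finite_induct)
    case (insert g S)
    show ?case
    proof -
      let ?p = "Poly_Mapping.single g (Poly_Mapping.lookup p g)"
      let ?q = "\<Sum>g\<in>S. Poly_Mapping.single g (Poly_Mapping.lookup p g)"
      have "Poly_Mapping.keys ?p \<subseteq> X" "P ?p" using insert by (auto intro: assms(3))
      moreover have "P ?q" "Poly_Mapping.keys ?q \<subseteq> X" using insert by auto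
      moreover have "Poly_Mapping.keys (?p + ?q) \<subseteq> X"
        using keys_add[of ?p ?q] calculation by blast
      ultimately show ?thesis
        unfolding sum.insert[OF insert(1,2)] using keys_add[of ?p ?q] by (auto intro!: assms(4))
    qed
  qed (simp add: assms(2))
  ultimately show ?thesis using assms(1) by (metis finite_keys)
qed

lemma monoid_algebra_simps:
  "carrier (monoid_algebra G) = {p. Poly_Mapping.keys p \<subseteq> carrier G}"
  "\<one>\<^bsub>monoid_algebra G\<^esub> = Poly_Mapping.single \<one>\<^bsub>G\<^esub> 1"
  "\<zero>\<^bsub>monoid_algebra G\<^esub> = 0"
  "p \<oplus>\<^bsub>monoid_algebra G\<^esub> q = p + q"
  "c \<odot>\<^bsub>monoid_algebra G\<^esub> p = Poly_Mapping.map ((*) c) p"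
  by (simp_all add: monoid_algebra_def)

lemma lookup_scale: "Poly_Mapping.lookup (Poly_Mapping.map ((*) c) p) g = c * Poly_Mapping.lookup p (g :: 'g) "
  for c :: "'k::field"
  by (simp add: Poly_Mapping.map.rep_eq when_def)

lemma map_scale_single: "Poly_Mapping.map ((*) c) (Poly_Mapping.single g d) = Poly_Mapping.single g (c * d)"
  for c :: "'k::field"
  by (rule poly_mapping_eqI) (simp add: lookup_scale lookup_single when_def)

lemma map_scale_zero: "Poly_Mapping.map ((*) c) 0 = 0"
  for c :: "'k::field"
  by (rule poly_mapping_eqI) (simp add: lookup_scale)

lemma map_scale_add: "Poly_Mapping.map ((*) c) (p + q) = Poly_Mapping.map ((*) c) p + Poly_Mapping.map ((*) c) q"
  for c :: "'k::field"
  by (rule poly_mapping_eqI) (simp add: lookup_scale lookup_add algebra_simps)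

text \<open>Terms outside the supports have coefficient 0. A common index set is needed for
  bilinearity, since cancellation can make the support of a sum smaller than the union of the
  supports.\<close>

lemma monoid_algebra_mult_superset:
  assumes "finite S" "finite T" "Poly_Mapping.keys p \<subseteq> S" "Poly_Mapping.keys q \<subseteq> T"
  shows "p \<otimes>\<^bsub>monoid_algebra G\<^esub> q = (\<Sum>g\<in>S. \<Sum>h\<in>T.
    Poly_Mapping.single (g \<otimes>\<^bsub>G\<^esub> h) (Poly_Mapping.lookup p g * Poly_Mapping.lookup q h))"
proof -
  have "p \<otimes>\<^bsub>monoid_algebra G\<^esub> q = (\<Sum>g\<in>Poly_Mapping.keys p. \<Sum>h\<in>T.
    Poly_Mapping.single (g \<otimes>\<^bsub>G\<^esub> h) (Poly_Mapping.lookup p g * Poly_Mapping.lookup q h))"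
    unfolding monoid_algebra_def monoid.simps
    by (intro sum.cong refl sum.mono_neutral_left) (use assms in \<open>auto simp: in_keys_iff\<close>)
  also have "\<dots> = (\<Sum>g\<in>S. \<Sum>h\<in>T.
    Poly_Mapping.single (g \<otimes>\<^bsub>G\<^esub> h) (Poly_Mapping.lookup p g * Poly_Mapping.lookup q h))"
    by (intro sum.mono_neutral_left) (use assms in \<open>auto simp: in_keys_iff\<close>)
  finally show ?thesis .
qed

lemma monoid_algebra_mult_single:
  "Poly_Mapping.single g c \<otimes>\<^bsub>monoid_algebra G\<^esub> Poly_Mapping.single h d =
    Poly_Mapping.single (g \<otimes>\<^bsub>G\<^esub> h) (c * d)"
  by (subst monoid_algebra_mult_superset[of "{g}" "{h}"]) auto

lemma monoid_algebra_l_distr: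
  "(p + p') \<otimes>\<^bsub>monoid_algebra G\<^esub> q = p \<otimes>\<^bsub>monoid_algebra G\<^esub> q + p' \<otimes>\<^bsub>monoid_algebra G\<^esub> q"
proof -
  let ?S = "Poly_Mapping.keys p \<union> Poly_Mapping.keys p'"
  show ?thesis
    using keys_add[of p p']
    by (simp add: monoid_algebra_mult_superset[of ?S "Poly_Mapping.keys q"] lookup_add
        distrib_right single_add sum.distrib)
qed

lemma monoid_algebra_r_distr:
  "q \<otimes>\<^bsub>monoid_algebra G\<^esub> (p + p') = q \<otimes>\<^bsub>monoid_algebra G\<^esub> p + q \<otimes>\<^bsub>monoid_algebra G\<^esub> p'"
proof -
  let ?S = "Poly_Mapping.keys p \<union> Poly_Mapping.keys p'"
  show ?thesis
    using keys_add[of p p']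
    by (simp add: monoid_algebra_mult_superset[of "Poly_Mapping.keys q" ?S] lookup_add
        distrib_left single_add sum.distrib)
qed

lemma monoid_algebra_mult_zero [simp]:
  "0 \<otimes>\<^bsub>monoid_algebra G\<^esub> q = 0" "q \<otimes>\<^bsub>monoid_algebra G\<^esub> 0 = 0"
  by (simp_all add: monoid_algebra_def)

text \<open>Bilinearity of the product reduces associativity to \<open>single\<close> terms, one
  argument after the other; there it is associativity in \<open>G\<close>.\<close>

lemma k_algebra_monoid_algebra:
  fixes G :: "('g, 'z) monoid_scheme"
  assumes "Group.monoid G"
  shows "k_algebra (monoid_algebra G :: ('k::field, 'g \<Rightarrow>\<^sub>0 'k) module)"
proof -
  interpret G: Group.monoid G by fact
  let ?M = "monoid_algebra G :: ('k::field, 'g \<Rightarrow>\<^sub>0 'k) module"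
  note ind = poly_mapping_induct_keys[where X = "carrier G"]
  have closed: "Poly_Mapping.keys (p \<otimes>\<^bsub>?M\<^esub> q) \<subseteq> carrier G"
    if "Poly_Mapping.keys p \<subseteq> carrier G" "Poly_Mapping.keys q \<subseteq> carrier G" for p q
  proof -
    have "Poly_Mapping.keys (p \<otimes>\<^bsub>?M\<^esub> q) \<subseteq>
      (\<Union>g\<in>Poly_Mapping.keys p. \<Union>h\<in>Poly_Mapping.keys q. {g \<otimes>\<^bsub>G\<^esub> h})"
      unfolding monoid_algebra_def monoid.simps
      by (intro order.trans[OF keys_sum] UN_mono order.refl) auto
    then show ?thesis using that by blast
  qed
  have assoc: "p \<otimes>\<^bsub>?M\<^esub> q \<otimes>\<^bsub>?M\<^esub> r = p \<otimes>\<^bsub>?M\<^esub> (q \<otimes>\<^bsub>?M\<^esub> r)"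
    if p: "Poly_Mapping.keys p \<subseteq> carrier G" and q: "Poly_Mapping.keys q \<subseteq> carrier G"
      and r: "Poly_Mapping.keys r \<subseteq> carrier G" for p q r
  proof (rule ind[OF p])
    fix g c assume g: "g \<in> carrier G"
    show "Poly_Mapping.single g c \<otimes>\<^bsub>?M\<^esub> q \<otimes>\<^bsub>?M\<^esub> r = Poly_Mapping.single g c \<otimes>\<^bsub>?M\<^esub> (q \<otimes>\<^bsub>?M\<^esub> r)"
    proof (rule ind[OF q])
      fix h d assume h: "h \<in> carrier G"
      show "Poly_Mapping.single g c \<otimes>\<^bsub>?M\<^esub> Poly_Mapping.single h d \<otimes>\<^bsub>?M\<^esub> r =
        Poly_Mapping.single g c \<otimes>\<^bsub>?M\<^esub> (Poly_Mapping.single h d \<otimes>\<^bsub>?M\<^esub> r)"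
        by (rule ind[OF r]) (auto simp: monoid_algebra_mult_single monoid_algebra_r_distr
            G.m_assoc g h mult.assoc)
    qed (auto simp: monoid_algebra_l_distr monoid_algebra_r_distr)
  qed (auto simp: monoid_algebra_l_distr)
  have ring: "ring ?M"
  proof (rule ringI)
    show "abelian_group ?M"
    proof (rule abelian_groupI)
      fix p assume "p \<in> carrier ?M"
      then show "\<exists>q\<in>carrier ?M. q \<oplus>\<^bsub>?M\<^esub> p = \<zero>\<^bsub>?M\<^esub>"
        by (intro bexI[of _ "- p"]) (auto simp: monoid_algebra_simps)
    qed (auto simp: monoid_algebra_simps algebra_simps dest: subsetD[OF keys_add])
    show "Group.monoid ?M"
    proof (rule monoidI)
      fix p assume "p \<in> carrier ?M"
      then have p: "Poly_Mapping.keys p \<subseteq> carrier G" by (simp add: monoid_algebra_simps)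
      show "\<one>\<^bsub>?M\<^esub> \<otimes>\<^bsub>?M\<^esub> p = p"
        unfolding monoid_algebra_simps
        by (rule ind[OF p]) (auto simp: monoid_algebra_mult_single monoid_algebra_r_distr)
      show "p \<otimes>\<^bsub>?M\<^esub> \<one>\<^bsub>?M\<^esub> = p"
        unfolding monoid_algebra_simps
        by (rule ind[OF p]) (auto simp: monoid_algebra_mult_single monoid_algebra_l_distr)
    qed (use closed assoc in \<open>auto simp: monoid_algebra_simps split: if_splits\<close>)
  qed (auto simp: monoid_algebra_simps monoid_algebra_l_distr monoid_algebra_r_distr)
  show ?thesis
  proof (rule k_algebraI[OF ring])
    fix c :: 'k and p q
    assume "p \<in> carrier ?M" and "q \<in> carrier ?M"
    then have p: "Poly_Mapping.keys p \<subseteq> carrier G" and q: "Poly_Mapping.keys q \<subseteq> carrier G"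
      by (simp_all add: monoid_algebra_simps)
    have 1: "(c \<odot>\<^bsub>?M\<^esub> Poly_Mapping.single g d) \<otimes>\<^bsub>?M\<^esub> q = c \<odot>\<^bsub>?M\<^esub> (Poly_Mapping.single g d \<otimes>\<^bsub>?M\<^esub> q)"
      for g and d :: 'k
      unfolding monoid_algebra_simps
      by (rule ind[OF q]) (auto simp: monoid_algebra_mult_single monoid_algebra_r_distr
          map_scale_zero map_scale_single map_scale_add mult.assoc)
    show "(c \<odot>\<^bsub>?M\<^esub> p) \<otimes>\<^bsub>?M\<^esub> q = c \<odot>\<^bsub>?M\<^esub> (p \<otimes>\<^bsub>?M\<^esub> q)"
      by (rule ind[OF p]) (use 1 in \<open>auto simp: monoid_algebra_simps monoid_algebra_l_distr
          map_scale_zero map_scale_add\<close>)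
    have 2: "Poly_Mapping.single g d \<otimes>\<^bsub>?M\<^esub> (c \<odot>\<^bsub>?M\<^esub> q) = c \<odot>\<^bsub>?M\<^esub> (Poly_Mapping.single g d \<otimes>\<^bsub>?M\<^esub> q)"
      for g and d :: 'k
      unfolding monoid_algebra_simps
      by (rule ind[OF q]) (auto simp: monoid_algebra_mult_single monoid_algebra_r_distr
          map_scale_zero map_scale_single map_scale_add mult.left_commute simp del: mult.commute)
    show "p \<otimes>\<^bsub>?M\<^esub> (c \<odot>\<^bsub>?M\<^esub> q) = c \<odot>\<^bsub>?M\<^esub> (p \<otimes>\<^bsub>?M\<^esub> q)"
      by (rule ind[OF p]) (use 2 in \<open>auto simp: monoid_algebra_simps monoid_algebra_l_distr
          map_scale_zero map_scale_add\<close>)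
  qed (auto simp: monoid_algebra_simps in_keys_iff lookup_scale lookup_add algebra_simps
      intro!: poly_mapping_eqI)
qed

section \<open>Linear extension of maps from a monoid to its algebra\<close>

definition lin_ext :: "('k::field, 'c, 'z) module_scheme \<Rightarrow> ('g \<Rightarrow> 'c) \<Rightarrow> ('g \<Rightarrow>\<^sub>0 'k) \<Rightarrow> 'c" where
  "lin_ext C \<phi> p = (\<Oplus>\<^bsub>C\<^esub>g\<in>Poly_Mapping.keys p. Poly_Mapping.lookup p g \<odot>\<^bsub>C\<^esub> \<phi> g)"

lemma (in kalg) lin_ext_superset:
  assumes "finite S" "Poly_Mapping.keys p \<subseteq> S" "\<phi> \<in> S \<rightarrow> carrier A"
  shows "lin_ext A \<phi> p = (\<Oplus>g\<in>S. Poly_Mapping.lookup p g \<odot> \<phi> g)"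
  unfolding lin_ext_def
  by (rule add.finprod_mono_neutral_cong_left) (use assms in \<open>auto simp: in_keys_iff Pi_def\<close>)

context kalg
begin

lemma lin_ext_zero: "lin_ext A \<phi> 0 = \<zero>"
  by (simp add: lin_ext_def)

context
  fixes \<phi> :: "'g \<Rightarrow> 'a" and X assumes \<phi>: "\<phi> \<in> X \<rightarrow> carrier A"
begin

lemma lin_ext_closed: "Poly_Mapping.keys p \<subseteq> X \<Longrightarrow> lin_ext A \<phi> p \<in> carrier A"
  unfolding lin_ext_def using \<phi> by (intro finsum_closed) auto

lemma lin_ext_single: "g \<in> X \<Longrightarrow> lin_ext A \<phi> (Poly_Mapping.single g c) = c \<odot> \<phi> g"
  using funcset_mem[OF \<phi>] by (subst lin_ext_superset[of "{g}"]) (auto simp: finsum_insert)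

lemma lin_ext_add:
  assumes "Poly_Mapping.keys p \<subseteq> X" "Poly_Mapping.keys q \<subseteq> X"
  shows "lin_ext A \<phi> (p + q) = lin_ext A \<phi> p \<oplus> lin_ext A \<phi> q"
proof -
  let ?S = "Poly_Mapping.keys p \<union> Poly_Mapping.keys q"
  have "\<phi> \<in> ?S \<rightarrow> carrier A" using \<phi> assms by auto
  then show ?thesis
    using keys_add[of p q]
    by (subst (1 2 3) lin_ext_superset[of ?S])
      (auto simp: lookup_add smult_l_distr Pi_def simp flip: finsum_addf intro!: finsum_cong')
qed

lemma lin_ext_scale:
  assumes "Poly_Mapping.keys p \<subseteq> X"
  shows "lin_ext A \<phi> (Poly_Mapping.map ((*) c) p) = c \<odot> lin_ext A \<phi> p"
proof (rule poly_mapping_induct_keys[OF assms])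
  fix p q :: "'g \<Rightarrow>\<^sub>0 'k"
  assume *: "Poly_Mapping.keys p \<subseteq> X" "Poly_Mapping.keys q \<subseteq> X"
    "lin_ext A \<phi> (Poly_Mapping.map ((*) c) p) = c \<odot> lin_ext A \<phi> p"
    "lin_ext A \<phi> (Poly_Mapping.map ((*) c) q) = c \<odot> lin_ext A \<phi> q"
  then have "Poly_Mapping.keys (Poly_Mapping.map ((*) c) p) \<subseteq> X"
    "Poly_Mapping.keys (Poly_Mapping.map ((*) c) q) \<subseteq> X"
    by (auto simp: in_keys_iff lookup_scale)
  with * show "lin_ext A \<phi> (Poly_Mapping.map ((*) c) (p + q)) = c \<odot> lin_ext A \<phi> (p + q)"
    by (simp add: map_scale_add lin_ext_add smult_r_distr lin_ext_closed)
qed (use \<phi> in \<open>auto simp: map_scale_zero map_scale_single lin_ext_single lin_ext_zero Pi_def\<close>)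

lemma lin_ext_diff:
  assumes "Poly_Mapping.keys p \<subseteq> X" "Poly_Mapping.keys q \<subseteq> X"
  shows "lin_ext A \<phi> (p - q) = lin_ext A \<phi> p \<ominus> lin_ext A \<phi> q"
proof -
  have "Poly_Mapping.map ((*) (- 1)) q = - q"
    by (rule poly_mapping_eqI) (simp add: lookup_scale)
  with lin_ext_add[of p "- q"] lin_ext_scale[of q "- 1"] assms show ?thesis
    by (simp add: lin_ext_closed minus_smult)
qed

lemma lin_ext_sum:
  assumes "finite S" "\<And>i. i \<in> S \<Longrightarrow> Poly_Mapping.keys (p i) \<subseteq> X"
  shows "lin_ext A \<phi> (\<Sum>i\<in>S. p i) = (\<Oplus>i\<in>S. lin_ext A \<phi> (p i))"
  using assms
proof (induction S rule: finite_induct)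
  case (insert i S)
  have "Poly_Mapping.keys (\<Sum>i\<in>S. p i) \<subseteq> X"
    using insert by (intro order.trans[OF keys_sum]) auto
  with insert show ?case
    by (subst finsum_insert) (auto simp: lin_ext_add lin_ext_closed)
qed (simp add: lin_ext_zero)

end

lemma k_linear_lin_ext:
  assumes "\<phi> \<in> carrier G \<rightarrow> carrier A"
  shows "k_linear (monoid_algebra G) A (lin_ext A \<phi>)"
  unfolding k_linear_def
  using lin_ext_closed[OF assms] lin_ext_add[OF assms] lin_ext_scale[OF assms]
  by (auto simp: monoid_algebra_simps)

text \<open>The universal property of the monoid algebra: by bilinearity, multiplicativity has to be
  tested on basis elements only, where it is the hypothesis \<open>hom\<close>.\<close>

lemma alg_hom_lin_ext:
  fixes G :: "('g, 'y) monoid_scheme"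
  assumes G: "Group.monoid G" and \<phi>: "\<phi> \<in> carrier G \<rightarrow> carrier A" and "\<phi> \<one>\<^bsub>G\<^esub> = \<one>"
    and hom: "\<And>g h. \<lbrakk>g \<in> carrier G; h \<in> carrier G\<rbrakk> \<Longrightarrow> \<phi> (g \<otimes>\<^bsub>G\<^esub> h) = \<phi> g \<otimes> \<phi> h"
  shows "alg_hom (monoid_algebra G) A (lin_ext A \<phi>)"
proof -
  interpret G: Group.monoid G by fact
  let ?M = "monoid_algebra G :: ('k, 'g \<Rightarrow>\<^sub>0 'k) module"
  interpret M: kalg ?M by (rule kalg.intro, rule k_algebra_monoid_algebra[OF G])
  note \<phi>c = funcset_mem[OF \<phi>]
  have cl: "Poly_Mapping.keys (p \<otimes>\<^bsub>?M\<^esub> q) \<subseteq> carrier G"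
    if "Poly_Mapping.keys p \<subseteq> carrier G" "Poly_Mapping.keys q \<subseteq> carrier G" for p q
    using M.m_closed[of p q] that by (simp add: monoid_algebra_simps)
  have mult: "lin_ext A \<phi> (p \<otimes>\<^bsub>?M\<^esub> q) = lin_ext A \<phi> p \<otimes> lin_ext A \<phi> q"
    if p: "Poly_Mapping.keys p \<subseteq> carrier G" and q: "Poly_Mapping.keys q \<subseteq> carrier G" for p q
  proof (rule poly_mapping_induct_keys[OF p])
    fix g c assume g: "g \<in> carrier G"
    show "lin_ext A \<phi> (Poly_Mapping.single g c \<otimes>\<^bsub>?M\<^esub> q) = lin_ext A \<phi> (Poly_Mapping.single g c) \<otimes> lin_ext A \<phi> q"
    proof (rule poly_mapping_induct_keys[OF q])
      fix p' q' :: "'g \<Rightarrow>\<^sub>0 'k"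
      assume *: "Poly_Mapping.keys p' \<subseteq> carrier G" "Poly_Mapping.keys q' \<subseteq> carrier G"
        "lin_ext A \<phi> (Poly_Mapping.single g c \<otimes>\<^bsub>?M\<^esub> p') = lin_ext A \<phi> (Poly_Mapping.single g c) \<otimes> lin_ext A \<phi> p'"
        "lin_ext A \<phi> (Poly_Mapping.single g c \<otimes>\<^bsub>?M\<^esub> q') = lin_ext A \<phi> (Poly_Mapping.single g c) \<otimes> lin_ext A \<phi> q'"
      have "Poly_Mapping.keys (Poly_Mapping.single g c) \<subseteq> carrier G" using g by simp
      with * show "lin_ext A \<phi> (Poly_Mapping.single g c \<otimes>\<^bsub>?M\<^esub> (p' + q')) =
          lin_ext A \<phi> (Poly_Mapping.single g c) \<otimes> lin_ext A \<phi> (p' + q')"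
        by (simp only: monoid_algebra_r_distr lin_ext_add[OF \<phi>] cl r_distr lin_ext_closed[OF \<phi>])
    qed (use g in \<open>simp_all add: lin_ext_zero lin_ext_single[OF \<phi>] monoid_algebra_mult_single hom \<phi>c mult_ac\<close>)
  next
    fix p' q' :: "'g \<Rightarrow>\<^sub>0 'k"
    assume *: "Poly_Mapping.keys p' \<subseteq> carrier G" "Poly_Mapping.keys q' \<subseteq> carrier G"
      "lin_ext A \<phi> (p' \<otimes>\<^bsub>?M\<^esub> q) = lin_ext A \<phi> p' \<otimes> lin_ext A \<phi> q"
      "lin_ext A \<phi> (q' \<otimes>\<^bsub>?M\<^esub> q) = lin_ext A \<phi> q' \<otimes> lin_ext A \<phi> q"
    then show "lin_ext A \<phi> ((p' + q') \<otimes>\<^bsub>?M\<^esub> q) = lin_ext A \<phi> (p' + q') \<otimes> lin_ext A \<phi> q"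
      by (simp only: monoid_algebra_l_distr lin_ext_add[OF \<phi>] cl l_distr lin_ext_closed[OF \<phi>] q)
  qed (simp_all add: lin_ext_zero lin_ext_closed[OF \<phi> q])
  show ?thesis
    unfolding alg_hom_def
    using k_linear_lin_ext[OF \<phi>] mult assms(3)
    by (auto simp: k_linear_def ring_hom_def monoid_algebra_simps lin_ext_single[OF \<phi>])
qed

end

section \<open>Quotients and homomorphisms\<close>

lemma k_linearD:
  assumes "k_linear A B f"
  shows "x \<in> carrier A \<Longrightarrow> f x \<in> carrier B"
    and "\<lbrakk>x \<in> carrier A; y \<in> carrier A\<rbrakk> \<Longrightarrow> f (x \<oplus>\<^bsub>A\<^esub> y) = f x \<oplus>\<^bsub>B\<^esub> f y"
    and "x \<in> carrier A \<Longrightarrow> f (c \<odot>\<^bsub>A\<^esub> x) = c \<odot>\<^bsub>B\<^esub> f x"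
  using assms by (auto simp: k_linear_def)

lemma k_linear_zero:
  assumes "kalg A" "kalg B" "k_linear A B f"
  shows "f \<zero>\<^bsub>A\<^esub> = \<zero>\<^bsub>B\<^esub>"
proof -
  interpret A: kalg A by fact
  interpret B: kalg B by fact
  have "f (0 \<odot>\<^bsub>A\<^esub> \<zero>\<^bsub>A\<^esub>) = 0 \<odot>\<^bsub>B\<^esub> f \<zero>\<^bsub>A\<^esub>"
    by (rule k_linearD(3)[OF assms(3)]) simp
  then show ?thesis using k_linearD(1)[OF assms(3) A.zero_closed] by simp
qed

lemma k_linear_diff:
  assumes "kalg A" "kalg B" "k_linear A B f" "x \<in> carrier A" "y \<in> carrier A"
  shows "f (x \<ominus>\<^bsub>A\<^esub> y) = f x \<ominus>\<^bsub>B\<^esub> f y" "f (\<ominus>\<^bsub>A\<^esub> y) = \<ominus>\<^bsub>B\<^esub> f y"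
proof -
  interpret A: kalg A by fact
  interpret B: kalg B by fact
  show "f (x \<ominus>\<^bsub>A\<^esub> y) = f x \<ominus>\<^bsub>B\<^esub> f y" "f (\<ominus>\<^bsub>A\<^esub> y) = \<ominus>\<^bsub>B\<^esub> f y"
    using assms(4,5) k_linearD[OF assms(3)]
    by (simp_all add: A.minus_smult B.minus_smult A.minus_one_smult B.minus_one_smult)
qed

lemma alg_homD:
  assumes "alg_hom A B f"
  shows "k_linear A B f"
    and "x \<in> carrier A \<Longrightarrow> f x \<in> carrier B"
    and "\<lbrakk>x \<in> carrier A; y \<in> carrier A\<rbrakk> \<Longrightarrow> f (x \<oplus>\<^bsub>A\<^esub> y) = f x \<oplus>\<^bsub>B\<^esub> f y"
    and "x \<in> carrier A \<Longrightarrow> f (c \<odot>\<^bsub>A\<^esub> x) = c \<odot>\<^bsub>B\<^esub> f x"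
    and "\<lbrakk>x \<in> carrier A; y \<in> carrier A\<rbrakk> \<Longrightarrow> f (x \<otimes>\<^bsub>A\<^esub> y) = f x \<otimes>\<^bsub>B\<^esub> f y"
    and "f \<one>\<^bsub>A\<^esub> = \<one>\<^bsub>B\<^esub>"
  using assms by (auto simp: alg_hom_def k_linear_def ring_hom_def)

lemma alg_homI:
  assumes "k_linear A B f" "f \<one>\<^bsub>A\<^esub> = \<one>\<^bsub>B\<^esub>"
    and "\<And>x y. \<lbrakk>x \<in> carrier A; y \<in> carrier A\<rbrakk> \<Longrightarrow> f (x \<otimes>\<^bsub>A\<^esub> y) = f x \<otimes>\<^bsub>B\<^esub> f y"
  shows "alg_hom A B f"
  using assms by (auto simp: alg_hom_def k_linear_def ring_hom_def)

lemma k_linear_comp: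
  assumes "k_linear A B f" "k_linear B C g" shows "k_linear A C (\<lambda>x. g (f x))"
  using assms by (auto simp: k_linear_def Pi_def)

lemma alg_hom_comp:
  assumes "alg_hom A B f" "alg_hom B C g" shows "alg_hom A C (\<lambda>x. g (f x))"
  by (rule alg_homI) (use assms in \<open>auto simp: alg_homD intro: k_linear_comp alg_homD(1)\<close>)

lemma alg_hom_pow:
  assumes "kalg A" "kalg B" "alg_hom A B f" "x \<in> carrier A"
  shows "f (x [^]\<^bsub>A\<^esub> (n::nat)) = f x [^]\<^bsub>B\<^esub> n"
proof -
  interpret A: kalg A by fact
  interpret B: kalg B by fact
  show ?thesis by (induction n) (use assms in \<open>auto simp: alg_homD\<close>)
qed

lemma alg_quot_simps:
  "carrier (alg_quot A N) = (\<lambda>x. N +>\<^bsub>A\<^esub> x) ` carrier A"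
  "\<one>\<^bsub>alg_quot A N\<^esub> = N +>\<^bsub>A\<^esub> \<one>\<^bsub>A\<^esub>"
  "\<zero>\<^bsub>alg_quot A N\<^esub> = N"
  by (auto simp: alg_quot_def FactRing_simps)

locale kalg_ideal = kalg + ideal N A for N
begin

lemma quot_eq_iff:
  "\<lbrakk>x \<in> carrier A; y \<in> carrier A\<rbrakk> \<Longrightarrow> N +> x = N +> y \<longleftrightarrow> x \<ominus> y \<in> N"
  using quotient_eq_iff_same_a_r_cos[OF ideal_axioms] by blast

lemma smult_ideal: "x \<in> N \<Longrightarrow> c \<odot> x \<in> N"
  using I_l_closed[of x "c \<odot> \<one>"] by simp

lemma quot_add: "\<lbrakk>x \<in> carrier A; y \<in> carrier A\<rbrakk> \<Longrightarrow>
    (N +> x) \<oplus>\<^bsub>alg_quot A N\<^esub> (N +> y) = N +> (x \<oplus> y)"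
  by (simp add: alg_quot_def FactRing_def a_rcos_sum)

lemma quot_mult: "\<lbrakk>x \<in> carrier A; y \<in> carrier A\<rbrakk> \<Longrightarrow>
    (N +> x) \<otimes>\<^bsub>alg_quot A N\<^esub> (N +> y) = N +> (x \<otimes> y)"
  by (simp add: alg_quot_def FactRing_def rcoset_mult_add)

lemma quot_smult:
  assumes x: "x \<in> carrier A"
  shows "c \<odot>\<^bsub>alg_quot A N\<^esub> (N +> x) = N +> (c \<odot> x)"
proof -
  have "N +> (c \<odot> y) = N +> (c \<odot> x)" if y: "y \<in> N +> x" for y
  proof -
    obtain h where h: "h \<in> N" "y = h \<oplus> x" using y by (auto simp: a_r_coset_def')
    have "c \<odot> y = c \<odot> h \<oplus> c \<odot> x" using h x by (simp add: smult_r_distr)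
    then show ?thesis
      using h x smult_ideal[OF h(1), of c]
      by (simp add: a_rcos_const quot_eq_iff minus_eq a_assoc r_neg)
  qed
  moreover have "N +> x \<noteq> {}" using a_rcos_self[OF x] by blast
  ultimately have "(\<Union>y\<in>N +> x. N +> (c \<odot> y)) = N +> (c \<odot> x)"
    by (intro SUP_eq_const)
  then show ?thesis by (simp add: alg_quot_def)
qed

lemma kalg_quot: "kalg (alg_quot A N)"
proof (rule kalg.intro, rule k_algebraI, rule ringI)
  have N: "N = N +> \<zero>" using a_coset_add_zero[OF a_subset] by simp
  show "abelian_group (alg_quot A N)"
  proof (rule abelian_groupI)
    fix X assume "X \<in> carrier (alg_quot A N)"
    then obtain x where "x \<in> carrier A" "X = N +> x" by (auto simp: alg_quot_simps)
    then show "\<exists>Y\<in>carrier (alg_quot A N). Y \<oplus>\<^bsub>alg_quot A N\<^esub> X = \<zero>\<^bsub>alg_quot A N\<^esub>"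
      by (intro bexI[of _ "N +> (\<ominus> x)"]) (auto simp: alg_quot_simps quot_add l_neg N[symmetric])
  next
    show "\<zero>\<^bsub>alg_quot A N\<^esub> \<in> carrier (alg_quot A N)"
      using N by (auto simp: alg_quot_simps)
    fix X assume "X \<in> carrier (alg_quot A N)"
    then obtain x where x: "x \<in> carrier A" "X = N +> x" by (auto simp: alg_quot_simps)
    then show "\<zero>\<^bsub>alg_quot A N\<^esub> \<oplus>\<^bsub>alg_quot A N\<^esub> X = X"
      using quot_add[of \<zero> x] by (simp add: alg_quot_simps N[symmetric])
  qed (auto simp: alg_quot_simps quot_add a_ac)
  show "Group.monoid (alg_quot A N)"
    by (rule monoidI) (auto simp: alg_quot_simps quot_mult m_assoc)
qed (auto simp: alg_quot_simps quot_add quot_mult quot_smult smult_l_distr smult_r_distr l_distr r_distr)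

text \<open>\<open>F\<close> evaluates \<open>f\<close> at a chosen representative; the choice does
  not matter because \<open>f\<close> vanishes on \<open>N\<close>. \<open>F\<close> is extensional
  so that maps can later be singled out by \<open>THE\<close>. The last clause is an implication so
  that one lemma serves both linear maps on tensor products and algebra maps on
  \<open>wU_alg\<close>.\<close>

lemma quot_lift_exists:
  assumes C: "kalg C" and f: "k_linear A C f" and ker: "\<And>x. x \<in> N \<Longrightarrow> f x = \<zero>\<^bsub>C\<^esub>"
  obtains F where "F \<in> extensional (carrier (alg_quot A N))" "k_linear (alg_quot A N) C F"
    "\<And>x. x \<in> carrier A \<Longrightarrow> F (N +> x) = f x"
    "alg_hom A C f \<Longrightarrow> alg_hom (alg_quot A N) C F"
proof -
  interpret C: kalg C by fact
  define F where "F = (\<lambda>X\<in>carrier (alg_quot A N). f (SOME x. x \<in> carrier A \<and> X = N +> x))"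
  have F: "F (N +> x) = f x" if x: "x \<in> carrier A" for x
  proof -
    have "\<exists>y. y \<in> carrier A \<and> N +> x = N +> y" using x by blast
    from someI_ex[OF this] have y: "(SOME y. y \<in> carrier A \<and> N +> x = N +> y) \<in> carrier A"
      "N +> x = N +> (SOME y. y \<in> carrier A \<and> N +> x = N +> y)" by auto
    have "f x \<ominus>\<^bsub>C\<^esub> f (SOME y. y \<in> carrier A \<and> N +> x = N +> y) = \<zero>\<^bsub>C\<^esub>"
      using k_linear_diff(1)[OF kalg_axioms C f x y(1)] ker y quot_eq_iff[OF x y(1)] by simp
    then show ?thesis
      using C.smult_diff_eq_iff k_linearD(1)[OF f] x y(1) by (simp add: F_def alg_quot_simps)
  qed
  have lin: "k_linear (alg_quot A N) C F"
    unfolding k_linear_def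
    by (auto simp: alg_quot_simps F quot_add quot_smult k_linearD[OF f])
  show ?thesis
  proof (rule that[OF _ lin F])
    assume "alg_hom A C f"
    then show "alg_hom (alg_quot A N) C F"
      by (intro alg_homI lin) (auto simp: alg_quot_simps F quot_mult alg_homD)
  qed (unfold F_def, rule restrict_extensional)
qed

end

text \<open>An anti-homomorphism into \<open>A\<close> is a homomorphism into
  \<open>op_alg A\<close>, so the universal property that yields \<open>wDelta\<close> and
  \<open>wepsilon\<close> also yields \<open>wT\<close>.\<close>

definition op_alg :: "('k, 'a, 'z) module_scheme \<Rightarrow> ('k, 'a) module" where
  "op_alg A = \<lparr>carrier = carrier A, mult = (\<lambda>x y. y \<otimes>\<^bsub>A\<^esub> x), one = \<one>\<^bsub>A\<^esub>, zero = \<zero>\<^bsub>A\<^esub>,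
     add = add A, smult = smult A\<rparr>"

lemma op_alg_simps [simp]:
  "carrier (op_alg A) = carrier A" "x \<otimes>\<^bsub>op_alg A\<^esub> y = y \<otimes>\<^bsub>A\<^esub> x" "\<one>\<^bsub>op_alg A\<^esub> = \<one>\<^bsub>A\<^esub>"
  "\<zero>\<^bsub>op_alg A\<^esub> = \<zero>\<^bsub>A\<^esub>" "x \<oplus>\<^bsub>op_alg A\<^esub> y = x \<oplus>\<^bsub>A\<^esub> y" "c \<odot>\<^bsub>op_alg A\<^esub> x = c \<odot>\<^bsub>A\<^esub> x"
  by (simp_all add: op_alg_def)

lemma alg_anti_hom_iff_op: "alg_anti_hom A B f \<longleftrightarrow> alg_hom A (op_alg B) f"
  by (auto simp: alg_anti_hom_def alg_hom_def k_linear_def ring_hom_def Pi_def)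

context kalg
begin

lemma kalg_op: "kalg (op_alg A)"
proof (rule kalg.intro, rule k_algebraI, rule ringI)
  show "abelian_group (op_alg A)"
  proof (rule abelian_groupI)
    fix x assume "x \<in> carrier (op_alg A)"
    then show "\<exists>y\<in>carrier (op_alg A). y \<oplus>\<^bsub>op_alg A\<^esub> x = \<zero>\<^bsub>op_alg A\<^esub>"
      by (intro bexI[of _ "\<ominus> x"]) (simp_all add: l_neg)
  qed (auto simp: a_ac)
  show "Group.monoid (op_alg A)"
    by (rule monoidI) (auto simp: m_assoc)
qed (auto simp: l_distr r_distr smult_l_distr smult_r_distr)

lemma op_pow [simp]: "x \<in> carrier A \<Longrightarrow> x [^]\<^bsub>op_alg A\<^esub> (n::nat) = x [^] n"
proof (induction n)
  case (Suc n)
  then show ?case using nat_pow_Suc2[of x n] by (simp add: nat_pow_def)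
qed (simp add: nat_pow_def)

lemma op_minus [simp]: "x \<in> carrier A \<Longrightarrow> \<ominus>\<^bsub>op_alg A\<^esub> x = \<ominus> x"
  "\<lbrakk>x \<in> carrier A; y \<in> carrier A\<rbrakk> \<Longrightarrow> x \<ominus>\<^bsub>op_alg A\<^esub> y = x \<ominus> y"
proof -
  interpret O: kalg "op_alg A" by (rule kalg_op)
  show "x \<in> carrier A \<Longrightarrow> \<ominus>\<^bsub>op_alg A\<^esub> x = \<ominus> x"
    "\<lbrakk>x \<in> carrier A; y \<in> carrier A\<rbrakk> \<Longrightarrow> x \<ominus>\<^bsub>op_alg A\<^esub> y = x \<ominus> y"
    by (simp_all add: O.minus_one_smult minus_one_smult O.minus_smult minus_smult)
qed

end

section \<open>Tensor products\<close>

definition bilin :: "('k::field, 'a, 'x) module_scheme \<Rightarrow> ('k, 'b, 'y) module_scheme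
    \<Rightarrow> ('k, 'c, 'z) module_scheme \<Rightarrow> ('a \<Rightarrow> 'b \<Rightarrow> 'c) \<Rightarrow> bool" where
  "bilin A B C \<phi> \<longleftrightarrow> (\<forall>a\<in>carrier A. k_linear B C (\<phi> a)) \<and> (\<forall>b\<in>carrier B. k_linear A C (\<lambda>a. \<phi> a b))"

lemma bilinD:
  assumes "bilin A B C \<phi>"
  shows "\<lbrakk>a \<in> carrier A; b \<in> carrier B\<rbrakk> \<Longrightarrow> \<phi> a b \<in> carrier C"
    "\<lbrakk>a \<in> carrier A; a' \<in> carrier A; b \<in> carrier B\<rbrakk> \<Longrightarrow> \<phi> (a \<oplus>\<^bsub>A\<^esub> a') b = \<phi> a b \<oplus>\<^bsub>C\<^esub> \<phi> a' b"
    "\<lbrakk>a \<in> carrier A; b \<in> carrier B; b' \<in> carrier B\<rbrakk> \<Longrightarrow> \<phi> a (b \<oplus>\<^bsub>B\<^esub> b') = \<phi> a b \<oplus>\<^bsub>C\<^esub> \<phi> a b'"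
    "\<lbrakk>a \<in> carrier A; b \<in> carrier B\<rbrakk> \<Longrightarrow> \<phi> (c \<odot>\<^bsub>A\<^esub> a) b = c \<odot>\<^bsub>C\<^esub> \<phi> a b"
    "\<lbrakk>a \<in> carrier A; b \<in> carrier B\<rbrakk> \<Longrightarrow> \<phi> a (c \<odot>\<^bsub>B\<^esub> b) = c \<odot>\<^bsub>C\<^esub> \<phi> a b"
  using assms unfolding bilin_def k_linear_def by auto

locale kalg2 = A: kalg A + B: kalg B
  for A :: "('k::field, 'a, 'y) module_scheme" and B :: "('k, 'b, 'z) module_scheme"
begin

abbreviation (input) "M \<equiv> monoid_algebra (A \<times>\<times> B) :: ('k, _) module"
abbreviation (input) "N \<equiv> bilinear_ideal A B"
abbreviation (input) "AB \<equiv> tensor A B"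
abbreviation (input) "pt \<equiv> pure_tensor A B"

lemma monoid_prod: "Group.monoid (A \<times>\<times> B)"
  by (rule DirProd_monoid) (rule A.monoid_axioms B.monoid_axioms)+

sublocale M: kalg M
  by (rule kalg.intro, rule k_algebra_monoid_algebra[OF monoid_prod])

lemma bilinear_relators_carrier: "bilinear_relators A B \<subseteq> carrier M"
  using keys_diff by (fastforce simp: bilinear_relators_def monoid_algebra_simps
      dest!: subsetD[OF keys_diff] split: if_splits)

sublocale I: kalg_ideal M N
  unfolding bilinear_ideal_def
  by (rule kalg_ideal.intro[OF M.kalg_axioms], rule M.genideal_ideal[OF bilinear_relators_carrier])

sublocale T: kalg AB
  unfolding tensor_def by (rule I.kalg_quot)

lemma single_carrier: "\<lbrakk>a \<in> carrier A; b \<in> carrier B\<rbrakk> \<Longrightarrow> Poly_Mapping.single (a, b) c \<in> carrier M"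
  by (simp add: monoid_algebra_simps)

lemma pt_closed [simp, intro]: "\<lbrakk>a \<in> carrier A; b \<in> carrier B\<rbrakk> \<Longrightarrow> pt a b \<in> carrier AB"
  by (simp add: tensor_def pure_tensor_def alg_quot_simps single_carrier)

lemma pt_mult [simp]:
  "\<lbrakk>a \<in> carrier A; b \<in> carrier B; a' \<in> carrier A; b' \<in> carrier B\<rbrakk> \<Longrightarrow>
    pt a b \<otimes>\<^bsub>AB\<^esub> pt a' b' = pt (a \<otimes>\<^bsub>A\<^esub> a') (b \<otimes>\<^bsub>B\<^esub> b')"
  by (simp add: tensor_def pure_tensor_def I.quot_mult single_carrier monoid_algebra_mult_single)

lemma pt_one: "pt \<one>\<^bsub>A\<^esub> \<one>\<^bsub>B\<^esub> = \<one>\<^bsub>AB\<^esub>"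
  by (simp add: tensor_def pure_tensor_def alg_quot_simps monoid_algebra_simps)

lemma M_minus: "\<lbrakk>p \<in> carrier M; q \<in> carrier M\<rbrakk> \<Longrightarrow> p \<ominus>\<^bsub>M\<^esub> q = p - q"
  by (simp add: M.minus_smult monoid_algebra_simps poly_mapping_eq_iff lookup_add lookup_scale
      lookup_minus fun_eq_iff)

lemma relator_in_ideal: "r \<in> bilinear_relators A B \<Longrightarrow> r \<in> N"
  using M.genideal_self[OF bilinear_relators_carrier] by (auto simp: bilinear_ideal_def)

lemma pt_add_l:
  assumes "a \<in> carrier A" "a' \<in> carrier A" "b \<in> carrier B"
  shows "pt (a \<oplus>\<^bsub>A\<^esub> a') b = pt a b \<oplus>\<^bsub>AB\<^esub> pt a' b"
proof -
  have "Poly_Mapping.single (a \<oplus>\<^bsub>A\<^esub> a', b) 1 - Poly_Mapping.single (a, b) 1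
        - Poly_Mapping.single (a', b) 1 \<in> N"
    by (rule relator_in_ideal) (use assms in \<open>auto simp: bilinear_relators_def\<close>)
  then show ?thesis
    using assms single_carrier[OF assms(1,3), of 1] single_carrier[OF assms(2,3), of 1]
    by (simp add: tensor_def pure_tensor_def I.quot_add single_carrier I.quot_eq_iff
        M_minus M.a_closed[unfolded monoid_algebra_simps(4)] monoid_algebra_simps(4) diff_diff_eq)
qed

lemma pt_add_r:
  assumes "a \<in> carrier A" "b' \<in> carrier B" "b \<in> carrier B"
  shows "pt a (b \<oplus>\<^bsub>B\<^esub> b') = pt a b \<oplus>\<^bsub>AB\<^esub> pt a b'"
proof -
  have "Poly_Mapping.single (a, b \<oplus>\<^bsub>B\<^esub> b') 1 - Poly_Mapping.single (a, b) 1
        - Poly_Mapping.single (a, b') 1 \<in> N"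
    by (rule relator_in_ideal) (use assms in \<open>auto simp: bilinear_relators_def\<close>)
  then show ?thesis
    using assms single_carrier[OF assms(1,2), of 1] single_carrier[OF assms(1,3), of 1]
    by (simp add: tensor_def pure_tensor_def I.quot_add single_carrier I.quot_eq_iff
        M_minus M.a_closed[unfolded monoid_algebra_simps(4)] monoid_algebra_simps(4) diff_diff_eq)
qed

lemma smult_single_M: "c \<odot>\<^bsub>M\<^esub> Poly_Mapping.single x d = Poly_Mapping.single x (c * d)"
  by (simp add: monoid_algebra_simps map_scale_single)

lemma pt_smult_l:
  assumes "a \<in> carrier A" "b \<in> carrier B"
  shows "pt (c \<odot>\<^bsub>A\<^esub> a) b = c \<odot>\<^bsub>AB\<^esub> pt a b"
proof -
  have "Poly_Mapping.single (c \<odot>\<^bsub>A\<^esub> a, b) 1 - Poly_Mapping.single (a, b) c \<in> N"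
    by (rule relator_in_ideal) (use assms in \<open>auto simp: bilinear_relators_def\<close>)
  then show ?thesis
    using assms
    by (simp add: tensor_def pure_tensor_def I.quot_smult single_carrier I.quot_eq_iff M_minus smult_single_M)
qed

lemma pt_smult_r:
  assumes "a \<in> carrier A" "b \<in> carrier B"
  shows "pt a (c \<odot>\<^bsub>B\<^esub> b) = c \<odot>\<^bsub>AB\<^esub> pt a b"
proof -
  have "Poly_Mapping.single (a, c \<odot>\<^bsub>B\<^esub> b) 1 - Poly_Mapping.single (a, b) c \<in> N"
    by (rule relator_in_ideal) (use assms in \<open>auto simp: bilinear_relators_def\<close>)
  then show ?thesis
    using assms
    by (simp add: tensor_def pure_tensor_def I.quot_smult single_carrier I.quot_eq_iff M_minus smult_single_M)
qed

lemma bilin_pt: "bilin A B AB pt"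
  by (auto simp: bilin_def k_linear_def pt_add_l pt_add_r pt_smult_l pt_smult_r)

lemma pt_zero [simp]:
  "b \<in> carrier B \<Longrightarrow> pt \<zero>\<^bsub>A\<^esub> b = \<zero>\<^bsub>AB\<^esub>" "a \<in> carrier A \<Longrightarrow> pt a \<zero>\<^bsub>B\<^esub> = \<zero>\<^bsub>AB\<^esub>"
  using pt_smult_l[of "\<zero>\<^bsub>A\<^esub>" b 0] pt_smult_r[of a "\<zero>\<^bsub>B\<^esub>" 0] by simp_all

lemma pt_pow:
  assumes "a \<in> carrier A" "b \<in> carrier B"
  shows "pt a b [^]\<^bsub>AB\<^esub> (n::nat) = pt (a [^]\<^bsub>A\<^esub> n) (b [^]\<^bsub>B\<^esub> n)"
  by (induction n) (use assms in \<open>simp_all add: pt_one\<close>)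

text \<open>A scalar is absorbed into the first entry of a pure tensor, so sums of pure tensors
  already exhaust the tensor product.\<close>

lemma tensor_induct [consumes 1, case_names zero pure add]:
  assumes "t \<in> carrier AB" "P \<zero>\<^bsub>AB\<^esub>"
    and pure: "\<And>a b. \<lbrakk>a \<in> carrier A; b \<in> carrier B\<rbrakk> \<Longrightarrow> P (pt a b)"
    and "\<And>s t. \<lbrakk>s \<in> carrier AB; t \<in> carrier AB; P s; P t\<rbrakk> \<Longrightarrow> P (s \<oplus>\<^bsub>AB\<^esub> t)"
  shows "P t"
proof -
  obtain p where p: "Poly_Mapping.keys p \<subseteq> carrier (A \<times>\<times> B)" "t = N +>\<^bsub>M\<^esub> p"
    using assms(1) by (auto simp: tensor_def alg_quot_simps monoid_algebra_simps)
  have "P (N +>\<^bsub>M\<^esub> p)"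
  proof (rule poly_mapping_induct_keys[OF p(1)])
    show "P (N +>\<^bsub>M\<^esub> 0)"
      using assms(2) M.a_coset_add_zero[OF I.a_subset] by (simp add: tensor_def alg_quot_simps monoid_algebra_simps)
    fix g and c :: 'k assume "g \<in> carrier (A \<times>\<times> B)"
    then obtain a b where g: "g = (a, b)" "a \<in> carrier A" "b \<in> carrier B" by auto
    have "N +>\<^bsub>M\<^esub> Poly_Mapping.single g c = pt (c \<odot>\<^bsub>A\<^esub> a) b"
      using g by (simp add: pt_smult_l) (simp add: pure_tensor_def tensor_def I.quot_smult single_carrier smult_single_M)
    then show "P (N +>\<^bsub>M\<^esub> Poly_Mapping.single g c)" using pure g by simp
  next
    fix p q :: "'a \<times> 'b \<Rightarrow>\<^sub>0 'k"
    assume *: "Poly_Mapping.keys p \<subseteq> carrier (A \<times>\<times> B)" "Poly_Mapping.keys q \<subseteq> carrier (A \<times>\<times> B)"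
      and "P (N +>\<^bsub>M\<^esub> p)" "P (N +>\<^bsub>M\<^esub> q)"
    then have "P ((N +>\<^bsub>M\<^esub> p) \<oplus>\<^bsub>AB\<^esub> (N +>\<^bsub>M\<^esub> q))"
      by (intro assms(4)) (auto simp: tensor_def alg_quot_simps monoid_algebra_simps)
    then show "P (N +>\<^bsub>M\<^esub> (p + q))"
      using * by (simp add: tensor_def I.quot_add monoid_algebra_simps)
  qed
  then show ?thesis using p by simp
qed

lemma lin_ext_bilinear_relator:
  assumes C: "kalg C" and bil: "bilin A B C \<psi>" and r: "r \<in> bilinear_relators A B"
  shows "lin_ext C (\<lambda>(a, b). \<psi> a b) r = \<zero>\<^bsub>C\<^esub>"
proof -
  interpret C: kalg C by fact
  let ?\<phi> = "\<lambda>(a, b). \<psi> a b" and ?X = "carrier A \<times> carrier B"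
  have \<phi>: "?\<phi> \<in> ?X \<rightarrow> carrier C" using bilinD(1)[OF bil] by auto
  have keys: "Poly_Mapping.keys (p - q) \<subseteq> ?X" if "Poly_Mapping.keys p \<subseteq> ?X" "Poly_Mapping.keys q \<subseteq> ?X"
    for p q :: "_ \<Rightarrow>\<^sub>0 'k" using that keys_diff[of p q] by blast
  have canc: "x \<oplus>\<^bsub>C\<^esub> y \<ominus>\<^bsub>C\<^esub> x \<ominus>\<^bsub>C\<^esub> y = \<zero>\<^bsub>C\<^esub>" if "x \<in> carrier C" "y \<in> carrier C" for x y
  proof -
    have "x \<oplus>\<^bsub>C\<^esub> y \<oplus>\<^bsub>C\<^esub> \<ominus>\<^bsub>C\<^esub> x = y" using that C.a_comm[of x y] by (simp add: C.a_assoc C.r_neg)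
    then show ?thesis using that by (simp add: C.minus_eq C.r_neg)
  qed
  have single: "lin_ext C ?\<phi> (Poly_Mapping.single (a, b) c) = c \<odot>\<^bsub>C\<^esub> \<psi> a b"
    if "a \<in> carrier A" "b \<in> carrier B" for a b c
    using C.lin_ext_single[OF \<phi>, of "(a, b)" c] that by simp
  note bilD = bilinD[OF bil]
  have diff2: "lin_ext C ?\<phi> (Poly_Mapping.single x 1 - Poly_Mapping.single y 1 - Poly_Mapping.single z 1) =
      lin_ext C ?\<phi> (Poly_Mapping.single x 1) \<ominus>\<^bsub>C\<^esub> lin_ext C ?\<phi> (Poly_Mapping.single y 1)
        \<ominus>\<^bsub>C\<^esub> lin_ext C ?\<phi> (Poly_Mapping.single z 1)"
    if "x \<in> ?X" "y \<in> ?X" "z \<in> ?X" for x y z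
    using that by (simp add: C.lin_ext_diff[OF \<phi>] keys)
  have diff1: "lin_ext C ?\<phi> (Poly_Mapping.single x 1 - Poly_Mapping.single y c) =
      lin_ext C ?\<phi> (Poly_Mapping.single x 1) \<ominus>\<^bsub>C\<^esub> lin_ext C ?\<phi> (Poly_Mapping.single y c)"
    if "x \<in> ?X" "y \<in> ?X" for x y c
    using that by (subst C.lin_ext_diff[OF \<phi>]) auto
  show ?thesis using r unfolding bilinear_relators_def
    by (elim UnE CollectE exE conjE)
      (simp_all add: diff1 diff2 single bilD canc C.r_neg[folded C.minus_eq] C.smult_diff_eq_iff)
qed

text \<open>The linear extension of \<open>\<psi>\<close> is not multiplicative, so its kernel is
  not visibly an ideal. The proof passes to the largest two-sided ideal \<open>Z\<close> inside the
  kernel and shows that \<open>Z\<close> contains the relators.\<close>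

lemma lin_ext_bilinear_ideal:
  assumes C: "kalg C" and bil: "bilin A B C \<psi>" and r: "r \<in> N"
  shows "lin_ext C (\<lambda>(a, b). \<psi> a b) r = \<zero>\<^bsub>C\<^esub>"
proof -
  interpret C: kalg C by fact
  let ?\<phi> = "\<lambda>(a, b). \<psi> a b"
  let ?L = "lin_ext C ?\<phi>"
  have \<phi>: "?\<phi> \<in> carrier (A \<times>\<times> B) \<rightarrow> carrier C" using bilinD(1)[OF bil] by auto
  have L: "k_linear M C ?L" by (rule C.k_linear_lin_ext[OF \<phi>])
  note Ls = k_linearD[OF L] k_linear_zero[OF M.kalg_axioms C L]
  define Z where "Z = {p \<in> carrier M. \<forall>x\<in>carrier M. \<forall>y\<in>carrier M. ?L (x \<otimes>\<^bsub>M\<^esub> p \<otimes>\<^bsub>M\<^esub> y) = \<zero>\<^bsub>C\<^esub>}"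
  have "ideal Z M"
  proof (rule idealI[OF M.ring_axioms])
    show "subgroup Z (add_monoid M)"
      by (rule M.add.subgroupI)
        (auto simp: Z_def M.l_distr M.r_distr Ls M.l_minus M.r_minus k_linear_diff[OF M.kalg_axioms C L]
          intro!: exI[of _ "\<zero>\<^bsub>M\<^esub>"])
    fix a x assume a: "a \<in> Z" "x \<in> carrier M"
    then have "y \<otimes>\<^bsub>M\<^esub> (x \<otimes>\<^bsub>M\<^esub> a) \<otimes>\<^bsub>M\<^esub> z = y \<otimes>\<^bsub>M\<^esub> x \<otimes>\<^bsub>M\<^esub> a \<otimes>\<^bsub>M\<^esub> z"
      "y \<otimes>\<^bsub>M\<^esub> (a \<otimes>\<^bsub>M\<^esub> x) \<otimes>\<^bsub>M\<^esub> z = y \<otimes>\<^bsub>M\<^esub> a \<otimes>\<^bsub>M\<^esub> (x \<otimes>\<^bsub>M\<^esub> z)"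
      if "y \<in> carrier M" "z \<in> carrier M" for y z
      using that by (simp_all add: Z_def M.m_assoc)
    with a show "x \<otimes>\<^bsub>M\<^esub> a \<in> Z" "a \<otimes>\<^bsub>M\<^esub> x \<in> Z" by (auto simp: Z_def)
  qed
  moreover have "bilinear_relators A B \<subseteq> Z"
  proof
    fix r assume r: "r \<in> bilinear_relators A B"
    have rc: "r \<in> carrier M" using r bilinear_relators_carrier by blast
    have "?L (x \<otimes>\<^bsub>M\<^esub> r \<otimes>\<^bsub>M\<^esub> y) = \<zero>\<^bsub>C\<^esub>" if x: "x \<in> carrier M" and y: "y \<in> carrier M" for x y
    proof (rule poly_mapping_induct_keys[of x "carrier (A \<times>\<times> B)"])
      fix g and c :: 'k assume "g \<in> carrier (A \<times>\<times> B)"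
      then obtain g1 g2 where g: "g = (g1, g2)" "g1 \<in> carrier A" "g2 \<in> carrier B" by auto
      note gc = single_carrier[OF g(2,3), folded g(1)]
      show "?L (Poly_Mapping.single g c \<otimes>\<^bsub>M\<^esub> r \<otimes>\<^bsub>M\<^esub> y) = \<zero>\<^bsub>C\<^esub>"
      proof (rule poly_mapping_induct_keys[of y "carrier (A \<times>\<times> B)"])
        fix h and d :: 'k assume "h \<in> carrier (A \<times>\<times> B)"
        then obtain h1 h2 where h: "h = (h1, h2)" "h1 \<in> carrier A" "h2 \<in> carrier B" by auto
        note hc = single_carrier[OF h(2,3), folded h(1)]
        \<comment> \<open>Multiplying a relator by the pairs \<open>g\<close> and \<open>h\<close>
          from both sides amounts to replacing \<open>\<psi>\<close> by another bilinear map, to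
          which the lemma on relators applies.\<close>
        define \<psi>' where "\<psi>' a b = \<psi> (g1 \<otimes>\<^bsub>A\<^esub> a \<otimes>\<^bsub>A\<^esub> h1) (g2 \<otimes>\<^bsub>B\<^esub> b \<otimes>\<^bsub>B\<^esub> h2)" for a b
        have bil': "bilin A B C \<psi>'"
          using g h bilinD[OF bil] unfolding bilin_def k_linear_def \<psi>'_def
          by (auto simp: A.l_distr A.r_distr B.l_distr B.r_distr)
        have \<phi>': "(\<lambda>(a, b). \<psi>' a b) \<in> carrier (A \<times>\<times> B) \<rightarrow> carrier C" using bilinD(1)[OF bil'] by auto
        have "?L (Poly_Mapping.single g c \<otimes>\<^bsub>M\<^esub> r \<otimes>\<^bsub>M\<^esub> Poly_Mapping.single h d) =
            (c * d) \<odot>\<^bsub>C\<^esub> lin_ext C (\<lambda>(a, b). \<psi>' a b) r"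
        proof (rule poly_mapping_induct_keys[of r "carrier (A \<times>\<times> B)"])
          fix p q :: "_ \<Rightarrow>\<^sub>0 'k"
          assume *: "Poly_Mapping.keys p \<subseteq> carrier (A \<times>\<times> B)" "Poly_Mapping.keys q \<subseteq> carrier (A \<times>\<times> B)"
            "?L (Poly_Mapping.single g c \<otimes>\<^bsub>M\<^esub> p \<otimes>\<^bsub>M\<^esub> Poly_Mapping.single h d) =
              (c * d) \<odot>\<^bsub>C\<^esub> lin_ext C (\<lambda>(a, b). \<psi>' a b) p"
            "?L (Poly_Mapping.single g c \<otimes>\<^bsub>M\<^esub> q \<otimes>\<^bsub>M\<^esub> Poly_Mapping.single h d) =
              (c * d) \<odot>\<^bsub>C\<^esub> lin_ext C (\<lambda>(a, b). \<psi>' a b) q"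
          then have "p \<in> carrier M" "q \<in> carrier M" by (simp_all add: monoid_algebra_simps)
          then show "?L (Poly_Mapping.single g c \<otimes>\<^bsub>M\<^esub> (p + q) \<otimes>\<^bsub>M\<^esub> Poly_Mapping.single h d) =
              (c * d) \<odot>\<^bsub>C\<^esub> lin_ext C (\<lambda>(a, b). \<psi>' a b) (p + q)"
            using * gc hc Ls(2)[unfolded monoid_algebra_simps(4)]
            by (simp add: monoid_algebra_l_distr monoid_algebra_r_distr C.lin_ext_add[OF \<phi>']
                C.smult_r_distr C.lin_ext_closed[OF \<phi>'])
        next
          fix k and e :: 'k assume "k \<in> carrier (A \<times>\<times> B)"
          then show "?L (Poly_Mapping.single g c \<otimes>\<^bsub>M\<^esub> Poly_Mapping.single k e \<otimes>\<^bsub>M\<^esub> Poly_Mapping.single h d) =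
              (c * d) \<odot>\<^bsub>C\<^esub> lin_ext C (\<lambda>(a, b). \<psi>' a b) (Poly_Mapping.single k e)"
            using g h C.lin_ext_single[OF \<phi>', of k e]
            by (auto simp: monoid_algebra_mult_single C.lin_ext_single[OF \<phi>]
                \<psi>'_def bilinD(1)[OF bil] mult_ac)
        qed (use rc in \<open>auto simp: monoid_algebra_simps C.lin_ext_zero\<close>)
        then show "?L (Poly_Mapping.single g c \<otimes>\<^bsub>M\<^esub> r \<otimes>\<^bsub>M\<^esub> Poly_Mapping.single h d) = \<zero>\<^bsub>C\<^esub>"
          by (simp add: lin_ext_bilinear_relator[OF C bil' r])
      next
        fix p q :: "_ \<Rightarrow>\<^sub>0 'k"
        assume *: "Poly_Mapping.keys p \<subseteq> carrier (A \<times>\<times> B)" "Poly_Mapping.keys q \<subseteq> carrier (A \<times>\<times> B)"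
          "?L (Poly_Mapping.single g c \<otimes>\<^bsub>M\<^esub> r \<otimes>\<^bsub>M\<^esub> p) = \<zero>\<^bsub>C\<^esub>"
          "?L (Poly_Mapping.single g c \<otimes>\<^bsub>M\<^esub> r \<otimes>\<^bsub>M\<^esub> q) = \<zero>\<^bsub>C\<^esub>"
        then have "p \<in> carrier M" "q \<in> carrier M" by (simp_all add: monoid_algebra_simps)
        then show "?L (Poly_Mapping.single g c \<otimes>\<^bsub>M\<^esub> r \<otimes>\<^bsub>M\<^esub> (p + q)) = \<zero>\<^bsub>C\<^esub>"
          using * gc rc Ls(2)[unfolded monoid_algebra_simps(4)] by (simp add: monoid_algebra_r_distr)
      qed (use y in \<open>auto simp: monoid_algebra_simps C.lin_ext_zero\<close>)
    next
      fix p q :: "_ \<Rightarrow>\<^sub>0 'k"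
      assume *: "Poly_Mapping.keys p \<subseteq> carrier (A \<times>\<times> B)" "Poly_Mapping.keys q \<subseteq> carrier (A \<times>\<times> B)"
        "?L (p \<otimes>\<^bsub>M\<^esub> r \<otimes>\<^bsub>M\<^esub> y) = \<zero>\<^bsub>C\<^esub>" "?L (q \<otimes>\<^bsub>M\<^esub> r \<otimes>\<^bsub>M\<^esub> y) = \<zero>\<^bsub>C\<^esub>"
      then have "p \<in> carrier M" "q \<in> carrier M" by (simp_all add: monoid_algebra_simps)
      then show "?L ((p + q) \<otimes>\<^bsub>M\<^esub> r \<otimes>\<^bsub>M\<^esub> y) = \<zero>\<^bsub>C\<^esub>"
        using * y rc Ls(2)[unfolded monoid_algebra_simps(4)] by (simp add: monoid_algebra_l_distr)
    qed (use x in \<open>auto simp: monoid_algebra_simps C.lin_ext_zero\<close>)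
    then show "r \<in> Z" using rc by (simp add: Z_def)
  qed
  ultimately have "N \<subseteq> Z" unfolding bilinear_ideal_def by (rule M.genideal_minimal)
  with r have "r \<in> Z" by blast
  then have "r \<in> carrier M" "?L (\<one>\<^bsub>M\<^esub> \<otimes>\<^bsub>M\<^esub> r \<otimes>\<^bsub>M\<^esub> \<one>\<^bsub>M\<^esub>) = \<zero>\<^bsub>C\<^esub>"
    unfolding Z_def using M.one_closed by blast+
  then show ?thesis by simp
qed

text \<open>Existence comes from the quotient and uniqueness from \<open>tensor_induct\<close>;
  together they make the definite description in \<open>tensor_lift\<close> meaningful.\<close>

lemma tensor_lift:
  assumes C: "kalg C" and bil: "bilin A B C \<phi>"
  shows "k_linear AB C (tensor_lift A B C \<phi>)"
    and "\<And>a b. \<lbrakk>a \<in> carrier A; b \<in> carrier B\<rbrakk> \<Longrightarrow> tensor_lift A B C \<phi> (pt a b) = \<phi> a b"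
proof -
  interpret C: kalg C by fact
  let ?\<phi> = "\<lambda>(a, b). \<phi> a b"
  let ?P = "\<lambda>f. f \<in> extensional (carrier AB) \<and> k_linear AB C f \<and>
     (\<forall>a\<in>carrier A. \<forall>b\<in>carrier B. f (pt a b) = \<phi> a b)"
  have \<phi>: "?\<phi> \<in> carrier (A \<times>\<times> B) \<rightarrow> carrier C" using bilinD(1)[OF bil] by auto
  obtain F where F: "F \<in> extensional (carrier AB)" "k_linear AB C F"
    "\<And>x. x \<in> carrier M \<Longrightarrow> F (N +>\<^bsub>M\<^esub> x) = lin_ext C ?\<phi> x"
    using I.quot_lift_exists[OF C C.k_linear_lin_ext[OF \<phi>] lin_ext_bilinear_ideal[OF C bil]]
    unfolding tensor_def by metis
  have "\<exists>!f. ?P f"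
  proof (rule ex1I)
    show "?P F" using F bilinD(1)[OF bil]
      by (auto simp: pure_tensor_def single_carrier C.lin_ext_single[OF \<phi>])
    fix f assume f: "?P f"
    show "f = F"
    proof (rule extensionalityI)
      fix t assume "t \<in> carrier AB"
      then show "f t = F t"
      proof (induction rule: tensor_induct)
        case zero
        show ?case using f F k_linear_zero[OF T.kalg_axioms C] by metis
      next
        case (pure a b)
        then show ?case using f \<open>?P F\<close> by simp
      next
        case (add s t)
        have "k_linear AB C f" using f by blast
        with add show ?case using F(2) by (simp add: k_linearD)
      qed
    qed (use f F in auto)
  qed
  from theI'[OF this] show "k_linear AB C (tensor_lift A B C \<phi>)"
    "\<And>a b. \<lbrakk>a \<in> carrier A; b \<in> carrier B\<rbrakk> \<Longrightarrow> tensor_lift A B C \<phi> (pt a b) = \<phi> a b"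
    unfolding tensor_lift_def by auto
qed

text \<open>Both sides are additive in \<open>s\<close> and in \<open>t\<close>, so pure tensors
  suffice, where the claim is \<open>mult\<close>. This is what allows the counit and
  coassociativity laws to be tested on generators.\<close>

lemma alg_hom_tensor_lift:
  assumes C: "kalg C" and bil: "bilin A B C \<phi>"
    and one: "\<phi> \<one>\<^bsub>A\<^esub> \<one>\<^bsub>B\<^esub> = \<one>\<^bsub>C\<^esub>"
    and mult: "\<And>a b a' b'. \<lbrakk>a \<in> carrier A; b \<in> carrier B; a' \<in> carrier A; b' \<in> carrier B\<rbrakk> \<Longrightarrow>
      \<phi> (a \<otimes>\<^bsub>A\<^esub> a') (b \<otimes>\<^bsub>B\<^esub> b') = \<phi> a b \<otimes>\<^bsub>C\<^esub> \<phi> a' b'"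
  shows "alg_hom AB C (tensor_lift A B C \<phi>)"
proof (rule alg_homI)
  interpret C: kalg C by fact
  note L = tensor_lift[OF C bil]
  note Ls = k_linearD[OF L(1)] k_linear_zero[OF T.kalg_axioms C L(1)]
  show "k_linear AB C (tensor_lift A B C \<phi>)" by (rule L)
  show "tensor_lift A B C \<phi> \<one>\<^bsub>AB\<^esub> = \<one>\<^bsub>C\<^esub>"
    using L(2)[of "\<one>\<^bsub>A\<^esub>" "\<one>\<^bsub>B\<^esub>"] by (simp add: one pt_one)
  fix s t assume s: "s \<in> carrier AB" and t: "t \<in> carrier AB"
  show "tensor_lift A B C \<phi> (s \<otimes>\<^bsub>AB\<^esub> t) = tensor_lift A B C \<phi> s \<otimes>\<^bsub>C\<^esub> tensor_lift A B C \<phi> t"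
    using s
  proof (induction rule: tensor_induct)
    case (pure a b)
    show ?case using t
    proof (induction rule: tensor_induct)
      case (pure a' b')
      then show ?case using \<open>a \<in> carrier A\<close> \<open>b \<in> carrier B\<close> by (simp add: L(2) mult)
    qed (use pure in \<open>simp_all add: Ls T.r_distr C.r_distr bilinD(1)[OF bil]\<close>)
  qed (use t in \<open>simp_all add: Ls T.l_distr C.l_distr\<close>)
qed

end

section \<open>Iterated skew commutators\<close>

definition qcomm :: "('k, 'a, 'z) module_scheme \<Rightarrow> 'k \<Rightarrow> 'a \<Rightarrow> 'a \<Rightarrow> bool" where
  "qcomm A c b a \<longleftrightarrow> b \<otimes>\<^bsub>A\<^esub> a = c \<odot>\<^bsub>A\<^esub> (a \<otimes>\<^bsub>A\<^esub> b)"

text \<open>With \<open>l k = q\<^sub>i\<^bsup>a\<^sub>i\<^sub>j + 2 k\<^esup>\<close> and \<open>n = 1 - a\<^sub>i\<^sub>j\<close> this is the quantum Serre element: by the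
  \<open>q\<close>-binomial theorem the Serre sum is a product of commuting operators \<open>y \<mapsto> x y - l y x\<close>.\<close>

primrec skew :: "('k::field, 'a, 'z) module_scheme \<Rightarrow> 'a \<Rightarrow> 'a \<Rightarrow> (nat \<Rightarrow> 'k) \<Rightarrow> nat \<Rightarrow> 'a" where
  "skew A x y l 0 = y"
| "skew A x y l (Suc k) =
    x \<otimes>\<^bsub>A\<^esub> skew A x y l k \<oplus>\<^bsub>A\<^esub> (- l k) \<odot>\<^bsub>A\<^esub> (skew A x y l k \<otimes>\<^bsub>A\<^esub> x)"

lemma skew_cong: "(\<And>k. k < n \<Longrightarrow> l k = l' k) \<Longrightarrow> skew A x y l n = skew A x y l' n"
  by (induction n) simp_all

context kalg
begin

lemma qcomm_one [simp]: "x \<in> carrier A \<Longrightarrow> qcomm A 1 x \<one>" "x \<in> carrier A \<Longrightarrow> qcomm A 1 \<one> x"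
  by (simp_all add: qcomm_def)

lemma qcomm_mult_r:
  assumes "qcomm A c b a" "qcomm A c' b a'" "a \<in> carrier A" "a' \<in> carrier A" "b \<in> carrier A"
  shows "qcomm A (c * c') b (a \<otimes> a')"
proof -
  have "b \<otimes> (a \<otimes> a') = (b \<otimes> a) \<otimes> a'"
    using assms by (simp add: m_assoc)
  also have "\<dots> = c \<odot> (a \<otimes> (b \<otimes> a'))"
    using assms(1,3-5) by (simp add: qcomm_def m_assoc)
  also have "\<dots> = (c * c') \<odot> (a \<otimes> a' \<otimes> b)"
    using assms(2-5) by (simp add: qcomm_def m_assoc)
  finally show ?thesis by (simp add: qcomm_def)
qed

lemma qcomm_mult_l:
  assumes "qcomm A c b a" "qcomm A c' b' a" "b \<in> carrier A" "b' \<in> carrier A" "a \<in> carrier A"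
  shows "qcomm A (c * c') (b \<otimes> b') a"
proof -
  have "b \<otimes> b' \<otimes> a = b \<otimes> (b' \<otimes> a)"
    using assms by (simp add: m_assoc)
  also have "\<dots> = c' \<odot> ((b \<otimes> a) \<otimes> b')"
    using assms(2-5) by (simp add: qcomm_def m_assoc)
  also have "\<dots> = (c * c') \<odot> (a \<otimes> (b \<otimes> b'))"
    using assms(1,3-5) by (simp add: qcomm_def m_assoc mult.commute)
  finally show ?thesis by (simp add: qcomm_def)
qed

lemma qcomm_add_r:
  assumes "qcomm A c b a" "qcomm A c b a'" "a \<in> carrier A" "a' \<in> carrier A" "b \<in> carrier A"
  shows "qcomm A c b (a \<oplus> a')"
  using assms by (simp add: qcomm_def l_distr r_distr smult_r_distr)

lemma qcomm_smult_r:
  assumes "qcomm A c b a" "a \<in> carrier A" "b \<in> carrier A"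
  shows "qcomm A c b (d \<odot> a)"
  using assms by (simp add: qcomm_def mult.commute)

lemma qcomm_pow_l:
  assumes "qcomm A c b a" "a \<in> carrier A" "b \<in> carrier A"
  shows "qcomm A (c ^ n) (b [^] (n::nat)) a"
proof (induction n)
  case (Suc n)
  then show ?case using qcomm_mult_l[OF Suc assms(1)] assms by (simp add: mult.commute)
qed (use assms in simp)

lemma qcomm_sym:
  assumes "qcomm A c b a" "c \<noteq> 0" "a \<in> carrier A" "b \<in> carrier A"
  shows "qcomm A (inverse c) a b"
  using assms by (simp add: qcomm_def)

lemma skew_closed [simp]: "\<lbrakk>x \<in> carrier A; y \<in> carrier A\<rbrakk> \<Longrightarrow> skew A x y l n \<in> carrier A"
  by (induction n) simp_all

text \<open>Every monomial of the iterated commutator contains \<open>y\<close> once and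
  \<open>x\<close> exactly \<open>n\<close> times, and weights multiply.\<close>

lemma qcomm_skew:
  assumes "qcomm A t b x" "qcomm A z b y" "b \<in> carrier A" "x \<in> carrier A" "y \<in> carrier A"
  shows "qcomm A (z * t ^ n) b (skew A x y l n)"
proof (induction n)
  case (Suc n)
  let ?s = "skew A x y l n"
  have "qcomm A (t * (z * t ^ n)) b (x \<otimes> ?s)" "qcomm A (z * t ^ n * t) b (?s \<otimes> x)"
    using assms Suc by (auto intro: qcomm_mult_r)
  then show ?case using assms by (auto intro!: qcomm_add_r qcomm_smult_r simp: mult_ac)
qed (use assms in simp)

text \<open>Moving \<open>b\<close> across the element of stage n costs \<open>z * t ^ n\<close>,
  which is precisely the scalar used in the next stage. So the contribution of \<open>b\<close>
  cancels every time.\<close>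

lemma skew_add_left:
  assumes "qcomm A t b a" "qcomm A z b c" "a \<in> carrier A" "b \<in> carrier A" "c \<in> carrier A"
  shows "skew A (a \<oplus> b) c (\<lambda>k. z * t ^ k) n = skew A a c (\<lambda>k. z * t ^ k) n"
proof (induction n)
  case (Suc n)
  let ?s = "skew A a c (\<lambda>k. z * t ^ k) n" and ?l = "z * t ^ n"
  have s: "?s \<in> carrier A" using assms by simp
  have bs: "b \<otimes> ?s = ?l \<odot> (?s \<otimes> b)"
    using qcomm_skew[OF assms(1,2,4,3,5)] by (simp add: qcomm_def)
  have "skew A (a \<oplus> b) c (\<lambda>k. z * t ^ k) (Suc n) =
      a \<otimes> ?s \<oplus> ?l \<odot> (?s \<otimes> b) \<oplus> ((- ?l) \<odot> (?s \<otimes> a) \<oplus> \<ominus> (?l \<odot> (?s \<otimes> b)))"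
    using assms s by (simp add: Suc l_distr r_distr bs smult_r_distr flip: uminus_smult)
  also have "\<dots> = a \<otimes> ?s \<oplus> (- ?l) \<odot> (?s \<otimes> a)"
  proof -
    have "p \<oplus> r \<oplus> (q \<oplus> \<ominus> r) = p \<oplus> q" if "p \<in> carrier A" "q \<in> carrier A" "r \<in> carrier A" for p q r
      using that by (simp add: a_assoc a_lcomm[of r] r_neg)
    then show ?thesis using assms s by simp
  qed
  finally show ?case by simp
qed simp

lemma skew_add_right:
  assumes "x \<in> carrier A" "c \<in> carrier A" "d \<in> carrier A"
  shows "skew A x (c \<oplus> d) l n = skew A x c l n \<oplus> skew A x d l n"
  by (induction n) (use assms in \<open>simp_all add: l_distr r_distr smult_r_distr a_ac\<close>)

lemma skew_Suc_shift:
  "skew A x y l (Suc n) = skew A x (x \<otimes> y \<oplus> (- l 0) \<odot> (y \<otimes> x)) (\<lambda>k. l (Suc k)) n"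
  by (induction n) simp_all

text \<open>Left and right multiplication by \<open>x\<close> commute, so a further factor of this
  kind may act at the start as well as at the end.\<close>

lemma skew_commute:
  assumes "x \<in> carrier A" "y \<in> carrier A"
  shows "skew A x (x \<otimes> y \<oplus> c \<odot> (y \<otimes> x)) l n =
    x \<otimes> skew A x y l n \<oplus> c \<odot> (skew A x y l n \<otimes> x)"
proof (induction n)
  case (Suc n)
  then show ?case using assms
    by (simp add: l_distr r_distr smult_r_distr m_assoc a_ac mult.commute)
qed simp

lemma skew_rev:
  assumes "x \<in> carrier A" "y \<in> carrier A"
  shows "skew A x y l n = skew A x y (\<lambda>k. l (n - 1 - k)) n"
proof (induction n)
  case (Suc n)
  have "skew A x y l (Suc n) = skew A x (x \<otimes> y \<oplus> (- l n) \<odot> (y \<otimes> x)) (\<lambda>k. l (n - 1 - k)) n"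
    by (simp only: skew.simps skew_commute[OF assms] Suc.IH[symmetric])
  also have "\<dots> = skew A x y (\<lambda>k. l (Suc n - 1 - k)) (Suc n)"
    by (subst skew_Suc_shift) simp
  finally show ?case .
qed simp

text \<open>By \<open>skew_rev\<close> the factors may be taken in reverse order, and the last
  hypothesis says that z t^(n-1-k) is the inverse of z t^k. For the Serre parameters z = q^a, t =
  q^2, n = 1 - a the exponents 2 a and 2 (n - 1) add up to 0.\<close>

lemma skew_inverse:
  assumes "x \<in> carrier A" "y \<in> carrier A" "z \<noteq> 0" "t \<noteq> 0" "z\<^sup>2 * t ^ (n - 1) = 1"
  shows "skew A x y (\<lambda>k. inverse (z * t ^ k)) n = skew A x y (\<lambda>k. z * t ^ k) n"
proof -
  have "z * t ^ (n - 1 - k) = inverse (z * t ^ k)" if "k < n" for k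
  proof -
    have "n - 1 = (n - 1 - k) + k" using that by simp
    then have "(z * t ^ (n - 1 - k)) * (z * t ^ k) = 1"
      using assms(5) by (metis (no_types, lifting) power_add mult.assoc mult.left_commute power2_eq_square)
    then show ?thesis by (metis inverse_unique mult.commute)
  qed
  then show ?thesis
    using skew_rev[OF assms(1,2), of "\<lambda>k. z * t ^ k" n] by (metis (no_types, lifting) skew_cong)
qed

text \<open>In the part with \<open>c\<close> the summand \<open>b\<close> drops out by
  \<open>skew_add_left\<close>. In the part with \<open>d\<close> the summand \<open>a\<close> drops
  out after all scalars have been inverted, because \<open>a\<close> passes \<open>b\<close> and
  \<open>d\<close> with the inverse weights. The two summands of a coproduct are of this shape, so
  the lemma yields the Serre relations for \<open>Delta_gen\<close>.\<close>

lemma skew_add: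
  assumes "qcomm A t b a" "qcomm A z b c" "qcomm A z d a"
    and "a \<in> carrier A" "b \<in> carrier A" "c \<in> carrier A" "d \<in> carrier A"
    and "z \<noteq> 0" "t \<noteq> 0" "z\<^sup>2 * t ^ (n - 1) = 1"
  shows "skew A (a \<oplus> b) (c \<oplus> d) (\<lambda>k. z * t ^ k) n =
    skew A a c (\<lambda>k. z * t ^ k) n \<oplus> skew A b d (\<lambda>k. z * t ^ k) n"
proof -
  have "skew A (a \<oplus> b) d (\<lambda>k. z * t ^ k) n = skew A (b \<oplus> a) d (\<lambda>k. inverse z * inverse t ^ k) n"
    using skew_inverse[of "a \<oplus> b" d z t n] assms by (simp add: a_comm power_inverse)
  also have "\<dots> = skew A b d (\<lambda>k. inverse z * inverse t ^ k) n"
    by (rule skew_add_left) (use assms in \<open>auto intro: qcomm_sym\<close>)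
  also have "\<dots> = skew A b d (\<lambda>k. z * t ^ k) n"
    using skew_inverse[of b d z t n] assms by (simp add: power_inverse)
  finally show ?thesis using assms by (simp add: skew_add_right skew_add_left)
qed

text \<open>Exchanging left and right turns s \<mapsto> x s - l s x into s \<mapsto> s x - l x s,
  which is -l times the operator with parameter 1/l.\<close>

lemma skew_op:
  assumes "x \<in> carrier A" "y \<in> carrier A" "\<And>k. l k \<noteq> 0"
  shows "skew (op_alg A) x y l n = (\<Prod>k<n. - l k) \<odot> skew A x y (\<lambda>k. inverse (l k)) n"
proof (induction n)
  case (Suc n)
  let ?s = "skew A x y (\<lambda>k. inverse (l k)) n" and ?p = "\<Prod>k<n. - l k"
  have s: "?s \<in> carrier A" using assms by simp
  have "skew (op_alg A) x y l (Suc n) = ?p \<odot> (?s \<otimes> x) \<oplus> (- l n) \<odot> (?p \<odot> (x \<otimes> ?s))"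
    using assms s by (simp add: Suc)
  also have "\<dots> = (?p * - l n) \<odot> (x \<otimes> ?s) \<oplus> (?p * - l n * - inverse (l n)) \<odot> (?s \<otimes> x)"
  proof -
    have "?p * - l n * - inverse (l n) = ?p" using assms(3)[of n] by simp
    then show ?thesis unfolding \<open>?p * - l n * - inverse (l n) = ?p\<close>
      using assms s by (subst a_comm) (simp_all add: mult.commute)
  qed
  also have "\<dots> = (?p * - l n) \<odot> (x \<otimes> ?s \<oplus> (- inverse (l n)) \<odot> (?s \<otimes> x))"
    using assms s by (simp add: smult_r_distr)
  finally show ?case by (simp add: mult.commute)
qed (use assms in simp)

lemma skew_op_zero:
  assumes "x \<in> carrier A" "y \<in> carrier A" "z \<noteq> 0" "t \<noteq> 0" "z\<^sup>2 * t ^ (n - 1) = 1"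
    and "skew A x y (\<lambda>k. z * t ^ k) n = \<zero>"
  shows "skew (op_alg A) x y (\<lambda>k. z * t ^ k) n = \<zero>"
  using skew_op[of x y "\<lambda>k. z * t ^ k" n] skew_inverse[OF assms(1-5)] assms by simp

text \<open>All factors \<open>L\<close> and \<open>L'\<close> are collected on the right. That
  \<open>L\<close> passes \<open>y\<close> with the same weight \<open>z'\<close> with which
  \<open>L'\<close> passes \<open>x\<close> makes both terms of a stage pick up the same
  scalar.\<close>

lemma skew_twist:
  assumes "qcomm A t' L x" "qcomm A z' L y" "qcomm A z' L' x" "L \<otimes> L' = L' \<otimes> L"
    and [simp]: "x \<in> carrier A" "y \<in> carrier A" "L \<in> carrier A" "L' \<in> carrier A"
  shows "skew A (x \<otimes> L) (y \<otimes> L') l n =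
    (\<Prod>k<n. z' * t' ^ k) \<odot> (skew A x y l n \<otimes> (L [^] n \<otimes> L'))"
proof (induction n)
  case (Suc n)
  let ?s = "skew A x y l n" and ?c = "z' * t' ^ n" and ?K = "L [^] n \<otimes> L'" and ?p = "\<Prod>k<n. z' * t' ^ k"
  have K: "?K \<in> carrier A" and s: "?s \<in> carrier A" by simp_all
  have 1: "L \<otimes> ?s = ?c \<odot> (?s \<otimes> L)"
    using qcomm_skew[OF assms(1,2)] by (simp add: qcomm_def)
  have 2: "?K \<otimes> x = ?c \<odot> (x \<otimes> ?K)"
    using qcomm_mult_l[OF qcomm_pow_l[OF assms(1)] assms(3)] by (simp add: qcomm_def mult.commute)
  have "L \<otimes> L [^] n = L [^] n \<otimes> L" by (metis assms(7) nat_pow_Suc nat_pow_Suc2)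
  then have 3: "L \<otimes> ?K = L [^] Suc n \<otimes> L'" by (simp flip: m_assoc)
  have 4: "?K \<otimes> L = L [^] Suc n \<otimes> L'" by (simp add: m_assoc assms(4))
  have "x \<otimes> L \<otimes> (?s \<otimes> ?K) = x \<otimes> (L \<otimes> ?s) \<otimes> ?K" using s K by (simp add: m_assoc)
  also have "\<dots> = ?c \<odot> (x \<otimes> ?s \<otimes> (L \<otimes> ?K))" using s K by (simp add: 1 m_assoc)
  finally have 5: "x \<otimes> L \<otimes> (?s \<otimes> ?K) = ?c \<odot> (x \<otimes> ?s \<otimes> (L [^] Suc n \<otimes> L'))" unfolding 3 .
  have "?s \<otimes> ?K \<otimes> (x \<otimes> L) = ?s \<otimes> (?K \<otimes> x) \<otimes> L" using s K by (simp add: m_assoc)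
  also have "\<dots> = ?c \<odot> (?s \<otimes> x \<otimes> (?K \<otimes> L))" unfolding 2 using s K by (simp add: m_assoc)
  finally have 6: "?s \<otimes> ?K \<otimes> (x \<otimes> L) = ?c \<odot> (?s \<otimes> x \<otimes> (L [^] Suc n \<otimes> L'))" unfolding 4 .
  have "skew A (x \<otimes> L) (y \<otimes> L') l (Suc n) =
      ?p \<odot> (x \<otimes> L \<otimes> (?s \<otimes> ?K)) \<oplus> (- l n) \<odot> (?p \<odot> (?s \<otimes> ?K \<otimes> (x \<otimes> L)))"
    using s K by (simp add: Suc)
  also have "\<dots> = (?p * ?c) \<odot> (skew A x y l (Suc n) \<otimes> (L [^] Suc n \<otimes> L'))"
    unfolding 5 6 using s by (simp add: l_distr smult_r_distr mult_ac)
  finally show ?case by simp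
qed simp

text \<open>Every monomial contains \<open>c\<close> once for each of the n factors \<open>x\<close>
  and once for \<open>y\<close>.\<close>

lemma skew_central:
  assumes c: "\<And>w. w \<in> carrier A \<Longrightarrow> c \<otimes> w = w \<otimes> c"
    and [simp]: "c \<in> carrier A" "x \<in> carrier A" "y \<in> carrier A"
  shows "skew A (c \<otimes> x) (c \<otimes> y) l n = c [^] Suc n \<otimes> skew A x y l n"
proof (induction n)
  case (Suc n)
  let ?s = "skew A x y l n" and ?p = "c [^] Suc n"
  have s: "?s \<in> carrier A" and p: "?p \<in> carrier A" by simp_all
  have px: "x \<otimes> ?p = ?p \<otimes> x"
    using qcomm_pow_l[of 1 c x "Suc n"] c[of x] by (simp add: qcomm_def)
  have "c \<otimes> x \<otimes> (?p \<otimes> ?s) = c \<otimes> (x \<otimes> ?p) \<otimes> ?s" using s p by (simp only: m_assoc m_closed assms)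
  also have "\<dots> = c \<otimes> ?p \<otimes> (x \<otimes> ?s)" unfolding px using s p by (simp only: m_assoc m_closed assms)
  also have "c \<otimes> ?p = c [^] Suc (Suc n)" by (simp only: nat_pow_Suc2 assms)
  finally have 1: "c \<otimes> x \<otimes> (?p \<otimes> ?s) = c [^] Suc (Suc n) \<otimes> (x \<otimes> ?s)" .
  have "?p \<otimes> ?s \<otimes> (c \<otimes> x) = ?p \<otimes> (?s \<otimes> c) \<otimes> x" using s p by (simp only: m_assoc m_closed assms)
  also have "\<dots> = ?p \<otimes> c \<otimes> (?s \<otimes> x)"
    unfolding c[OF s, symmetric] using s p by (simp only: m_assoc m_closed assms)
  finally have 2: "?p \<otimes> ?s \<otimes> (c \<otimes> x) = c [^] Suc (Suc n) \<otimes> (?s \<otimes> x)" by (simp only: nat_pow_Suc)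
  show ?case
    unfolding skew.simps(2)[of A "c \<otimes> x"] Suc 1 2 using s by (simp add: r_distr)
qed simp

lemma comb4:
  assumes "p \<in> carrier A" "r \<in> carrier A"
  shows "\<alpha> \<odot> p \<oplus> \<beta> \<odot> r \<oplus> (\<gamma> \<odot> p \<oplus> \<delta> \<odot> r) = (\<alpha> + \<gamma>) \<odot> p \<oplus> (\<beta> + \<delta>) \<odot> r"
  using assms by (simp add: smult_l_distr a_ac)

lemma skew_smult:
  assumes [simp]: "x \<in> carrier A" "y \<in> carrier A"
  shows "skew A (c \<odot> x) (d \<odot> y) l n = (c ^ n * d) \<odot> skew A x y l n"
  by (induction n) (simp_all add: smult_r_distr mult_ac)

lemma skew_commutes:
  assumes "g \<otimes> x = x \<otimes> g" "g \<otimes> y = y \<otimes> g" "g \<in> carrier A" "x \<in> carrier A" "y \<in> carrier A"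
  shows "g \<otimes> skew A x y l n = skew A x y l n \<otimes> g"
  using qcomm_skew[of 1 g x 1 y n l] assms by (simp add: qcomm_def)

text \<open>The terms in \<open>L\<close> cancel at the first stage, because \<open>L\<close> passes
  \<open>x\<close> with weight 1/z. After k + 1 stages the deviation from commuting is a multiple of
  x^(k+1) L', with coefficient -c times the product of 1 - z^2 t^j over j \<le> k. The hypothesis on
  \<open>z\<close> makes the factor with j = n - 1 vanish.\<close>

lemma skew_commutes_y:
  assumes gx: "g \<otimes> x = x \<otimes> g" and gy: "g \<otimes> y = y \<otimes> g \<oplus> c \<odot> (L \<ominus> L')"
    and L: "qcomm A (inverse z) L x" and L': "qcomm A z L' x"
    and [simp]: "g \<in> carrier A" "x \<in> carrier A" "y \<in> carrier A" "L \<in> carrier A" "L' \<in> carrier A"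
    and z: "z \<noteq> 0" "z\<^sup>2 * t ^ (n - 1) = 1" "n > 0"
  shows "g \<otimes> skew A x y (\<lambda>k. z * t ^ k) n = skew A x y (\<lambda>k. z * t ^ k) n \<otimes> g"
proof -
  let ?s = "skew A x y (\<lambda>k. z * t ^ k)"
  have *: "g \<otimes> ?s (Suc k) = ?s (Suc k) \<otimes> g \<oplus> (- c * (\<Prod>j<Suc k. 1 - z\<^sup>2 * t ^ j)) \<odot> (x [^] Suc k \<otimes> L')" for k
  proof (induction k)
    case 0
    have "g \<otimes> ?s (Suc 0) = x \<otimes> (g \<otimes> y) \<oplus> (- z) \<odot> ((g \<otimes> y) \<otimes> x)"
      by (simp add: r_distr gx flip: m_assoc)
    also have "\<dots> = (x \<otimes> y \<oplus> (- z) \<odot> (y \<otimes> x)) \<otimes> g \<oplus>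
        (x \<otimes> (c \<odot> (L \<ominus> L')) \<oplus> (- z) \<odot> (c \<odot> (L \<ominus> L') \<otimes> x))"
      by (simp add: gy l_distr r_distr smult_r_distr m_assoc gx a_ac)
    also have "x \<otimes> (c \<odot> (L \<ominus> L')) \<oplus> (- z) \<odot> (c \<odot> (L \<ominus> L') \<otimes> x) =
        c \<odot> (x \<otimes> L) \<oplus> (- c) \<odot> (x \<otimes> L') \<oplus>
          ((- z * c * inverse z) \<odot> (x \<otimes> L) \<oplus> (z * c * z) \<odot> (x \<otimes> L'))"
      using L L' by (simp add: qcomm_def minus_smult l_distr r_distr smult_r_distr mult_ac)
    also have "\<dots> = (- c * (1 - z\<^sup>2)) \<odot> (x \<otimes> L')"
      using z(1) by (subst comb4) (simp_all add: field_simps power2_eq_square)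
    finally show ?case by simp
  next
    case (Suc k)
    let ?t = "?s (Suc k)" and ?l = "z * t ^ Suc k" and ?W = "x [^] Suc k \<otimes> L'"
    define D where "D = - c * (\<Prod>j<Suc k. 1 - z\<^sup>2 * t ^ j)"
    have cl [simp]: "?t \<in> carrier A" "?W \<in> carrier A" by (simp_all del: skew.simps)
    have IH: "g \<otimes> ?t = ?t \<otimes> g \<oplus> D \<odot> ?W" using Suc unfolding D_def .
    have xW: "x \<otimes> ?W = x [^] Suc (Suc k) \<otimes> L'"
      by (simp only: nat_pow_Suc2 m_assoc[symmetric] assms nat_pow_closed m_closed)
    have Wx: "?W \<otimes> x = z \<odot> (x [^] Suc (Suc k) \<otimes> L')"
      using L' by (simp add: m_assoc qcomm_def)
    have "g \<otimes> ?s (Suc (Suc k)) = g \<otimes> (x \<otimes> ?t) \<oplus> (- ?l) \<odot> (g \<otimes> (?t \<otimes> x))"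
      unfolding skew.simps(2)[of A x y _ "Suc k"] by (simp only: r_distr smult_mult_r assms cl m_closed smult_closed)
    also have "g \<otimes> (x \<otimes> ?t) = x \<otimes> (g \<otimes> ?t)"
      by (simp only: m_assoc[symmetric] gx assms cl)
    also have "g \<otimes> (?t \<otimes> x) = (g \<otimes> ?t) \<otimes> x"
      by (simp only: m_assoc assms cl)
    also have "x \<otimes> (g \<otimes> ?t) = x \<otimes> ?t \<otimes> g \<oplus> D \<odot> (x \<otimes> ?W)"
      unfolding IH by (simp only: r_distr smult_mult_r m_assoc assms cl m_closed smult_closed)
    also have "(g \<otimes> ?t) \<otimes> x = ?t \<otimes> x \<otimes> g \<oplus> D \<odot> (?W \<otimes> x)"
      unfolding IH by (simp only: l_distr smult_mult_l m_assoc gx assms cl m_closed smult_closed)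
    also have "x \<otimes> ?t \<otimes> g \<oplus> D \<odot> (x \<otimes> ?W) \<oplus> (- ?l) \<odot> (?t \<otimes> x \<otimes> g \<oplus> D \<odot> (?W \<otimes> x)) =
        (x \<otimes> ?t \<oplus> (- ?l) \<odot> (?t \<otimes> x)) \<otimes> g \<oplus> (D \<odot> (x \<otimes> ?W) \<oplus> (- ?l * D) \<odot> (?W \<otimes> x))"
      by (simp only: l_distr smult_mult_l smult_r_distr smult_smult a_ac assms cl m_closed smult_closed a_closed)
    also have "D \<odot> (x \<otimes> ?W) \<oplus> (- ?l * D) \<odot> (?W \<otimes> x) =
        (D + - ?l * D * z) \<odot> (x [^] Suc (Suc k) \<otimes> L')"
      unfolding xW Wx by (simp only: smult_smult smult_l_distr assms m_closed nat_pow_closed)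
    also have "D + - ?l * D * z = - c * (\<Prod>j<Suc (Suc k). 1 - z\<^sup>2 * t ^ j)"
      by (simp add: D_def power2_eq_square algebra_simps)
    finally show ?case by simp
  qed
  have "(\<Prod>j<n. 1 - z\<^sup>2 * t ^ j) = 0"
    using z by (auto intro!: prod_zero bexI[of _ "n - 1"])
  with *[of "n - 1"] z show ?thesis by simp
qed

text \<open>In the step from stage k to stage k + 1 the commutator with \<open>g\<close> contributes
  the multiple 1/(z t^k) - z t^k of the element of stage k times \<open>L\<close>, while the terms
  in \<open>L'\<close> cancel. These numbers add up to 0 over k < n, since reflecting k to n - 1 - k
  exchanges the two summands.\<close>

lemma skew_commutes_x:
  assumes gy: "g \<otimes> y = y \<otimes> g" and gx: "g \<otimes> x = x \<otimes> g \<oplus> c \<odot> (L \<ominus> L')"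
    and L: "qcomm A (inverse t) L x" "qcomm A (inverse z) L y" and L': "qcomm A t L' x" "qcomm A z L' y"
    and [simp]: "g \<in> carrier A" "x \<in> carrier A" "y \<in> carrier A" "L \<in> carrier A" "L' \<in> carrier A"
    and z: "z \<noteq> 0" "t \<noteq> 0" "z\<^sup>2 * t ^ (n - 1) = 1"
  shows "g \<otimes> skew A x y (\<lambda>k. z * t ^ k) n = skew A x y (\<lambda>k. z * t ^ k) n \<otimes> g"
proof -
  let ?s = "skew A x y (\<lambda>k. z * t ^ k)"
  let ?\<gamma> = "\<lambda>k. c * (\<Sum>j<k. inverse (z * t ^ j) - z * t ^ j)"
  \<comment> \<open>For k = 0 the coefficient \<open>?\<gamma> 0\<close> is an empty sum, so the
    truncated index k - 1 does no harm.\<close>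
  have *: "g \<otimes> ?s k = ?s k \<otimes> g \<oplus> ?\<gamma> k \<odot> (?s (k - 1) \<otimes> L)" for k
  proof (induction k)
    case (Suc k)
    let ?t = "?s k" and ?p = "?s (k - 1)" and ?l = "z * t ^ k" and ?h = "c \<odot> (L \<ominus> L')"
    have cl [simp]: "?t \<in> carrier A" "?p \<in> carrier A" "?h \<in> carrier A" by simp_all
    have l: "?l \<noteq> 0" using z by simp
    have Lt: "L \<otimes> ?t = inverse ?l \<odot> (?t \<otimes> L)" "L' \<otimes> ?t = ?l \<odot> (?t \<otimes> L')"
      using qcomm_skew[OF L, of k] qcomm_skew[OF L', of k] by (simp_all add: qcomm_def power_inverse)
    have "g \<otimes> ?s (Suc k) = g \<otimes> (x \<otimes> ?t) \<oplus> (- ?l) \<odot> (g \<otimes> (?t \<otimes> x))"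
      by (simp add: r_distr)
    also have "g \<otimes> (x \<otimes> ?t) = x \<otimes> (g \<otimes> ?t) \<oplus> ?h \<otimes> ?t"
      using gx by (simp only: m_assoc[symmetric] l_distr assms cl m_closed)
    also have "x \<otimes> (g \<otimes> ?t) = x \<otimes> ?t \<otimes> g \<oplus> ?\<gamma> k \<odot> (x \<otimes> ?p \<otimes> L)"
      unfolding Suc by (simp only: r_distr smult_mult_r m_assoc assms cl m_closed smult_closed)
    also have "g \<otimes> (?t \<otimes> x) = ?t \<otimes> (g \<otimes> x) \<oplus> ?\<gamma> k \<odot> (?p \<otimes> (L \<otimes> x))"
    proof -
      have "g \<otimes> (?t \<otimes> x) = (g \<otimes> ?t) \<otimes> x" by (simp only: m_assoc assms cl)
      then show ?thesis
        unfolding Suc by (simp only: l_distr smult_mult_l m_assoc assms cl m_closed smult_closed)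
    qed
    also have "?t \<otimes> (g \<otimes> x) = ?t \<otimes> x \<otimes> g \<oplus> ?t \<otimes> ?h"
      unfolding gx by (simp only: r_distr m_assoc assms cl m_closed)
    also have "?p \<otimes> (L \<otimes> x) = inverse t \<odot> (?p \<otimes> x \<otimes> L)"
      using L(1) by (simp add: qcomm_def m_assoc)
    also have "x \<otimes> ?t \<otimes> g \<oplus> ?\<gamma> k \<odot> (x \<otimes> ?p \<otimes> L) \<oplus> ?h \<otimes> ?t \<oplus>
        (- ?l) \<odot> (?t \<otimes> x \<otimes> g \<oplus> ?t \<otimes> ?h \<oplus> ?\<gamma> k \<odot> (inverse t \<odot> (?p \<otimes> x \<otimes> L))) =
        (x \<otimes> ?t \<oplus> (- ?l) \<odot> (?t \<otimes> x)) \<otimes> g \<oplus>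
        ((?\<gamma> k \<odot> (x \<otimes> ?p \<otimes> L) \<oplus> (- ?l * ?\<gamma> k * inverse t) \<odot> (?p \<otimes> x \<otimes> L)) \<oplus>
         (?h \<otimes> ?t \<oplus> (- ?l) \<odot> (?t \<otimes> ?h)))"
      by (simp only: l_distr smult_mult_l smult_r_distr smult_smult a_ac mult.assoc assms cl m_closed smult_closed a_closed)
    also have "?h \<otimes> ?t \<oplus> (- ?l) \<odot> (?t \<otimes> ?h) =
        (c * inverse ?l) \<odot> (?t \<otimes> L) \<oplus> (- c * ?l) \<odot> (?t \<otimes> L') \<oplus>
        ((- ?l * c) \<odot> (?t \<otimes> L) \<oplus> (?l * c) \<odot> (?t \<otimes> L'))"
      using Lt by (simp add: minus_smult l_distr r_distr smult_r_distr mult_ac)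
    also have "\<dots> = (c * (inverse ?l - ?l)) \<odot> (?t \<otimes> L)"
      by (subst comb4) (simp_all add: algebra_simps)
    also have "?\<gamma> k \<odot> (x \<otimes> ?p \<otimes> L) \<oplus> (- ?l * ?\<gamma> k * inverse t) \<odot> (?p \<otimes> x \<otimes> L) = ?\<gamma> k \<odot> (?t \<otimes> L)"
    proof (cases k)
      case (Suc j)
      \<comment> \<open>Division of \<open>?l\<close> by \<open>t\<close> gives the scalar of the
        preceding stage, so the two terms recombine to the element of stage k.\<close>
      have e: "- ?l * ?\<gamma> k * inverse t = ?\<gamma> k * - (z * t ^ j)" using z Suc by simp
      have "?\<gamma> k \<odot> (x \<otimes> ?p \<otimes> L) \<oplus> (?\<gamma> k * - (z * t ^ j)) \<odot> (?p \<otimes> x \<otimes> L) =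
          ?\<gamma> k \<odot> ((x \<otimes> ?p \<oplus> (- (z * t ^ j)) \<odot> (?p \<otimes> x)) \<otimes> L)"
        by (simp only: l_distr smult_mult_l smult_r_distr smult_smult assms cl m_closed smult_closed)
      also have "x \<otimes> ?p \<oplus> (- (z * t ^ j)) \<odot> (?p \<otimes> x) = ?t" using Suc by simp
      finally show ?thesis unfolding e .
    qed simp
    also have "?\<gamma> k \<odot> (?t \<otimes> L) \<oplus> (c * (inverse ?l - ?l)) \<odot> (?t \<otimes> L) = ?\<gamma> (Suc k) \<odot> (?t \<otimes> L)"
      by (simp add: smult_l_distr[symmetric] distrib_left)
    finally show ?case by simp
  qed (simp add: gy)
  have "(\<Sum>j<n. inverse (z * t ^ j)) = (\<Sum>j<n. z * t ^ j)"
  proof (rule sum.reindex_bij_witness[of _ "\<lambda>j. n - 1 - j" "\<lambda>j. n - 1 - j"])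
    fix j assume "j \<in> {..<n}"
    then have "n - 1 = (n - 1 - j) + j" by simp
    then have "(z * t ^ (n - 1 - j)) * (z * t ^ j) = 1"
      using z(3) by (metis (no_types, lifting) power_add mult.assoc mult.left_commute power2_eq_square)
    then show "z * t ^ (n - 1 - j) = inverse (z * t ^ j)" by (metis inverse_unique mult.commute)
  qed auto
  then have "?\<gamma> n = 0" by (simp add: sum_subtractf)
  from *[of n, unfolded this] show ?thesis by simp
qed

end

text \<open>Since \<open>u\<close> and \<open>v\<close> commute, all monomials have the same first
  tensor factor.\<close>

lemma (in kalg2) skew_pure:
  assumes [simp]: "u \<in> carrier A" "v \<in> carrier A" "x \<in> carrier B" "y \<in> carrier B" and uv: "u \<otimes>\<^bsub>A\<^esub> v = v \<otimes>\<^bsub>A\<^esub> u"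
  shows "skew AB (pt u x) (pt v y) l n = pt (u [^]\<^bsub>A\<^esub> n \<otimes>\<^bsub>A\<^esub> v) (skew B x y l n)"
proof (induction n)
  case (Suc n)
  let ?s = "skew B x y l n"
  have 1: "u \<otimes>\<^bsub>A\<^esub> (u [^]\<^bsub>A\<^esub> n \<otimes>\<^bsub>A\<^esub> v) = u [^]\<^bsub>A\<^esub> Suc n \<otimes>\<^bsub>A\<^esub> v"
    by (simp only: A.nat_pow_Suc2 A.m_assoc assms A.nat_pow_closed)
  have 2: "u [^]\<^bsub>A\<^esub> n \<otimes>\<^bsub>A\<^esub> v \<otimes>\<^bsub>A\<^esub> u = u [^]\<^bsub>A\<^esub> Suc n \<otimes>\<^bsub>A\<^esub> v"
    by (simp add: A.m_assoc uv)
  show ?case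
    unfolding skew.simps(2)[of AB] Suc
    using pt_add_r[of "u [^]\<^bsub>A\<^esub> Suc n \<otimes>\<^bsub>A\<^esub> v" "(- l n) \<odot>\<^bsub>B\<^esub> (?s \<otimes>\<^bsub>B\<^esub> x)" "x \<otimes>\<^bsub>B\<^esub> ?s"]
    by (simp add: 1 2 pt_smult_r)
qed simp

lemma (in kalg2) pure_skew:
  assumes [simp]: "u \<in> carrier B" "v \<in> carrier B" "x \<in> carrier A" "y \<in> carrier A" and uv: "u \<otimes>\<^bsub>B\<^esub> v = v \<otimes>\<^bsub>B\<^esub> u"
  shows "skew AB (pt x u) (pt y v) l n = pt (skew A x y l n) (u [^]\<^bsub>B\<^esub> n \<otimes>\<^bsub>B\<^esub> v)"
proof (induction n)
  case (Suc n)
  let ?s = "skew A x y l n"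
  have 1: "u \<otimes>\<^bsub>B\<^esub> (u [^]\<^bsub>B\<^esub> n \<otimes>\<^bsub>B\<^esub> v) = u [^]\<^bsub>B\<^esub> Suc n \<otimes>\<^bsub>B\<^esub> v"
    by (simp only: B.nat_pow_Suc2 B.m_assoc assms B.nat_pow_closed)
  have 2: "u [^]\<^bsub>B\<^esub> n \<otimes>\<^bsub>B\<^esub> v \<otimes>\<^bsub>B\<^esub> u = u [^]\<^bsub>B\<^esub> Suc n \<otimes>\<^bsub>B\<^esub> v"
    by (simp add: B.m_assoc uv)
  show ?case
    unfolding skew.simps(2)[of AB] Suc
    using pt_add_l[of "x \<otimes>\<^bsub>A\<^esub> ?s" "(- l n) \<odot>\<^bsub>A\<^esub> (?s \<otimes>\<^bsub>A\<^esub> x)" "u [^]\<^bsub>B\<^esub> Suc n \<otimes>\<^bsub>B\<^esub> v"]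
    by (simp add: 1 2 pt_smult_l)
qed simp

section \<open>Gaussian binomial coefficients and the Serre sum\<close>

text \<open>The Gaussian binomial coefficient as a polynomial in \<open>t\<close>, by its Pascal
  rule. No division occurs, so it can be evaluated at roots of unity. For r > n, where the exponent
  n - r is truncated, the coefficient behind the power is 0.\<close>

fun gauss_binom :: "'r::comm_ring_1 \<Rightarrow> nat \<Rightarrow> nat \<Rightarrow> 'r" where
  "gauss_binom t n 0 = 1"
| "gauss_binom t 0 (Suc r) = 0"
| "gauss_binom t (Suc n) (Suc r) = gauss_binom t n (Suc r) + t ^ (n - r) * gauss_binom t n r"

lemma gauss_binom_eq_0: "n < r \<Longrightarrow> gauss_binom t n r = 0"
  by (induction t n r rule: gauss_binom.induct) auto

lemma nu_eqs:
  "nu ^ k = (Fract ([:0, 1:] ^ k) 1 :: 'k::field poly fract)"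
  by (induction k) (simp_all add: nu_def One_fract_def)

lemma nu_neq_0: "nu \<noteq> (0 :: 'k::field poly fract)"
  by (simp add: nu_def Zero_fract_def eq_fract)

text \<open>A positive power of the indeterminate has positive degree.\<close>

lemma nu_pow_neq_1:
  assumes "k > 0" shows "nu ^ k \<noteq> (1 :: 'k::field poly fract)"
proof
  assume "nu ^ k = (1 :: 'k poly fract)"
  then have "([:0, 1:] :: 'k poly) ^ k = 1" by (simp add: nu_eqs One_fract_def eq_fract)
  then have "degree (([:0, 1:] :: 'k poly) ^ k) = 0" by simp
  with assms show False by (simp add: degree_power_eq)
qed

lemma nu_diff_neq_0:
  assumes "k > 0" shows "nu ^ k - inverse nu ^ k \<noteq> (0 :: 'k::field poly fract)"
proof
  assume "nu ^ k - inverse nu ^ k = (0 :: 'k poly fract)"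
  then have "nu ^ k * nu ^ k = (1 :: 'k poly fract)"
    using nu_neq_0[where 'k = 'k] by (simp add: power_inverse) (metis power_not_zero right_inverse)
  then show False using nu_pow_neq_1[of "k + k", where 'k = 'k] assms by (simp add: power_add)
qed

lemma qint_neq_0: "k > 0 \<Longrightarrow> qint k \<noteq> (0 :: 'k::field poly fract)"
  using nu_diff_neq_0[of k] nu_diff_neq_0[of 1] by (simp add: qint_def)

lemma qfact_neq_0: "qfact k \<noteq> (0 :: 'k::field poly fract)"
  using qint_neq_0[where 'k = 'k] by (fastforce simp: qfact_def)

lemma qfact_Suc: "qfact (Suc k) = qint (Suc k) * qfact k"
  by (simp add: qfact_def mult.commute)

text \<open>The addition rule for quantum integers in the form that matches the Pascal rule of
  \<open>gauss_binom\<close> at \<open>nu\<close> squared.\<close>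

lemma qint_add:
  "nu ^ b * qint (a + b) = qint a + nu ^ (a + b) * (qint b :: 'k::field poly fract)"
proof -
  have "nu ^ b * (nu ^ (a + b) - inverse nu ^ (a + b)) =
    nu ^ a - inverse nu ^ a + nu ^ (a + b) * (nu ^ b - inverse nu ^ b :: 'k poly fract)"
    using nu_neq_0[where 'k = 'k] by (simp add: field_simps power_add power_inverse)
  then show ?thesis by (simp only: qint_def times_divide_eq_right add_divide_distrib[symmetric])
qed

text \<open>The symmetric quantum binomial and the polynomial one at \<open>nu\<close> squared
  differ by the power \<open>nu ^ (a * b)\<close>. The factorials are multiplied out, and the index
  is split as a + b, so that the induction meets neither division nor truncated subtraction.\<close>

lemma gauss_binom_qfact:
  "gauss_binom (nu\<^sup>2) (a + b) b * (qfact b * qfact a) = nu ^ (a * b) * (qfact (a + b) :: 'k::field poly fract)"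
proof (induction "a + b" arbitrary: a b)
  case 0
  then show ?case by (simp add: qfact_def)
next
  case (Suc n)
  show ?case
  proof (cases b)
    case 0
    then show ?thesis by (simp add: qfact_def)
  next
    case b: (Suc b')
    show ?thesis
    proof (cases a)
      case 0
      then have "n = b'" using b Suc by simp
      then show ?thesis using 0 b Suc(1)[of 0 b'] by (simp add: gauss_binom_eq_0 qfact_Suc)
    next
      case a: (Suc a')
      have n: "n = a' + b" "n = a + b'" using Suc a b by simp_all
      have 1: "gauss_binom (nu\<^sup>2) n b * (qfact b * qfact a') = nu ^ (a' * b) * (qfact n :: 'k poly fract)"
        using Suc(1)[OF n(1)] n by simp
      have 2: "gauss_binom (nu\<^sup>2) n b' * (qfact b' * qfact a) = nu ^ (a * b') * (qfact n :: 'k poly fract)"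
        using Suc(1)[OF n(2)] n by simp
      have "gauss_binom (nu\<^sup>2) (a + b) b * (qfact b * qfact a) =
        qint a * (gauss_binom (nu\<^sup>2) n b * (qfact b * qfact a')) +
        nu ^ (2 * a) * qint b * (gauss_binom (nu\<^sup>2) n b' * (qfact b' * qfact a) :: 'k poly fract)"
      proof -
        have "gauss_binom (nu\<^sup>2) (a + b) b = gauss_binom (nu\<^sup>2) n b +
            nu ^ (2 * a) * (gauss_binom (nu\<^sup>2) n b' :: 'k poly fract)"
          using Suc(2) b n(2) by (simp add: power_mult flip: Suc(2))
        moreover have "qfact a = qint a * (qfact a' :: 'k poly fract)" "qfact b = qint b * (qfact b' :: 'k poly fract)"
          using a b by (simp_all add: qfact_Suc)
        ultimately show ?thesis by (simp add: algebra_simps)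
      qed
      also have "\<dots> = (nu ^ (a' * b) * qint a + nu ^ (2 * a + a * b') * qint b) * qfact n"
        unfolding 1 2 by (simp add: algebra_simps power_add)
      also have "nu ^ (a' * b) * qint a + nu ^ (2 * a + a * b') * qint b =
          nu ^ (a' * b) * (qint a + nu ^ (a + b) * (qint b :: 'k poly fract))"
      proof -
        have "2 * a + a * b' = a' * b + (a + b)" using a b by simp
        then show ?thesis by (simp only: power_add distrib_left mult.assoc)
      qed
      also have "\<dots> = nu ^ (a * b) * qint (a + b)"
        unfolding qint_add[symmetric] using a by (simp add: power_add)
      also have "nu ^ (a * b) * qint (a + b) * qfact n = nu ^ (a * b) * (qfact (a + b) :: 'k poly fract)"
        by (simp add: qfact_Suc flip: Suc(2))
      finally show ?thesis .
    qed
  qed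
qed

text \<open>The factorials cancel up to a power of the indeterminate. Hence the evaluation of
  \<open>qbinom\<close> is meaningful at every nonzero point, roots of unity included.\<close>

lemma qbinom_eq_Fract:
  assumes "r \<le> n"
  shows "qbinom n r = Fract (gauss_binom ([:0, 1:]\<^sup>2) n r) ([:0, 1:] ^ (r * (n - r)) :: 'k::field poly)"
proof -
  have Fr: "Fract (gauss_binom t n r) 1 = gauss_binom (Fract t 1) n (r :: nat)" for t :: "'k poly" and n r
  proof (induction t n r rule: gauss_binom.induct)
    case (3 t n r)
    have "Fract (t ^ k) 1 = Fract t 1 ^ k" for k
    proof (induction k)
      case (Suc k)
      then show ?case by (simp add: mult_fract flip: Suc)
    qed (simp add: One_fract_def)
    moreover have "Fract (p + q * p') 1 = Fract p 1 + Fract q 1 * Fract p' 1" for p q p' :: "'k poly"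
      by simp
    ultimately show ?case using 3 by (simp only: gauss_binom.simps)
  qed (simp_all add: One_fract_def Zero_fract_def)
  have "gauss_binom (nu\<^sup>2) n r * (qfact r * qfact (n - r)) = nu ^ (r * (n - r)) * (qfact n :: 'k poly fract)"
    using gauss_binom_qfact[of "n - r" r, where 'k = 'k] assms by (simp add: mult.commute)
  then have "nu ^ (r * (n - r)) * qbinom n r = (gauss_binom (nu\<^sup>2) n r :: 'k poly fract)"
    using qfact_neq_0[where 'k = 'k] by (simp add: qbinom_def field_simps)
  then have "qbinom n r = (gauss_binom (nu\<^sup>2) n r / nu ^ (r * (n - r)) :: 'k poly fract)"
    using nu_neq_0[where 'k = 'k] by (simp add: field_simps)
  also have "nu\<^sup>2 = (Fract ([:0, 1:]\<^sup>2) 1 :: 'k poly fract)" by (rule nu_eqs)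
  finally show ?thesis by (simp add: nu_eqs flip: Fr)
qed

text \<open>Two representations with denominators nonzero at \<open>x\<close> give the same value by
  cross-multiplication, so the definite description is well defined.\<close>

lemma rat_eval_Fract:
  fixes n d :: "'k::field poly"
  assumes "poly d x \<noteq> 0" shows "rat_eval (Fract n d) x = poly n x / poly d x"
  unfolding rat_eval_def
proof (rule the_equality)
  fix v assume "\<exists>n' d'. Fract n d = Fract n' d' \<and> poly d' x \<noteq> 0 \<and> v = poly n' x / poly d' x"
  then obtain n' d' where *: "Fract n d = Fract n' d'" "poly d' x \<noteq> 0" "v = poly n' x / poly d' x" by auto
  have "d \<noteq> 0" "d' \<noteq> 0" using assms * by auto
  with * have "n * d' = n' * d" by (simp add: eq_fract)
  then have "poly n x * poly d' x = poly n' x * poly d x" by (metis poly_mult)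
  then have "poly n x / poly d x = poly n' x / poly d' x" using * assms by (simp add: frac_eq_eq)
  with * show "v = poly n x / poly d x" by simp
qed (use assms in blast)

lemma rat_eval_qbinom:
  assumes "x \<noteq> 0" "r \<le> n"
  shows "rat_eval (qbinom n r) x = gauss_binom (x\<^sup>2) n r / (x :: 'k::field) ^ (r * (n - r))"
proof -
  have "poly (gauss_binom t n r) x = gauss_binom (poly t x) n r" for t :: "'k poly" and n r
    by (induction t n r rule: gauss_binom.induct) simp_all
  then show ?thesis using assms by (simp add: qbinom_eq_Fract rat_eval_Fract)
qed

context kalg
begin

lemma finsum_smult:
  "\<lbrakk>finite S; f \<in> S \<rightarrow> carrier A\<rbrakk> \<Longrightarrow> c \<odot> (\<Oplus>i\<in>S. f i) = (\<Oplus>i\<in>S. c \<odot> f i)"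
  by (induction S rule: finite_induct) (auto simp: smult_r_distr Pi_def)

text \<open>The q-binomial theorem for left and right multiplication by \<open>x\<close>: the
  coefficients are those of the product of the factors 1 - z t^k u over k < n.\<close>

lemma skew_expand:
  assumes [simp]: "x \<in> carrier A" "y \<in> carrier A"
  shows "skew A x y (\<lambda>k. z * t ^ k) n =
    (\<Oplus>r\<in>{..n}. ((- z) ^ r * t ^ (r choose 2) * gauss_binom t n r) \<odot> (x [^] (n - r) \<otimes> y \<otimes> x [^] r))"
proof (induction n)
  case 0
  show ?case by (simp add: numeral_2_eq_2)
next
  case (Suc n)
  let ?e = "\<lambda>n r. (- z) ^ r * t ^ (r choose 2) * gauss_binom t n r"
  let ?M = "\<lambda>n r. x [^] (n - r) \<otimes> y \<otimes> x [^] r"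
  have "x \<otimes> skew A x y (\<lambda>k. z * t ^ k) n = (\<Oplus>r\<in>{..n}. x \<otimes> (?e n r \<odot> ?M n r))"
    unfolding Suc by (rule finsum_rdistr) auto
  also have "\<dots> = (\<Oplus>r\<in>{..n}. ?e n r \<odot> ?M (Suc n) r)"
  proof (rule finsum_cong')
    fix r assume "r \<in> {..n}"
    then have "x [^] (Suc n - r) = x \<otimes> x [^] (n - r)"
      by (simp only: nat_pow_Suc2[symmetric] assms Suc_diff_le atMost_iff)
    then show "x \<otimes> (?e n r \<odot> ?M n r) = ?e n r \<odot> ?M (Suc n) r" by (simp add: m_assoc)
  qed auto
  also have "\<dots> = (\<Oplus>r\<in>{..Suc n}. ?e n r \<odot> ?M (Suc n) r)"
    by (subst finsum_Suc) (auto simp: gauss_binom_eq_0)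
  finally have 1: "x \<otimes> skew A x y (\<lambda>k. z * t ^ k) n = (\<Oplus>r\<in>{..Suc n}. ?e n r \<odot> ?M (Suc n) r)" .
  \<comment> \<open>Multiplying by \<open>x\<close> on the right raises the right exponent by one.
    With the coefficients shifted accordingly, and 0 put at r = 0, both sums run over the same range
    and the Pascal rule applies termwise.\<close>
  define b where "b r = (case r of 0 \<Rightarrow> 0 | Suc r' \<Rightarrow> - (z * t ^ n) * ?e n r')" for r
  have "(- (z * t ^ n)) \<odot> (skew A x y (\<lambda>k. z * t ^ k) n \<otimes> x) =
      (- (z * t ^ n)) \<odot> (\<Oplus>r\<in>{..n}. (?e n r \<odot> ?M n r) \<otimes> x)"
    unfolding Suc by (subst finsum_ldistr) auto
  also have "\<dots> = (\<Oplus>r\<in>{..n}. (- (z * t ^ n)) \<odot> ((?e n r \<odot> ?M n r) \<otimes> x))"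
    by (rule finsum_smult) auto
  also have "\<dots> = (\<Oplus>r\<in>{..n}. b (Suc r) \<odot> ?M (Suc n) (Suc r))"
    by (rule finsum_cong') (auto simp: m_assoc b_def)
  also have "\<dots> = (\<Oplus>r\<in>{..Suc n}. b r \<odot> ?M (Suc n) r)"
    by (subst finsum_Suc2) (auto simp: b_def)
  finally have 2: "(- (z * t ^ n)) \<odot> (skew A x y (\<lambda>k. z * t ^ k) n \<otimes> x) =
    (\<Oplus>r\<in>{..Suc n}. b r \<odot> ?M (Suc n) r)" .
  have "skew A x y (\<lambda>k. z * t ^ k) (Suc n) =
      (\<Oplus>r\<in>{..Suc n}. ?e n r \<odot> ?M (Suc n) r \<oplus> b r \<odot> ?M (Suc n) r)"
    unfolding skew.simps 1 2 by (rule finsum_addf[symmetric]) auto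
  also have "\<dots> = (\<Oplus>r\<in>{..Suc n}. ?e (Suc n) r \<odot> ?M (Suc n) r)"
  proof (rule finsum_cong')
    fix r assume r: "r \<in> {..Suc n}"
    have "?e (Suc n) r = ?e n r + b r"
    proof (cases r)
      case (Suc r')
      then have "t ^ (Suc r' choose 2) * t ^ (n - r') = t ^ n * t ^ (r' choose 2)"
        using r by (simp add: numeral_2_eq_2 add.commute flip: power_add)
      then show ?thesis using Suc by (simp add: b_def algebra_simps)
    qed (simp add: b_def)
    then show "?e n r \<odot> ?M (Suc n) r \<oplus> b r \<odot> ?M (Suc n) r = ?e (Suc n) r \<odot> ?M (Suc n) r"
      by (simp only: smult_l_distr m_closed assms nat_pow_closed)
  qed auto
  finally show ?case .
qed

text \<open>In the r-th coefficient of \<open>skew_expand\<close> the exponent of q is a r + r (r -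
  1) = - r (n - r), because n = 1 - a. This is the power by which the symmetric binomial differs
  from \<open>gauss_binom\<close> at the square of q.\<close>

lemma serre_sum_eq_skew:
  assumes [simp]: "x \<in> carrier A" "y \<in> carrier A" and q: "q \<noteq> 0" and a: "a \<le> 0" and n: "n = nat (1 - a)"
  shows "(\<Oplus>r\<in>{..n}. ((- 1) ^ r * rat_eval (qbinom n r) q) \<odot> (x [^] (n - r) \<otimes> y \<otimes> x [^] r)) =
    skew A x y (\<lambda>k. q powi a * (q powi 2) ^ k) n"
  unfolding skew_expand[OF assms(1,2)]
proof (rule finsum_cong')
  fix r assume "r \<in> {..n}"
  then have r: "r \<le> n" by simp
  have e: "2 * int (r choose 2) = int r * (int r - 1)"
    by (induction r) (simp_all add: numeral_2_eq_2 algebra_simps)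
  have "(q powi a) ^ r * (q powi 2) ^ (r choose 2) = q powi (a * int r + 2 * int (r choose 2))"
    using q by (simp add: power_int_add power_int_mult)
  also have "a * int r + 2 * int (r choose 2) = - int (r * (n - r))"
    unfolding e using r a n by (simp add: algebra_simps of_nat_diff)
  finally have "(q powi a) ^ r * (q powi 2) ^ (r choose 2) = inverse (q ^ (r * (n - r)))"
    by (simp only: power_int_minus power_int_of_nat)
  then have "(- (q powi a)) ^ r * (q powi 2) ^ (r choose 2) = (- 1) ^ r * inverse (q ^ (r * (n - r)))"
    by (simp only: power_minus[of "q powi a"] mult.assoc)
  then show "((- 1) ^ r * rat_eval (qbinom n r) q) \<odot> (x [^] (n - r) \<otimes> y \<otimes> x [^] r) =
      ((- (q powi a)) ^ r * (q powi 2) ^ (r choose 2) * gauss_binom (q powi 2) n r) \<odot> (x [^] (n - r) \<otimes> y \<otimes> x [^] r)"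
    using q r by (simp only: rat_eval_qbinom[OF q r] divide_inverse power_int_numeral mult.assoc mult.commute[of "gauss_binom _ _ _"])
qed auto

end

section \<open>The universal property\<close>

lemma free_monoid_simps [simp]:
  "carrier (free_monoid X) = lists X" "v \<otimes>\<^bsub>free_monoid X\<^esub> w = v @ w" "\<one>\<^bsub>free_monoid X\<^esub> = []"
  by (simp_all add: free_monoid_def)

lemma monoid_free_monoid: "Group.monoid (free_monoid X)"
  by (rule monoidI) auto

definition ev :: "('k, 'c, 'z) module_scheme \<Rightarrow> ('g \<Rightarrow> 'c) \<Rightarrow> 'g list \<Rightarrow> 'c" where
  "ev C f w = foldr (\<lambda>g x. f g \<otimes>\<^bsub>C\<^esub> x) w \<one>\<^bsub>C\<^esub>"

lemma ev_simps [simp]: "ev C f [] = \<one>\<^bsub>C\<^esub>" "ev C f (g # w) = f g \<otimes>\<^bsub>C\<^esub> ev C f w"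
  by (simp_all add: ev_def)

abbreviation wU_relators :: "'k::field wU_data \<Rightarrow> (gen list \<Rightarrow>\<^sub>0 'k) set" where
  "wU_relators P \<equiv> J_relators P \<union> type_relators P \<union> EF_relators P \<union> serre_relators P"

text \<open>This and the next three predicates restate the relators as equations between the values
  of \<open>f\<close> in an arbitrary algebra. In this form they are checked for the coproduct, the
  anti-homomorphisms, the characters and the modules without reference to the free algebra.\<close>

definition J_rels :: "'k::field wU_data \<Rightarrow> ('k, 'c, 'z) module_scheme \<Rightarrow> (gen \<Rightarrow> 'c) \<Rightarrow> bool" where
  "J_rels P C f \<longleftrightarrow> (let I = idx P; e = f gJ [^]\<^bsub>C\<^esub> (Jexp P - 1) in
     f gJ [^]\<^bsub>C\<^esub> Jexp P = f gJ \<and>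
     (\<forall>i\<in>I. f (gK i) \<otimes>\<^bsub>C\<^esub> f (gKb i) = e \<and> f (gD i) \<otimes>\<^bsub>C\<^esub> f (gDb i) = e) \<and>
     (\<forall>x\<in>{gJ} \<union> toral_gens I. \<forall>y\<in>{gJ} \<union> toral_gens I. f x \<otimes>\<^bsub>C\<^esub> f y = f y \<otimes>\<^bsub>C\<^esub> f x) \<and>
     (\<forall>x\<in>toral_gens I. f x \<otimes>\<^bsub>C\<^esub> e = f x))"

definition type_rels :: "'k::field wU_data \<Rightarrow> ('k, 'c, 'z) module_scheme \<Rightarrow> (gen \<Rightarrow> 'c) \<Rightarrow> bool" where
  "type_rels P C f \<longleftrightarrow> (\<forall>i\<in>idx P. \<forall>j\<in>idx P. let c = qi P i powi cartan P i j; c' = qi P i powi (- cartan P i j) in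
     (type_E P i = 1 \<longrightarrow> qcomm C c (f (gK j)) (f (gE i)) \<and> qcomm C c' (f (gKb j)) (f (gE i))) \<and>
     (type_E P i = 0 \<longrightarrow> f (gK j) \<otimes>\<^bsub>C\<^esub> (f (gE i) \<otimes>\<^bsub>C\<^esub> f (gKb j)) = c \<odot>\<^bsub>C\<^esub> f (gE i)) \<and>
     (type_F P i = 1 \<longrightarrow> qcomm C c' (f (gK j)) (f (gF i)) \<and> qcomm C c (f (gKb j)) (f (gF i))) \<and>
     (type_F P i = 0 \<longrightarrow> f (gK j) \<otimes>\<^bsub>C\<^esub> (f (gF i) \<otimes>\<^bsub>C\<^esub> f (gKb j)) = c' \<odot>\<^bsub>C\<^esub> f (gF i)))"

definition EF_rels :: "'k::field wU_data \<Rightarrow> ('k, 'c, 'z) module_scheme \<Rightarrow> (gen \<Rightarrow> 'c) \<Rightarrow> bool" where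
  "EF_rels P C f \<longleftrightarrow> (\<forall>i\<in>idx P. \<forall>j\<in>idx P.
     f (gE i) \<otimes>\<^bsub>C\<^esub> f (gF j) \<ominus>\<^bsub>C\<^esub> f (gF j) \<otimes>\<^bsub>C\<^esub> f (gE i) =
     (if i = j then inverse (qi P i - inverse (qi P i)) \<odot>\<^bsub>C\<^esub> (f (gK i) \<ominus>\<^bsub>C\<^esub> f (gKb i)) else \<zero>\<^bsub>C\<^esub>))"

text \<open>Serre and commutation relations are merged: for a_ij = 0 the iterated commutator has a
  single factor, with scalar 1, and is x y - y x. The base q_i^(a_ii) equals q_i^2 if a_ii = 2; it
  is written this way because it is the weight with which K_i passes E_i, which the lemmas on
  \<open>skew\<close> refer to.\<close>

definition serre_rels :: "'k::field wU_data \<Rightarrow> ('k, 'c, 'z) module_scheme \<Rightarrow> (gen \<Rightarrow> 'c) \<Rightarrow> bool" where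
  "serre_rels P C f \<longleftrightarrow> (\<forall>X\<in>{gE, gF}. \<forall>i\<in>idx P. \<forall>j\<in>idx P.
     i \<noteq> j \<and> (cartan P i i = 2 \<or> cartan P i j = 0) \<longrightarrow>
     skew C (f (X i)) (f (X j)) (\<lambda>k. qi P i powi cartan P i j * (qi P i powi cartan P i i) ^ k)
       (nat (1 - cartan P i j)) = \<zero>\<^bsub>C\<^esub>)"

definition wU_rels :: "'k::field wU_data \<Rightarrow> ('k, 'c, 'z) module_scheme \<Rightarrow> (gen \<Rightarrow> 'c) \<Rightarrow> bool" where
  "wU_rels P C f \<longleftrightarrow> f \<in> gens (idx P) \<rightarrow> carrier C \<and>
     J_rels P C f \<and> type_rels P C f \<and> EF_rels P C f \<and> serre_rels P C f"

lemma gensI [simp]: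
  "gJ \<in> gens I" "i \<in> I \<Longrightarrow> gE i \<in> gens I" "i \<in> I \<Longrightarrow> gF i \<in> gens I" "i \<in> I \<Longrightarrow> gK i \<in> gens I"
  "i \<in> I \<Longrightarrow> gKb i \<in> gens I" "i \<in> I \<Longrightarrow> gD i \<in> gens I" "i \<in> I \<Longrightarrow> gDb i \<in> gens I"
  "x \<in> toral_gens I \<Longrightarrow> x \<in> gens I"
  by (auto simp: gens_def toral_gens_def)

lemma toral_gensI [simp]:
  "i \<in> I \<Longrightarrow> gK i \<in> toral_gens I" "i \<in> I \<Longrightarrow> gKb i \<in> toral_gens I"
  "i \<in> I \<Longrightarrow> gD i \<in> toral_gens I" "i \<in> I \<Longrightarrow> gDb i \<in> toral_gens I"
  by (auto simp: toral_gens_def)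

lemma ball_compr:
  "(\<forall>r\<in>{F x |x. R x}. Q r) \<longleftrightarrow> (\<forall>x. R x \<longrightarrow> Q (F x))"
  "(\<forall>r\<in>{G x y |x y. S x y}. Q r) \<longleftrightarrow> (\<forall>x y. S x y \<longrightarrow> Q (G x y))"
  "(\<forall>r\<in>{H x y z |x y z. T x y z}. Q r) \<longleftrightarrow> (\<forall>x y z. T x y z \<longrightarrow> Q (H x y z))"
  by blast+

locale wU_map = kalg C for C :: "('k::field, 'c, 'z) module_scheme" (structure) +
  fixes P :: "'k wU_data" and f :: "gen \<Rightarrow> 'c"
  assumes datum: "wU_datum P" and f: "f \<in> gens (idx P) \<rightarrow> carrier C"
begin

abbreviation "L \<equiv> lin_ext C (ev C f)"

lemma fc [simp]: "g \<in> gens (idx P) \<Longrightarrow> f g \<in> carrier C"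
  using f by auto

lemma ev_closed [simp]: "set w \<subseteq> gens (idx P) \<Longrightarrow> ev C f w \<in> carrier C"
  by (induction w) auto

lemma ev_append: "\<lbrakk>set v \<subseteq> gens (idx P); set w \<subseteq> gens (idx P)\<rbrakk> \<Longrightarrow> ev C f (v @ w) = ev C f v \<otimes> ev C f w"
  by (induction v) (simp_all add: m_assoc)

lemma ev_replicate: "g \<in> gens (idx P) \<Longrightarrow> ev C f (replicate n g) = f g [^] n"
  by (induction n) (simp_all only: replicate.simps ev_simps nat_pow_0 nat_pow_Suc2 fc)

lemma ev_funcset: "ev C f \<in> carrier (free_monoid (gens (idx P))) \<rightarrow> carrier C"
  by (auto simp: lists_eq_set)

lemma L_wd: "set w \<subseteq> gens (idx P) \<Longrightarrow> L (wd w c) = c \<odot> ev C f w"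
  using lin_ext_single[OF ev_funcset, of w c] by (simp add: lists_eq_set)

lemma L_diff: "\<lbrakk>Poly_Mapping.keys p \<subseteq> lists (gens (idx P)); Poly_Mapping.keys q \<subseteq> lists (gens (idx P))\<rbrakk> \<Longrightarrow>
    L (p - q) = L p \<ominus> L q"
  using lin_ext_diff[OF ev_funcset, of p q] by simp

lemma L_wd_diff: "\<lbrakk>set v \<subseteq> gens (idx P); set w \<subseteq> gens (idx P)\<rbrakk> \<Longrightarrow>
    L (wd v c - wd w d) = c \<odot> ev C f v \<ominus> d \<odot> ev C f w"
  by (subst L_diff) (auto simp: lists_eq_set L_wd)

lemma alg_hom_L: "alg_hom (free_algebra (gens (idx P))) C L"
  by (rule alg_hom_lin_ext[OF monoid_free_monoid ev_funcset])
    (auto simp: lists_eq_set ev_append)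

lemma L_diff_zero: "\<lbrakk>set v \<subseteq> gens (idx P); set w \<subseteq> gens (idx P)\<rbrakk> \<Longrightarrow>
    L (wd v 1 - wd w d) = \<zero> \<longleftrightarrow> ev C f v = d \<odot> ev C f w"
  by (simp add: L_wd_diff smult_diff_eq_iff)

lemma J_rels_iff: "(\<forall>r\<in>J_relators P. L r = \<zero>) \<longleftrightarrow> J_rels P C f"
proof -
  let ?I = "idx P" and ?w = "replicate (Jexp P - 1) gJ"
  have w: "set ?w \<subseteq> gens ?I" by auto
  have 1: "L (wd (replicate (Jexp P) gJ) 1 - wd [gJ] 1) = \<zero> \<longleftrightarrow> f gJ [^] Jexp P = f gJ"
    by (subst L_diff_zero) (auto simp: ev_replicate)
  have 2: "L (wd ?w 1 - wd [gK i, gKb i] 1) = \<zero> \<longleftrightarrow> f (gK i) \<otimes> f (gKb i) = f gJ [^] (Jexp P - 1)"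
    "L (wd ?w 1 - wd [gD i, gDb i] 1) = \<zero> \<longleftrightarrow> f (gD i) \<otimes> f (gDb i) = f gJ [^] (Jexp P - 1)" if "i \<in> ?I" for i
    using that w by (subst L_diff_zero; auto simp: ev_replicate)+
  have 3: "L (wd [x, y] 1 - wd [y, x] 1) = \<zero> \<longleftrightarrow> f x \<otimes> f y = f y \<otimes> f x"
    if "x \<in> gens ?I" "y \<in> gens ?I" for x y
    using that by (subst L_diff_zero) auto
  have 4: "L (wd (x # ?w) 1 - wd [x] 1) = \<zero> \<longleftrightarrow> f x \<otimes> f gJ [^] (Jexp P - 1) = f x"
    if "x \<in> gens ?I" for x
    using that w by (subst L_diff_zero) (auto simp: ev_replicate)
  have T: "x \<in> gens ?I" if "x \<in> {gJ} \<union> toral_gens ?I" for x using that by auto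
  show ?thesis
    unfolding J_relators_def J_rels_def Let_def ball_Un ball_compr
    by (simp only: 1 2 3 4 T Un_iff gensI ball_simps imp_conjL all_conj_distrib
        ball_conj_distrib Ball_def conj_assoc cong: imp_cong conj_cong) (auto simp: 1)
qed

lemma type_rels_iff: "(\<forall>r\<in>type_relators P. L r = \<zero>) \<longleftrightarrow> type_rels P C f"
proof -
  have 1: "L (wd [x, y] 1 - wd [y, x] c) = \<zero> \<longleftrightarrow> qcomm C c (f x) (f y)"
    if "x \<in> gens (idx P)" "y \<in> gens (idx P)" for x y c
    using that by (subst L_diff_zero) (auto simp: qcomm_def)
  have 2: "L (wd [x, y, z] 1 - wd [y] c) = \<zero> \<longleftrightarrow> f x \<otimes> (f y \<otimes> f z) = c \<odot> f y"
    if "x \<in> gens (idx P)" "y \<in> gens (idx P)" "z \<in> gens (idx P)" for x y z c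
    using that by (subst L_diff_zero) auto
  show ?thesis
    unfolding type_relators_def type_rels_def Let_def ball_Un ball_compr
    by (simp only: 1 2 gensI Ball_def cong: imp_cong conj_cong)
      (intro iffI conjI allI impI; elim conjE; blast)
qed

lemma EF_rels_iff: "(\<forall>r\<in>EF_relators P. L r = \<zero>) \<longleftrightarrow> EF_rels P C f"
proof -
  let ?c = "\<lambda>i. inverse (qi P i - inverse (qi P i))"
  have "L (wd [gE i, gF j] 1 - wd [gF j, gE i] 1
        - (if i = j then wd [gK i] (?c i) - wd [gKb i] (?c i) else 0)) = \<zero> \<longleftrightarrow>
     f (gE i) \<otimes> f (gF j) \<ominus> f (gF j) \<otimes> f (gE i) =
     (if i = j then ?c i \<odot> (f (gK i) \<ominus> f (gKb i)) else \<zero>)" if "i \<in> idx P" "j \<in> idx P" for i j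
  proof -
    have k: "Poly_Mapping.keys (p - q) \<subseteq> lists (gens (idx P))"
      if "Poly_Mapping.keys p \<subseteq> lists (gens (idx P))" "Poly_Mapping.keys q \<subseteq> lists (gens (idx P))"
      for p q :: "gen list \<Rightarrow>\<^sub>0 'k"
      using that keys_diff[of p q] by blast
    have "L (wd [gE i, gF j] 1 - wd [gF j, gE i] 1) = f (gE i) \<otimes> f (gF j) \<ominus> f (gF j) \<otimes> f (gE i)"
      using that by (subst L_wd_diff) auto
    moreover have "L (if i = j then wd [gK i] (?c i) - wd [gKb i] (?c i) else 0) =
        (if i = j then ?c i \<odot> (f (gK i) \<ominus> f (gKb i)) else \<zero>)"
      using that by (auto simp: lin_ext_zero L_wd_diff minus_smult smult_r_distr mult.commute)
    moreover have "Poly_Mapping.keys (wd [gE i, gF j] 1 - wd [gF j, gE i] (1 :: 'k)) \<subseteq> lists (gens (idx P))"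
      using that by (intro k) simp_all
    moreover have "Poly_Mapping.keys (if i = j then wd [gK i] (?c i) - wd [gKb i] (?c i) else 0) \<subseteq> lists (gens (idx P))"
      using that by (cases "i = j") (simp_all add: k)
    ultimately show ?thesis
      using that by (simp add: L_diff smult_diff_eq_iff)
  qed
  then show ?thesis
    unfolding EF_relators_def EF_rels_def Let_def by blast
qed

lemma qi_neq_0: "i \<in> idx P \<Longrightarrow> qi P i \<noteq> 0"
  using datum by (auto simp: wU_datum_def)

lemma cartan_nonpos: "\<lbrakk>i \<in> idx P; j \<in> idx P; i \<noteq> j\<rbrakk> \<Longrightarrow> cartan P i j \<le> 0"
  using datum by (auto simp: wU_datum_def borcherds_cartan_def)

text \<open>Relators with a_ii = 2 are handled by \<open>serre_sum_eq_skew\<close>, and a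
  commutation relator is an iterated commutator of length 1. For i = j the latter is 0 from the
  outset, which justifies the side condition in \<open>serre_rels\<close>.\<close>

lemma serre_rels_iff: "(\<forall>r\<in>serre_relators P. L r = \<zero>) \<longleftrightarrow> serre_rels P C f"
proof -
  let ?N = "\<lambda>i j. nat (1 - cartan P i j)"
  let ?l = "\<lambda>i j k. qi P i powi cartan P i j * (qi P i powi cartan P i i) ^ k"
  have 1: "L (\<Sum>r=0..?N i j. wd (replicate (?N i j - r) (X i) @ [X j] @ replicate r (X i))
          ((-1) ^ r * rat_eval (qbinom (?N i j) r) (qi P i))) = \<zero> \<longleftrightarrow>
      skew C (f (X i)) (f (X j)) (?l i j) (?N i j) = \<zero>"
    if X: "X \<in> {gE, gF}" and i: "i \<in> idx P" and j: "j \<in> idx P" and ij: "i \<noteq> j" "cartan P i i = 2" for X i j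
  proof -
    have g: "X i \<in> gens (idx P)" "X j \<in> gens (idx P)" using X i j by auto
    have w: "set (replicate n (X i) @ [X j] @ replicate r (X i)) \<subseteq> gens (idx P)" for n r using g by auto
    have evw: "ev C f (replicate n (X i) @ [X j] @ replicate r (X i)) = f (X i) [^] n \<otimes> f (X j) \<otimes> f (X i) [^] r" for n r
      using g by (subst ev_append; (subst ev_append)?) (auto simp: ev_replicate m_assoc)
    have "L (\<Sum>r=0..?N i j. wd (replicate (?N i j - r) (X i) @ [X j] @ replicate r (X i))
          ((-1) ^ r * rat_eval (qbinom (?N i j) r) (qi P i))) =
        (\<Oplus>r\<in>{..?N i j}. ((- 1) ^ r * rat_eval (qbinom (?N i j) r) (qi P i)) \<odot>
          (f (X i) [^] (?N i j - r) \<otimes> f (X j) \<otimes> f (X i) [^] r))"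
      unfolding atMost_atLeast0
    proof (subst lin_ext_sum[OF ev_funcset])
      show "(\<Oplus>r\<in>{0..?N i j}. L (wd (replicate (?N i j - r) (X i) @ [X j] @ replicate r (X i))
          ((-1) ^ r * rat_eval (qbinom (?N i j) r) (qi P i)))) =
        (\<Oplus>r\<in>{0..?N i j}. ((- 1) ^ r * rat_eval (qbinom (?N i j) r) (qi P i)) \<odot>
          (f (X i) [^] (?N i j - r) \<otimes> f (X j) \<otimes> f (X i) [^] r))"
        by (rule finsum_cong') (use g in \<open>simp_all only: L_wd[OF w] evw, auto\<close>)
    qed (use g in auto)
    also have "\<dots> = skew C (f (X i)) (f (X j)) (?l i j) (?N i j)"
      unfolding ij(2) by (rule serre_sum_eq_skew) (use g qi_neq_0[OF i] cartan_nonpos[OF i j ij(1)] in auto)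
    finally show ?thesis by simp
  qed
  have 2: "L (wd [X i, X j] 1 - wd [X j, X i] 1) = \<zero> \<longleftrightarrow>
      skew C (f (X i)) (f (X j)) (?l i j) (?N i j) = \<zero>"
    if X: "X \<in> {gE, gF}" and i: "i \<in> idx P" and j: "j \<in> idx P" and ij: "cartan P i j = 0" for X i j
  proof -
    have g: "X i \<in> gens (idx P)" "X j \<in> gens (idx P)" using X i j by auto
    show ?thesis
      using g by (subst L_diff_zero) (auto simp: ij minus_smult[symmetric] smult_diff_eq_iff)
  qed
  have 3: "L (wd [X i, X i] 1 - wd [X i, X i] 1) = \<zero>" for X i
    by (simp add: lin_ext_zero)
  define G where "G X i j \<longleftrightarrow> skew C (f (X i)) (f (X j)) (?l i j) (?N i j) = \<zero>" for X :: "nat \<Rightarrow> gen" and i j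
  have G: "G X i i" if "X \<in> {gE, gF}" "i \<in> idx P" "cartan P i i = 0" for X i
    using 2[OF that(1,2,2,3)] 3[of X i] by (simp add: G_def)
  have "(\<forall>r\<in>serre_relators P. L r = \<zero>) \<longleftrightarrow>
      (\<forall>X i j. X \<in> {gE, gF} \<and> i \<in> idx P \<and> j \<in> idx P \<and> i \<noteq> j \<and> cartan P i i = 2 \<longrightarrow> G X i j) \<and>
      (\<forall>X i j. X \<in> {gE, gF} \<and> i \<in> idx P \<and> j \<in> idx P \<and> cartan P i j = 0 \<longrightarrow> G X i j)"
  proof -
    have A: "(X \<in> {gE, gF} \<and> i \<in> idx P \<and> j \<in> idx P \<and> i \<noteq> j \<and> cartan P i i = 2 \<longrightarrow>
        L (\<Sum>r=0..?N i j. wd (replicate (?N i j - r) (X i) @ [X j] @ replicate r (X i))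
          ((-1) ^ r * rat_eval (qbinom (?N i j) r) (qi P i))) = \<zero>) \<longleftrightarrow>
      (X \<in> {gE, gF} \<and> i \<in> idx P \<and> j \<in> idx P \<and> i \<noteq> j \<and> cartan P i i = 2 \<longrightarrow> G X i j)" for X i j
      unfolding G_def by (intro imp_cong refl; elim conjE; rule 1; assumption)
    have B: "(X \<in> {gE, gF} \<and> i \<in> idx P \<and> j \<in> idx P \<and> cartan P i j = 0 \<longrightarrow>
        L (wd [X i, X j] 1 - wd [X j, X i] 1) = \<zero>) \<longleftrightarrow>
      (X \<in> {gE, gF} \<and> i \<in> idx P \<and> j \<in> idx P \<and> cartan P i j = 0 \<longrightarrow> G X i j)" for X i j
      unfolding G_def by (intro imp_cong refl; elim conjE; rule 2; assumption)
    show ?thesis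
      unfolding serre_relators_def Let_def ball_Un ball_compr by (simp only: A B)
  qed
  also have "\<dots> \<longleftrightarrow> serre_rels P C f"
    unfolding serre_rels_def G_def[symmetric]
  proof -
    have "(\<forall>X i j. X \<in> S \<and> i \<in> idx P \<and> j \<in> idx P \<and> i \<noteq> j \<and> cartan P i i = 2 \<longrightarrow> G X i j) \<and>
      (\<forall>X i j. X \<in> S \<and> i \<in> idx P \<and> j \<in> idx P \<and> cartan P i j = 0 \<longrightarrow> G X i j) \<longleftrightarrow>
      (\<forall>X\<in>S. \<forall>i\<in>idx P. \<forall>j\<in>idx P. i \<noteq> j \<and> (cartan P i i = 2 \<or> cartan P i j = 0) \<longrightarrow> G X i j)"
      if "\<And>X i. \<lbrakk>X \<in> S; i \<in> idx P; cartan P i i = 0\<rbrakk> \<Longrightarrow> G X i i" for S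
    proof (intro iffI conjI allI impI ballI, goal_cases)
      case (3 X i j)
      then show ?case using that[of X i] by (cases "i = j") auto
    qed auto
    from this[OF G] show "((\<forall>X i j. X \<in> {gE, gF} \<and> i \<in> idx P \<and> j \<in> idx P \<and> i \<noteq> j \<and> cartan P i i = 2 \<longrightarrow> G X i j) \<and>
      (\<forall>X i j. X \<in> {gE, gF} \<and> i \<in> idx P \<and> j \<in> idx P \<and> cartan P i j = 0 \<longrightarrow> G X i j)) \<longleftrightarrow>
      (\<forall>X\<in>{gE, gF}. \<forall>i\<in>idx P. \<forall>j\<in>idx P. i \<noteq> j \<and> (cartan P i i = 2 \<or> cartan P i j = 0) \<longrightarrow> G X i j)" .
  qed
  finally show ?thesis .
qed

lemma relators_iff: "(\<forall>r\<in>wU_relators P. L r = \<zero>) \<longleftrightarrow> wU_rels P C f"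
  using f unfolding ball_Un J_rels_iff type_rels_iff EF_rels_iff serre_rels_iff by (auto simp: wU_rels_def)

end

lemma kalg_free_algebra: "kalg (free_algebra X)"
  by (rule kalg.intro, rule k_algebra_monoid_algebra, rule monoid_free_monoid)

lemma wU_relators_carrier:
  "wU_relators P \<subseteq> carrier (free_algebra (gens (idx P)) :: ('k::field, gen list \<Rightarrow>\<^sub>0 'k) module)"
proof -
  let ?X = "lists (gens (idx P))"
  have k1: "Poly_Mapping.keys (p - q) \<subseteq> ?X"
    if "Poly_Mapping.keys p \<subseteq> ?X" "Poly_Mapping.keys q \<subseteq> ?X" for p q :: "gen list \<Rightarrow>\<^sub>0 'k"
    using that keys_diff[of p q] by blast
  have k2: "Poly_Mapping.keys (wd w c) \<subseteq> ?X" if "set w \<subseteq> gens (idx P)" for w and c :: 'k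
    using that by (auto simp: lists_eq_set)
  have kd: "Poly_Mapping.keys (wd v c - wd w d) \<subseteq> ?X"
    if "set v \<subseteq> gens (idx P)" "set w \<subseteq> gens (idx P)" for v w and c d :: 'k
    using that by (intro k1 k2)
  have "\<forall>r\<in>J_relators P. Poly_Mapping.keys r \<subseteq> ?X"
    unfolding J_relators_def Let_def ball_Un ball_compr
    by (intro conjI allI impI ballI; (elim singletonE; hypsubst)?; rule kd; auto)
  moreover have "\<forall>r\<in>type_relators P. Poly_Mapping.keys r \<subseteq> ?X"
    unfolding type_relators_def Let_def ball_Un ball_compr
    by (intro conjI allI impI; (rule kd | intro k1 k2); auto)
  moreover have "\<forall>r\<in>EF_relators P. Poly_Mapping.keys r \<subseteq> ?X"
    unfolding EF_relators_def Let_def ball_compr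
  proof (intro allI impI k1)
    fix i j assume "i \<in> idx P \<and> j \<in> idx P"
    then show "Poly_Mapping.keys (if i = j then wd [gK i] (inverse (qi P i - inverse (qi P i))) -
        wd [gKb i] (inverse (qi P i - inverse (qi P i))) else 0) \<subseteq> ?X"
      by (cases "i = j") (simp_all add: kd)
  qed (intro k2, simp)+
  moreover have "\<forall>r\<in>serre_relators P. Poly_Mapping.keys r \<subseteq> ?X"
    unfolding serre_relators_def Let_def ball_Un ball_compr
  proof (intro conjI allI impI; elim conjE)
    fix X :: "nat \<Rightarrow> gen" and i j
    assume "X \<in> {gE, gF}" "i \<in> idx P" "j \<in> idx P"
    then have X: "X i \<in> gens (idx P)" "X j \<in> gens (idx P)" by auto
    show "Poly_Mapping.keys (wd [X i, X j] 1 - wd [X j, X i] (1 :: 'k)) \<subseteq> ?X"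
      using X by (intro kd) simp_all
    show "Poly_Mapping.keys (\<Sum>r=0..nat (1 - cartan P i j).
        wd (replicate (nat (1 - cartan P i j) - r) (X i) @ [X j] @ replicate r (X i))
          ((- 1) ^ r * rat_eval (qbinom (nat (1 - cartan P i j)) r) (qi P i))) \<subseteq> ?X"
      using X by (intro order.trans[OF keys_sum] UN_least k2) auto
  qed
  ultimately have K: "\<forall>r\<in>wU_relators P. Poly_Mapping.keys r \<subseteq> ?X"
    unfolding ball_Un by (intro conjI)
  show ?thesis
  proof
    fix r :: "gen list \<Rightarrow>\<^sub>0 'k" assume "r \<in> wU_relators P"
    then have "Poly_Mapping.keys r \<subseteq> ?X" by (rule bspec[OF K])
    then show "r \<in> carrier (free_algebra (gens (idx P)))" by (simp only: monoid_algebra_simps free_monoid_simps mem_Collect_eq)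
  qed
qed

section \<open>The algebra as a quotient: generators, induction and universal property\<close>

locale wU_setup =
  fixes P :: "'k::field wU_data"
  assumes datum: "wU_datum P"
begin

abbreviation "A \<equiv> wU_alg P"
abbreviation "Fr \<equiv> free_algebra (gens (idx P)) :: ('k, gen list \<Rightarrow>\<^sub>0 'k) module"
abbreviation "W \<equiv> wgen P"

sublocale Fr: kalg Fr by (rule kalg_free_algebra)

sublocale Q: kalg_ideal Fr "wU_ideal P"
  unfolding wU_ideal_def
  by (rule kalg_ideal.intro[OF Fr.kalg_axioms], rule Fr.genideal_ideal[OF wU_relators_carrier])

sublocale A: kalg A
  unfolding wU_alg_def by (rule Q.kalg_quot)

lemma A_zero: "\<zero>\<^bsub>A\<^esub> = wU_ideal P"
  by (simp add: wU_alg_def alg_quot_simps)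

lemma wd_carrier: "set w \<subseteq> gens (idx P) \<Longrightarrow> wd w c \<in> carrier Fr"
  by (auto simp: monoid_algebra_simps lists_eq_set)

lemma W_closed [simp]: "g \<in> gens (idx P) \<Longrightarrow> W g \<in> carrier A"
  by (auto simp: wU_alg_def wgen_def alg_quot_simps wd_carrier)

sublocale WM: wU_map A P W
  by unfold_locales (auto simp: datum)

lemma coset_word: "set w \<subseteq> gens (idx P) \<Longrightarrow> wU_ideal P +>\<^bsub>Fr\<^esub> wd w 1 = ev A W w"
proof (induction w)
  case Nil
  then show ?case by (simp add: wU_alg_def alg_quot_simps monoid_algebra_simps)
next
  case (Cons g w)
  have "wd (g # w) 1 = wd [g] 1 \<otimes>\<^bsub>Fr\<^esub> wd w (1 :: 'k)"
    by (simp add: monoid_algebra_mult_single)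
  with Cons show ?case
    by (simp add: wU_alg_def wgen_def Q.quot_mult[symmetric] wd_carrier)
qed

text \<open>Both sides are linear in \<open>p\<close> and agree on words. Read on relators this
  gives \<open>wU_rels_W\<close>; read on arbitrary elements it gives induction over words.\<close>

lemma coset_eq_L:
  assumes "p \<in> carrier Fr"
  shows "wU_ideal P +>\<^bsub>Fr\<^esub> p = WM.L p"
proof -
  have p: "Poly_Mapping.keys p \<subseteq> lists (gens (idx P))"
    using assms by (simp add: monoid_algebra_simps)
  show ?thesis
  proof (rule poly_mapping_induct_keys[OF p])
    show "wU_ideal P +>\<^bsub>Fr\<^esub> 0 = WM.L 0"
      using Fr.a_coset_add_zero[OF Q.a_subset]
      by (simp add: A.lin_ext_zero A_zero monoid_algebra_simps)
    fix w and c :: 'k assume w: "w \<in> lists (gens (idx P))"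
    have "wd w c = c \<odot>\<^bsub>Fr\<^esub> wd w 1" by (simp add: monoid_algebra_simps map_scale_single)
    then have "wU_ideal P +>\<^bsub>Fr\<^esub> wd w c = c \<odot>\<^bsub>A\<^esub> (wU_ideal P +>\<^bsub>Fr\<^esub> wd w 1)"
      using w by (simp add: wU_alg_def Q.quot_smult wd_carrier lists_eq_set)
    then show "wU_ideal P +>\<^bsub>Fr\<^esub> wd w c = WM.L (wd w c)"
      using w by (simp add: coset_word WM.L_wd lists_eq_set)
  next
    fix p q :: "gen list \<Rightarrow>\<^sub>0 'k"
    assume *: "Poly_Mapping.keys p \<subseteq> lists (gens (idx P))" "Poly_Mapping.keys q \<subseteq> lists (gens (idx P))"
      "wU_ideal P +>\<^bsub>Fr\<^esub> p = WM.L p" "wU_ideal P +>\<^bsub>Fr\<^esub> q = WM.L q"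
    then have "wU_ideal P +>\<^bsub>Fr\<^esub> (p + q) = (wU_ideal P +>\<^bsub>Fr\<^esub> p) \<oplus>\<^bsub>A\<^esub> (wU_ideal P +>\<^bsub>Fr\<^esub> q)"
      using Q.quot_add[of p q] by (simp add: wU_alg_def monoid_algebra_simps)
    with * show "wU_ideal P +>\<^bsub>Fr\<^esub> (p + q) = WM.L (p + q)"
      using A.lin_ext_add[OF WM.ev_funcset] by simp
  qed
qed

lemma wU_rels_W: "wU_rels P A W"
  unfolding WM.relators_iff[symmetric]
proof
  fix r assume r: "r \<in> wU_relators P"
  then have rc: "r \<in> carrier Fr" using wU_relators_carrier by blast
  have "r \<in> wU_ideal P"
    unfolding wU_ideal_def using Fr.genideal_self[OF wU_relators_carrier] r by blast
  then have "wU_ideal P +>\<^bsub>Fr\<^esub> r = \<zero>\<^bsub>A\<^esub>"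
    by (simp add: Q.a_rcos_const wU_alg_def alg_quot_simps)
  then show "WM.L r = \<zero>\<^bsub>A\<^esub>" using coset_eq_L[OF rc] by simp
qed

lemma wU_word_induct [consumes 1, case_names word add smult]:
  assumes "x \<in> carrier A"
    and word: "\<And>w. set w \<subseteq> gens (idx P) \<Longrightarrow> R (ev A W w)"
    and add: "\<And>x y. \<lbrakk>x \<in> carrier A; y \<in> carrier A; R x; R y\<rbrakk> \<Longrightarrow> R (x \<oplus>\<^bsub>A\<^esub> y)"
    and smult: "\<And>c x. \<lbrakk>x \<in> carrier A; R x\<rbrakk> \<Longrightarrow> R (c \<odot>\<^bsub>A\<^esub> x)"
  shows "R x"
proof -
  obtain p where p: "p \<in> carrier Fr" "x = WM.L p"
    using assms(1) coset_eq_L by (auto simp: wU_alg_def alg_quot_simps)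
  have "Poly_Mapping.keys p \<subseteq> lists (gens (idx P))" using p by (simp add: monoid_algebra_simps)
  then have "R (WM.L p)"
  proof (rule poly_mapping_induct_keys)
    show "R (WM.L 0)" using smult[of "\<one>\<^bsub>A\<^esub>" 0] word[of "[]"] by (simp add: A.lin_ext_zero)
  next
    fix p q :: "gen list \<Rightarrow>\<^sub>0 'k"
    assume "Poly_Mapping.keys p \<subseteq> lists (gens (idx P))" "Poly_Mapping.keys q \<subseteq> lists (gens (idx P))"
      "R (WM.L p)" "R (WM.L q)"
    then show "R (WM.L (p + q))"
      using A.lin_ext_add[OF WM.ev_funcset] A.lin_ext_closed[OF WM.ev_funcset] add by simp
  qed (use word smult in \<open>auto simp: WM.L_wd lists_eq_set\<close>)
  with p show ?thesis by simp
qed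

lemma wU_induct [consumes 1, case_names one gen add smult]:
  assumes "x \<in> carrier A" "R \<one>\<^bsub>A\<^esub>"
    and gen: "\<And>g x. \<lbrakk>g \<in> gens (idx P); x \<in> carrier A; R x\<rbrakk> \<Longrightarrow> R (W g \<otimes>\<^bsub>A\<^esub> x)"
    and add: "\<And>x y. \<lbrakk>x \<in> carrier A; y \<in> carrier A; R x; R y\<rbrakk> \<Longrightarrow> R (x \<oplus>\<^bsub>A\<^esub> y)"
    and smult: "\<And>c x. \<lbrakk>x \<in> carrier A; R x\<rbrakk> \<Longrightarrow> R (c \<odot>\<^bsub>A\<^esub> x)"
  shows "R x"
  using assms(1)
proof (induction rule: wU_word_induct)
  case (word w)
  then show ?case by (induction w) (auto intro: assms(2) gen)
qed (rule add smult; assumption)+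

lemma wU_hom_unique:
  assumes C: "kalg C" and "alg_hom A C F" "alg_hom A C G"
    and "\<And>g. g \<in> gens (idx P) \<Longrightarrow> F (W g) = G (W g)" and "x \<in> carrier A"
  shows "F x = G x"
  using assms(5)
proof (induction rule: wU_induct)
qed (use assms in \<open>simp_all add: alg_homD\<close>)

text \<open>The kernel of the evaluation of words at \<open>f\<close> is an ideal that contains the
  relators, so the evaluation descends; induction over generators gives uniqueness. Unique existence
  is what the \<open>THE\<close> in \<open>wDelta\<close>, \<open>wepsilon\<close> and
  \<open>wT\<close> calls for.\<close>

lemma wU_hom_exists:
  assumes C: "kalg C" and f: "wU_rels P C f"
  shows "\<exists>!F. F \<in> extensional (carrier A) \<and> alg_hom A C F \<and> (\<forall>g\<in>gens (idx P). F (W g) = f g)"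
proof -
  interpret C: kalg C by fact
  interpret M: wU_map C P f
    by unfold_locales (use f datum in \<open>auto simp: wU_rels_def\<close>)
  note hom = M.alg_hom_L
  define Z where "Z = {p \<in> carrier Fr. M.L p = \<zero>\<^bsub>C\<^esub>}"
  have "ideal Z Fr"
  proof -
    interpret R: ring_hom_ring Fr C M.L
      by (rule ring_hom_ringI2) (use hom in \<open>auto simp: alg_hom_def Fr.ring_axioms C.ring_axioms\<close>)
    have "a_kernel Fr C M.L = Z" by (simp only: a_kernel_def' Z_def)
    with R.kernel_is_ideal show ?thesis by simp
  qed
  moreover have "wU_relators P \<subseteq> Z"
  proof
    fix r assume r: "r \<in> wU_relators P"
    have "M.L r = \<zero>\<^bsub>C\<^esub>" using M.relators_iff f r by blast
    moreover have "r \<in> carrier Fr" using r wU_relators_carrier by blast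
    ultimately show "r \<in> Z" by (simp add: Z_def)
  qed
  ultimately have "wU_ideal P \<subseteq> Z" unfolding wU_ideal_def by (rule Fr.genideal_minimal)
  then have ker: "M.L x = \<zero>\<^bsub>C\<^esub>" if "x \<in> wU_ideal P" for x using that by (auto simp: Z_def)
  obtain F where F: "F \<in> extensional (carrier A)" "alg_hom A C F"
    "\<And>x. x \<in> carrier Fr \<Longrightarrow> F (wU_ideal P +>\<^bsub>Fr\<^esub> x) = M.L x"
  proof (rule Q.quot_lift_exists[OF C alg_homD(1)[OF hom] ker])
    fix F assume "F \<in> extensional (carrier (alg_quot Fr (wU_ideal P)))"
      "\<And>x. x \<in> carrier Fr \<Longrightarrow> F (wU_ideal P +>\<^bsub>Fr\<^esub> x) = M.L x"
      "alg_hom Fr C M.L \<Longrightarrow> alg_hom (alg_quot Fr (wU_ideal P)) C F"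
    with hom show thesis by (intro that[of F]) (simp_all only: wU_alg_def)
  qed
  have FW: "F (W g) = f g" if g: "g \<in> gens (idx P)" for g
  proof -
    have "F (W g) = M.L (wd [g] 1)"
      unfolding wgen_def by (rule F(3)) (use g in \<open>simp add: wd_carrier\<close>)
    also have "\<dots> = f g"
      using g by (subst M.L_wd) simp_all
    finally show ?thesis .
  qed
  show ?thesis
  proof (rule ex1I[of _ F])
    show "F \<in> extensional (carrier A) \<and> alg_hom A C F \<and> (\<forall>g\<in>gens (idx P). F (W g) = f g)"
      by (intro conjI ballI F FW)
    fix G assume G: "G \<in> extensional (carrier A) \<and> alg_hom A C G \<and> (\<forall>g\<in>gens (idx P). G (W g) = f g)"
    then have G: "G \<in> extensional (carrier A)" "alg_hom A C G" "\<And>g. g \<in> gens (idx P) \<Longrightarrow> G (W g) = F (W g)"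
      by (simp_all only: FW)
    show "G = F"
      by (rule extensionalityI[OF G(1) F(1)], rule wU_hom_unique[OF C G(2) F(2) G(3)])
  qed
qed

end

section \<open>Consequences of the defining relations\<close>

lemma (in kalg) qcomm_conj:
  assumes "qcomm A c k x" "x \<otimes> (k \<otimes> k') = x" "k \<in> carrier A" "k' \<in> carrier A" "x \<in> carrier A"
  shows "k \<otimes> (x \<otimes> k') = c \<odot> x"
proof -
  have "k \<otimes> (x \<otimes> k') = (k \<otimes> x) \<otimes> k'" using assms by (simp add: m_assoc)
  also have "\<dots> = c \<odot> (x \<otimes> (k \<otimes> k'))" using assms(1,3-) by (simp add: qcomm_def m_assoc)
  finally show ?thesis using assms(2) by simp
qed

text \<open>Multiplying the relation by \<open>k\<close> or \<open>k'\<close> cancels one of them up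
  to \<open>e\<close>. Thus a relation of type zero amounts to the commutation rules of type one
  together with e x = x, and both types can be treated alike; \<open>qcomm_conj\<close> is the way
  back.\<close>

lemma (in kalg) qcomm_conj_inv:
  assumes "k \<otimes> (x \<otimes> k') = c \<odot> x" "c \<noteq> 0" and kk: "k \<otimes> k' = e" "k' \<otimes> k = e"
    and ke: "e \<otimes> k = k" "k' \<otimes> e = k'"
    and [simp]: "k \<in> carrier A" "k' \<in> carrier A" "x \<in> carrier A"
  shows "e \<otimes> x = x" "x \<otimes> e = x" "qcomm A c k x" "qcomm A (inverse c) k' x"
proof -
  have e [simp]: "e \<in> carrier A" using kk(1) by auto
  have x: "x = inverse c \<odot> (k \<otimes> (x \<otimes> k'))" using assms(1,2) by simp
  have "e \<otimes> x = inverse c \<odot> ((e \<otimes> k) \<otimes> (x \<otimes> k'))"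
    by (subst x) (simp add: m_assoc)
  then show 1: "e \<otimes> x = x" unfolding ke x[symmetric] .
  have "x \<otimes> e = inverse c \<odot> (k \<otimes> (x \<otimes> (k' \<otimes> e)))"
    by (subst x) (simp add: m_assoc)
  then show 2: "x \<otimes> e = x" unfolding ke x[symmetric] .
  have "c \<odot> (x \<otimes> k) = (c \<odot> x) \<otimes> k" by simp
  also have "\<dots> = k \<otimes> (x \<otimes> (k' \<otimes> k))" unfolding assms(1)[symmetric] by (simp add: m_assoc)
  finally show "qcomm A c k x" unfolding kk 2 by (simp add: qcomm_def)
  have "c \<odot> (k' \<otimes> x) = k' \<otimes> (c \<odot> x)" by simp
  also have "\<dots> = k' \<otimes> k \<otimes> x \<otimes> k'" unfolding assms(1)[symmetric] by (simp add: m_assoc)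
  finally have "c \<odot> (k' \<otimes> x) = x \<otimes> k'" unfolding kk 1 .
  then have "inverse c \<odot> (x \<otimes> k') = inverse c \<odot> (c \<odot> (k' \<otimes> x))" by simp
  with assms(2) show "qcomm A (inverse c) k' x" by (simp add: qcomm_def)
qed

context wU_setup
begin

lemma Jexp_ge_2: "Jexp P \<ge> 2"
  and type_cases: "i \<in> idx P \<Longrightarrow> type_E P i = 0 \<or> type_E P i = 1" "i \<in> idx P \<Longrightarrow> type_F P i = 0 \<or> type_F P i = 1"
  and qi_neq: "i \<in> idx P \<Longrightarrow> qi P i \<noteq> 0" "i \<in> idx P \<Longrightarrow> qi P i - inverse (qi P i) \<noteq> 0"
proof -
  show "Jexp P \<ge> 2" "i \<in> idx P \<Longrightarrow> type_E P i = 0 \<or> type_E P i = 1"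
    "i \<in> idx P \<Longrightarrow> type_F P i = 0 \<or> type_F P i = 1" "i \<in> idx P \<Longrightarrow> qi P i \<noteq> 0"
    using datum by (auto simp: wU_datum_def)
  assume "i \<in> idx P"
  then have q: "qi P i \<noteq> 0" "qi P i \<noteq> 1" "qi P i \<noteq> - 1" using datum by (auto simp: wU_datum_def)
  show "qi P i - inverse (qi P i) \<noteq> 0"
  proof
    assume "qi P i - inverse (qi P i) = 0"
    then have "qi P i * qi P i = 1" using q(1) by (metis eq_iff_diff_eq_0 right_inverse)
    then show False using q by (simp add: square_eq_1_iff)
  qed
qed

text \<open>Both sides are the power of the ground parameter with exponent s_i a_ij = s_j a_ji. This
  is where symmetrizability is used.\<close>

lemma qi_powi_sym:
  assumes "i \<in> idx P" "j \<in> idx P"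
  shows "qi P j powi cartan P j i = qi P i powi cartan P i j"
proof -
  have *: "(qpar P ^ s) powi a = qpar P powi (int s * a)" for s a
    by (simp add: power_int_mult)
  have "int (symm P i) * cartan P i j = int (symm P j) * cartan P j i"
    using datum assms by (auto simp: wU_datum_def)
  then show ?thesis unfolding qi_def * by simp
qed

definition serre_pair :: "nat \<Rightarrow> nat \<Rightarrow> bool" where
  "serre_pair i j \<longleftrightarrow> i \<in> idx P \<and> j \<in> idx P \<and> i \<noteq> j \<and> (cartan P i i = 2 \<or> cartan P i j = 0)"

text \<open>The identity for z and t has two sources. For a_ij = 0 one has z = 1 and n = 1;
  otherwise a_ii = 2, and the exponents 2 a_ij and 2 (n - 1) = - 2 a_ij cancel.\<close>

lemma serre_pair_params:
  assumes "serre_pair i j"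
  defines "z \<equiv> qi P i powi cartan P i j" and "t \<equiv> qi P i powi cartan P i i"
    and "n \<equiv> nat (1 - cartan P i j)"
  shows "z \<noteq> 0" "t \<noteq> 0" "z\<^sup>2 * t ^ (n - 1) = 1" "n > 0" "i \<in> idx P" "j \<in> idx P" "i \<noteq> j"
proof -
  show ij: "i \<in> idx P" "j \<in> idx P" "i \<noteq> j" using assms(1) by (auto simp: serre_pair_def)
  have q: "qi P i \<noteq> 0" using qi_neq ij by blast
  then show "z \<noteq> 0" "t \<noteq> 0" by (simp_all add: z_def t_def)
  have a: "cartan P i j \<le> 0" using datum ij by (auto simp: wU_datum_def borcherds_cartan_def)
  then show "n > 0" by (simp add: n_def)
  show "z\<^sup>2 * t ^ (n - 1) = 1"
  proof (cases "cartan P i j = 0")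
    case False
    then have aii: "cartan P i i = 2" using assms(1) by (auto simp: serre_pair_def)
    have n: "int (n - 1) = - cartan P i j" using a by (simp add: n_def)
    have "z\<^sup>2 = qi P i powi (cartan P i j * 2)" unfolding z_def power_int_mult by simp
    moreover have "t ^ (n - 1) = qi P i powi (2 * int (n - 1))" unfolding t_def aii power_int_mult by simp
    ultimately show ?thesis using q unfolding n by (simp flip: power_int_add)
  qed (simp add: z_def n_def)
qed

end

definition J_idem :: "('k::field, 'c, 'z) module_scheme \<Rightarrow> 'k wU_data \<Rightarrow> (gen \<Rightarrow> 'c) \<Rightarrow> 'c" where
  "J_idem C P f = f gJ [^]\<^bsub>C\<^esub> (Jexp P - 1)"

locale wU_family = wU_setup P + kalg C for P :: "'k::field wU_data" and C :: "('k, 'c, 'z) module_scheme" (structure) +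
  fixes f :: "gen \<Rightarrow> 'c"
  assumes rels: "wU_rels P C f"
begin

abbreviation "I \<equiv> idx P"
abbreviation "e \<equiv> J_idem C P f"
abbreviation "c i \<equiv> inverse (qi P i - inverse (qi P i))"

lemma fc [simp]: "g \<in> gens I \<Longrightarrow> f g \<in> carrier C"
  using rels by (auto simp: wU_rels_def)

lemma e_closed [simp]: "e \<in> carrier C" by (simp add: J_idem_def)

lemma toral_commute: "\<lbrakk>x \<in> {gJ} \<union> toral_gens I; y \<in> {gJ} \<union> toral_gens I\<rbrakk> \<Longrightarrow> f x \<otimes> f y = f y \<otimes> f x"
  using rels unfolding wU_rels_def J_rels_def Let_def by blast

lemma toral_e: "x \<in> toral_gens I \<Longrightarrow> f x \<otimes> e = f x"
  using rels unfolding wU_rels_def J_rels_def Let_def J_idem_def by blast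

lemma KKb: "i \<in> I \<Longrightarrow> f (gK i) \<otimes> f (gKb i) = e" and DDb: "i \<in> I \<Longrightarrow> f (gD i) \<otimes> f (gDb i) = e"
  using rels unfolding wU_rels_def J_rels_def Let_def J_idem_def by blast+

lemma J_pow: "f gJ [^] Jexp P = f gJ"
  using rels unfolding wU_rels_def J_rels_def Let_def by blast

lemma KbK: "i \<in> I \<Longrightarrow> f (gKb i) \<otimes> f (gK i) = e" and DbD: "i \<in> I \<Longrightarrow> f (gDb i) \<otimes> f (gD i) = e"
  using KKb DDb toral_commute[of "gKb i" "gK i"] toral_commute[of "gDb i" "gD i"] by simp_all

lemma e_J: "e \<otimes> f gJ = f gJ" and J_e: "f gJ \<otimes> e = f gJ"
proof -
  have m: "Jexp P = Suc (Jexp P - 1)" using Jexp_ge_2 by simp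
  have p: "f gJ [^] Suc (Jexp P - 1) = f gJ" using J_pow m by (simp only:)
  show "e \<otimes> f gJ = f gJ" using p by (simp only: J_idem_def nat_pow_Suc)
  show "f gJ \<otimes> e = f gJ" using p by (simp only: J_idem_def nat_pow_Suc2 fc gensI)
qed

text \<open>As m \<ge> 2, the element \<open>e\<close> has J as a left factor, and multiplication by
  \<open>e\<close> fixes J.\<close>

lemma e_idem: "e \<otimes> e = e"
proof -
  obtain k where k: "Jexp P - 1 = Suc k" using Jexp_ge_2 by (metis Suc_diff_le add_2_eq_Suc diff_Suc_1 le_Suc_ex numeral_2_eq_2)
  have e: "e = f gJ \<otimes> f gJ [^] k" unfolding J_idem_def k by (simp only: nat_pow_Suc2 fc gensI)
  have "e \<otimes> (f gJ \<otimes> f gJ [^] k) = (e \<otimes> f gJ) \<otimes> f gJ [^] k" by (simp add: m_assoc)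
  also have "\<dots> = f gJ \<otimes> f gJ [^] k" unfolding e_J ..
  finally show ?thesis unfolding e[symmetric] .
qed

lemma e_toral: "x \<in> toral_gens I \<Longrightarrow> e \<otimes> f x = f x"
proof -
  assume x: "x \<in> toral_gens I"
  have "f gJ \<otimes> f x = f x \<otimes> f gJ" using toral_commute x by blast
  then have "qcomm C 1 e (f x)"
    using qcomm_pow_l[of 1 "f gJ" "f x" "Jexp P - 1"] x by (simp add: qcomm_def J_idem_def)
  then show ?thesis using toral_e[OF x] x by (simp add: qcomm_def)
qed

text \<open>For type one these are defining relations; for type zero \<open>qcomm_conj_inv\<close>
  provides them, together with the information that \<open>e\<close> fixes the generator. The
  commutation rules are thereby independent of the type.\<close>

lemma K_E_all:
  assumes i: "i \<in> I" and j: "j \<in> I"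
  shows K_E: "qcomm C (qi P i powi cartan P i j) (f (gK j)) (f (gE i))"
    and Kb_E: "qcomm C (inverse (qi P i powi cartan P i j)) (f (gKb j)) (f (gE i))"
    and e_E0: "type_E P i = 0 \<Longrightarrow> e \<otimes> f (gE i) = f (gE i)"
    and K_F: "qcomm C (inverse (qi P i powi cartan P i j)) (f (gK j)) (f (gF i))"
    and Kb_F: "qcomm C (qi P i powi cartan P i j) (f (gKb j)) (f (gF i))"
    and e_F0: "type_F P i = 0 \<Longrightarrow> e \<otimes> f (gF i) = f (gF i)"
proof -
  let ?c = "qi P i powi cartan P i j"
  have c0: "?c \<noteq> 0" "inverse ?c \<noteq> 0" using qi_neq i by simp_all
  note R = rels[unfolded wU_rels_def type_rels_def Let_def power_int_minus, THEN conjunct2, THEN conjunct2,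
      THEN conjunct1, rule_format, OF i j]
  note ke = KKb[OF j] KbK[OF j] e_toral[of "gK j"] toral_e[of "gKb j"]
  have E0: "e \<otimes> f (gE i) = f (gE i) \<and> qcomm C ?c (f (gK j)) (f (gE i)) \<and> qcomm C (inverse ?c) (f (gKb j)) (f (gE i))"
    if "type_E P i = 0"
    using qcomm_conj_inv[OF _ c0(1) ke, of "f (gE i)"] R that i j by simp
  have F0: "e \<otimes> f (gF i) = f (gF i) \<and> qcomm C (inverse ?c) (f (gK j)) (f (gF i)) \<and> qcomm C ?c (f (gKb j)) (f (gF i))"
    if "type_F P i = 0"
    using qcomm_conj_inv[OF _ c0(2) ke, of "f (gF i)"] R that i j by simp
  have E1: "qcomm C ?c (f (gK j)) (f (gE i)) \<and> qcomm C (inverse ?c) (f (gKb j)) (f (gE i))"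
    if "type_E P i = 1" using R that by simp
  have F1: "qcomm C (inverse ?c) (f (gK j)) (f (gF i)) \<and> qcomm C ?c (f (gKb j)) (f (gF i))"
    if "type_F P i = 1" using R that by simp
  show "qcomm C ?c (f (gK j)) (f (gE i))"
    "qcomm C (inverse ?c) (f (gKb j)) (f (gE i))"
    "type_E P i = 0 \<Longrightarrow> e \<otimes> f (gE i) = f (gE i)"
    "qcomm C (inverse ?c) (f (gK j)) (f (gF i))"
    "qcomm C ?c (f (gKb j)) (f (gF i))"
    "type_F P i = 0 \<Longrightarrow> e \<otimes> f (gF i) = f (gF i)"
    using E0 E1 F0 F1 type_cases[OF i] by auto
qed

text \<open>The idempotent is the product of K_i and its partner, which pass the generator with
  inverse weights.\<close>

lemma e_E: "i \<in> I \<Longrightarrow> e \<otimes> f (gE i) = f (gE i) \<otimes> e" and e_F: "i \<in> I \<Longrightarrow> e \<otimes> f (gF i) = f (gF i) \<otimes> e"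
proof -
  assume i: "i \<in> I"
  have q: "qi P i powi cartan P i i \<noteq> 0" using qi_neq i by simp
  show "e \<otimes> f (gE i) = f (gE i) \<otimes> e" "e \<otimes> f (gF i) = f (gF i) \<otimes> e"
    using qcomm_mult_l[OF K_E[OF i i] Kb_E[OF i i]] qcomm_mult_l[OF K_F[OF i i] Kb_F[OF i i]] q i
    by (simp_all add: KKb qcomm_def)
qed

lemma e_commute_gen: "g \<in> gens I \<Longrightarrow> e \<otimes> f g = f g \<otimes> e"
  using e_E e_F e_J J_e e_toral toral_e by (auto simp: gens_def)

lemma EF:
  assumes "i \<in> I" "j \<in> I"
  shows "f (gE i) \<otimes> f (gF j) = f (gF j) \<otimes> f (gE i) \<oplus> (if i = j then c i \<odot> (f (gK i) \<ominus> f (gKb i)) else \<zero>)"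
proof -
  have "f (gE i) \<otimes> f (gF j) \<ominus> f (gF j) \<otimes> f (gE i) = (if i = j then c i \<odot> (f (gK i) \<ominus> f (gKb i)) else \<zero>)"
    using rels assms unfolding wU_rels_def EF_rels_def by blast
  moreover
  have "x = y \<oplus> (x \<ominus> y)" if "x \<in> carrier C" "y \<in> carrier C" for x y
    using that by (simp add: minus_eq a_lcomm r_neg)
  from this[of "f (gE i) \<otimes> f (gF j)" "f (gF j) \<otimes> f (gE i)"] assms
  have "f (gE i) \<otimes> f (gF j) = f (gF j) \<otimes> f (gE i) \<oplus> (f (gE i) \<otimes> f (gF j) \<ominus> f (gF j) \<otimes> f (gE i))"
    by simp
  ultimately show ?thesis by (simp only:)
qed

lemma serre:
  assumes "X \<in> {gE, gF}" "serre_pair i j"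
  shows "skew C (f (X i)) (f (X j)) (\<lambda>k. qi P i powi cartan P i j * (qi P i powi cartan P i i) ^ k)
       (nat (1 - cartan P i j)) = \<zero>"
  using rels assms unfolding wU_rels_def serre_rels_def serre_pair_def by blast

end

context wU_setup
begin

sublocale F: wU_family P A W
  by unfold_locales (rule wU_rels_W)

abbreviation "e \<equiv> J_idem A P W"

lemma e_central: "x \<in> carrier A \<Longrightarrow> e \<otimes>\<^bsub>A\<^esub> x = x \<otimes>\<^bsub>A\<^esub> e"
proof (induction rule: wU_induct)
  case (gen g x)
  have "e \<otimes>\<^bsub>A\<^esub> (W g \<otimes>\<^bsub>A\<^esub> x) = (e \<otimes>\<^bsub>A\<^esub> W g) \<otimes>\<^bsub>A\<^esub> x" using gen by (simp add: A.m_assoc)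
  also have "\<dots> = W g \<otimes>\<^bsub>A\<^esub> (e \<otimes>\<^bsub>A\<^esub> x)" using gen by (simp add: F.e_commute_gen A.m_assoc)
  finally show ?case using gen by (simp add: A.m_assoc)
qed (simp_all add: A.l_distr A.r_distr)

abbreviation "uE i \<equiv> type_unit P (type_E P i)"
abbreviation "uF i \<equiv> type_unit P (type_F P i)"

lemma type_unit_cases: "type_unit P k = \<one>\<^bsub>A\<^esub> \<or> type_unit P k = e"
  by (simp add: type_unit_def J_idem_def)

lemma type_unit_closed [simp]: "type_unit P k \<in> carrier A"
  using type_unit_cases[of k] by auto

lemma type_unit_central: "x \<in> carrier A \<Longrightarrow> type_unit P k \<otimes>\<^bsub>A\<^esub> x = x \<otimes>\<^bsub>A\<^esub> type_unit P k"
  using type_unit_cases[of k] e_central by auto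

lemma type_unit_toral: "x \<in> toral_gens (idx P) \<Longrightarrow> type_unit P k \<otimes>\<^bsub>A\<^esub> W x = W x"
  "x \<in> toral_gens (idx P) \<Longrightarrow> W x \<otimes>\<^bsub>A\<^esub> type_unit P k = W x"
  using type_unit_cases[of k] F.e_toral F.toral_e by auto

lemma type_unit_e: "type_unit P k \<otimes>\<^bsub>A\<^esub> e = e"
  using type_unit_cases[of k] F.e_idem by auto

lemma type_unit_E: "i \<in> idx P \<Longrightarrow> uE i \<otimes>\<^bsub>A\<^esub> W (gE i) = W (gE i)"
  and type_unit_F: "i \<in> idx P \<Longrightarrow> uF i \<otimes>\<^bsub>A\<^esub> W (gF i) = W (gF i)"
  using type_cases[of i] F.e_E0[of i i] F.e_F0[of i i] by (auto simp: type_unit_def J_idem_def)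

section \<open>Comultiplication and counit\<close>

sublocale AA: kalg2 A A ..

abbreviation "T2 \<equiv> tensor A A"
abbreviation "pt2 \<equiv> pure_tensor A A"

lemma qcomm_pt:
  assumes "qcomm A c b a" "qcomm A d b' a'" "a \<in> carrier A" "b \<in> carrier A" "a' \<in> carrier A" "b' \<in> carrier A"
  shows "qcomm T2 (c * d) (pt2 b b') (pt2 a a')"
  using assms by (simp add: qcomm_def AA.pt_smult_l AA.pt_smult_r mult.commute)

lemma qcomm_type_unit: "x \<in> carrier A \<Longrightarrow> qcomm A 1 x (type_unit P k)"
  "x \<in> carrier A \<Longrightarrow> qcomm A 1 (type_unit P k) x"
  by (simp_all add: qcomm_def type_unit_central)

lemma qcomm_toral: "\<lbrakk>x \<in> toral_gens (idx P); y \<in> toral_gens (idx P)\<rbrakk> \<Longrightarrow> qcomm A 1 (W x) (W y)"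
  using F.toral_commute[of x y] by (simp add: qcomm_def)

lemma Delta_gen_EF:
  "Delta_gen P (gE i) = pt2 (uE i) (W (gE i)) \<oplus>\<^bsub>T2\<^esub> pt2 (W (gE i)) (W (gK i))"
  "Delta_gen P (gF i) = pt2 (W (gF i)) (uF i) \<oplus>\<^bsub>T2\<^esub> pt2 (W (gKb i)) (W (gF i))"
  by (simp_all add: Let_def)

lemma Delta_gen_grouplike: "x \<in> {gJ} \<union> toral_gens (idx P) \<Longrightarrow> Delta_gen P x = pt2 (W x) (W x)"
  by (auto simp: toral_gens_def)

lemma Delta_gen_closed: "g \<in> gens (idx P) \<Longrightarrow> Delta_gen P g \<in> carrier T2"
  by (auto simp: gens_def Delta_gen_EF Delta_gen_grouplike simp del: Delta_gen.simps)

lemma Delta_J_rels: "J_rels P T2 (Delta_gen P)"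
proof -
  have [simp]: "Delta_gen P gJ = pt2 (W gJ) (W gJ)" by simp
  note [simp del] = Delta_gen.simps
  have pow: "Delta_gen P gJ [^]\<^bsub>T2\<^esub> (n::nat) = pt2 (W gJ [^]\<^bsub>A\<^esub> n) (W gJ [^]\<^bsub>A\<^esub> n)" for n
    by (simp add: AA.pt_pow)
  have powe: "Delta_gen P gJ [^]\<^bsub>T2\<^esub> (Jexp P - 1) = pt2 e e"
    unfolding pow J_idem_def ..
  show ?thesis
    unfolding J_rels_def Let_def
  proof (intro conjI ballI)
    show "Delta_gen P gJ [^]\<^bsub>T2\<^esub> Jexp P = Delta_gen P gJ"
      unfolding pow F.J_pow by simp
    fix i assume i: "i \<in> idx P"
    show "Delta_gen P (gK i) \<otimes>\<^bsub>T2\<^esub> Delta_gen P (gKb i) = Delta_gen P gJ [^]\<^bsub>T2\<^esub> (Jexp P - 1)"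
      "Delta_gen P (gD i) \<otimes>\<^bsub>T2\<^esub> Delta_gen P (gDb i) = Delta_gen P gJ [^]\<^bsub>T2\<^esub> (Jexp P - 1)"
      unfolding powe using i by (simp_all add: Delta_gen_grouplike F.KKb F.DDb)
  next
    fix x y assume xy: "x \<in> {gJ} \<union> toral_gens (idx P)" "y \<in> {gJ} \<union> toral_gens (idx P)"
    then have "x \<in> gens (idx P)" "y \<in> gens (idx P)" by auto
    then show "Delta_gen P x \<otimes>\<^bsub>T2\<^esub> Delta_gen P y = Delta_gen P y \<otimes>\<^bsub>T2\<^esub> Delta_gen P x"
      using F.toral_commute[OF xy] unfolding Delta_gen_grouplike[OF xy(1)] Delta_gen_grouplike[OF xy(2)] by simp
  next
    fix x assume "x \<in> toral_gens (idx P)"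
    then show "Delta_gen P x \<otimes>\<^bsub>T2\<^esub> Delta_gen P gJ [^]\<^bsub>T2\<^esub> (Jexp P - 1) = Delta_gen P x"
      unfolding powe by (simp add: Delta_gen_grouplike F.toral_e)
  qed
qed

text \<open>Each summand of the coproduct of E_i contains E_i in one tensor factor and a central or
  toral element in the other, so the weight is unchanged. For type zero the conjugation form is
  recovered by \<open>qcomm_conj\<close>, since \<open>pt2 e e\<close> fixes the coproduct.\<close>

lemma Delta_type_rels: "type_rels P T2 (Delta_gen P)"
proof -
  note [simp del] = Delta_gen.simps
  show ?thesis
    unfolding type_rels_def Let_def
  proof (intro ballI)
    fix i j assume i: "i \<in> idx P" and j: "j \<in> idx P"
    let ?c = "qi P i powi cartan P i j"
    have m: "qi P i powi - cartan P i j = inverse ?c" by (simp add: power_int_minus)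
    have E: "qcomm T2 d (Delta_gen P x) (Delta_gen P (gE i))"
      if "qcomm A d (W x) (W (gE i))" "x \<in> toral_gens (idx P)" for d x
    proof -
      have "qcomm T2 d (pt2 (W x) (W x)) (pt2 (uE i) (W (gE i)))"
        using qcomm_pt[OF qcomm_type_unit(1) that(1), of "W x"] that i by simp
      moreover have "qcomm T2 d (pt2 (W x) (W x)) (pt2 (W (gE i)) (W (gK i)))"
        using qcomm_pt[OF that(1) qcomm_toral[of x "gK i"]] that i by simp
      ultimately show ?thesis
        using that i by (simp add: Delta_gen_EF Delta_gen_grouplike AA.T.qcomm_add_r)
    qed
    have F: "qcomm T2 d (Delta_gen P x) (Delta_gen P (gF i))"
      if "qcomm A d (W x) (W (gF i))" "x \<in> toral_gens (idx P)" for d x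
    proof -
      have "qcomm T2 d (pt2 (W x) (W x)) (pt2 (W (gF i)) (uF i))"
        using qcomm_pt[OF that(1) qcomm_type_unit(1), of "W x"] that i by simp
      moreover have "qcomm T2 d (pt2 (W x) (W x)) (pt2 (W (gKb i)) (W (gF i)))"
        using qcomm_pt[OF qcomm_toral[of x "gKb i"] that(1)] that i by simp
      ultimately show ?thesis
        using that i by (simp add: Delta_gen_EF Delta_gen_grouplike AA.T.qcomm_add_r)
    qed
    note q = E[OF F.K_E[OF i j]] E[OF F.Kb_E[OF i j]] F[OF F.K_F[OF i j]] F[OF F.Kb_F[OF i j]]
    have KKb: "Delta_gen P (gK j) \<otimes>\<^bsub>T2\<^esub> Delta_gen P (gKb j) = pt2 e e"
      using j by (simp add: Delta_gen_grouplike F.KKb)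
    have E0: "Delta_gen P (gE i) \<otimes>\<^bsub>T2\<^esub> pt2 e e = Delta_gen P (gE i)" if t: "type_E P i = 0"
    proof -
      have "uE i = e" using t by (simp add: type_unit_def J_idem_def)
      then show ?thesis
        using i F.e_E0[OF i i t] by (simp add: Delta_gen_EF AA.T.l_distr F.e_idem F.e_toral e_central[symmetric])
    qed
    have F0: "Delta_gen P (gF i) \<otimes>\<^bsub>T2\<^esub> pt2 e e = Delta_gen P (gF i)" if t: "type_F P i = 0"
    proof -
      have "uF i = e" using t by (simp add: type_unit_def J_idem_def)
      then show ?thesis
        using i F.e_F0[OF i i t] by (simp add: Delta_gen_EF AA.T.l_distr F.e_idem F.e_toral e_central[symmetric])
    qed
    show "(type_E P i = 1 \<longrightarrow> qcomm T2 ?c (Delta_gen P (gK j)) (Delta_gen P (gE i)) \<and>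
          qcomm T2 (qi P i powi - cartan P i j) (Delta_gen P (gKb j)) (Delta_gen P (gE i))) \<and>
       (type_E P i = 0 \<longrightarrow> Delta_gen P (gK j) \<otimes>\<^bsub>T2\<^esub> (Delta_gen P (gE i) \<otimes>\<^bsub>T2\<^esub> Delta_gen P (gKb j)) =
          ?c \<odot>\<^bsub>T2\<^esub> Delta_gen P (gE i)) \<and>
       (type_F P i = 1 \<longrightarrow> qcomm T2 (qi P i powi - cartan P i j) (Delta_gen P (gK j)) (Delta_gen P (gF i)) \<and>
          qcomm T2 ?c (Delta_gen P (gKb j)) (Delta_gen P (gF i))) \<and>
       (type_F P i = 0 \<longrightarrow> Delta_gen P (gK j) \<otimes>\<^bsub>T2\<^esub> (Delta_gen P (gF i) \<otimes>\<^bsub>T2\<^esub> Delta_gen P (gKb j)) =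
          (qi P i powi - cartan P i j) \<odot>\<^bsub>T2\<^esub> Delta_gen P (gF i))"
      unfolding m
    proof (intro conjI impI)
      assume "type_E P i = 0"
      then show "Delta_gen P (gK j) \<otimes>\<^bsub>T2\<^esub> (Delta_gen P (gE i) \<otimes>\<^bsub>T2\<^esub> Delta_gen P (gKb j)) =
          ?c \<odot>\<^bsub>T2\<^esub> Delta_gen P (gE i)"
        using i j by (intro AA.T.qcomm_conj q) (simp_all add: KKb E0 Delta_gen_closed)
    next
      assume "type_F P i = 0"
      then show "Delta_gen P (gK j) \<otimes>\<^bsub>T2\<^esub> (Delta_gen P (gF i) \<otimes>\<^bsub>T2\<^esub> Delta_gen P (gKb j)) =
          inverse ?c \<odot>\<^bsub>T2\<^esub> Delta_gen P (gF i)"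
        using i j by (intro AA.T.qcomm_conj q) (simp_all add: KKb F0 Delta_gen_closed)
    qed (use j in \<open>auto intro: q\<close>)
  qed
qed

text \<open>Of the four products in the expansion, two produce the commutator of E_i and F_j inside
  one tensor factor and one is symmetric because the units are central. In the last one,
  \<open>p4\<close>, the reorderings in the two factors cost the same scalar by
  symmetrizability.\<close>

lemma Delta_EF_rels: "EF_rels P T2 (Delta_gen P)"
  unfolding EF_rels_def
proof (intro ballI)
  note [simp del] = Delta_gen.simps
  fix i j assume i: "i \<in> idx P" and j: "j \<in> idx P"
  let ?E = "W (gE i)" and ?F = "W (gF j)" and ?K = "W (gK i)" and ?Kb = "W (gKb j)"
  let ?c = "inverse (qi P i - inverse (qi P i))"
  define d where "d = (if i = j then ?c \<odot>\<^bsub>A\<^esub> (W (gK i) \<ominus>\<^bsub>A\<^esub> W (gKb i)) else \<zero>\<^bsub>A\<^esub>)"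
  have [simp]: "d \<in> carrier A" "?E \<in> carrier A" "?F \<in> carrier A" "?K \<in> carrier A" "?Kb \<in> carrier A"
    using i j by (simp_all add: d_def)
  have EF: "?E \<otimes>\<^bsub>A\<^esub> ?F = ?F \<otimes>\<^bsub>A\<^esub> ?E \<oplus>\<^bsub>A\<^esub> d" using F.EF[OF i j] by (simp add: d_def)
  let ?p1 = "pt2 (?F \<otimes>\<^bsub>A\<^esub> uE i) (uF j \<otimes>\<^bsub>A\<^esub> ?E)" and ?p2 = "pt2 ?Kb (?F \<otimes>\<^bsub>A\<^esub> ?E)"
    and ?p3 = "pt2 (?F \<otimes>\<^bsub>A\<^esub> ?E) ?K" and ?p4 = "pt2 (?Kb \<otimes>\<^bsub>A\<^esub> ?E) (?F \<otimes>\<^bsub>A\<^esub> ?K)"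
    and ?d1 = "pt2 ?Kb d" and ?d2 = "pt2 d ?K"
  have p4: "pt2 (?E \<otimes>\<^bsub>A\<^esub> ?Kb) (?K \<otimes>\<^bsub>A\<^esub> ?F) = ?p4"
  proof -
    have 1: "?Kb \<otimes>\<^bsub>A\<^esub> ?E = inverse (qi P i powi cartan P i j) \<odot>\<^bsub>A\<^esub> (?E \<otimes>\<^bsub>A\<^esub> ?Kb)"
      using F.Kb_E[OF i j] by (simp add: qcomm_def)
    have 2: "?K \<otimes>\<^bsub>A\<^esub> ?F = inverse (qi P i powi cartan P i j) \<odot>\<^bsub>A\<^esub> (?F \<otimes>\<^bsub>A\<^esub> ?K)"
      using F.K_F[OF j i] qi_powi_sym[OF i j] by (simp add: qcomm_def)
    show ?thesis unfolding 1 2 by (simp add: AA.pt_smult_l AA.pt_smult_r)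
  qed
  have "Delta_gen P (gE i) \<otimes>\<^bsub>T2\<^esub> Delta_gen P (gF j) =
      ?p1 \<oplus>\<^bsub>T2\<^esub> (?p3 \<oplus>\<^bsub>T2\<^esub> ?d2) \<oplus>\<^bsub>T2\<^esub> ((?p2 \<oplus>\<^bsub>T2\<^esub> ?d1) \<oplus>\<^bsub>T2\<^esub> ?p4)"
  proof -
    have "pt2 (uE i) ?E \<otimes>\<^bsub>T2\<^esub> pt2 ?F (uF j) = ?p1"
      using type_unit_central[of ?F "type_E P i"] type_unit_central[of ?E "type_F P j"] by simp
    moreover have "pt2 ?E ?K \<otimes>\<^bsub>T2\<^esub> pt2 ?F (uF j) = ?p3 \<oplus>\<^bsub>T2\<^esub> ?d2"
      using i by (simp add: EF AA.pt_add_l type_unit_toral)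
    moreover have "pt2 (uE i) ?E \<otimes>\<^bsub>T2\<^esub> pt2 ?Kb ?F = ?p2 \<oplus>\<^bsub>T2\<^esub> ?d1"
      using j by (simp add: EF AA.pt_add_r type_unit_toral)
    moreover have "pt2 ?E ?K \<otimes>\<^bsub>T2\<^esub> pt2 ?Kb ?F = ?p4" using p4 by simp
    ultimately show ?thesis
      unfolding Delta_gen_EF by (simp add: AA.T.l_distr AA.T.r_distr del: AA.pt_mult)
  qed
  moreover have "Delta_gen P (gF j) \<otimes>\<^bsub>T2\<^esub> Delta_gen P (gE i) = ?p1 \<oplus>\<^bsub>T2\<^esub> ?p3 \<oplus>\<^bsub>T2\<^esub> (?p2 \<oplus>\<^bsub>T2\<^esub> ?p4)"
    unfolding Delta_gen_EF using i j by (simp add: AA.T.l_distr AA.T.r_distr type_unit_toral AA.T.a_ac)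
  moreover have "p1 \<oplus>\<^bsub>T2\<^esub> (p3 \<oplus>\<^bsub>T2\<^esub> d2) \<oplus>\<^bsub>T2\<^esub> ((p2 \<oplus>\<^bsub>T2\<^esub> d1) \<oplus>\<^bsub>T2\<^esub> p4) \<ominus>\<^bsub>T2\<^esub> (p1 \<oplus>\<^bsub>T2\<^esub> p3 \<oplus>\<^bsub>T2\<^esub> (p2 \<oplus>\<^bsub>T2\<^esub> p4)) =
      d1 \<oplus>\<^bsub>T2\<^esub> d2"
    if "p1 \<in> carrier T2" "p2 \<in> carrier T2" "p3 \<in> carrier T2" "p4 \<in> carrier T2" "d1 \<in> carrier T2" "d2 \<in> carrier T2"
    for p1 p2 p3 p4 d1 d2
  proof -
    have "p1 \<oplus>\<^bsub>T2\<^esub> (p3 \<oplus>\<^bsub>T2\<^esub> d2) \<oplus>\<^bsub>T2\<^esub> ((p2 \<oplus>\<^bsub>T2\<^esub> d1) \<oplus>\<^bsub>T2\<^esub> p4) =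
        (d1 \<oplus>\<^bsub>T2\<^esub> d2) \<oplus>\<^bsub>T2\<^esub> (p1 \<oplus>\<^bsub>T2\<^esub> p3 \<oplus>\<^bsub>T2\<^esub> (p2 \<oplus>\<^bsub>T2\<^esub> p4))"
      using that by (simp add: AA.T.a_ac)
    then show ?thesis using that by (simp only: AA.T.minus_eq AA.T.a_assoc AA.T.a_closed AA.T.a_inv_closed AA.T.r_neg AA.T.r_zero)
  qed
  ultimately have "Delta_gen P (gE i) \<otimes>\<^bsub>T2\<^esub> Delta_gen P (gF j) \<ominus>\<^bsub>T2\<^esub> Delta_gen P (gF j) \<otimes>\<^bsub>T2\<^esub> Delta_gen P (gE i) =
      ?d1 \<oplus>\<^bsub>T2\<^esub> ?d2" by simp
  also have "\<dots> = (if i = j then ?c \<odot>\<^bsub>T2\<^esub> (Delta_gen P (gK i) \<ominus>\<^bsub>T2\<^esub> Delta_gen P (gKb i)) else \<zero>\<^bsub>T2\<^esub>)"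
  proof (cases "i = j")
    case True
    \<comment> \<open>The sum of K-bar \<otimes> (K - K-bar) and (K - K-bar) \<otimes> K telescopes:
      the mixed term K-bar \<otimes> K cancels.\<close>
    let ?k = "pt2 ?K ?K" and ?l = "pt2 ?Kb ?Kb" and ?m = "pt2 ?Kb ?K"
    have cl: "?k \<in> carrier T2" "?l \<in> carrier T2" "?m \<in> carrier T2" by simp_all
    have "?d1 = ?c \<odot>\<^bsub>T2\<^esub> ?m \<oplus>\<^bsub>T2\<^esub> (- ?c) \<odot>\<^bsub>T2\<^esub> ?l" "?d2 = ?c \<odot>\<^bsub>T2\<^esub> ?k \<oplus>\<^bsub>T2\<^esub> (- ?c) \<odot>\<^bsub>T2\<^esub> ?m"
      using True j by (simp_all add: d_def A.minus_smult A.smult_r_distr AA.pt_add_l AA.pt_add_r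
          AA.pt_smult_l AA.pt_smult_r)
    then have "?d1 \<oplus>\<^bsub>T2\<^esub> ?d2 = (?c \<odot>\<^bsub>T2\<^esub> ?m \<oplus>\<^bsub>T2\<^esub> (- ?c) \<odot>\<^bsub>T2\<^esub> ?l) \<oplus>\<^bsub>T2\<^esub> ((- ?c) \<odot>\<^bsub>T2\<^esub> ?m \<oplus>\<^bsub>T2\<^esub> ?c \<odot>\<^bsub>T2\<^esub> ?k)"
      by (simp only: AA.T.a_comm[of "?c \<odot>\<^bsub>T2\<^esub> ?k"] AA.T.smult_closed cl)
    also have "\<dots> = (?c \<odot>\<^bsub>T2\<^esub> ?m \<oplus>\<^bsub>T2\<^esub> (- ?c) \<odot>\<^bsub>T2\<^esub> ?m) \<oplus>\<^bsub>T2\<^esub> (?c \<odot>\<^bsub>T2\<^esub> ?k \<oplus>\<^bsub>T2\<^esub> (- ?c) \<odot>\<^bsub>T2\<^esub> ?l)"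
      by (simp only: AA.T.a_assoc AA.T.a_lcomm AA.T.a_comm AA.T.smult_closed cl AA.T.a_closed)
    also have "\<dots> = ?c \<odot>\<^bsub>T2\<^esub> (?k \<ominus>\<^bsub>T2\<^esub> ?l)"
      by (simp add: AA.T.minus_smult AA.T.smult_r_distr flip: AA.T.smult_l_distr)
    finally show ?thesis using True j by (simp add: Delta_gen_grouplike)
  qed (simp add: d_def)
  finally show "Delta_gen P (gE i) \<otimes>\<^bsub>T2\<^esub> Delta_gen P (gF j) \<ominus>\<^bsub>T2\<^esub> Delta_gen P (gF j) \<otimes>\<^bsub>T2\<^esub> Delta_gen P (gE i) =
       (if i = j then ?c \<odot>\<^bsub>T2\<^esub> (Delta_gen P (gK i) \<ominus>\<^bsub>T2\<^esub> Delta_gen P (gKb i)) else \<zero>\<^bsub>T2\<^esub>)" .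
qed

text \<open>The two summands of a coproduct meet the hypotheses of \<open>skew_add\<close>, because
  K_i passes E_j, and its partner passes F_j, with weight z or t, while the units are central. Each
  of the two remaining iterated commutators has a Serre element of the algebra as a tensor
  factor.\<close>

lemma Delta_serre_rels: "serre_rels P T2 (Delta_gen P)"
  unfolding serre_rels_def serre_pair_def[symmetric]
proof (intro ballI impI)
  note [simp del] = Delta_gen.simps
  fix X i j assume X: "X \<in> {gE, gF}" and ij: "i \<in> idx P" "j \<in> idx P" "i \<noteq> j \<and> (cartan P i i = 2 \<or> cartan P i j = 0)"
  then have sp: "serre_pair i j" by (simp add: serre_pair_def)
  note par = serre_pair_params[OF sp]
  let ?z = "qi P i powi cartan P i j" and ?t = "qi P i powi cartan P i i" and ?n = "nat (1 - cartan P i j)"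
  note S = F.serre[OF X sp]
  have z: "qi P j powi cartan P j i = ?z" using qi_powi_sym ij by simp
  consider "X = gE" | "X = gF" using X by blast
  then show "skew T2 (Delta_gen P (X i)) (Delta_gen P (X j)) (\<lambda>k. ?z * ?t ^ k) ?n = \<zero>\<^bsub>T2\<^esub>"
  proof cases
    case 1
    have "skew T2 (pt2 (uE i) (W (gE i)) \<oplus>\<^bsub>T2\<^esub> pt2 (W (gE i)) (W (gK i)))
        (pt2 (uE j) (W (gE j)) \<oplus>\<^bsub>T2\<^esub> pt2 (W (gE j)) (W (gK j))) (\<lambda>k. ?z * ?t ^ k) ?n =
      skew T2 (pt2 (uE i) (W (gE i))) (pt2 (uE j) (W (gE j))) (\<lambda>k. ?z * ?t ^ k) ?n \<oplus>\<^bsub>T2\<^esub>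
      skew T2 (pt2 (W (gE i)) (W (gK i))) (pt2 (W (gE j)) (W (gK j))) (\<lambda>k. ?z * ?t ^ k) ?n"
    proof (rule AA.T.skew_add)
      show "qcomm T2 ?t (pt2 (W (gE i)) (W (gK i))) (pt2 (uE i) (W (gE i)))"
        using qcomm_pt[OF qcomm_type_unit(1) F.K_E[of i i]] ij by simp
      show "qcomm T2 ?z (pt2 (W (gE i)) (W (gK i))) (pt2 (uE j) (W (gE j)))"
        using qcomm_pt[OF qcomm_type_unit(1) F.K_E[of j i]] ij z by simp
      show "qcomm T2 ?z (pt2 (W (gE j)) (W (gK j))) (pt2 (uE i) (W (gE i)))"
        using qcomm_pt[OF qcomm_type_unit(1) F.K_E[of i j]] ij z by simp
    qed (use ij par in simp_all)
    also have "\<dots> = \<zero>\<^bsub>T2\<^esub>"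
    proof -
      have "W (gK i) \<otimes>\<^bsub>A\<^esub> W (gK j) = W (gK j) \<otimes>\<^bsub>A\<^esub> W (gK i)"
        using F.toral_commute[of "gK i" "gK j"] ij by simp
      from AA.pure_skew[OF _ _ _ _ this] AA.skew_pure[OF _ _ _ _ type_unit_central] show ?thesis
        using ij by (simp add: S[unfolded 1])
    qed
    finally show ?thesis unfolding 1 Delta_gen_EF .
  next
    case 2
    have "skew T2 (pt2 (W (gF i)) (uF i) \<oplus>\<^bsub>T2\<^esub> pt2 (W (gKb i)) (W (gF i)))
        (pt2 (W (gF j)) (uF j) \<oplus>\<^bsub>T2\<^esub> pt2 (W (gKb j)) (W (gF j))) (\<lambda>k. ?z * ?t ^ k) ?n =
      skew T2 (pt2 (W (gF i)) (uF i)) (pt2 (W (gF j)) (uF j)) (\<lambda>k. ?z * ?t ^ k) ?n \<oplus>\<^bsub>T2\<^esub>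
      skew T2 (pt2 (W (gKb i)) (W (gF i))) (pt2 (W (gKb j)) (W (gF j))) (\<lambda>k. ?z * ?t ^ k) ?n"
    proof (rule AA.T.skew_add)
      show "qcomm T2 ?t (pt2 (W (gKb i)) (W (gF i))) (pt2 (W (gF i)) (uF i))"
        using qcomm_pt[OF F.Kb_F[of i i] qcomm_type_unit(1)] ij by simp
      show "qcomm T2 ?z (pt2 (W (gKb i)) (W (gF i))) (pt2 (W (gF j)) (uF j))"
        using qcomm_pt[OF F.Kb_F[of j i] qcomm_type_unit(1)] ij z by simp
      show "qcomm T2 ?z (pt2 (W (gKb j)) (W (gF j))) (pt2 (W (gF i)) (uF i))"
        using qcomm_pt[OF F.Kb_F[of i j] qcomm_type_unit(1)] ij z by simp
    qed (use ij par in simp_all)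
    also have "\<dots> = \<zero>\<^bsub>T2\<^esub>"
    proof -
      have "W (gKb i) \<otimes>\<^bsub>A\<^esub> W (gKb j) = W (gKb j) \<otimes>\<^bsub>A\<^esub> W (gKb i)"
        using F.toral_commute[of "gKb i" "gKb j"] ij by simp
      from AA.skew_pure[OF _ _ _ _ this] AA.pure_skew[OF _ _ _ _ type_unit_central] show ?thesis
        using ij by (simp add: S[unfolded 2])
    qed
    finally show ?thesis unfolding 2 Delta_gen_EF .
  qed
qed

lemma wU_rels_Delta: "wU_rels P T2 (Delta_gen P)"
  using Delta_gen_closed Delta_J_rels Delta_type_rels Delta_EF_rels Delta_serre_rels
  by (simp add: wU_rels_def)

lemma wDelta: "wDelta P \<in> extensional (carrier A)" "alg_hom A T2 (wDelta P)"
  "g \<in> gens (idx P) \<Longrightarrow> wDelta P (W g) = Delta_gen P g"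
  using theI'[OF wU_hom_exists[OF AA.T.kalg_axioms wU_rels_Delta], folded wDelta_def] by auto

lemma kalg_ground: "kalg (ground :: ('k, 'k) module)"
  by (rule kalg.intro, rule k_algebraI) (auto simp: cring.axioms(1)[OF cring_ground] algebra_simps)

end

lemma (in kalg) skew_zero_right: "x \<in> carrier A \<Longrightarrow> skew A x \<zero> l n = \<zero>"
  by (induction n) simp_all

lemma k_linear_id: "k_linear A A (\<lambda>x. x)"
  by (simp add: k_linear_def)

lemma alg_hom_id: "alg_hom A A (\<lambda>x. x)"
  by (simp add: alg_hom_def k_linear_id ring_hom_def)

context kalg2
begin

lemma bilin_precomp:
  assumes "bilin A' B' C \<phi>" "k_linear A A' g" "k_linear B B' h" shows "bilin A B C (\<lambda>a b. \<phi> (g a) (h b))"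
  using assms unfolding bilin_def k_linear_def by (auto simp: Pi_def)

end

lemma (in kalg) bilin_mult: "bilin A A A (\<otimes>)"
  by (auto simp: bilin_def k_linear_def l_distr r_distr)

lemma (in kalg) bilin_smult: "k_linear A ground g \<Longrightarrow> bilin A A A (\<lambda>a b. g a \<odot> b)"
  by (auto simp: bilin_def k_linear_def smult_l_distr smult_r_distr mult.commute)

lemma (in kalg) bilin_smult': "k_linear A ground g \<Longrightarrow> bilin A A A (\<lambda>a b. g b \<odot> a)"
  by (auto simp: bilin_def k_linear_def smult_l_distr smult_r_distr mult.commute)

context wU_setup
begin

text \<open>With E_i and F_i sent to 0 and K_i and its partner to the same scalar, the commutator
  relation reads 0 = 0, and only relations among J, K and D remain. The counit, the sign character
  and the zero character are instances.\<close>

lemma wU_rels_ground: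
  assumes "\<And>i. i \<in> idx P \<Longrightarrow> f (gE i) = 0" "\<And>i. i \<in> idx P \<Longrightarrow> f (gF i) = 0"
    and "\<And>i. i \<in> idx P \<Longrightarrow> f (gKb i) = f (gK i)"
    and "f gJ ^ Jexp P = f gJ"
    and "\<And>i. i \<in> idx P \<Longrightarrow> f (gK i) * f (gK i) = f gJ ^ (Jexp P - 1)"
    and "\<And>i. i \<in> idx P \<Longrightarrow> f (gD i) * f (gDb i) = f gJ ^ (Jexp P - 1)"
    and "\<And>x. x \<in> toral_gens (idx P) \<Longrightarrow> f x * f gJ ^ (Jexp P - 1) = f x"
  shows "wU_rels P (ground :: ('k, 'k) module) f"
proof -
  interpret G: kalg "ground :: ('k, 'k) module" by (rule kalg_ground)
  have pow: "x [^]\<^bsub>ground :: ('k, 'k) module\<^esub> (n::nat) = x ^ n" for x :: 'k and n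
    by (induction n) (simp_all add: mult.commute)
  have "x \<ominus>\<^bsub>ground\<^esub> y = x - y" for x y :: 'k by (simp add: G.minus_smult)
  with assms G.skew_zero_right show ?thesis
    by (auto simp: wU_rels_def J_rels_def type_rels_def EF_rels_def serre_rels_def qcomm_def pow mult.commute
        simp del: skew.simps)
qed

lemma wU_rels_epsilon: "wU_rels P (ground :: ('k, 'k) module) epsilon_gen"
  by (rule wU_rels_ground) (auto simp: toral_gens_def)

lemma wepsilon: "wepsilon P \<in> extensional (carrier A)" "alg_hom A ground (wepsilon P)"
  "g \<in> gens (idx P) \<Longrightarrow> wepsilon P (W g) = epsilon_gen g"
  using theI'[OF wU_hom_exists[OF kalg_ground wU_rels_epsilon], folded wepsilon_def] by auto

abbreviation "\<epsilon> \<equiv> wepsilon P"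
abbreviation "\<Delta> \<equiv> wDelta P"

lemmas \<epsilon> = alg_homD[OF wepsilon(2), unfolded ground_simps]
lemmas \<Delta> = alg_homD[OF wDelta(2)]

lemma pow_ground: "x [^]\<^bsub>ground :: ('k, 'k) module\<^esub> (n::nat) = x ^ n"
proof -
  interpret G: kalg "ground :: ('k, 'k) module" by (rule kalg_ground)
  show ?thesis by (induction n) (simp_all add: mult.commute)
qed

lemma \<epsilon>_e: "\<epsilon> e = 1"
  unfolding J_idem_def by (subst alg_hom_pow[OF A.kalg_axioms kalg_ground wepsilon(2)])
    (simp_all add: wepsilon(3) pow_ground)

lemma \<Delta>_e: "\<Delta> e = pt2 e e"
  unfolding J_idem_def by (subst alg_hom_pow[OF A.kalg_axioms AA.T.kalg_axioms wDelta(2)])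
    (simp_all add: wDelta(3) AA.pt_pow)

lemma \<epsilon>_type_unit: "\<epsilon> (type_unit P k) = 1" and \<Delta>_type_unit: "\<Delta> (type_unit P k) = pt2 (type_unit P k) (type_unit P k)"
  using type_unit_cases[of k] \<epsilon>_e \<Delta>_e \<epsilon>(6) \<Delta>(6) by (auto simp: AA.pt_one)

lemma gens_cases:
  assumes "g \<in> gens (idx P)"
  obtains "g \<in> {gJ} \<union> toral_gens (idx P)" | i where "i \<in> idx P" "g = gE i" | i where "i \<in> idx P" "g = gF i"
  using assms by (auto simp: gens_def)

lemma \<epsilon>_grouplike: "x \<in> {gJ} \<union> toral_gens (idx P) \<Longrightarrow> \<epsilon> (W x) = 1"
  by (auto simp: wepsilon(3) toral_gens_def)

lemma \<epsilon>_EF: "i \<in> idx P \<Longrightarrow> \<epsilon> (W (gE i)) = 0" "i \<in> idx P \<Longrightarrow> \<epsilon> (W (gF i)) = 0"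
  by (auto simp: wepsilon(3))

lemma \<Delta>_grouplike: "x \<in> {gJ} \<union> toral_gens (idx P) \<Longrightarrow> \<Delta> (W x) = pt2 (W x) (W x)"
  by (subst wDelta(3)) (use Delta_gen_grouplike[of x] in \<open>auto simp only: gensI Un_iff singleton_iff\<close>)

lemma \<Delta>_EF:
  "i \<in> idx P \<Longrightarrow> \<Delta> (W (gE i)) = pt2 (uE i) (W (gE i)) \<oplus>\<^bsub>T2\<^esub> pt2 (W (gE i)) (W (gK i))"
  "i \<in> idx P \<Longrightarrow> \<Delta> (W (gF i)) = pt2 (W (gF i)) (uF i) \<oplus>\<^bsub>T2\<^esub> pt2 (W (gKb i)) (W (gF i))"
  by (simp_all add: wDelta(3) Delta_gen_EF del: Delta_gen.simps)

lemma counit_l: "x \<in> carrier A \<Longrightarrow> tensor_lift A A A (\<lambda>a b. \<epsilon> a \<odot>\<^bsub>A\<^esub> b) (\<Delta> x) = x"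
proof -
  let ?\<phi> = "\<lambda>a b. \<epsilon> a \<odot>\<^bsub>A\<^esub> b"
  have bil: "bilin A A A ?\<phi>" by (rule A.bilin_smult[OF alg_homD(1)[OF wepsilon(2)]])
  have hom: "alg_hom T2 A (tensor_lift A A A ?\<phi>)"
    by (rule AA.alg_hom_tensor_lift[OF A.kalg_axioms bil]) (auto simp: \<epsilon> mult.commute)
  note L = AA.tensor_lift(2)[OF A.kalg_axioms bil] alg_homD(3)[OF hom]
  show "x \<in> carrier A \<Longrightarrow> tensor_lift A A A ?\<phi> (\<Delta> x) = x"
  proof (rule wU_hom_unique[OF A.kalg_axioms alg_hom_comp[OF wDelta(2) hom] alg_hom_id])
    fix g assume "g \<in> gens (idx P)"
    then show "tensor_lift A A A ?\<phi> (\<Delta> (W g)) = W g"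
    proof (cases rule: gens_cases)
      case 1
      then have "W g \<in> carrier A" by auto
      then show ?thesis by (simp add: \<Delta>_grouplike[OF 1] \<epsilon>_grouplike[OF 1] L)
    qed (auto simp: \<Delta>_EF L \<epsilon>_EF \<epsilon>_type_unit \<epsilon>_grouplike)
  qed
qed

lemma counit_r: "x \<in> carrier A \<Longrightarrow> tensor_lift A A A (\<lambda>a b. \<epsilon> b \<odot>\<^bsub>A\<^esub> a) (\<Delta> x) = x"
proof -
  let ?\<phi> = "\<lambda>a b. \<epsilon> b \<odot>\<^bsub>A\<^esub> a"
  have bil: "bilin A A A ?\<phi>" by (rule A.bilin_smult'[OF alg_homD(1)[OF wepsilon(2)]])
  have hom: "alg_hom T2 A (tensor_lift A A A ?\<phi>)"
    by (rule AA.alg_hom_tensor_lift[OF A.kalg_axioms bil]) (auto simp: \<epsilon> mult.commute)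
  note L = AA.tensor_lift(2)[OF A.kalg_axioms bil] alg_homD(3)[OF hom]
  show "x \<in> carrier A \<Longrightarrow> tensor_lift A A A ?\<phi> (\<Delta> x) = x"
  proof (rule wU_hom_unique[OF A.kalg_axioms alg_hom_comp[OF wDelta(2) hom] alg_hom_id])
    fix g assume "g \<in> gens (idx P)"
    then show "tensor_lift A A A ?\<phi> (\<Delta> (W g)) = W g"
    proof (cases rule: gens_cases)
      case 1
      then have "W g \<in> carrier A" by auto
      then show ?thesis by (simp add: \<Delta>_grouplike[OF 1] \<epsilon>_grouplike[OF 1] L)
    qed (auto simp: \<Delta>_EF L \<epsilon>_EF \<epsilon>_type_unit \<epsilon>_grouplike)
  qed
qed

section \<open>Coassociativity\<close>

sublocale A3: kalg2 A T2 ..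

abbreviation "T3 \<equiv> tensor A T2"
abbreviation "pt3 \<equiv> pure_tensor A T2"

text \<open>The identification of (A \<otimes> A) \<otimes> A with A \<otimes> (A \<otimes> A), as a
  family of maps on A \<otimes> A indexed by the last factor. This is the form in which it occurs in
  \<open>bialgebra\<close>.\<close>

abbreviation assoc :: "(gen list \<Rightarrow>\<^sub>0 'k) set \<Rightarrow> _ \<Rightarrow> _" where
  "assoc b \<equiv> tensor_lift A A T3 (\<lambda>a1 a2. pt3 a1 (pt2 a2 b))"

lemma assoc_bilin: "b \<in> carrier A \<Longrightarrow> bilin A A T3 (\<lambda>a1 a2. pt3 a1 (pt2 a2 b))"
  by (auto simp: bilin_def k_linear_def A3.pt_add_l A3.pt_smult_l A3.pt_add_r A3.pt_smult_r AA.pt_add_l AA.pt_smult_l)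

lemma assoc_pure: "\<lbrakk>b \<in> carrier A; a1 \<in> carrier A; a2 \<in> carrier A\<rbrakk> \<Longrightarrow> assoc b (pt2 a1 a2) = pt3 a1 (pt2 a2 b)"
  by (rule AA.tensor_lift(2)[OF A3.T.kalg_axioms assoc_bilin])

lemma assoc_linear: "b \<in> carrier A \<Longrightarrow> k_linear T2 T3 (assoc b)"
  by (rule AA.tensor_lift(1)[OF A3.T.kalg_axioms assoc_bilin])

lemmas assoc_lin = k_linearD[OF assoc_linear] k_linear_zero[OF AA.T.kalg_axioms A3.T.kalg_axioms assoc_linear]

lemma bilin_assoc: "bilin T2 A T3 (\<lambda>t b. assoc b t)"
  unfolding bilin_def
proof (intro conjI ballI)
  fix t assume t: "t \<in> carrier T2"
  have "assoc (b \<oplus>\<^bsub>A\<^esub> b') t = assoc b t \<oplus>\<^bsub>T3\<^esub> assoc b' t" if "b \<in> carrier A" "b' \<in> carrier A" for b b'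
    using t by (induction rule: AA.tensor_induct)
      (use that in \<open>simp_all add: assoc_lin assoc_pure AA.pt_add_r A3.pt_add_r A3.T.a_ac\<close>)
  moreover have "assoc (c \<odot>\<^bsub>A\<^esub> b) t = c \<odot>\<^bsub>T3\<^esub> assoc b t" if "b \<in> carrier A" for c b
    using t by (induction rule: AA.tensor_induct)
      (use that in \<open>simp_all add: assoc_lin assoc_pure AA.pt_smult_r A3.pt_smult_r A3.T.smult_r_distr\<close>)
  ultimately show "k_linear A T3 (\<lambda>b. assoc b t)"
    using t by (auto simp: k_linear_def assoc_lin)
qed (rule assoc_linear)

text \<open>Coassociativity is tested on generators, for which both sides must be algebra maps. This
  is the multiplicativity of the side that reassociates.\<close>

lemma assoc_mult:
  assumes "s \<in> carrier T2" "t \<in> carrier T2" and b: "b \<in> carrier A" "b' \<in> carrier A"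
  shows "assoc (b \<otimes>\<^bsub>A\<^esub> b') (s \<otimes>\<^bsub>T2\<^esub> t) = assoc b s \<otimes>\<^bsub>T3\<^esub> assoc b' t"
  using assms(1)
proof (induction rule: AA.tensor_induct)
  case (pure a1 a2)
  show ?case
    using assms(2)
    by (induction rule: AA.tensor_induct)
      (use b pure in \<open>simp_all add: assoc_lin assoc_pure AA.T.r_distr A3.T.r_distr\<close>)
qed (use assms(2) b in \<open>simp_all add: assoc_lin AA.T.l_distr A3.T.l_distr\<close>)

lemma coassoc:
  assumes "x \<in> carrier A"
  shows "tensor_lift A A T3 (\<lambda>a b. pt3 a (\<Delta> b)) (\<Delta> x) =
    tensor_lift A A T3 (\<lambda>a b. assoc b (\<Delta> a)) (\<Delta> x)"
proof -
  let ?\<phi> = "\<lambda>a b. pt3 a (\<Delta> b)" and ?\<psi> = "\<lambda>a b. assoc b (\<Delta> a)"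
  have bil1: "bilin A A T3 ?\<phi>"
    by (rule AA.bilin_precomp[OF A3.bilin_pt k_linear_id alg_homD(1)[OF wDelta(2)]])
  have bil2: "bilin A A T3 ?\<psi>"
    using AA.bilin_precomp[OF bilin_assoc alg_homD(1)[OF wDelta(2)] k_linear_id] .
  have hom1: "alg_hom T2 T3 (tensor_lift A A T3 ?\<phi>)"
    by (rule AA.alg_hom_tensor_lift[OF A3.T.kalg_axioms bil1]) (simp_all add: \<Delta> A3.pt_one)
  have hom2: "alg_hom T2 T3 (tensor_lift A A T3 ?\<psi>)"
  proof (rule AA.alg_hom_tensor_lift[OF A3.T.kalg_axioms bil2])
    show "assoc \<one>\<^bsub>A\<^esub> (\<Delta> \<one>\<^bsub>A\<^esub>) = \<one>\<^bsub>T3\<^esub>"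
      using assoc_pure[of "\<one>\<^bsub>A\<^esub>" "\<one>\<^bsub>A\<^esub>" "\<one>\<^bsub>A\<^esub>"] by (simp add: \<Delta> AA.pt_one A3.pt_one)
  qed (simp add: \<Delta> assoc_mult)
  note L = AA.tensor_lift(2)[OF A3.T.kalg_axioms bil1] alg_homD(3)[OF hom1]
    AA.tensor_lift(2)[OF A3.T.kalg_axioms bil2] alg_homD(3)[OF hom2]
  show ?thesis
  proof (rule wU_hom_unique[OF A3.T.kalg_axioms alg_hom_comp[OF wDelta(2) hom1] alg_hom_comp[OF wDelta(2) hom2] _ assms])
    fix g assume "g \<in> gens (idx P)"
    then show "tensor_lift A A T3 ?\<phi> (\<Delta> (W g)) = tensor_lift A A T3 ?\<psi> (\<Delta> (W g))"
    proof (cases rule: gens_cases)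
      case 1
      then have "W g \<in> carrier A" by auto
      then show ?thesis by (simp add: \<Delta>_grouplike[OF 1] L assoc_pure)
    qed (auto simp: \<Delta>_EF L assoc_pure assoc_lin \<Delta>_type_unit \<Delta>_grouplike A3.pt_add_r A3.T.a_assoc)
  qed
qed

section \<open>The bialgebra\<close>

abbreviation "H \<equiv> wU P"

text \<open>\<open>wU P\<close> and \<open>wU_alg P\<close> share carrier and operations but have
  different record types. This and the following rules rewrite every construction on the former into
  the one on the latter.\<close>

lemma wU_simps [simp]:
  "carrier H = carrier A" "mult H = mult A" "\<one>\<^bsub>H\<^esub> = \<one>\<^bsub>A\<^esub>" "\<zero>\<^bsub>H\<^esub> = \<zero>\<^bsub>A\<^esub>"
  "add H = add A" "smult H = smult A" "comult H = \<Delta>" "counit H = \<epsilon>"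
  by (simp_all add: wU_def Let_def)

lemma k_linear_wU [simp]: "k_linear H B = k_linear A B" "k_linear B H = k_linear B A"
  by (auto simp: k_linear_def fun_eq_iff)

lemma alg_hom_wU [simp]: "alg_hom H B = alg_hom A B" "alg_hom B H = alg_hom B A" "alg_anti_hom H H = alg_anti_hom A A"
  by (auto simp: alg_hom_def alg_anti_hom_def ring_hom_def fun_eq_iff)

lemma prod_wU: "H \<times>\<times> B = A \<times>\<times> B" "B \<times>\<times> H = B \<times>\<times> A" "H \<times>\<times> H = A \<times>\<times> A"
  by (simp_all add: DirProd_def)

lemma bilinear_ideal_wU: "bilinear_ideal H B = bilinear_ideal A B" "bilinear_ideal B H = bilinear_ideal B A"
  by (simp_all add: bilinear_ideal_def bilinear_relators_def prod_wU)

lemma tensor_wU [simp]: "tensor H B = tensor A B" "tensor B H = tensor B A"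
  by (simp_all add: tensor_def prod_wU bilinear_ideal_wU)

lemma pure_tensor_wU [simp]: "pure_tensor H B = pure_tensor A B" "pure_tensor B H = pure_tensor B A"
  by (simp_all add: pure_tensor_def prod_wU bilinear_ideal_wU fun_eq_iff)

lemma tensor_lift_wU [simp]: "tensor_lift H H B = tensor_lift A A B" "tensor_lift A A H = tensor_lift A A A"
  "tensor_lift H H H = tensor_lift A A A"
  by (simp_all add: tensor_lift_def fun_eq_iff)

lemma k_algebra_wU: "k_algebra H"
proof (rule k_algebraI, rule ringI)
  show "abelian_group H"
  proof (rule abelian_groupI)
    fix x assume "x \<in> carrier H"
    then show "\<exists>y\<in>carrier H. y \<oplus>\<^bsub>H\<^esub> x = \<zero>\<^bsub>H\<^esub>"
      by (intro bexI[of _ "\<ominus>\<^bsub>A\<^esub> x"]) (simp_all add: A.l_neg)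
  qed (auto simp: A.a_ac)
  show "Group.monoid H"
    by (rule monoidI) (auto simp: A.m_assoc)
qed (auto simp: A.l_distr A.r_distr A.smult_l_distr A.smult_r_distr)

lemma bialgebra_wU: "bialgebra H"
  unfolding bialgebra_def
  using k_algebra_wU wDelta(2) wepsilon(2) coassoc counit_l counit_r by simp

end

section \<open>Anti-endomorphisms\<close>

text \<open>The map \<open>T\<close> is the case \<open>r = 0\<close>, \<open>\<mu>\<^sub>i = -1\<close>.  Taking \<open>r = 1 - J\<^bsup>m-1\<^esup>\<close> instead makes it act as an
  anti-automorphism on the summand \<open>(1 - J\<^bsup>m-1\<^esup>) A\<close>, which \<open>T\<close> itself maps to \<open>K (1 - J\<^bsup>m-1\<^esup>)\<close>.\<close>

fun anti_gen :: "'k::field wU_data \<Rightarrow> (nat \<Rightarrow> 'k) \<Rightarrow> (nat \<Rightarrow> 'k) \<Rightarrow> (gen list \<Rightarrow>\<^sub>0 'k) set \<Rightarrow> gen \<Rightarrow> (gen list \<Rightarrow>\<^sub>0 'k) set" where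
  "anti_gen P \<mu> \<nu> r gJ = wgen P gJ"
| "anti_gen P \<mu> \<nu> r (gK i) = wgen P (gKb i)"
| "anti_gen P \<mu> \<nu> r (gKb i) = wgen P (gK i)"
| "anti_gen P \<mu> \<nu> r (gD i) = wgen P (gDb i)"
| "anti_gen P \<mu> \<nu> r (gDb i) = wgen P (gD i)"
| "anti_gen P \<mu> \<nu> r (gE i) = \<mu> i \<odot>\<^bsub>wU_alg P\<^esub> (wgen P (gE i) \<otimes>\<^bsub>wU_alg P\<^esub> wgen P (gKb i))
     \<oplus>\<^bsub>wU_alg P\<^esub> r \<otimes>\<^bsub>wU_alg P\<^esub> wgen P (gE i)"
| "anti_gen P \<mu> \<nu> r (gF i) = \<nu> i \<odot>\<^bsub>wU_alg P\<^esub> (wgen P (gF i) \<otimes>\<^bsub>wU_alg P\<^esub> wgen P (gK i))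
     \<oplus>\<^bsub>wU_alg P\<^esub> r \<otimes>\<^bsub>wU_alg P\<^esub> wgen P (gF i)"

text \<open>The normalisation of \<mu> and \<nu> is dictated by the commutator of E_i and F_i, whose
  toral right-hand side must come back with coefficient 1. Both families are kept as parameters,
  because for r = \<rho> exchanging them leads to the inverse map.\<close>

locale wU_anti = wU_setup +
  fixes \<mu> \<nu> :: "nat \<Rightarrow> 'a" and r :: "(gen list \<Rightarrow>\<^sub>0 'a) set"
  assumes r [simp]: "r \<in> carrier A" and r_central: "\<And>x. x \<in> carrier A \<Longrightarrow> r \<otimes>\<^bsub>A\<^esub> x = x \<otimes>\<^bsub>A\<^esub> r"
    and r_e: "r \<otimes>\<^bsub>A\<^esub> e = \<zero>\<^bsub>A\<^esub>"
    and \<mu>\<nu>: "\<And>i. i \<in> idx P \<Longrightarrow> \<mu> i * \<nu> i * qi P i powi cartan P i i = 1"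
begin

abbreviation "T \<equiv> anti_gen P \<mu> \<nu> r"

text \<open>Toral generators are fixed by \<open>e\<close>, which \<open>r\<close>
  annihilates.\<close>

lemma r_toral: "x \<in> toral_gens (idx P) \<Longrightarrow> r \<otimes>\<^bsub>A\<^esub> W x = \<zero>\<^bsub>A\<^esub>"
proof -
  assume x: "x \<in> toral_gens (idx P)"
  have "r \<otimes>\<^bsub>A\<^esub> W x = (r \<otimes>\<^bsub>A\<^esub> e) \<otimes>\<^bsub>A\<^esub> W x" using x by (simp add: A.m_assoc F.e_toral)
  then show ?thesis using x by (simp add: r_e)
qed

lemma toral_r: "x \<in> toral_gens (idx P) \<Longrightarrow> W x \<otimes>\<^bsub>A\<^esub> r = \<zero>\<^bsub>A\<^esub>"
  using r_toral[of x] r_central[of "W x"] by simp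

lemma T_closed: "g \<in> gens (idx P) \<Longrightarrow> T g \<in> carrier A"
  by (auto simp: gens_def toral_gens_def)

lemma T_toral: "x \<in> toral_gens (idx P) \<Longrightarrow> \<exists>y\<in>toral_gens (idx P). T x = W y"
  by (auto simp: toral_gens_def)

lemma T_J_rels: "J_rels P (op_alg A) T"
  unfolding J_rels_def Let_def
proof (intro conjI ballI)
  show "T gJ [^]\<^bsub>op_alg A\<^esub> Jexp P = T gJ" by (simp add: F.J_pow)
  have e: "T gJ [^]\<^bsub>op_alg A\<^esub> (Jexp P - 1) = e" by (simp add: J_idem_def)
  fix i assume i: "i \<in> idx P"
  show "T (gK i) \<otimes>\<^bsub>op_alg A\<^esub> T (gKb i) = T gJ [^]\<^bsub>op_alg A\<^esub> (Jexp P - 1)"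
    "T (gD i) \<otimes>\<^bsub>op_alg A\<^esub> T (gDb i) = T gJ [^]\<^bsub>op_alg A\<^esub> (Jexp P - 1)"
    unfolding e using i by (simp_all add: F.KKb F.DDb)
next
  fix x y assume "x \<in> {gJ} \<union> toral_gens (idx P)" "y \<in> {gJ} \<union> toral_gens (idx P)"
  then have "\<exists>x'\<in>{gJ} \<union> toral_gens (idx P). T x = W x'" "\<exists>y'\<in>{gJ} \<union> toral_gens (idx P). T y = W y'"
    using T_toral by auto
  then show "T x \<otimes>\<^bsub>op_alg A\<^esub> T y = T y \<otimes>\<^bsub>op_alg A\<^esub> T x"
    unfolding op_alg_simps using F.toral_commute by metis
next
  have e: "T gJ [^]\<^bsub>op_alg A\<^esub> (Jexp P - 1) = e" by (simp add: J_idem_def)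
  fix x assume "x \<in> toral_gens (idx P)"
  then obtain y where "y \<in> toral_gens (idx P)" "T x = W y" using T_toral by blast
  then show "T x \<otimes>\<^bsub>op_alg A\<^esub> T gJ [^]\<^bsub>op_alg A\<^esub> (Jexp P - 1) = T x"
    unfolding e by (simp add: F.e_toral)
qed

sublocale O: kalg "op_alg A" by (rule A.kalg_op)

text \<open>\<open>T\<close> exchanges K_j with its partner, which inverts the weights, and passing
  to the opposite algebra inverts them once more. The central factor \<open>r\<close> leaves weights
  unchanged.\<close>

lemma T_type_rels: "type_rels P (op_alg A) T"
  unfolding type_rels_def Let_def
proof (intro ballI)
  fix i j assume i: "i \<in> idx P" and j: "j \<in> idx P"
  let ?c = "qi P i powi cartan P i j"
  have c0: "?c \<noteq> 0" using qi_neq i by simp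
  have m: "qi P i powi - cartan P i j = inverse ?c" by (simp add: power_int_minus)
  have X: "qcomm (op_alg A) d (W k) (s \<odot>\<^bsub>A\<^esub> (W x \<otimes>\<^bsub>A\<^esub> W k') \<oplus>\<^bsub>A\<^esub> r \<otimes>\<^bsub>A\<^esub> W x)"
    if "qcomm A (inverse d) (W k) (W x)" "d \<noteq> 0" and g: "k \<in> toral_gens (idx P)" "k' \<in> toral_gens (idx P)" "x \<in> gens (idx P)"
    for d k k' x s
  proof -
    have "qcomm A (inverse d * 1) (W k) (W x \<otimes>\<^bsub>A\<^esub> W k')"
      by (rule A.qcomm_mult_r[OF that(1) qcomm_toral]) (use g in simp_all)
    moreover have "qcomm A (1 * inverse d) (W k) (r \<otimes>\<^bsub>A\<^esub> W x)"
      by (rule A.qcomm_mult_r[OF _ that(1)]) (use g in \<open>simp_all add: qcomm_def r_central\<close>)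
    ultimately have "qcomm A (inverse d) (W k) (s \<odot>\<^bsub>A\<^esub> (W x \<otimes>\<^bsub>A\<^esub> W k') \<oplus>\<^bsub>A\<^esub> r \<otimes>\<^bsub>A\<^esub> W x)"
      using g by (intro A.qcomm_add_r A.qcomm_smult_r) simp_all
    from A.qcomm_sym[OF this] that(2) g show ?thesis by (simp add: qcomm_def)
  qed
  have q: "qcomm (op_alg A) ?c (T (gK j)) (T (gE i))" "qcomm (op_alg A) (inverse ?c) (T (gKb j)) (T (gE i))"
    "qcomm (op_alg A) (inverse ?c) (T (gK j)) (T (gF i))" "qcomm (op_alg A) ?c (T (gKb j)) (T (gF i))"
    unfolding anti_gen.simps
    by (rule X; use i j c0 F.Kb_E[OF i j] F.K_E[OF i j] F.Kb_F[OF i j] F.K_F[OF i j] in simp)+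
  have KKb: "T (gK j) \<otimes>\<^bsub>op_alg A\<^esub> T (gKb j) = e" using j by (simp add: F.KKb)
  have E0: "T (gE i) \<otimes>\<^bsub>op_alg A\<^esub> e = T (gE i)" if t: "type_E P i = 0"
  proof -
    have "e \<otimes>\<^bsub>A\<^esub> (r \<otimes>\<^bsub>A\<^esub> W (gE i)) = r \<otimes>\<^bsub>A\<^esub> (e \<otimes>\<^bsub>A\<^esub> W (gE i))"
      using i r_central[of e] by (simp flip: A.m_assoc)
    then show ?thesis using i F.e_E0[OF i i t] by (simp add: A.r_distr flip: A.m_assoc)
  qed
  have F0: "T (gF i) \<otimes>\<^bsub>op_alg A\<^esub> e = T (gF i)" if t: "type_F P i = 0"
  proof -
    have "e \<otimes>\<^bsub>A\<^esub> (r \<otimes>\<^bsub>A\<^esub> W (gF i)) = r \<otimes>\<^bsub>A\<^esub> (e \<otimes>\<^bsub>A\<^esub> W (gF i))"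
      using i r_central[of e] by (simp flip: A.m_assoc)
    then show ?thesis using i F.e_F0[OF i i t] by (simp add: A.r_distr flip: A.m_assoc)
  qed
  show "(type_E P i = 1 \<longrightarrow> qcomm (op_alg A) ?c (T (gK j)) (T (gE i)) \<and>
        qcomm (op_alg A) (qi P i powi - cartan P i j) (T (gKb j)) (T (gE i))) \<and>
     (type_E P i = 0 \<longrightarrow> T (gK j) \<otimes>\<^bsub>op_alg A\<^esub> (T (gE i) \<otimes>\<^bsub>op_alg A\<^esub> T (gKb j)) =
        ?c \<odot>\<^bsub>op_alg A\<^esub> T (gE i)) \<and>
     (type_F P i = 1 \<longrightarrow> qcomm (op_alg A) (qi P i powi - cartan P i j) (T (gK j)) (T (gF i)) \<and>
        qcomm (op_alg A) ?c (T (gKb j)) (T (gF i))) \<and>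
     (type_F P i = 0 \<longrightarrow> T (gK j) \<otimes>\<^bsub>op_alg A\<^esub> (T (gF i) \<otimes>\<^bsub>op_alg A\<^esub> T (gKb j)) =
        (qi P i powi - cartan P i j) \<odot>\<^bsub>op_alg A\<^esub> T (gF i))"
    unfolding m
  proof (intro conjI impI)
    assume t: "type_E P i = 0"
    show "T (gK j) \<otimes>\<^bsub>op_alg A\<^esub> (T (gE i) \<otimes>\<^bsub>op_alg A\<^esub> T (gKb j)) = ?c \<odot>\<^bsub>op_alg A\<^esub> T (gE i)"
    proof (rule O.qcomm_conj[OF q(1)])
      show "T (gE i) \<otimes>\<^bsub>op_alg A\<^esub> (T (gK j) \<otimes>\<^bsub>op_alg A\<^esub> T (gKb j)) = T (gE i)"
        unfolding KKb by (rule E0[OF t])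
    qed (use i j in \<open>simp_all only: op_alg_simps T_closed gensI\<close>)
  next
    assume t: "type_F P i = 0"
    show "T (gK j) \<otimes>\<^bsub>op_alg A\<^esub> (T (gF i) \<otimes>\<^bsub>op_alg A\<^esub> T (gKb j)) = inverse ?c \<odot>\<^bsub>op_alg A\<^esub> T (gF i)"
    proof (rule O.qcomm_conj[OF q(3)])
      show "T (gF i) \<otimes>\<^bsub>op_alg A\<^esub> (T (gK j) \<otimes>\<^bsub>op_alg A\<^esub> T (gKb j)) = T (gF i)"
        unfolding KKb by (rule F0[OF t])
    qed (use i j in \<open>simp_all only: op_alg_simps T_closed gensI\<close>)
  qed (rule q)+
qed

text \<open>Products of an \<open>r\<close>-part with a toral part vanish, so the computation
  splits. The toral parts reproduce the commutator up to \<mu>_i \<nu>_j q_i^(a_ij), which is 1 for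
  i = j, while for i \<noteq> j the commutator is 0. The \<open>r\<close>-parts commute because
  \<open>r\<close> annihilates the toral right-hand side.\<close>

lemma T_EF_rels: "EF_rels P (op_alg A) T"
  unfolding EF_rels_def
proof (intro ballI)
  fix i j assume i: "i \<in> idx P" and j: "j \<in> idx P"
  let ?E = "W (gE i)" and ?F = "W (gF j)" and ?K = "W (gK j)" and ?Kb = "W (gKb i)"
  let ?c = "inverse (qi P i - inverse (qi P i))" and ?z = "qi P i powi cartan P i j"
  have [simp]: "?E \<in> carrier A" "?F \<in> carrier A" "?K \<in> carrier A" "?Kb \<in> carrier A" using i j by simp_all
  note [simp del] = anti_gen.simps
  define h where "h = (if i = j then ?c \<odot>\<^bsub>A\<^esub> (W (gK i) \<ominus>\<^bsub>A\<^esub> W (gKb i)) else \<zero>\<^bsub>A\<^esub>)"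
  have h [simp]: "h \<in> carrier A" using i j by (simp add: h_def)
  have EF: "?E \<otimes>\<^bsub>A\<^esub> ?F = ?F \<otimes>\<^bsub>A\<^esub> ?E \<oplus>\<^bsub>A\<^esub> h" using F.EF[OF i j] by (simp add: h_def)
  have rh: "r \<otimes>\<^bsub>A\<^esub> h = \<zero>\<^bsub>A\<^esub>"
    using i j by (simp add: h_def A.minus_smult A.r_distr r_toral)
  have he: "h \<otimes>\<^bsub>A\<^esub> e = h"
    using i j by (simp add: h_def A.minus_smult A.l_distr F.toral_e)
  let ?a = "\<mu> i \<odot>\<^bsub>A\<^esub> (?E \<otimes>\<^bsub>A\<^esub> ?Kb)" and ?b = "r \<otimes>\<^bsub>A\<^esub> ?E"
  let ?a' = "\<nu> j \<odot>\<^bsub>A\<^esub> (?F \<otimes>\<^bsub>A\<^esub> ?K)" and ?b' = "r \<otimes>\<^bsub>A\<^esub> ?F"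
  have kill: "x \<otimes>\<^bsub>A\<^esub> W k \<otimes>\<^bsub>A\<^esub> (r \<otimes>\<^bsub>A\<^esub> y) = \<zero>\<^bsub>A\<^esub>" "r \<otimes>\<^bsub>A\<^esub> y \<otimes>\<^bsub>A\<^esub> (x \<otimes>\<^bsub>A\<^esub> W k) = \<zero>\<^bsub>A\<^esub>"
    if "x \<in> carrier A" "y \<in> carrier A" "k \<in> toral_gens (idx P)" for x y k
  proof -
    have "x \<otimes>\<^bsub>A\<^esub> W k \<otimes>\<^bsub>A\<^esub> (r \<otimes>\<^bsub>A\<^esub> y) = x \<otimes>\<^bsub>A\<^esub> (W k \<otimes>\<^bsub>A\<^esub> r) \<otimes>\<^bsub>A\<^esub> y"
      using that by (simp add: A.m_assoc)
    then show "x \<otimes>\<^bsub>A\<^esub> W k \<otimes>\<^bsub>A\<^esub> (r \<otimes>\<^bsub>A\<^esub> y) = \<zero>\<^bsub>A\<^esub>" using that by (simp add: toral_r)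
    have "r \<otimes>\<^bsub>A\<^esub> y \<otimes>\<^bsub>A\<^esub> (x \<otimes>\<^bsub>A\<^esub> W k) = (y \<otimes>\<^bsub>A\<^esub> x) \<otimes>\<^bsub>A\<^esub> (r \<otimes>\<^bsub>A\<^esub> W k)"
      using that r_central[of "y \<otimes>\<^bsub>A\<^esub> x"] by (simp add: A.m_assoc) (simp flip: A.m_assoc)
    then show "r \<otimes>\<^bsub>A\<^esub> y \<otimes>\<^bsub>A\<^esub> (x \<otimes>\<^bsub>A\<^esub> W k) = \<zero>\<^bsub>A\<^esub>" using that by (simp add: r_toral)
  qed
  have rr: "r \<otimes>\<^bsub>A\<^esub> x \<otimes>\<^bsub>A\<^esub> (r \<otimes>\<^bsub>A\<^esub> y) = r \<otimes>\<^bsub>A\<^esub> (r \<otimes>\<^bsub>A\<^esub> (x \<otimes>\<^bsub>A\<^esub> y))" if "x \<in> carrier A" "y \<in> carrier A" for x y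
  proof -
    have "r \<otimes>\<^bsub>A\<^esub> x \<otimes>\<^bsub>A\<^esub> (r \<otimes>\<^bsub>A\<^esub> y) = r \<otimes>\<^bsub>A\<^esub> (x \<otimes>\<^bsub>A\<^esub> r) \<otimes>\<^bsub>A\<^esub> y" using that by (simp add: A.m_assoc)
    also have "x \<otimes>\<^bsub>A\<^esub> r = r \<otimes>\<^bsub>A\<^esub> x" using that by (simp add: r_central)
    finally show ?thesis using that by (simp add: A.m_assoc)
  qed
  have bb: "?b \<otimes>\<^bsub>A\<^esub> ?b' = ?b' \<otimes>\<^bsub>A\<^esub> ?b"
    by (simp add: rr EF A.r_distr rh)
  let ?q = "?F \<otimes>\<^bsub>A\<^esub> ?E \<otimes>\<^bsub>A\<^esub> (?K \<otimes>\<^bsub>A\<^esub> ?Kb)" and ?s = "\<mu> i * \<nu> j * ?z"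
  have a'a: "?a' \<otimes>\<^bsub>A\<^esub> ?a = ?s \<odot>\<^bsub>A\<^esub> ?q"
  proof -
    have "?F \<otimes>\<^bsub>A\<^esub> ?K \<otimes>\<^bsub>A\<^esub> (?E \<otimes>\<^bsub>A\<^esub> ?Kb) = ?F \<otimes>\<^bsub>A\<^esub> (?K \<otimes>\<^bsub>A\<^esub> ?E) \<otimes>\<^bsub>A\<^esub> ?Kb" by (simp add: A.m_assoc)
    also have "\<dots> = ?z \<odot>\<^bsub>A\<^esub> ?q"
      using F.K_E[OF i j] by (simp add: qcomm_def A.m_assoc)
    finally show ?thesis by (simp add: mult_ac)
  qed
  have aa': "?a \<otimes>\<^bsub>A\<^esub> ?a' = ?s \<odot>\<^bsub>A\<^esub> (?q \<oplus>\<^bsub>A\<^esub> h \<otimes>\<^bsub>A\<^esub> (?K \<otimes>\<^bsub>A\<^esub> ?Kb))"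
  proof -
    have KK: "?Kb \<otimes>\<^bsub>A\<^esub> ?K = ?K \<otimes>\<^bsub>A\<^esub> ?Kb" using F.toral_commute[of "gKb i" "gK j"] i j by simp
    have "?E \<otimes>\<^bsub>A\<^esub> ?Kb \<otimes>\<^bsub>A\<^esub> (?F \<otimes>\<^bsub>A\<^esub> ?K) = ?E \<otimes>\<^bsub>A\<^esub> (?Kb \<otimes>\<^bsub>A\<^esub> ?F) \<otimes>\<^bsub>A\<^esub> ?K" by (simp add: A.m_assoc)
    also have "\<dots> = ?z \<odot>\<^bsub>A\<^esub> ((?E \<otimes>\<^bsub>A\<^esub> ?F) \<otimes>\<^bsub>A\<^esub> (?Kb \<otimes>\<^bsub>A\<^esub> ?K))"
      using F.Kb_F[OF j i] by (simp add: qcomm_def A.m_assoc qi_powi_sym[OF i j])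
    finally have "?E \<otimes>\<^bsub>A\<^esub> ?Kb \<otimes>\<^bsub>A\<^esub> (?F \<otimes>\<^bsub>A\<^esub> ?K) = ?z \<odot>\<^bsub>A\<^esub> ((?E \<otimes>\<^bsub>A\<^esub> ?F) \<otimes>\<^bsub>A\<^esub> (?Kb \<otimes>\<^bsub>A\<^esub> ?K))" .
    then show ?thesis unfolding EF KK by (simp add: A.l_distr mult_ac)
  qed
  have sh: "?s \<odot>\<^bsub>A\<^esub> (h \<otimes>\<^bsub>A\<^esub> (?K \<otimes>\<^bsub>A\<^esub> ?Kb)) = h"
  proof (cases "i = j")
    case True
    then have "?s = 1" using \<mu>\<nu>[OF i] by simp
    then show ?thesis using True i by (simp add: F.KKb he)
  qed (simp add: h_def)
  have TT': "T (gF j) \<otimes>\<^bsub>A\<^esub> T (gE i) = ?s \<odot>\<^bsub>A\<^esub> ?q \<oplus>\<^bsub>A\<^esub> ?b' \<otimes>\<^bsub>A\<^esub> ?b"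
  proof -
    have "T (gF j) \<otimes>\<^bsub>A\<^esub> T (gE i) = ?a' \<otimes>\<^bsub>A\<^esub> ?a \<oplus>\<^bsub>A\<^esub> ?b' \<otimes>\<^bsub>A\<^esub> ?a \<oplus>\<^bsub>A\<^esub> (?a' \<otimes>\<^bsub>A\<^esub> ?b \<oplus>\<^bsub>A\<^esub> ?b' \<otimes>\<^bsub>A\<^esub> ?b)"
      unfolding anti_gen.simps by (simp add: A.l_distr A.r_distr del: A.smult_mult_l A.smult_mult_r)
    moreover have "?b' \<otimes>\<^bsub>A\<^esub> ?a = \<zero>\<^bsub>A\<^esub>" "?a' \<otimes>\<^bsub>A\<^esub> ?b = \<zero>\<^bsub>A\<^esub>" using i j by (simp_all add: kill)
    ultimately show ?thesis unfolding a'a by simp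
  qed
  have T'T: "T (gE i) \<otimes>\<^bsub>A\<^esub> T (gF j) = ?s \<odot>\<^bsub>A\<^esub> ?q \<oplus>\<^bsub>A\<^esub> h \<oplus>\<^bsub>A\<^esub> ?b' \<otimes>\<^bsub>A\<^esub> ?b"
  proof -
    have "T (gE i) \<otimes>\<^bsub>A\<^esub> T (gF j) = ?a \<otimes>\<^bsub>A\<^esub> ?a' \<oplus>\<^bsub>A\<^esub> ?b \<otimes>\<^bsub>A\<^esub> ?a' \<oplus>\<^bsub>A\<^esub> (?a \<otimes>\<^bsub>A\<^esub> ?b' \<oplus>\<^bsub>A\<^esub> ?b \<otimes>\<^bsub>A\<^esub> ?b')"
      unfolding anti_gen.simps by (simp add: A.l_distr A.r_distr del: A.smult_mult_l A.smult_mult_r)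
    moreover have "?b \<otimes>\<^bsub>A\<^esub> ?a' = \<zero>\<^bsub>A\<^esub>" "?a \<otimes>\<^bsub>A\<^esub> ?b' = \<zero>\<^bsub>A\<^esub>" using i j by (simp_all add: kill)
    ultimately show ?thesis unfolding aa' bb by (simp add: A.smult_r_distr sh)
  qed
  have canc: "x \<oplus>\<^bsub>A\<^esub> y \<ominus>\<^bsub>A\<^esub> (x \<oplus>\<^bsub>A\<^esub> h \<oplus>\<^bsub>A\<^esub> y) = \<ominus>\<^bsub>A\<^esub> h" if "x \<in> carrier A" "y \<in> carrier A" for x y
  proof -
    have "x \<oplus>\<^bsub>A\<^esub> h \<oplus>\<^bsub>A\<^esub> y = (x \<oplus>\<^bsub>A\<^esub> y) \<oplus>\<^bsub>A\<^esub> h" using that by (simp add: A.a_ac)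
    moreover have "p \<ominus>\<^bsub>A\<^esub> (p \<oplus>\<^bsub>A\<^esub> h) = \<ominus>\<^bsub>A\<^esub> h" if "p \<in> carrier A" for p
      using that by (simp add: A.minus_eq A.minus_add A.r_neg flip: A.a_assoc)
    ultimately show ?thesis using that by simp
  qed
  have "T (gE i) \<otimes>\<^bsub>op_alg A\<^esub> T (gF j) \<ominus>\<^bsub>op_alg A\<^esub> T (gF j) \<otimes>\<^bsub>op_alg A\<^esub> T (gE i) = \<ominus>\<^bsub>A\<^esub> h"
  proof -
    have "T (gF j) \<otimes>\<^bsub>A\<^esub> T (gE i) \<ominus>\<^bsub>A\<^esub> T (gE i) \<otimes>\<^bsub>A\<^esub> T (gF j) = \<ominus>\<^bsub>A\<^esub> h"
      unfolding TT' T'T by (rule canc) simp_all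
    then show ?thesis using T_closed[of "gE i"] T_closed[of "gF j"] i j by simp
  qed
  also have "\<ominus>\<^bsub>A\<^esub> h = (if i = j then ?c \<odot>\<^bsub>op_alg A\<^esub> (T (gK i) \<ominus>\<^bsub>op_alg A\<^esub> T (gKb i)) else \<zero>\<^bsub>op_alg A\<^esub>)"
    using i j by (simp add: h_def anti_gen.simps A.minus_smult A.minus_one_smult A.smult_r_distr A.a_comm)
  finally show "T (gE i) \<otimes>\<^bsub>op_alg A\<^esub> T (gF j) \<ominus>\<^bsub>op_alg A\<^esub> T (gF j) \<otimes>\<^bsub>op_alg A\<^esub> T (gE i) =
     (if i = j then ?c \<odot>\<^bsub>op_alg A\<^esub> (T (gK i) \<ominus>\<^bsub>op_alg A\<^esub> T (gKb i)) else \<zero>\<^bsub>op_alg A\<^esub>)" .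
qed

text \<open>The two summands of the image of a generator have zero products with each other, so they
  q-commute with any scalar and \<open>skew_add\<close> applies. The toral summands are covered by
  \<open>skew_twist\<close>, the others by \<open>skew_central\<close>, and
  \<open>skew_op_zero\<close> carries the result to the opposite algebra.\<close>

lemma T_serre_rels: "serre_rels P (op_alg A) T"
  unfolding serre_rels_def
proof (intro ballI impI)
  note [simp del] = anti_gen.simps
  fix X i j assume X: "X \<in> {gE, gF}" and ij: "i \<in> idx P" "j \<in> idx P" "i \<noteq> j \<and> (cartan P i i = 2 \<or> cartan P i j = 0)"
  then have sp: "serre_pair i j" by (simp add: serre_pair_def)
  note par = serre_pair_params[OF sp]
  let ?z = "qi P i powi cartan P i j" and ?t = "qi P i powi cartan P i i" and ?n = "nat (1 - cartan P i j)"
  note S = F.serre[OF X sp]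
  have z: "qi P j powi cartan P j i = ?z" using qi_powi_sym ij by simp
  obtain L L' s s' t' z' where L: "L \<in> toral_gens (idx P)" "L' \<in> toral_gens (idx P)"
    and T: "T (X i) = s \<odot>\<^bsub>A\<^esub> (W (X i) \<otimes>\<^bsub>A\<^esub> W L) \<oplus>\<^bsub>A\<^esub> r \<otimes>\<^bsub>A\<^esub> W (X i)"
      "T (X j) = s' \<odot>\<^bsub>A\<^esub> (W (X j) \<otimes>\<^bsub>A\<^esub> W L') \<oplus>\<^bsub>A\<^esub> r \<otimes>\<^bsub>A\<^esub> W (X j)"
    and q: "qcomm A t' (W L) (W (X i))" "qcomm A z' (W L) (W (X j))" "qcomm A z' (W L') (W (X i))"
  proof (cases "X = gE")
    case True
    then show thesis
      using that[of "gKb i" "gKb j" "\<mu> i" "\<mu> j" "inverse ?t" "inverse ?z"] ij z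
        F.Kb_E[of i i] F.Kb_E[of j i] F.Kb_E[of i j] by (simp add: anti_gen.simps)
  next
    case False
    then have "X = gF" using X by blast
    then show thesis
      using that[of "gK i" "gK j" "\<nu> i" "\<nu> j" "inverse ?t" "inverse ?z"] ij z
        F.K_F[of i i] F.K_F[of j i] F.K_F[of i j] by (simp add: anti_gen.simps)
  qed
  have Xc: "X i \<in> gens (idx P)" "X j \<in> gens (idx P)" using X ij by auto
  have kill: "qcomm A d (r \<otimes>\<^bsub>A\<^esub> y) (s \<odot>\<^bsub>A\<^esub> (x \<otimes>\<^bsub>A\<^esub> W k))"
    if "x \<in> carrier A" "y \<in> carrier A" "k \<in> toral_gens (idx P)" for d s x y k
  proof -
    have "x \<otimes>\<^bsub>A\<^esub> W k \<otimes>\<^bsub>A\<^esub> (r \<otimes>\<^bsub>A\<^esub> y) = x \<otimes>\<^bsub>A\<^esub> (W k \<otimes>\<^bsub>A\<^esub> r) \<otimes>\<^bsub>A\<^esub> y"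
      using that by (simp add: A.m_assoc)
    moreover have "r \<otimes>\<^bsub>A\<^esub> y \<otimes>\<^bsub>A\<^esub> (x \<otimes>\<^bsub>A\<^esub> W k) = (y \<otimes>\<^bsub>A\<^esub> x) \<otimes>\<^bsub>A\<^esub> (r \<otimes>\<^bsub>A\<^esub> W k)"
      using that r_central[of "y \<otimes>\<^bsub>A\<^esub> x"] by (simp add: A.m_assoc) (simp flip: A.m_assoc)
    ultimately show ?thesis using that by (simp add: qcomm_def toral_r r_toral)
  qed
  have LL: "W L \<otimes>\<^bsub>A\<^esub> W L' = W L' \<otimes>\<^bsub>A\<^esub> W L" using F.toral_commute[of L L'] L by blast
  have "skew A (T (X i)) (T (X j)) (\<lambda>k. ?z * ?t ^ k) ?n =
    skew A (s \<odot>\<^bsub>A\<^esub> (W (X i) \<otimes>\<^bsub>A\<^esub> W L)) (s' \<odot>\<^bsub>A\<^esub> (W (X j) \<otimes>\<^bsub>A\<^esub> W L')) (\<lambda>k. ?z * ?t ^ k) ?n \<oplus>\<^bsub>A\<^esub>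
    skew A (r \<otimes>\<^bsub>A\<^esub> W (X i)) (r \<otimes>\<^bsub>A\<^esub> W (X j)) (\<lambda>k. ?z * ?t ^ k) ?n"
    unfolding T by (rule A.skew_add) (use Xc L par in \<open>simp_all add: kill\<close>)
  also have "\<dots> = \<zero>\<^bsub>A\<^esub>"
    using Xc L by (simp add: A.skew_smult A.skew_twist[OF q LL] A.skew_central[OF r_central] S del: A.nat_pow_Suc)
  finally show "skew (op_alg A) (T (X i)) (T (X j)) (\<lambda>k. ?z * ?t ^ k) ?n = \<zero>\<^bsub>op_alg A\<^esub>"
    using A.skew_op_zero[OF T_closed T_closed par(1-3)] Xc by simp
qed

lemma wU_rels_T: "wU_rels P (op_alg A) T"
  using T_closed T_J_rels T_type_rels T_EF_rels T_serre_rels by (simp add: wU_rels_def)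

definition anti :: "(gen list \<Rightarrow>\<^sub>0 'a) set \<Rightarrow> (gen list \<Rightarrow>\<^sub>0 'a) set" where
  "anti = (THE f. f \<in> extensional (carrier A) \<and> alg_hom A (op_alg A) f \<and> (\<forall>g\<in>gens (idx P). f (W g) = T g))"

lemma anti: "anti \<in> extensional (carrier A)" "alg_hom A (op_alg A) anti"
  "g \<in> gens (idx P) \<Longrightarrow> anti (W g) = T g"
  using theI'[OF wU_hom_exists[OF A.kalg_op wU_rels_T], folded anti_def] by auto

lemmas anti_simps = alg_homD[OF anti(2), unfolded op_alg_simps]

end

section \<open>Convolution and weak antipodes\<close>

context wU_setup
begin

abbreviation conv :: "((gen list \<Rightarrow>\<^sub>0 'k) set \<Rightarrow> (gen list \<Rightarrow>\<^sub>0 'k) set) \<Rightarrow> _ \<Rightarrow> (gen list \<Rightarrow>\<^sub>0 'k) set \<Rightarrow> (gen list \<Rightarrow>\<^sub>0 'k) set" where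
  "conv f g x \<equiv> tensor_lift A A A (\<lambda>a b. f a \<otimes>\<^bsub>A\<^esub> g b) (\<Delta> x)"

lemma convolution_wU [simp]: "convolution H f g x = conv f g x"
  by (simp add: convolution_def)

section \<open>The complementary idempotent and maps compatible with the splitting\<close>

definition \<rho> :: "(gen list \<Rightarrow>\<^sub>0 'k) set" where
  "\<rho> = \<one>\<^bsub>A\<^esub> \<ominus>\<^bsub>A\<^esub> e"

lemma \<rho>_closed [simp]: "\<rho> \<in> carrier A"
  by (simp add: \<rho>_def)

lemma \<rho>_central: "x \<in> carrier A \<Longrightarrow> \<rho> \<otimes>\<^bsub>A\<^esub> x = x \<otimes>\<^bsub>A\<^esub> \<rho>"
  by (simp add: \<rho>_def A.minus_smult A.l_distr A.r_distr e_central)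

lemma \<rho>_mult: "x \<in> carrier A \<Longrightarrow> \<rho> \<otimes>\<^bsub>A\<^esub> x = x \<ominus>\<^bsub>A\<^esub> e \<otimes>\<^bsub>A\<^esub> x"
  by (simp add: \<rho>_def A.minus_smult A.l_distr)

lemma \<rho>_e: "\<rho> \<otimes>\<^bsub>A\<^esub> e = \<zero>\<^bsub>A\<^esub>"
  by (simp add: \<rho>_mult F.e_idem A.minus_eq A.r_neg)

lemma \<rho>_idem: "\<rho> \<otimes>\<^bsub>A\<^esub> \<rho> = \<rho>"
  using \<rho>_mult[of \<rho>] \<rho>_e e_central[of \<rho>] by (simp add: A.minus_eq)

lemma \<rho>_grouplike: "x \<in> {gJ} \<union> toral_gens (idx P) \<Longrightarrow> \<rho> \<otimes>\<^bsub>A\<^esub> W x = \<zero>\<^bsub>A\<^esub>"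
proof -
  assume x: "x \<in> {gJ} \<union> toral_gens (idx P)"
  then have "x \<in> gens (idx P)" "e \<otimes>\<^bsub>A\<^esub> W x = W x" using F.e_J F.e_toral by auto
  then show ?thesis by (simp add: \<rho>_mult A.minus_eq A.r_neg)
qed

lemma \<rho>_type_zero:
  "\<lbrakk>i \<in> idx P; type_E P i = 0\<rbrakk> \<Longrightarrow> \<rho> \<otimes>\<^bsub>A\<^esub> W (gE i) = \<zero>\<^bsub>A\<^esub>"
  "\<lbrakk>i \<in> idx P; type_F P i = 0\<rbrakk> \<Longrightarrow> \<rho> \<otimes>\<^bsub>A\<^esub> W (gF i) = \<zero>\<^bsub>A\<^esub>"
  using F.e_E0[of i i] F.e_F0[of i i] by (simp_all add: \<rho>_mult A.minus_eq A.r_neg)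

lemma e_\<rho>_eqI:
  assumes "x \<in> carrier A" "y \<in> carrier A" "e \<otimes>\<^bsub>A\<^esub> x = e \<otimes>\<^bsub>A\<^esub> y" "\<rho> \<otimes>\<^bsub>A\<^esub> x = \<rho> \<otimes>\<^bsub>A\<^esub> y"
  shows "x = y"
proof -
  have "z = \<rho> \<otimes>\<^bsub>A\<^esub> z \<oplus>\<^bsub>A\<^esub> e \<otimes>\<^bsub>A\<^esub> z" if "z \<in> carrier A" for z
    using that by (simp add: \<rho>_mult A.minus_eq A.a_assoc A.l_neg)
  then show ?thesis using assms by metis
qed

lemma central_cancel:
  assumes c: "\<And>x. x \<in> carrier A \<Longrightarrow> c \<otimes>\<^bsub>A\<^esub> x = x \<otimes>\<^bsub>A\<^esub> c" "c \<in> carrier A" "c \<otimes>\<^bsub>A\<^esub> c = c"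
    and "x \<in> carrier A" "y \<in> carrier A"
  shows "c \<otimes>\<^bsub>A\<^esub> x \<otimes>\<^bsub>A\<^esub> (c \<otimes>\<^bsub>A\<^esub> y) = c \<otimes>\<^bsub>A\<^esub> (x \<otimes>\<^bsub>A\<^esub> y)"
proof -
  have "c \<otimes>\<^bsub>A\<^esub> x \<otimes>\<^bsub>A\<^esub> (c \<otimes>\<^bsub>A\<^esub> y) = c \<otimes>\<^bsub>A\<^esub> (x \<otimes>\<^bsub>A\<^esub> c) \<otimes>\<^bsub>A\<^esub> y" using assms(2,4,5) by (simp add: A.m_assoc)
  also have "\<dots> = (c \<otimes>\<^bsub>A\<^esub> c) \<otimes>\<^bsub>A\<^esub> x \<otimes>\<^bsub>A\<^esub> y" unfolding c(1)[OF assms(4), symmetric] using assms(2,4,5) by (simp add: A.m_assoc)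
  finally show ?thesis unfolding assms(3) using assms(2,4,5) by (simp add: A.m_assoc)
qed

text \<open>Such maps preserve both summands. As \<open>e\<close> is group-like, convolution stays
  within this class, so iterated convolutions can be compared on one summand at a time.\<close>

definition e_linear :: "((gen list \<Rightarrow>\<^sub>0 'k) set \<Rightarrow> (gen list \<Rightarrow>\<^sub>0 'k) set) \<Rightarrow> bool" where
  "e_linear f \<longleftrightarrow> k_linear A A f \<and> (\<forall>x\<in>carrier A. f (e \<otimes>\<^bsub>A\<^esub> x) = e \<otimes>\<^bsub>A\<^esub> f x)"

lemma e_linearD:
  assumes "e_linear f"
  shows "k_linear A A f" "x \<in> carrier A \<Longrightarrow> f x \<in> carrier A" "x \<in> carrier A \<Longrightarrow> f (e \<otimes>\<^bsub>A\<^esub> x) = e \<otimes>\<^bsub>A\<^esub> f x"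
    "x \<in> carrier A \<Longrightarrow> f (\<rho> \<otimes>\<^bsub>A\<^esub> x) = \<rho> \<otimes>\<^bsub>A\<^esub> f x"
proof -
  show f: "k_linear A A f" "x \<in> carrier A \<Longrightarrow> f x \<in> carrier A" "x \<in> carrier A \<Longrightarrow> f (e \<otimes>\<^bsub>A\<^esub> x) = e \<otimes>\<^bsub>A\<^esub> f x"
    using assms by (auto simp: e_linear_def k_linearD)
  then show "x \<in> carrier A \<Longrightarrow> f (\<rho> \<otimes>\<^bsub>A\<^esub> x) = \<rho> \<otimes>\<^bsub>A\<^esub> f x"
    by (simp add: \<rho>_mult k_linear_diff[OF A.kalg_axioms A.kalg_axioms f(1)])
qed

lemma conv_bilin:
  assumes "k_linear A A f" "k_linear A A g"
  shows "bilin A A A (\<lambda>a b. f a \<otimes>\<^bsub>A\<^esub> g b)"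
  by (rule AA.bilin_precomp[OF A.bilin_mult assms])

lemmas conv_lift = AA.tensor_lift[OF A.kalg_axioms conv_bilin]

lemma conv_linear:
  assumes "k_linear A A f" "k_linear A A g"
  shows "k_linear A A (conv f g)"
  by (rule k_linear_comp[OF alg_homD(1)[OF wDelta(2)] conv_lift(1)[OF assms]])

lemma conv_e_linear:
  assumes "e_linear f" "e_linear g"
  shows "e_linear (conv f g)"
proof -
  note f = e_linearD[OF assms(1)] and g = e_linearD[OF assms(2)]
  let ?L = "tensor_lift A A A (\<lambda>a b. f a \<otimes>\<^bsub>A\<^esub> g b)"
  note L = conv_lift[OF f(1) g(1)]
  have "?L (pt2 e e \<otimes>\<^bsub>T2\<^esub> t) = e \<otimes>\<^bsub>A\<^esub> ?L t" if "t \<in> carrier T2" for t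
    using that
    by (induction rule: AA.tensor_induct)
      (use k_linearD[OF L(1)] k_linear_zero[OF AA.T.kalg_axioms A.kalg_axioms L(1)] in
        \<open>simp_all add: L(2) f g central_cancel[OF e_central] F.e_idem AA.T.r_distr A.r_distr\<close>)
  then show ?thesis
    using conv_linear[OF f(1) g(1)] by (simp add: e_linear_def \<Delta> \<Delta>_e)
qed

text \<open>An e-linear map commutes with multiplication by \<rho>, hence \<rho> f(a) g(b) =
  f(\<rho> a) g(\<rho> b). Although the coproduct of \<rho> is 1 \<otimes> 1 - e \<otimes> e, only
  the component in \<rho> A \<otimes> \<rho> A contributes.\<close>

lemma \<rho>_conv:
  assumes "e_linear f" "e_linear g" "x \<in> carrier A"
  shows "\<rho> \<otimes>\<^bsub>A\<^esub> conv f g x = tensor_lift A A A (\<lambda>a b. f a \<otimes>\<^bsub>A\<^esub> g b) (pt2 \<rho> \<rho> \<otimes>\<^bsub>T2\<^esub> \<Delta> x)"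
proof -
  note f = e_linearD[OF assms(1)] and g = e_linearD[OF assms(2)]
  let ?L = "tensor_lift A A A (\<lambda>a b. f a \<otimes>\<^bsub>A\<^esub> g b)"
  note L = conv_lift[OF f(1) g(1)]
  have "?L (pt2 \<rho> \<rho> \<otimes>\<^bsub>T2\<^esub> t) = \<rho> \<otimes>\<^bsub>A\<^esub> ?L t" if "t \<in> carrier T2" for t
    using that
    by (induction rule: AA.tensor_induct)
      (use k_linearD[OF L(1)] k_linear_zero[OF AA.T.kalg_axioms A.kalg_axioms L(1)] in
        \<open>simp_all add: L(2) f g central_cancel[OF \<rho>_central] \<rho>_idem AA.T.r_distr A.r_distr\<close>)
  then show ?thesis using assms(3) by (simp add: \<Delta>)
qed

section \<open>Triangular words in the summand cut out by \<rho>\<close>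

definition F_word :: "nat list \<Rightarrow> (gen list \<Rightarrow>\<^sub>0 'k) set" where "F_word js = ev A W (map gF js)"
definition E_word :: "nat list \<Rightarrow> (gen list \<Rightarrow>\<^sub>0 'k) set" where "E_word is = ev A W (map gE is)"

abbreviation "I1E \<equiv> {i \<in> idx P. type_E P i = 1}"
abbreviation "I1F \<equiv> {i \<in> idx P. type_F P i = 1}"

lemma F_word_simps [simp]: "F_word [] = \<one>\<^bsub>A\<^esub>" "F_word (j # js) = W (gF j) \<otimes>\<^bsub>A\<^esub> F_word js"
  by (simp_all add: F_word_def)

lemma E_word_simps [simp]: "E_word [] = \<one>\<^bsub>A\<^esub>" "E_word (i # is) = W (gE i) \<otimes>\<^bsub>A\<^esub> E_word is"
  by (simp_all add: E_word_def)

lemma F_word_closed [simp]: "set js \<subseteq> I1F \<Longrightarrow> F_word js \<in> carrier A"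
  by (induction js) auto

lemma E_word_closed [simp]: "set is \<subseteq> I1E \<Longrightarrow> E_word is \<in> carrier A"
  by (induction "is") auto

text \<open>The commutator of E_i and F_j is toral, and \<rho> annihilates toral elements.\<close>

lemma \<rho>_EF:
  assumes "i \<in> idx P" "j \<in> idx P"
  shows "\<rho> \<otimes>\<^bsub>A\<^esub> (W (gE i) \<otimes>\<^bsub>A\<^esub> W (gF j)) = \<rho> \<otimes>\<^bsub>A\<^esub> (W (gF j) \<otimes>\<^bsub>A\<^esub> W (gE i))"
  using assms by (simp add: F.EF A.r_distr A.minus_smult \<rho>_grouplike)

lemma \<rho>_E_F_word:
  assumes "i \<in> idx P" "set js \<subseteq> I1F"
  shows "\<rho> \<otimes>\<^bsub>A\<^esub> (W (gE i) \<otimes>\<^bsub>A\<^esub> F_word js) = \<rho> \<otimes>\<^bsub>A\<^esub> (F_word js \<otimes>\<^bsub>A\<^esub> W (gE i))"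
  using assms(2)
proof (induction js)
  case (Cons j js)
  let ?E = "W (gE i)" and ?F = "W (gF j)" and ?w = "F_word js"
  have [simp]: "?E \<in> carrier A" "?F \<in> carrier A" "?w \<in> carrier A" using Cons assms by simp_all
  have "\<rho> \<otimes>\<^bsub>A\<^esub> (?E \<otimes>\<^bsub>A\<^esub> (?F \<otimes>\<^bsub>A\<^esub> ?w)) = \<rho> \<otimes>\<^bsub>A\<^esub> (?E \<otimes>\<^bsub>A\<^esub> ?F) \<otimes>\<^bsub>A\<^esub> ?w" by (simp add: A.m_assoc)
  also have "\<dots> = (\<rho> \<otimes>\<^bsub>A\<^esub> ?F) \<otimes>\<^bsub>A\<^esub> (?E \<otimes>\<^bsub>A\<^esub> ?w)" using \<rho>_EF[of i j] Cons assms by (simp add: A.m_assoc)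
  also have "\<dots> = ?F \<otimes>\<^bsub>A\<^esub> (\<rho> \<otimes>\<^bsub>A\<^esub> (?E \<otimes>\<^bsub>A\<^esub> ?w))" by (simp add: \<rho>_central[of ?F] A.m_assoc)
  also have "\<dots> = (?F \<otimes>\<^bsub>A\<^esub> \<rho>) \<otimes>\<^bsub>A\<^esub> (?w \<otimes>\<^bsub>A\<^esub> ?E)" using Cons by (simp add: A.m_assoc)
  also have "\<dots> = \<rho> \<otimes>\<^bsub>A\<^esub> (?F \<otimes>\<^bsub>A\<^esub> ?w \<otimes>\<^bsub>A\<^esub> ?E)" by (simp add: \<rho>_central[of ?F, symmetric] A.m_assoc)
  finally show ?case by simp
qed (use assms in simp)

text \<open>After multiplication by \<rho>, group-like generators and those of type zero become 0,
  and every E_i can be moved to the right past the F_j. The coproduct of what remains is accessible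
  through \<open>\<rho>_\<Delta>_words\<close>.\<close>

lemma \<rho>_word:
  assumes "set w \<subseteq> gens (idx P)"
  shows "\<rho> \<otimes>\<^bsub>A\<^esub> ev A W w = \<zero>\<^bsub>A\<^esub> \<or>
    (\<exists>js is. set js \<subseteq> I1F \<and> set is \<subseteq> I1E \<and> \<rho> \<otimes>\<^bsub>A\<^esub> ev A W w = \<rho> \<otimes>\<^bsub>A\<^esub> (F_word js \<otimes>\<^bsub>A\<^esub> E_word is))"
  using assms
proof (induction w)
  case Nil
  show ?case by (intro disjI2 exI[of _ "[]"]) simp
next
  case (Cons g w)
  let ?w = "ev A W w"
  have g: "g \<in> gens (idx P)" and w: "?w \<in> carrier A" using Cons by simp_all
  have split: "\<rho> \<otimes>\<^bsub>A\<^esub> (W g \<otimes>\<^bsub>A\<^esub> ?w) = (\<rho> \<otimes>\<^bsub>A\<^esub> W g) \<otimes>\<^bsub>A\<^esub> ?w" using g w by (simp add: A.m_assoc)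
  have split': "\<rho> \<otimes>\<^bsub>A\<^esub> (W g \<otimes>\<^bsub>A\<^esub> y) = W g \<otimes>\<^bsub>A\<^esub> (\<rho> \<otimes>\<^bsub>A\<^esub> y)" if "y \<in> carrier A" for y
    using g that \<rho>_central[of "W g"] by (simp flip: A.m_assoc)
  show ?case
  proof (cases "\<rho> \<otimes>\<^bsub>A\<^esub> W g = \<zero>\<^bsub>A\<^esub> \<or> \<rho> \<otimes>\<^bsub>A\<^esub> ?w = \<zero>\<^bsub>A\<^esub>")
    case True
    then have "\<rho> \<otimes>\<^bsub>A\<^esub> (W g \<otimes>\<^bsub>A\<^esub> ?w) = \<zero>\<^bsub>A\<^esub>"
    proof
      assume "\<rho> \<otimes>\<^bsub>A\<^esub> W g = \<zero>\<^bsub>A\<^esub>" then show ?thesis unfolding split using w by simp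
    next
      assume "\<rho> \<otimes>\<^bsub>A\<^esub> ?w = \<zero>\<^bsub>A\<^esub>" then show ?thesis unfolding split'[OF w] using g by simp
    qed
    then show ?thesis by simp
  next
    case False
    then obtain js "is" where jsis: "set js \<subseteq> I1F" "set is \<subseteq> I1E"
      and rw: "\<rho> \<otimes>\<^bsub>A\<^esub> ?w = \<rho> \<otimes>\<^bsub>A\<^esub> (F_word js \<otimes>\<^bsub>A\<^esub> E_word is)" using Cons by auto
    note [simp] = F_word_closed[OF jsis(1)] E_word_closed[OF jsis(2)]
    have gw: "\<rho> \<otimes>\<^bsub>A\<^esub> ev A W (g # w) = \<rho> \<otimes>\<^bsub>A\<^esub> (W g \<otimes>\<^bsub>A\<^esub> (F_word js \<otimes>\<^bsub>A\<^esub> E_word is))"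
      using split'[OF w] split'[of "F_word js \<otimes>\<^bsub>A\<^esub> E_word is"] rw by simp
    from g show ?thesis
    proof (cases rule: gens_cases)
      case 1
      then show ?thesis using False \<rho>_grouplike by blast
    next
      case (2 i)
      then have i: "i \<in> I1E" using False \<rho>_type_zero type_cases by blast
      have "\<rho> \<otimes>\<^bsub>A\<^esub> ev A W (g # w) = (\<rho> \<otimes>\<^bsub>A\<^esub> (W (gE i) \<otimes>\<^bsub>A\<^esub> F_word js)) \<otimes>\<^bsub>A\<^esub> E_word is"
        unfolding gw using 2 by (simp add: A.m_assoc)
      also have "\<dots> = \<rho> \<otimes>\<^bsub>A\<^esub> (F_word js \<otimes>\<^bsub>A\<^esub> E_word (i # is))"
        unfolding \<rho>_E_F_word[OF 2(1) jsis(1)] using 2 by (simp add: A.m_assoc)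
      finally have "\<rho> \<otimes>\<^bsub>A\<^esub> ev A W (g # w) = \<rho> \<otimes>\<^bsub>A\<^esub> (F_word js \<otimes>\<^bsub>A\<^esub> E_word (i # is))" .
      moreover have "set (i # is) \<subseteq> I1E" using i jsis by simp
      ultimately show ?thesis using jsis(1) by blast
    next
      case (3 j)
      then have j: "j \<in> I1F" using False \<rho>_type_zero type_cases by blast
      have "\<rho> \<otimes>\<^bsub>A\<^esub> ev A W (g # w) = \<rho> \<otimes>\<^bsub>A\<^esub> (F_word (j # js) \<otimes>\<^bsub>A\<^esub> E_word is)"
        unfolding gw using 3 by (simp add: A.m_assoc)
      moreover have "set (j # js) \<subseteq> I1F" using j jsis by simp
      ultimately show ?thesis using jsis(2) by blast
    qed
  qed
qed

text \<open>The summand E_i \<otimes> K_i is annihilated, and the unit of a type one generator is 1.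
  So left multiplication by E_i acts on the second tensor factor only.\<close>

lemma \<rho>_\<Delta>_E:
  assumes "i \<in> I1E" "x \<in> carrier A"
  shows "pt2 \<rho> \<rho> \<otimes>\<^bsub>T2\<^esub> \<Delta> (W (gE i) \<otimes>\<^bsub>A\<^esub> x) = pt2 \<one>\<^bsub>A\<^esub> (W (gE i)) \<otimes>\<^bsub>T2\<^esub> (pt2 \<rho> \<rho> \<otimes>\<^bsub>T2\<^esub> \<Delta> x)"
proof -
  have i: "i \<in> idx P" and u: "uE i = \<one>\<^bsub>A\<^esub>" using assms by (simp_all add: type_unit_def)
  have "pt2 \<rho> \<rho> \<otimes>\<^bsub>T2\<^esub> \<Delta> (W (gE i)) = pt2 \<one>\<^bsub>A\<^esub> (W (gE i)) \<otimes>\<^bsub>T2\<^esub> pt2 \<rho> \<rho>"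
    using i by (simp add: \<Delta>_EF u AA.T.r_distr \<rho>_grouplike \<rho>_central[of "W (gE i)"])
  then have "pt2 \<rho> \<rho> \<otimes>\<^bsub>T2\<^esub> (\<Delta> (W (gE i)) \<otimes>\<^bsub>T2\<^esub> \<Delta> x) = pt2 \<one>\<^bsub>A\<^esub> (W (gE i)) \<otimes>\<^bsub>T2\<^esub> pt2 \<rho> \<rho> \<otimes>\<^bsub>T2\<^esub> \<Delta> x"
    using i assms(2) by (simp add: \<Delta> del: AA.pt_mult flip: AA.T.m_assoc)
  then show ?thesis using i assms(2) by (simp add: \<Delta> AA.T.m_assoc del: AA.pt_mult)
qed

lemma \<rho>_\<Delta>_F:
  assumes "i \<in> I1F" "x \<in> carrier A"
  shows "pt2 \<rho> \<rho> \<otimes>\<^bsub>T2\<^esub> \<Delta> (W (gF i) \<otimes>\<^bsub>A\<^esub> x) = pt2 (W (gF i)) \<one>\<^bsub>A\<^esub> \<otimes>\<^bsub>T2\<^esub> (pt2 \<rho> \<rho> \<otimes>\<^bsub>T2\<^esub> \<Delta> x)"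
proof -
  have i: "i \<in> idx P" and u: "uF i = \<one>\<^bsub>A\<^esub>" using assms by (simp_all add: type_unit_def)
  have "pt2 \<rho> \<rho> \<otimes>\<^bsub>T2\<^esub> \<Delta> (W (gF i)) = pt2 (W (gF i)) \<one>\<^bsub>A\<^esub> \<otimes>\<^bsub>T2\<^esub> pt2 \<rho> \<rho>"
    using i by (simp add: \<Delta>_EF u AA.T.r_distr \<rho>_grouplike \<rho>_central[of "W (gF i)"])
  then have "pt2 \<rho> \<rho> \<otimes>\<^bsub>T2\<^esub> (\<Delta> (W (gF i)) \<otimes>\<^bsub>T2\<^esub> \<Delta> x) = pt2 (W (gF i)) \<one>\<^bsub>A\<^esub> \<otimes>\<^bsub>T2\<^esub> pt2 \<rho> \<rho> \<otimes>\<^bsub>T2\<^esub> \<Delta> x"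
    using i assms(2) by (simp add: \<Delta> del: AA.pt_mult flip: AA.T.m_assoc)
  then show ?thesis using i assms(2) by (simp add: \<Delta> AA.T.m_assoc del: AA.pt_mult)
qed

text \<open>The F_j act on the first tensor factor and the E_i on the second, so the word is cut at
  exactly one place. Convolutions of such words thus reduce to a single product.\<close>

lemma \<rho>_\<Delta>_words:
  assumes "set js \<subseteq> I1F" "set is \<subseteq> I1E"
  shows "pt2 \<rho> \<rho> \<otimes>\<^bsub>T2\<^esub> \<Delta> (F_word js \<otimes>\<^bsub>A\<^esub> E_word is) = pt2 (\<rho> \<otimes>\<^bsub>A\<^esub> F_word js) (\<rho> \<otimes>\<^bsub>A\<^esub> E_word is)"
  using assms(1)
proof (induction js)
  case Nil
  have "pt2 \<rho> \<rho> \<otimes>\<^bsub>T2\<^esub> \<Delta> (E_word is) = pt2 \<rho> (\<rho> \<otimes>\<^bsub>A\<^esub> E_word is)"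
    using assms(2)
  proof (induction "is")
    case (Cons i "is")
    then have "W (gE i) \<in> carrier A" "E_word is \<in> carrier A" by auto
    then show ?case using Cons \<rho>_central[of "W (gE i)"] by (simp add: \<rho>_\<Delta>_E flip: A.m_assoc)
  qed (simp add: \<Delta>)
  then show ?case using assms by simp
next
  case (Cons j js)
  then have "W (gF j) \<in> carrier A" "F_word js \<in> carrier A" "E_word is \<in> carrier A" using assms by auto
  then show ?case using Cons \<rho>_central[of "W (gF j)"]
    by (simp add: A.m_assoc \<rho>_\<Delta>_F) (simp flip: A.m_assoc)
qed

end

text \<open>The sign -1 is that of the usual antipode and determines \<nu> through the
  normalisation. The element \<open>r\<close> stays free, so that one proof covers the given map, r
  = 0, and its bijective modification, r = \<rho>.\<close>

locale wU_weak = wU_anti +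
  assumes \<mu>_minus_one: "\<And>i. \<mu> i = - 1" and Jexp_2_3: "Jexp P = 2 \<or> Jexp P = 3"
begin

abbreviation "S \<equiv> anti"

lemma S_linear: "k_linear A A S"
  using alg_homD(1)[OF anti(2)] by (simp add: k_linear_def)

lemma S_closed [simp]: "x \<in> carrier A \<Longrightarrow> S x \<in> carrier A" by (rule anti_simps(2))

lemma S_mult: "\<lbrakk>x \<in> carrier A; y \<in> carrier A\<rbrakk> \<Longrightarrow> S (x \<otimes>\<^bsub>A\<^esub> y) = S y \<otimes>\<^bsub>A\<^esub> S x" by (rule anti_simps(5))

lemma S_e: "S e = e"
  unfolding J_idem_def by (subst alg_hom_pow[OF A.kalg_axioms A.kalg_op anti(2)]) (simp_all add: anti(3))

lemma S_type_unit: "S (type_unit P k) = type_unit P k"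
  using type_unit_cases[of k] S_e anti_simps(6) by auto

lemma S_e_linear: "e_linear S"
  using S_linear by (simp add: e_linear_def S_mult S_e e_central)

lemma id_e_linear: "e_linear (\<lambda>x. x)"
  by (simp add: e_linear_def k_linear_id)

lemma nu_eq: "i \<in> idx P \<Longrightarrow> \<nu> i = - inverse (qi P i powi cartan P i i)"
  using \<mu>\<nu>[of i] \<mu>_minus_one[of i] qi_neq[of i] by (simp add: field_simps) (metis minus_equation_iff mult_minus_left)

lemma S_E: "i \<in> idx P \<Longrightarrow> S (W (gE i)) = \<ominus>\<^bsub>A\<^esub> (W (gE i) \<otimes>\<^bsub>A\<^esub> W (gKb i)) \<oplus>\<^bsub>A\<^esub> r \<otimes>\<^bsub>A\<^esub> W (gE i)"
  by (simp add: anti(3) \<mu>_minus_one A.minus_one_smult)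

text \<open>The value of \<nu> is minus the weight with which K_i passes F_i; rewriting F_i K_i as
  K_i F_i absorbs it and gives the prescribed form of the image.\<close>

lemma S_F: "i \<in> idx P \<Longrightarrow> S (W (gF i)) = \<ominus>\<^bsub>A\<^esub> (W (gK i) \<otimes>\<^bsub>A\<^esub> W (gF i)) \<oplus>\<^bsub>A\<^esub> r \<otimes>\<^bsub>A\<^esub> W (gF i)"
  using F.K_F[of i i] by (simp add: anti(3) nu_eq qcomm_def A.minus_one_smult)

lemma e_r: "x \<in> carrier A \<Longrightarrow> e \<otimes>\<^bsub>A\<^esub> (r \<otimes>\<^bsub>A\<^esub> x) = \<zero>\<^bsub>A\<^esub>"
  using r_e e_central[of r] by (simp flip: A.m_assoc)

lemma e_S_E: "i \<in> idx P \<Longrightarrow> e \<otimes>\<^bsub>A\<^esub> S (W (gE i)) = \<ominus>\<^bsub>A\<^esub> (W (gE i) \<otimes>\<^bsub>A\<^esub> W (gKb i))"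
proof -
  assume i: "i \<in> idx P"
  have "e \<otimes>\<^bsub>A\<^esub> (W (gE i) \<otimes>\<^bsub>A\<^esub> W (gKb i)) = W (gE i) \<otimes>\<^bsub>A\<^esub> (e \<otimes>\<^bsub>A\<^esub> W (gKb i))"
    using i e_central[of "W (gE i)"] by (simp flip: A.m_assoc)
  then show ?thesis using i by (simp add: S_E A.r_distr A.r_minus e_r F.e_toral)
qed

lemma e_S_F: "i \<in> idx P \<Longrightarrow> e \<otimes>\<^bsub>A\<^esub> S (W (gF i)) = \<ominus>\<^bsub>A\<^esub> (W (gK i) \<otimes>\<^bsub>A\<^esub> W (gF i))"
proof -
  assume i: "i \<in> idx P"
  have "e \<otimes>\<^bsub>A\<^esub> (W (gK i) \<otimes>\<^bsub>A\<^esub> W (gF i)) = W (gK i) \<otimes>\<^bsub>A\<^esub> W (gF i)"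
    using i by (simp add: F.e_toral flip: A.m_assoc)
  then show ?thesis using i by (simp add: S_F A.r_distr A.r_minus e_r)
qed

text \<open>Here \<open>m\<close> enters: \<open>J\<close> is its own inverse in \<open>J\<^bsup>m-1\<^esup> A\<close> because \<open>m - 1\<close> divides 2.\<close>

lemma grouplike_S:
  assumes "x \<in> {gJ} \<union> toral_gens (idx P)"
  shows "W x \<otimes>\<^bsub>A\<^esub> S (W x) = e" "S (W x) \<otimes>\<^bsub>A\<^esub> W x = e"
proof -
  have JJ: "W gJ \<otimes>\<^bsub>A\<^esub> W gJ = e"
    using Jexp_2_3
  proof
    assume m: "Jexp P = 2"
    then have "Jexp P = Suc (Suc 0)" "Jexp P - 1 = Suc 0" by simp_all
    then show ?thesis using F.J_pow by (simp add: J_idem_def)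
  next
    assume "Jexp P = 3"
    then have "Jexp P - 1 = Suc (Suc 0)" by simp
    then show ?thesis by (simp add: J_idem_def)
  qed
  show "W x \<otimes>\<^bsub>A\<^esub> S (W x) = e" "S (W x) \<otimes>\<^bsub>A\<^esub> W x = e"
    using assms unfolding toral_gens_def
    by (elim UnE imageE singletonE; simp add: anti(3) F.KKb F.KbK F.DDb F.DbD JJ)+
qed

section \<open>The antipode identities on the summand e A\<close>

abbreviation "Mr \<equiv> tensor_lift A A A (\<lambda>a b. a \<otimes>\<^bsub>A\<^esub> S b)"

lemmas Mr = conv_lift[OF k_linear_id S_linear]
lemmas Mr_lin = k_linearD[OF Mr(1)] k_linear_zero[OF AA.T.kalg_axioms A.kalg_axioms Mr(1)]

text \<open>\<open>S\<close> reverses products, so a new left factor of the coproduct wraps around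
  the value already obtained.\<close>

lemma Mr_mult:
  assumes "a \<in> carrier A" "b \<in> carrier A" "t \<in> carrier T2"
  shows "Mr (pt2 a b \<otimes>\<^bsub>T2\<^esub> t) = a \<otimes>\<^bsub>A\<^esub> Mr t \<otimes>\<^bsub>A\<^esub> S b"
  using assms(3)
  by (induction rule: AA.tensor_induct)
    (use assms(1,2) in \<open>simp_all add: Mr_lin Mr(2) S_mult A.m_assoc AA.T.r_distr A.r_distr A.l_distr\<close>)

text \<open>On e A the map \<open>S\<close> is an honest antipode. In the induction the inner value
  is \<epsilon>(x) e by hypothesis and can be pulled out, so only the contribution of one generator
  is left, and for E_i and F_i its two terms cancel.\<close>

lemma e_conv_id_S:
  assumes "x \<in> carrier A"
  shows "e \<otimes>\<^bsub>A\<^esub> conv (\<lambda>x. x) S x = \<epsilon> x \<odot>\<^bsub>A\<^esub> e"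
  using assms
proof (induction rule: wU_induct)
  case one
  then show ?case using Mr(2)[of "\<one>\<^bsub>A\<^esub>" "\<one>\<^bsub>A\<^esub>"] by (simp add: \<Delta> \<epsilon> anti_simps(6) flip: AA.pt_one)
next
  case (gen g x)
  let ?y = "Mr (\<Delta> x)"
  have y [simp]: "?y \<in> carrier A" and \<Delta>x [simp]: "\<Delta> x \<in> carrier T2" using gen by (simp_all add: \<Delta> Mr_lin)
  have ey: "e \<otimes>\<^bsub>A\<^esub> (a \<otimes>\<^bsub>A\<^esub> ?y \<otimes>\<^bsub>A\<^esub> b) = \<epsilon> x \<odot>\<^bsub>A\<^esub> (a \<otimes>\<^bsub>A\<^esub> (e \<otimes>\<^bsub>A\<^esub> b))"
    if "a \<in> carrier A" "b \<in> carrier A" for a b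
  proof -
    have "e \<otimes>\<^bsub>A\<^esub> (a \<otimes>\<^bsub>A\<^esub> ?y \<otimes>\<^bsub>A\<^esub> b) = (e \<otimes>\<^bsub>A\<^esub> a) \<otimes>\<^bsub>A\<^esub> (?y \<otimes>\<^bsub>A\<^esub> b)" using that by (simp add: A.m_assoc)
    also have "\<dots> = a \<otimes>\<^bsub>A\<^esub> (e \<otimes>\<^bsub>A\<^esub> ?y) \<otimes>\<^bsub>A\<^esub> b"
      unfolding e_central[OF that(1)] using that by (simp add: A.m_assoc)
    also have "\<dots> = \<epsilon> x \<odot>\<^bsub>A\<^esub> (a \<otimes>\<^bsub>A\<^esub> (e \<otimes>\<^bsub>A\<^esub> b))"
      unfolding gen(3) using that by (simp add: A.m_assoc)
    finally show ?thesis .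
  qed
  from gen(1) show ?case
  proof (cases rule: gens_cases)
    case 1
    have g: "W g \<in> carrier A" using gen by simp
    have "W g \<otimes>\<^bsub>A\<^esub> (e \<otimes>\<^bsub>A\<^esub> S (W g)) = e \<otimes>\<^bsub>A\<^esub> (W g \<otimes>\<^bsub>A\<^esub> S (W g))"
      using g e_central[OF g] by (simp flip: A.m_assoc)
    then have "W g \<otimes>\<^bsub>A\<^esub> (e \<otimes>\<^bsub>A\<^esub> S (W g)) = e" using grouplike_S[OF 1] by (simp add: F.e_idem)
    then show ?thesis using g gen by (simp add: \<Delta> \<epsilon> \<Delta>_grouplike[OF 1] \<epsilon>_grouplike[OF 1] Mr_mult ey)
  next
    case (2 i)
    have "e \<otimes>\<^bsub>A\<^esub> Mr (\<Delta> (W (gE i)) \<otimes>\<^bsub>T2\<^esub> \<Delta> x) = \<epsilon> x \<odot>\<^bsub>A\<^esub> (uE i \<otimes>\<^bsub>A\<^esub> (e \<otimes>\<^bsub>A\<^esub> S (W (gE i)))) \<oplus>\<^bsub>A\<^esub>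
        \<epsilon> x \<odot>\<^bsub>A\<^esub> (W (gE i) \<otimes>\<^bsub>A\<^esub> (e \<otimes>\<^bsub>A\<^esub> W (gKb i)))"
      using 2 by (simp add: \<Delta>_EF AA.T.l_distr Mr_lin Mr_mult A.r_distr ey) (simp add: anti(3))
    also have "uE i \<otimes>\<^bsub>A\<^esub> (e \<otimes>\<^bsub>A\<^esub> S (W (gE i))) = \<ominus>\<^bsub>A\<^esub> (W (gE i) \<otimes>\<^bsub>A\<^esub> W (gKb i))"
      using 2 by (simp add: e_S_E A.r_minus type_unit_E flip: A.m_assoc)
    finally show ?thesis using 2 gen by (simp add: \<Delta> \<epsilon> \<epsilon>_EF F.e_toral A.l_neg flip: A.smult_r_distr)
  next
    case (3 i)
    have "e \<otimes>\<^bsub>A\<^esub> Mr (\<Delta> (W (gF i)) \<otimes>\<^bsub>T2\<^esub> \<Delta> x) = \<epsilon> x \<odot>\<^bsub>A\<^esub> (W (gF i) \<otimes>\<^bsub>A\<^esub> (e \<otimes>\<^bsub>A\<^esub> uF i)) \<oplus>\<^bsub>A\<^esub>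
        \<epsilon> x \<odot>\<^bsub>A\<^esub> (W (gKb i) \<otimes>\<^bsub>A\<^esub> (e \<otimes>\<^bsub>A\<^esub> S (W (gF i))))"
      using 3 by (simp add: \<Delta>_EF AA.T.l_distr Mr_lin Mr_mult A.r_distr ey S_type_unit)
    also have "W (gKb i) \<otimes>\<^bsub>A\<^esub> (e \<otimes>\<^bsub>A\<^esub> S (W (gF i))) = \<ominus>\<^bsub>A\<^esub> (e \<otimes>\<^bsub>A\<^esub> W (gF i))"
      using 3 by (simp add: e_S_F A.r_minus F.KbK flip: A.m_assoc)
    also have "W (gF i) \<otimes>\<^bsub>A\<^esub> (e \<otimes>\<^bsub>A\<^esub> uF i) = e \<otimes>\<^bsub>A\<^esub> W (gF i)"
      using 3 e_central[of "W (gF i)"] e_central[of "uF i"] by (simp add: type_unit_e)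
    finally show ?thesis using 3 gen by (simp add: \<Delta> \<epsilon> \<epsilon>_EF A.r_neg flip: A.smult_r_distr)
  qed
qed (simp_all add: \<Delta> \<epsilon> Mr_lin A.r_distr A.smult_l_distr)

text \<open>In the convolution of S with the identity, a new left factor lands in the middle,
  between S(a) and b. The parameter \<open>z\<close> records what has accumulated there, and
  \<open>Ml_mult\<close> is the resulting recursion.\<close>

abbreviation "Ml z \<equiv> tensor_lift A A A (\<lambda>a b. S a \<otimes>\<^bsub>A\<^esub> (z \<otimes>\<^bsub>A\<^esub> b))"

lemma Ml_bilin: "z \<in> carrier A \<Longrightarrow> bilin A A A (\<lambda>a b. S a \<otimes>\<^bsub>A\<^esub> (z \<otimes>\<^bsub>A\<^esub> b))"
  by (rule conv_bilin[OF S_linear]) (simp add: k_linear_def A.r_distr)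

lemmas Ml = AA.tensor_lift[OF A.kalg_axioms Ml_bilin]
lemmas Ml_lin = k_linearD[OF Ml(1)] k_linear_zero[OF AA.T.kalg_axioms A.kalg_axioms Ml(1)]

lemma Ml_mult:
  assumes "z \<in> carrier A" "a \<in> carrier A" "b \<in> carrier A" "t \<in> carrier T2"
  shows "Ml z (pt2 a b \<otimes>\<^bsub>T2\<^esub> t) = Ml (S a \<otimes>\<^bsub>A\<^esub> (z \<otimes>\<^bsub>A\<^esub> b)) t"
  using assms(4)
  by (induction rule: AA.tensor_induct)
    (use assms(1-3) in \<open>simp_all add: Ml_lin Ml(2) S_mult A.m_assoc AA.T.r_distr\<close>)

lemma Ml_add:
  assumes "z \<in> carrier A" "z' \<in> carrier A" "t \<in> carrier T2"
  shows "Ml z t \<oplus>\<^bsub>A\<^esub> Ml z' t = Ml (z \<oplus>\<^bsub>A\<^esub> z') t"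
  using assms(3)
proof (induction rule: AA.tensor_induct)
  case (add s t)
  have "a \<oplus>\<^bsub>A\<^esub> b \<oplus>\<^bsub>A\<^esub> (c \<oplus>\<^bsub>A\<^esub> d) = a \<oplus>\<^bsub>A\<^esub> c \<oplus>\<^bsub>A\<^esub> (b \<oplus>\<^bsub>A\<^esub> d)"
    if "a \<in> carrier A" "b \<in> carrier A" "c \<in> carrier A" "d \<in> carrier A" for a b c d
    using that by (simp add: A.a_ac)
  from this[of "Ml z s" "Ml z t" "Ml z' s" "Ml z' t"] show ?case
    using add assms(1,2) by (simp add: Ml_lin)
qed (use assms(1,2) in \<open>simp_all add: Ml_lin Ml(2) A.l_distr A.r_distr\<close>)

lemma Ml_zero: "t \<in> carrier T2 \<Longrightarrow> Ml \<zero>\<^bsub>A\<^esub> t = \<zero>\<^bsub>A\<^esub>"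
  by (induction rule: AA.tensor_induct) (simp_all add: Ml_lin Ml(2))

lemma Ml_e: "t \<in> carrier T2 \<Longrightarrow> Ml e t = e \<otimes>\<^bsub>A\<^esub> tensor_lift A A A (\<lambda>a b. S a \<otimes>\<^bsub>A\<^esub> b) t"
proof (induction rule: AA.tensor_induct)
  case (pure a b)
  then have "S a \<otimes>\<^bsub>A\<^esub> (e \<otimes>\<^bsub>A\<^esub> b) = e \<otimes>\<^bsub>A\<^esub> (S a \<otimes>\<^bsub>A\<^esub> b)"
    using e_central[of "S a"] by (simp flip: A.m_assoc)
  then show ?case using pure by (simp add: Ml(2) conv_lift(2)[OF S_linear k_linear_id])
qed (use k_linearD[OF conv_lift(1)[OF S_linear k_linear_id]]
    k_linear_zero[OF AA.T.kalg_axioms A.kalg_axioms conv_lift(1)[OF S_linear k_linear_id]] in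
    \<open>simp_all add: Ml_lin A.r_distr\<close>)

text \<open>Start with \<open>e\<close> in the middle. A generator contributes there the sum of
  S(g') e g'' over its coproduct, which equals \<epsilon>(g) e, so the recursion closes.\<close>

lemma e_conv_S_id:
  assumes "x \<in> carrier A"
  shows "e \<otimes>\<^bsub>A\<^esub> conv S (\<lambda>x. x) x = \<epsilon> x \<odot>\<^bsub>A\<^esub> e"
proof -
  have "Ml e (\<Delta> x) = \<epsilon> x \<odot>\<^bsub>A\<^esub> e"
    using assms
  proof (induction rule: wU_induct)
    case one
    then show ?case using Ml(2)[of e "\<one>\<^bsub>A\<^esub>" "\<one>\<^bsub>A\<^esub>"] by (simp add: \<Delta> \<epsilon> anti_simps(6) flip: AA.pt_one)
  next
    case (gen g x)
    have \<Delta>x [simp]: "\<Delta> x \<in> carrier T2" using gen by (simp add: \<Delta>)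
    from gen(1) show ?case
    proof (cases rule: gens_cases)
      case 1
      have g: "W g \<in> carrier A" using gen by simp
      have "S (W g) \<otimes>\<^bsub>A\<^esub> (e \<otimes>\<^bsub>A\<^esub> W g) = S (W g) \<otimes>\<^bsub>A\<^esub> W g \<otimes>\<^bsub>A\<^esub> e"
        using g e_central[OF g] by (simp add: A.m_assoc)
      then have "S (W g) \<otimes>\<^bsub>A\<^esub> (e \<otimes>\<^bsub>A\<^esub> W g) = e" using grouplike_S[OF 1] by (simp add: F.e_idem)
      then show ?thesis using g gen by (simp add: \<Delta> \<epsilon> \<Delta>_grouplike[OF 1] \<epsilon>_grouplike[OF 1] Ml_mult)
    next
      case (2 i)
      have "Ml e (\<Delta> (W (gE i)) \<otimes>\<^bsub>T2\<^esub> \<Delta> x) =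
          Ml (uE i \<otimes>\<^bsub>A\<^esub> (e \<otimes>\<^bsub>A\<^esub> W (gE i)) \<oplus>\<^bsub>A\<^esub> S (W (gE i)) \<otimes>\<^bsub>A\<^esub> (e \<otimes>\<^bsub>A\<^esub> W (gK i))) (\<Delta> x)"
        using 2 by (simp add: \<Delta>_EF AA.T.l_distr Ml_lin Ml_mult Ml_add S_type_unit)
      also have "uE i \<otimes>\<^bsub>A\<^esub> (e \<otimes>\<^bsub>A\<^esub> W (gE i)) = e \<otimes>\<^bsub>A\<^esub> W (gE i)"
        using 2 by (simp add: type_unit_e flip: A.m_assoc)
      also have "S (W (gE i)) \<otimes>\<^bsub>A\<^esub> (e \<otimes>\<^bsub>A\<^esub> W (gK i)) = (e \<otimes>\<^bsub>A\<^esub> S (W (gE i))) \<otimes>\<^bsub>A\<^esub> W (gK i)"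
        using 2 e_central[of "S (W (gE i))"] by (simp flip: A.m_assoc)
      also have "\<dots> = \<ominus>\<^bsub>A\<^esub> (e \<otimes>\<^bsub>A\<^esub> W (gE i))"
        using 2 e_central[of "W (gE i)"] by (simp add: e_S_E A.l_minus A.m_assoc F.KbK)
      finally show ?thesis using 2 gen by (simp add: \<Delta> \<epsilon> \<epsilon>_EF A.r_neg Ml_zero)
    next
      case (3 i)
      have "Ml e (\<Delta> (W (gF i)) \<otimes>\<^bsub>T2\<^esub> \<Delta> x) =
          Ml (S (W (gF i)) \<otimes>\<^bsub>A\<^esub> (e \<otimes>\<^bsub>A\<^esub> uF i) \<oplus>\<^bsub>A\<^esub> W (gK i) \<otimes>\<^bsub>A\<^esub> (e \<otimes>\<^bsub>A\<^esub> W (gF i))) (\<Delta> x)"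
        using 3 by (simp add: \<Delta>_EF AA.T.l_distr Ml_lin Ml_mult Ml_add) (simp add: anti(3))
      also have "S (W (gF i)) \<otimes>\<^bsub>A\<^esub> (e \<otimes>\<^bsub>A\<^esub> uF i) = e \<otimes>\<^bsub>A\<^esub> S (W (gF i))"
        using 3 e_central[of "S (W (gF i))"] e_central[of "uF i"] by (simp add: type_unit_e)
      also have "\<dots> = \<ominus>\<^bsub>A\<^esub> (W (gK i) \<otimes>\<^bsub>A\<^esub> W (gF i))"
        using 3 by (simp add: e_S_F)
      also have "W (gK i) \<otimes>\<^bsub>A\<^esub> (e \<otimes>\<^bsub>A\<^esub> W (gF i)) = W (gK i) \<otimes>\<^bsub>A\<^esub> W (gF i)"
        using 3 by (simp add: F.toral_e flip: A.m_assoc)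
      finally show ?thesis using 3 gen by (simp add: \<Delta> \<epsilon> \<epsilon>_EF A.l_neg Ml_zero)
    qed
  qed (simp_all add: \<Delta> \<epsilon> Ml_lin A.smult_l_distr)
  then show ?thesis using Ml_e[of "\<Delta> x"] assms by (simp add: \<Delta>)
qed

text \<open>On e A the map \<open>f\<close> is the counit, the neutral element of convolution, and
  the counit law removes it.\<close>

lemma e_conv:
  assumes f: "e_linear f" and g: "e_linear g" and fe: "\<And>x. x \<in> carrier A \<Longrightarrow> e \<otimes>\<^bsub>A\<^esub> f x = \<epsilon> x \<odot>\<^bsub>A\<^esub> e"
    and x: "x \<in> carrier A"
  shows "e \<otimes>\<^bsub>A\<^esub> conv f g x = e \<otimes>\<^bsub>A\<^esub> g x"
proof -
  note f' = e_linearD[OF f] and g' = e_linearD[OF g]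
  let ?L = "tensor_lift A A A (\<lambda>a b. f a \<otimes>\<^bsub>A\<^esub> g b)" and ?C = "tensor_lift A A A (\<lambda>a b. \<epsilon> a \<odot>\<^bsub>A\<^esub> b)"
  note L = conv_lift[OF f'(1) g'(1)]
  note C = AA.tensor_lift[OF A.kalg_axioms A.bilin_smult[OF alg_homD(1)[OF wepsilon(2)]]]
  note lin = k_linearD[OF L(1)] k_linear_zero[OF AA.T.kalg_axioms A.kalg_axioms L(1)]
    k_linearD[OF C(1)] k_linear_zero[OF AA.T.kalg_axioms A.kalg_axioms C(1)]
    k_linearD[OF g'(1)] k_linear_zero[OF A.kalg_axioms A.kalg_axioms g'(1)]
  have "e \<otimes>\<^bsub>A\<^esub> ?L t = e \<otimes>\<^bsub>A\<^esub> g (?C t)" if "t \<in> carrier T2" for t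
    using that
  proof (induction rule: AA.tensor_induct)
    case (pure a b)
    then have "e \<otimes>\<^bsub>A\<^esub> (f a \<otimes>\<^bsub>A\<^esub> g b) = \<epsilon> a \<odot>\<^bsub>A\<^esub> (e \<otimes>\<^bsub>A\<^esub> g b)"
      using fe[of a] f' g' by (simp flip: A.m_assoc)
    then show ?case using pure by (simp add: L(2) C(2) lin)
  qed (simp_all add: lin A.r_distr)
  then show ?thesis using x counit_l[OF x] by (simp add: \<Delta>)
qed

section \<open>The identities on the complementary summand and the weak antipode\<close>

lemma \<rho>_conv_words:
  assumes f: "e_linear f" and g: "e_linear g" and "set js \<subseteq> I1F" "set is \<subseteq> I1E"
  shows "\<rho> \<otimes>\<^bsub>A\<^esub> conv f g (F_word js \<otimes>\<^bsub>A\<^esub> E_word is) = \<rho> \<otimes>\<^bsub>A\<^esub> (f (F_word js) \<otimes>\<^bsub>A\<^esub> g (E_word is))"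
  using e_linearD[OF f] e_linearD[OF g] assms
  by (simp add: \<rho>_conv \<rho>_\<Delta>_words conv_lift central_cancel[OF \<rho>_central] \<rho>_idem)

text \<open>The images of the generators satisfy the commutator relation in the opposite algebra.
  Its right-hand side is toral, and \<rho> annihilates it.\<close>

lemma \<rho>_S_commute_gen:
  assumes "i \<in> idx P" "j \<in> idx P"
  shows "\<rho> \<otimes>\<^bsub>A\<^esub> (S (W (gE i)) \<otimes>\<^bsub>A\<^esub> S (W (gF j))) = \<rho> \<otimes>\<^bsub>A\<^esub> (S (W (gF j)) \<otimes>\<^bsub>A\<^esub> S (W (gE i)))"
proof -
  interpret Op: wU_family P "op_alg A" T
    by unfold_locales (rule wU_rels_T)
  have "S (W (gF j)) \<otimes>\<^bsub>A\<^esub> S (W (gE i)) = S (W (gE i)) \<otimes>\<^bsub>A\<^esub> S (W (gF j)) \<oplus>\<^bsub>A\<^esub>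
      (if i = j then Op.c i \<odot>\<^bsub>A\<^esub> (W (gKb i) \<ominus>\<^bsub>A\<^esub> W (gK i)) else \<zero>\<^bsub>A\<^esub>)"
    using Op.EF[OF assms] assms by (simp add: anti(3) del: anti_gen.simps(6,7))
  then show ?thesis
    using assms by (simp add: A.r_distr A.minus_smult \<rho>_grouplike)
qed

text \<open>\<open>S\<close> sends the word F E to S(E) S(F), whereas the convolution produces S(F)
  S(E). After multiplication by \<rho> the two agree, since the images of single letters commute
  there; this extends to words letter by letter.\<close>

lemma \<rho>_S_commute:
  assumes "set js \<subseteq> I1F" "set is \<subseteq> I1E"
  shows "\<rho> \<otimes>\<^bsub>A\<^esub> (S (E_word is) \<otimes>\<^bsub>A\<^esub> S (F_word js)) = \<rho> \<otimes>\<^bsub>A\<^esub> (S (F_word js) \<otimes>\<^bsub>A\<^esub> S (E_word is))"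
proof -
  have comm: "\<rho> \<otimes>\<^bsub>A\<^esub> (a \<otimes>\<^bsub>A\<^esub> b \<otimes>\<^bsub>A\<^esub> c) = \<rho> \<otimes>\<^bsub>A\<^esub> (c \<otimes>\<^bsub>A\<^esub> (a \<otimes>\<^bsub>A\<^esub> b))"
    if ac: "\<rho> \<otimes>\<^bsub>A\<^esub> (a \<otimes>\<^bsub>A\<^esub> c) = \<rho> \<otimes>\<^bsub>A\<^esub> (c \<otimes>\<^bsub>A\<^esub> a)" and bc: "\<rho> \<otimes>\<^bsub>A\<^esub> (b \<otimes>\<^bsub>A\<^esub> c) = \<rho> \<otimes>\<^bsub>A\<^esub> (c \<otimes>\<^bsub>A\<^esub> b)"
      and [simp]: "a \<in> carrier A" "b \<in> carrier A" "c \<in> carrier A" for a b c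
  proof -
    have "\<rho> \<otimes>\<^bsub>A\<^esub> (a \<otimes>\<^bsub>A\<^esub> b \<otimes>\<^bsub>A\<^esub> c) = a \<otimes>\<^bsub>A\<^esub> (\<rho> \<otimes>\<^bsub>A\<^esub> (b \<otimes>\<^bsub>A\<^esub> c))"
      by (simp add: A.m_assoc \<rho>_central[of a] flip: A.m_assoc)
    also have "\<dots> = (\<rho> \<otimes>\<^bsub>A\<^esub> (a \<otimes>\<^bsub>A\<^esub> c)) \<otimes>\<^bsub>A\<^esub> b"
      unfolding bc by (simp add: A.m_assoc \<rho>_central[of a] flip: A.m_assoc)
    finally show ?thesis unfolding ac by (simp add: A.m_assoc)
  qed
  have comm': "\<rho> \<otimes>\<^bsub>A\<^esub> (c \<otimes>\<^bsub>A\<^esub> (a \<otimes>\<^bsub>A\<^esub> b)) = \<rho> \<otimes>\<^bsub>A\<^esub> (a \<otimes>\<^bsub>A\<^esub> b \<otimes>\<^bsub>A\<^esub> c)"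
    if "\<rho> \<otimes>\<^bsub>A\<^esub> (c \<otimes>\<^bsub>A\<^esub> a) = \<rho> \<otimes>\<^bsub>A\<^esub> (a \<otimes>\<^bsub>A\<^esub> c)" "\<rho> \<otimes>\<^bsub>A\<^esub> (c \<otimes>\<^bsub>A\<^esub> b) = \<rho> \<otimes>\<^bsub>A\<^esub> (b \<otimes>\<^bsub>A\<^esub> c)"
      "a \<in> carrier A" "b \<in> carrier A" "c \<in> carrier A" for a b c
    using comm[of a c b] that by simp
  have 1: "\<rho> \<otimes>\<^bsub>A\<^esub> (S (E_word is) \<otimes>\<^bsub>A\<^esub> S (W (gF j))) = \<rho> \<otimes>\<^bsub>A\<^esub> (S (W (gF j)) \<otimes>\<^bsub>A\<^esub> S (E_word is))"
    if "j \<in> idx P" for j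
    using assms(2)
  proof (induction "is")
    case (Cons i "is")
    then have *: "W (gE i) \<in> carrier A" "E_word is \<in> carrier A" "i \<in> idx P" by auto
    then have "S (E_word (i # is)) = S (E_word is) \<otimes>\<^bsub>A\<^esub> S (W (gE i))" by (simp add: S_mult)
    then show ?case using Cons * that by (simp only: comm \<rho>_S_commute_gen S_closed W_closed gensI set_subset_Cons
        list.set insert_subset)
  qed (use that in \<open>simp add: anti_simps(6)\<close>)
  show ?thesis
    using assms(1)
  proof (induction js)
    case (Cons j js)
    then have *: "W (gF j) \<in> carrier A" "F_word js \<in> carrier A" "j \<in> idx P" by auto
    then have "S (F_word (j # js)) = S (F_word js) \<otimes>\<^bsub>A\<^esub> S (W (gF j))" by (simp add: S_mult)
    then show ?case using Cons * assms(2) by (simp only: comm' 1 S_closed E_word_closed list.set insert_subset)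
  qed (use assms in \<open>simp add: anti_simps(6)\<close>)
qed

text \<open>On e A the inner convolution is the counit, so the outer one gives back the last map. On
  triangular words F E only one product survives: the first triple convolution gives F E, the second
  S(F) S(E).\<close>

lemma weak_antipode_S: "weak_antipode H S"
proof -
  let ?id = "\<lambda>x::(gen list \<Rightarrow>\<^sub>0 'a) set. x"
  note lin = S_e_linear id_e_linear conv_e_linear[OF id_e_linear S_e_linear] conv_e_linear[OF S_e_linear id_e_linear]
  have L: "e_linear (conv (conv ?id S) ?id)" "e_linear (conv (conv S ?id) S)"
    by (intro conv_e_linear lin)+
  note L' = e_linearD[OF L(1)] e_linearD[OF L(2)]
  \<comment> \<open>By \<open>\<rho>_word\<close> the triangular words determine an e-linear map on
    \<rho> A.\<close>
  have \<rho>: "\<rho> \<otimes>\<^bsub>A\<^esub> f x = \<rho> \<otimes>\<^bsub>A\<^esub> h x"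
    if fh: "e_linear f" "e_linear h" and "x \<in> carrier A"
      and words: "\<And>js is. \<lbrakk>set js \<subseteq> I1F; set is \<subseteq> I1E\<rbrakk> \<Longrightarrow>
        \<rho> \<otimes>\<^bsub>A\<^esub> f (F_word js \<otimes>\<^bsub>A\<^esub> E_word is) = \<rho> \<otimes>\<^bsub>A\<^esub> h (F_word js \<otimes>\<^bsub>A\<^esub> E_word is)" for f h x
  proof -
    note f = e_linearD[OF fh(1)] k_linearD(2,3)[OF e_linearD(1)[OF fh(1)]] k_linear_zero[OF A.kalg_axioms A.kalg_axioms e_linearD(1)[OF fh(1)]]
    note h = e_linearD[OF fh(2)] k_linearD(2,3)[OF e_linearD(1)[OF fh(2)]] k_linear_zero[OF A.kalg_axioms A.kalg_axioms e_linearD(1)[OF fh(2)]]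
    show ?thesis
      using that(3)
    proof (induction rule: wU_word_induct)
      case (word w)
      then have w: "ev A W w \<in> carrier A" by simp
      from \<rho>_word[OF word] show ?case
      proof (elim disjE exE conjE)
        assume "\<rho> \<otimes>\<^bsub>A\<^esub> ev A W w = \<zero>\<^bsub>A\<^esub>"
        then show ?thesis unfolding f(4)[OF w, symmetric] h(4)[OF w, symmetric] by (simp only: f h)
      next
        fix js "is" assume jsis: "set js \<subseteq> I1F" "set is \<subseteq> I1E"
          and eq: "\<rho> \<otimes>\<^bsub>A\<^esub> ev A W w = \<rho> \<otimes>\<^bsub>A\<^esub> (F_word js \<otimes>\<^bsub>A\<^esub> E_word is)"
        have c: "F_word js \<otimes>\<^bsub>A\<^esub> E_word is \<in> carrier A" using jsis by simp
        show ?thesis unfolding f(4)[OF w, symmetric] h(4)[OF w, symmetric] eq f(4)[OF c] h(4)[OF c]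
          by (rule words[OF jsis])
      qed
    qed (simp_all add: f h A.r_distr)
  qed
  have "conv (conv ?id S) ?id x = x" if x: "x \<in> carrier A" for x
  proof (rule e_\<rho>_eqI[OF L'(2)[OF x] x])
    show "e \<otimes>\<^bsub>A\<^esub> conv (conv ?id S) ?id x = e \<otimes>\<^bsub>A\<^esub> x"
      by (rule e_conv[OF lin(3,2) e_conv_id_S x])
    show "\<rho> \<otimes>\<^bsub>A\<^esub> conv (conv ?id S) ?id x = \<rho> \<otimes>\<^bsub>A\<^esub> x"
    proof (rule \<rho>[OF L(1) id_e_linear x])
      fix js "is" assume w: "set js \<subseteq> I1F" "set is \<subseteq> I1E"
      \<comment> \<open>The word F is read as F times the empty word in the E_i, so that
        \<open>S\<close> is evaluated at 1.\<close>
      have "\<rho> \<otimes>\<^bsub>A\<^esub> conv ?id S (F_word js) = \<rho> \<otimes>\<^bsub>A\<^esub> F_word js"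
        using \<rho>_conv_words[OF lin(2,1) w(1), of "[]"] w by (simp add: anti_simps(6))
      then show "\<rho> \<otimes>\<^bsub>A\<^esub> conv (conv ?id S) ?id (F_word js \<otimes>\<^bsub>A\<^esub> E_word is) = \<rho> \<otimes>\<^bsub>A\<^esub> (F_word js \<otimes>\<^bsub>A\<^esub> E_word is)"
        unfolding \<rho>_conv_words[OF lin(3,2) w] using w e_linearD(2)[OF lin(3)] by (simp flip: A.m_assoc)
    qed
  qed
  moreover have "conv (conv S ?id) S x = S x" if x: "x \<in> carrier A" for x
  proof (rule e_\<rho>_eqI[OF L'(6)[OF x] S_closed[OF x]])
    show "e \<otimes>\<^bsub>A\<^esub> conv (conv S ?id) S x = e \<otimes>\<^bsub>A\<^esub> S x"
      by (rule e_conv[OF lin(4,1) e_conv_S_id x])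
    show "\<rho> \<otimes>\<^bsub>A\<^esub> conv (conv S ?id) S x = \<rho> \<otimes>\<^bsub>A\<^esub> S x"
    proof (rule \<rho>[OF L(2) S_e_linear x])
      fix js "is" assume w: "set js \<subseteq> I1F" "set is \<subseteq> I1E"
      have "\<rho> \<otimes>\<^bsub>A\<^esub> conv S ?id (F_word js) = \<rho> \<otimes>\<^bsub>A\<^esub> S (F_word js)"
        using \<rho>_conv_words[OF lin(1,2) w(1), of "[]"] w by (simp add: anti_simps(6))
      then have "\<rho> \<otimes>\<^bsub>A\<^esub> conv (conv S ?id) S (F_word js \<otimes>\<^bsub>A\<^esub> E_word is) = \<rho> \<otimes>\<^bsub>A\<^esub> (S (F_word js) \<otimes>\<^bsub>A\<^esub> S (E_word is))"
        unfolding \<rho>_conv_words[OF lin(4,1) w] using w e_linearD(2)[OF lin(4)] by (simp flip: A.m_assoc)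
      then show "\<rho> \<otimes>\<^bsub>A\<^esub> conv (conv S ?id) S (F_word js \<otimes>\<^bsub>A\<^esub> E_word is) = \<rho> \<otimes>\<^bsub>A\<^esub> S (F_word js \<otimes>\<^bsub>A\<^esub> E_word is)"
        using w by (simp add: S_mult \<rho>_S_commute)
    qed
  qed
  moreover have "alg_anti_hom A A S" using anti(2) by (simp add: alg_anti_hom_iff_op)
  ultimately show ?thesis by (simp add: weak_antipode_def id_def)
qed

end

section \<open>Representations on spaces of functions\<close>

definition fun_space :: "('x \<Rightarrow> 'k::field) set \<Rightarrow> bool" where
  "fun_space U \<longleftrightarrow> (\<lambda>x. 0) \<in> U \<and> (\<forall>\<phi>\<in>U. \<forall>\<psi>\<in>U. (\<lambda>x. \<phi> x + \<psi> x) \<in> U) \<and> (\<forall>c. \<forall>\<phi>\<in>U. (\<lambda>x. c * \<phi> x) \<in> U)"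

definition fun_linear :: "('x \<Rightarrow> 'k::field) set \<Rightarrow> (('x \<Rightarrow> 'k) \<Rightarrow> 'x \<Rightarrow> 'k) \<Rightarrow> bool" where
  "fun_linear U T \<longleftrightarrow> T \<in> U \<rightarrow> U \<and> (\<forall>\<phi>\<in>U. \<forall>\<psi>\<in>U. T (\<lambda>x. \<phi> x + \<psi> x) = (\<lambda>x. T \<phi> x + T \<psi> x)) \<and>
     (\<forall>c. \<forall>\<phi>\<in>U. T (\<lambda>x. c * \<phi> x) = (\<lambda>x. c * T \<phi> x))"

text \<open>Operators are cut off outside \<open>U\<close>, so that equality of elements is the same
  as equality on \<open>U\<close>.\<close>

definition fun_end :: "('x \<Rightarrow> 'k::field) set \<Rightarrow> ('k, ('x \<Rightarrow> 'k) \<Rightarrow> 'x \<Rightarrow> 'k) module" where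
  "fun_end U = \<lparr>carrier = {T \<in> extensional U. fun_linear U T}, mult = (\<lambda>T S. \<lambda>\<phi>\<in>U. T (S \<phi>)), one = (\<lambda>\<phi>\<in>U. \<phi>),
     zero = (\<lambda>\<phi>\<in>U. \<lambda>x. 0), add = (\<lambda>T S. \<lambda>\<phi>\<in>U. \<lambda>x. T \<phi> x + S \<phi> x), smult = (\<lambda>c T. \<lambda>\<phi>\<in>U. \<lambda>x. c * T \<phi> x)\<rparr>"

locale fun_rep =
  fixes U :: "('x \<Rightarrow> 'k::field) set"
  assumes fun_space: "fun_space U"
begin

abbreviation "C \<equiv> fun_end U"

lemma U_closed [simp, intro]: "(\<lambda>x. 0) \<in> U" "\<lbrakk>\<phi> \<in> U; \<psi> \<in> U\<rbrakk> \<Longrightarrow> (\<lambda>x. \<phi> x + \<psi> x) \<in> U" "\<phi> \<in> U \<Longrightarrow> (\<lambda>x. c * \<phi> x) \<in> U"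
  using fun_space by (auto simp: fun_space_def)

lemma C_carrier: "T \<in> carrier C \<longleftrightarrow> T \<in> extensional U \<and> fun_linear U T"
  by (simp add: fun_end_def)

lemma C_app:
  "\<phi> \<in> U \<Longrightarrow> (T \<otimes>\<^bsub>C\<^esub> S) \<phi> = T (S \<phi>)" "\<phi> \<in> U \<Longrightarrow> (T \<oplus>\<^bsub>C\<^esub> S) \<phi> = (\<lambda>x. T \<phi> x + S \<phi> x)"
  "\<phi> \<in> U \<Longrightarrow> (c \<odot>\<^bsub>C\<^esub> T) \<phi> = (\<lambda>x. c * T \<phi> x)" "\<phi> \<in> U \<Longrightarrow> \<one>\<^bsub>C\<^esub> \<phi> = \<phi>" "\<phi> \<in> U \<Longrightarrow> \<zero>\<^bsub>C\<^esub> \<phi> = (\<lambda>x. 0)"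
  by (simp_all add: fun_end_def)

lemma C_ext: "T \<otimes>\<^bsub>C\<^esub> S \<in> extensional U" "T \<oplus>\<^bsub>C\<^esub> S \<in> extensional U" "c \<odot>\<^bsub>C\<^esub> T \<in> extensional U"
  "\<one>\<^bsub>C\<^esub> \<in> extensional U" "\<zero>\<^bsub>C\<^esub> \<in> extensional U"
  by (simp_all add: fun_end_def)

lemma C_mem: "\<lbrakk>T \<in> carrier C; \<phi> \<in> U\<rbrakk> \<Longrightarrow> T \<phi> \<in> U"
  by (auto simp: C_carrier fun_linear_def)

lemma C_linear:
  "\<lbrakk>T \<in> carrier C; \<phi> \<in> U; \<psi> \<in> U\<rbrakk> \<Longrightarrow> T (\<lambda>x. \<phi> x + \<psi> x) = (\<lambda>x. T \<phi> x + T \<psi> x)"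
  "\<lbrakk>T \<in> carrier C; \<phi> \<in> U\<rbrakk> \<Longrightarrow> T (\<lambda>x. c * \<phi> x) = (\<lambda>x. c * T \<phi> x)"
  by (auto simp: C_carrier fun_linear_def)

lemma C_zero_app: "T \<in> carrier C \<Longrightarrow> T (\<lambda>x. 0) = (\<lambda>x. 0)"
  using C_linear(2)[of T "\<lambda>x. 0" 0] by simp

lemma C_closed: "\<lbrakk>T \<in> carrier C; S \<in> carrier C\<rbrakk> \<Longrightarrow> T \<otimes>\<^bsub>C\<^esub> S \<in> carrier C"
  "\<lbrakk>T \<in> carrier C; S \<in> carrier C\<rbrakk> \<Longrightarrow> T \<oplus>\<^bsub>C\<^esub> S \<in> carrier C"
  "T \<in> carrier C \<Longrightarrow> c \<odot>\<^bsub>C\<^esub> T \<in> carrier C" "\<one>\<^bsub>C\<^esub> \<in> carrier C" "\<zero>\<^bsub>C\<^esub> \<in> carrier C"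
  unfolding C_carrier[of "_ \<otimes>\<^bsub>C\<^esub> _"] C_carrier[of "_ \<oplus>\<^bsub>C\<^esub> _"] C_carrier[of "_ \<odot>\<^bsub>C\<^esub> _"] C_carrier[of "\<one>\<^bsub>C\<^esub>"] C_carrier[of "\<zero>\<^bsub>C\<^esub>"]
    fun_linear_def
  by (simp_all add: C_app C_ext C_mem C_linear Pi_def algebra_simps)

lemma C_eqI: "\<lbrakk>T \<in> extensional U; S \<in> extensional U; \<And>\<phi>. \<phi> \<in> U \<Longrightarrow> T \<phi> = S \<phi>\<rbrakk> \<Longrightarrow> T = S"
  by (rule extensionalityI)

lemma C_carrier_ext: "T \<in> carrier C \<Longrightarrow> T \<in> extensional U"
  by (simp add: C_carrier)

sublocale C: kalg C
proof (rule kalg.intro, rule k_algebraI, rule ringI)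
  show "abelian_group C"
  proof (rule abelian_groupI)
    fix T assume T: "T \<in> carrier C"
    show "\<exists>S\<in>carrier C. S \<oplus>\<^bsub>C\<^esub> T = \<zero>\<^bsub>C\<^esub>"
      by (rule bexI[of _ "(- 1) \<odot>\<^bsub>C\<^esub> T"]; (rule C_eqI)?) (simp_all add: C_app C_ext C_closed T)
  next
    fix S T R assume "S \<in> carrier C" "T \<in> carrier C" "R \<in> carrier C"
    then show "S \<oplus>\<^bsub>C\<^esub> T \<oplus>\<^bsub>C\<^esub> R = S \<oplus>\<^bsub>C\<^esub> (T \<oplus>\<^bsub>C\<^esub> R)" "S \<oplus>\<^bsub>C\<^esub> T = T \<oplus>\<^bsub>C\<^esub> S" "\<zero>\<^bsub>C\<^esub> \<oplus>\<^bsub>C\<^esub> S = S"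
      by - (rule C_eqI; simp add: C_app C_ext C_carrier_ext algebra_simps)+
  qed (simp_all add: C_closed)
  show "Group.monoid C"
  proof (rule monoidI)
    fix S T R assume "S \<in> carrier C" "T \<in> carrier C" "R \<in> carrier C"
    then show "S \<otimes>\<^bsub>C\<^esub> T \<otimes>\<^bsub>C\<^esub> R = S \<otimes>\<^bsub>C\<^esub> (T \<otimes>\<^bsub>C\<^esub> R)" "\<one>\<^bsub>C\<^esub> \<otimes>\<^bsub>C\<^esub> S = S" "S \<otimes>\<^bsub>C\<^esub> \<one>\<^bsub>C\<^esub> = S"
      by - (rule C_eqI; simp add: C_app C_ext C_carrier_ext C_mem)+
  qed (simp_all add: C_closed)
next
  fix S T R assume "S \<in> carrier C" "T \<in> carrier C" "R \<in> carrier C"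
  then show "(S \<oplus>\<^bsub>C\<^esub> T) \<otimes>\<^bsub>C\<^esub> R = S \<otimes>\<^bsub>C\<^esub> R \<oplus>\<^bsub>C\<^esub> T \<otimes>\<^bsub>C\<^esub> R" "R \<otimes>\<^bsub>C\<^esub> (S \<oplus>\<^bsub>C\<^esub> T) = R \<otimes>\<^bsub>C\<^esub> S \<oplus>\<^bsub>C\<^esub> R \<otimes>\<^bsub>C\<^esub> T"
    by - (rule C_eqI; simp add: C_app C_ext C_mem C_linear)+
next
  fix c d S T assume "S \<in> carrier C" "T \<in> carrier C"
  then show "(c \<odot>\<^bsub>C\<^esub> S) \<otimes>\<^bsub>C\<^esub> T = c \<odot>\<^bsub>C\<^esub> (S \<otimes>\<^bsub>C\<^esub> T)" "S \<otimes>\<^bsub>C\<^esub> (c \<odot>\<^bsub>C\<^esub> T) = c \<odot>\<^bsub>C\<^esub> (S \<otimes>\<^bsub>C\<^esub> T)"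
    "c \<odot>\<^bsub>C\<^esub> (S \<oplus>\<^bsub>C\<^esub> T) = c \<odot>\<^bsub>C\<^esub> S \<oplus>\<^bsub>C\<^esub> c \<odot>\<^bsub>C\<^esub> T"
    "c \<odot>\<^bsub>C\<^esub> S \<in> carrier C"
    by - ((rule C_eqI)?; simp add: C_app C_ext C_mem C_linear C_closed algebra_simps)+
next
  fix c d S assume "S \<in> carrier C"
  then show "(c + d) \<odot>\<^bsub>C\<^esub> S = c \<odot>\<^bsub>C\<^esub> S \<oplus>\<^bsub>C\<^esub> d \<odot>\<^bsub>C\<^esub> S" "(c * d) \<odot>\<^bsub>C\<^esub> S = c \<odot>\<^bsub>C\<^esub> (d \<odot>\<^bsub>C\<^esub> S)"
    "1 \<odot>\<^bsub>C\<^esub> S = S"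
    by - (rule C_eqI; simp add: C_app C_ext C_carrier_ext algebra_simps)+
qed

lemma C_minus_app: "\<lbrakk>T \<in> carrier C; S \<in> carrier C; \<phi> \<in> U\<rbrakk> \<Longrightarrow> (T \<ominus>\<^bsub>C\<^esub> S) \<phi> = (\<lambda>x. T \<phi> x - S \<phi> x)"
  by (simp add: C.minus_smult C_app)

lemma restrict_carrier: "fun_linear U T \<Longrightarrow> restrict T U \<in> carrier C"
  by (simp add: C_carrier) (auto simp: fun_linear_def Pi_def)

end

subsection \<open>A module on which \<open>K\<^sub>i\<close> and its inverse differ\<close>

text \<open>A Verma-type module in dual form: \<open>E\<^sub>i\<close> acts on functions of words by \<open>(E\<^sub>i \<phi>) w = \<phi> (i w)\<close>, and \<open>F\<^sub>i\<close> by
  the formula that the commutator relation dictates.  The Serre elements in the \<open>F\<^sub>i\<close> act by zero since they commute with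
  all \<open>E\<^sub>k\<close>; those in the \<open>E\<^sub>i\<close> commute with all \<open>F\<^sub>k\<close>, so they vanish on the submodule generated by the
  function \<open>vac\<close>.\<close>

context wU_setup
begin

text \<open>The eigenvalue of K_j at a word: a letter i contributes q_i^(-a_ij), the weight with
  which K_j passes F_i, and the empty word contributes the highest weight 2, which differs from its
  inverse in characteristic 0 for every q.\<close>

primrec \<kappa> :: "nat \<Rightarrow> nat list \<Rightarrow> 'k" where
  "\<kappa> j [] = 2"
| "\<kappa> j (i # w) = inverse (qi P i powi cartan P i j) * \<kappa> j w"

primrec f_at :: "nat \<Rightarrow> nat list \<Rightarrow> (nat list \<Rightarrow> 'k) \<Rightarrow> 'k" where
  "f_at i [] \<phi> = 0"
| "f_at i (j # w) \<phi> = f_at i w (\<lambda>u. \<phi> (j # u)) +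
     (if j = i then inverse (qi P i - inverse (qi P i)) * (\<kappa> i w - inverse (\<kappa> i w)) * \<phi> w else 0)"

definition "e_op i \<phi> = (\<lambda>w. \<phi> (i # w))" for i and \<phi> :: "nat list \<Rightarrow> 'k"
definition "f_op i \<phi> = (\<lambda>w. f_at i w \<phi>)" for i and \<phi> :: "nat list \<Rightarrow> 'k"
definition "k_op i \<phi> = (\<lambda>w. \<kappa> i w * \<phi> w)" for i and \<phi> :: "nat list \<Rightarrow> 'k"
definition "kb_op i \<phi> = (\<lambda>w. inverse (\<kappa> i w) * \<phi> w)" for i and \<phi> :: "nat list \<Rightarrow> 'k"
definition "vac = (\<lambda>w::nat list. if w = [] then 1 else 0 :: 'k)"

text \<open>Closure under the E_i and K_i follows by moving them past the F_i until they reach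
  \<open>vac\<close>. The index \<open>i\<close> ranges over all natural numbers, so that no
  condition on the letters has to be carried along.\<close>

inductive_set verma :: "(nat list \<Rightarrow> 'k) set" where
  vac: "vac \<in> verma"
| add: "\<lbrakk>\<phi> \<in> verma; \<psi> \<in> verma\<rbrakk> \<Longrightarrow> (\<lambda>w. \<phi> w + \<psi> w) \<in> verma"
| scale: "\<phi> \<in> verma \<Longrightarrow> (\<lambda>w. c * \<phi> w) \<in> verma"
| f_op: "\<phi> \<in> verma \<Longrightarrow> f_op i \<phi> \<in> verma"

lemma one_in_idx: "1 \<in> idx P"
  using datum by (auto simp: wU_datum_def)

text \<open>Words may contain letters outside \<open>idx P\<close>, for which
  \<open>wU_datum\<close> makes no statement on \<open>qi\<close>. Index 1 shows that the ground
  parameter is nonzero, and this passes to all its powers.\<close>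

lemma qi_neq_0': "qi P i \<noteq> 0"
  using qi_neq(1)[OF one_in_idx] datum one_in_idx by (auto simp: qi_def wU_datum_def)

lemma \<kappa>_neq_0: "(2 :: 'k) \<noteq> 0 \<Longrightarrow> \<kappa> j w \<noteq> 0"
  by (induction w) (simp_all add: qi_neq_0')

lemma f_at_add: "f_at i w (\<lambda>u. \<phi> u + \<psi> u) = f_at i w \<phi> + f_at i w \<psi>"
  by (induction w arbitrary: \<phi> \<psi>) (simp_all add: algebra_simps)

lemma f_at_scale: "f_at i w (\<lambda>u. c * \<phi> u) = c * f_at i w \<phi>"
  by (induction w arbitrary: \<phi>) (simp_all add: algebra_simps)

text \<open>Evaluation at i # w is the action of E_i, so the recursion of \<open>f_at\<close> on a
  nonempty word is this relation read at that word.\<close>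

lemma e_op_f_op:
  "e_op i (f_op j \<phi>) = (\<lambda>w. f_op j (e_op i \<phi>) w +
    (if i = j then inverse (qi P j - inverse (qi P j)) * (k_op j \<phi> w - kb_op j \<phi> w) else 0))"
  by (simp add: e_op_def f_op_def k_op_def kb_op_def fun_eq_iff algebra_simps)

lemma k_op_e_op:
  "k_op j (e_op i \<phi>) = (\<lambda>w. qi P i powi cartan P i j * e_op i (k_op j \<phi>) w)"
  "kb_op j (e_op i \<phi>) = (\<lambda>w. inverse (qi P i powi cartan P i j) * e_op i (kb_op j \<phi>) w)"
  using qi_neq_0' by (simp_all add: e_op_def k_op_def kb_op_def fun_eq_iff)

text \<open>The computation shared by \<open>k_f_at\<close> and \<open>kb_f_at\<close>:
  \<open>a\<close> is the weight of the first letter l and \<open>b\<close> that of the index i, and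
  these agree whenever the extra term for l = i is present.\<close>

lemma f_at_aux:
  assumes "k * x = b * (y :: 'k)" "l = i \<Longrightarrow> a = b"
  shows "a * k * (x + (if l = i then c * p else 0)) = b * (a * y + (if l = i then c * (k * p) else 0))"
proof -
  have "a * k * (x + r) = a * (b * y) + a * k * r" for r
    unfolding assms(1)[symmetric] by (simp add: algebra_simps)
  moreover have "b * (a * y + r) = a * (b * y) + b * r" for r by (simp add: algebra_simps)
  ultimately show ?thesis using assms(2) by (simp only:) (simp add: mult_ac)
qed

lemma k_f_at:
  "\<kappa> j w * f_at i w \<phi> = inverse (qi P i powi cartan P i j) * f_at i w (k_op j \<phi>)"
proof (induction w arbitrary: \<phi>)
  case (Cons l w)
  have 1: "(\<lambda>u. k_op j \<phi> (l # u)) = (\<lambda>u. inverse (qi P l powi cartan P l j) * k_op j (\<lambda>u. \<phi> (l # u)) u)"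
    by (simp add: k_op_def mult_ac)
  show ?case
    unfolding f_at.simps 1 f_at_scale \<kappa>.simps
    by (subst f_at_aux[OF Cons[of "\<lambda>u. \<phi> (l # u)"]]) (simp_all add: k_op_def)
qed simp

lemma kb_f_at:
  "inverse (\<kappa> j w) * f_at i w \<phi> = qi P i powi cartan P i j * f_at i w (kb_op j \<phi>)"
proof (induction w arbitrary: \<phi>)
  case (Cons l w)
  have 1: "(\<lambda>u. kb_op j \<phi> (l # u)) = (\<lambda>u. qi P l powi cartan P l j * kb_op j (\<lambda>u. \<phi> (l # u)) u)"
    by (simp add: kb_op_def mult_ac)
  show ?case
    unfolding f_at.simps 1 f_at_scale \<kappa>.simps inverse_mult_distrib inverse_inverse_eq
    by (subst f_at_aux[OF Cons[of "\<lambda>u. \<phi> (l # u)"]]) (simp_all add: kb_op_def)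
qed simp

lemma k_op_f_op:
  "k_op j (f_op i \<phi>) = (\<lambda>w. inverse (qi P i powi cartan P i j) * f_op i (k_op j \<phi>) w)"
  "kb_op j (f_op i \<phi>) = (\<lambda>w. qi P i powi cartan P i j * f_op i (kb_op j \<phi>) w)"
  using k_f_at kb_f_at by (simp_all add: k_op_def kb_op_def f_op_def)

lemma op_linear:
  "e_op i (\<lambda>w. \<phi> w + \<psi> w) = (\<lambda>w. e_op i \<phi> w + e_op i \<psi> w)" "e_op i (\<lambda>w. c * \<phi> w) = (\<lambda>w. c * e_op i \<phi> w)"
  "f_op i (\<lambda>w. \<phi> w + \<psi> w) = (\<lambda>w. f_op i \<phi> w + f_op i \<psi> w)" "f_op i (\<lambda>w. c * \<phi> w) = (\<lambda>w. c * f_op i \<phi> w)"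
  "k_op i (\<lambda>w. \<phi> w + \<psi> w) = (\<lambda>w. k_op i \<phi> w + k_op i \<psi> w)" "k_op i (\<lambda>w. c * \<phi> w) = (\<lambda>w. c * k_op i \<phi> w)"
  "kb_op i (\<lambda>w. \<phi> w + \<psi> w) = (\<lambda>w. kb_op i \<phi> w + kb_op i \<psi> w)" "kb_op i (\<lambda>w. c * \<phi> w) = (\<lambda>w. c * kb_op i \<phi> w)"
  by (simp_all add: e_op_def f_op_def k_op_def kb_op_def f_at_add f_at_scale algebra_simps)

lemma op_vac: "k_op j vac = (\<lambda>w. 2 * vac w)" "kb_op j vac = (\<lambda>w. inverse 2 * vac w)" "e_op j vac = (\<lambda>w. 0 * vac w)"
  by (simp_all add: k_op_def kb_op_def e_op_def vac_def fun_eq_iff)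

lemma k_op_verma: "\<phi> \<in> verma \<Longrightarrow> k_op j \<phi> \<in> verma" and kb_op_verma: "\<phi> \<in> verma \<Longrightarrow> kb_op j \<phi> \<in> verma"
proof -
  show "\<phi> \<in> verma \<Longrightarrow> k_op j \<phi> \<in> verma"
    by (induction rule: verma.induct) (simp_all only: op_vac op_linear k_op_f_op verma.intros)
  show "\<phi> \<in> verma \<Longrightarrow> kb_op j \<phi> \<in> verma"
    by (induction rule: verma.induct) (simp_all only: op_vac op_linear k_op_f_op verma.intros)
qed

lemma e_op_verma: "\<phi> \<in> verma \<Longrightarrow> e_op j \<phi> \<in> verma"
proof (induction rule: verma.induct)
  case (f_op \<phi> i)
  let ?c = "if j = i then inverse (qi P i - inverse (qi P i)) else 0"
  have "e_op j (f_op i \<phi>) = (\<lambda>w. f_op i (e_op j \<phi>) w + (?c * k_op i \<phi> w + (- ?c) * kb_op i \<phi> w))"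
    by (simp add: e_op_f_op fun_eq_iff algebra_simps)
  moreover have "\<dots> \<in> verma"
    by (intro verma.intros k_op_verma kb_op_verma f_op)
  ultimately show ?case by simp
qed (simp_all only: op_vac op_linear verma.intros)

lemma fun_space_verma: "fun_space verma"
  using verma.scale[OF verma.vac, of 0] by (auto simp: fun_space_def intro: verma.intros)

sublocale V: fun_rep verma
  by unfold_locales (rule fun_space_verma)

fun verma_gen :: "gen \<Rightarrow> (nat list \<Rightarrow> 'k) \<Rightarrow> nat list \<Rightarrow> 'k" where
  "verma_gen (gE i) = restrict (e_op i) verma"
| "verma_gen (gF i) = restrict (f_op i) verma"
| "verma_gen (gK i) = restrict (k_op i) verma"
| "verma_gen (gKb i) = restrict (kb_op i) verma"
| "verma_gen g = \<one>\<^bsub>V.C\<^esub>"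

lemma verma_gen_closed [simp]: "verma_gen g \<in> carrier V.C"
proof (cases g)
qed (auto intro!: V.restrict_carrier simp: fun_linear_def op_linear e_op_verma k_op_verma kb_op_verma verma.f_op)

lemma verma_app:
  "\<phi> \<in> verma \<Longrightarrow> verma_gen (gE i) \<phi> = e_op i \<phi>" "\<phi> \<in> verma \<Longrightarrow> verma_gen (gF i) \<phi> = f_op i \<phi>"
  "\<phi> \<in> verma \<Longrightarrow> verma_gen (gK i) \<phi> = k_op i \<phi>" "\<phi> \<in> verma \<Longrightarrow> verma_gen (gKb i) \<phi> = kb_op i \<phi>"
  by simp_all

lemmas verma_mem = e_op_verma k_op_verma kb_op_verma verma.f_op

lemma verma_eqI:
  "\<lbrakk>T \<in> carrier V.C; S \<in> carrier V.C; \<And>\<phi>. \<phi> \<in> verma \<Longrightarrow> T \<phi> = S \<phi>\<rbrakk> \<Longrightarrow> T = S"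
  by (rule V.C_eqI) (simp_all add: V.C_carrier_ext)

lemma verma_qcomm:
  "qcomm V.C (qi P i powi cartan P i j) (verma_gen (gK j)) (verma_gen (gE i))"
  "qcomm V.C (inverse (qi P i powi cartan P i j)) (verma_gen (gKb j)) (verma_gen (gE i))"
  "qcomm V.C (inverse (qi P i powi cartan P i j)) (verma_gen (gK j)) (verma_gen (gF i))"
  "qcomm V.C (qi P i powi cartan P i j) (verma_gen (gKb j)) (verma_gen (gF i))"
  unfolding qcomm_def
  by (rule verma_eqI; simp add: V.C_app verma_app verma_mem k_op_e_op k_op_f_op del: verma_gen.simps)+

lemma verma_EF:
  "verma_gen (gE i) \<otimes>\<^bsub>V.C\<^esub> verma_gen (gF j) = verma_gen (gF j) \<otimes>\<^bsub>V.C\<^esub> verma_gen (gE i) \<oplus>\<^bsub>V.C\<^esub>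
     (if i = j then inverse (qi P i - inverse (qi P i)) \<odot>\<^bsub>V.C\<^esub> (verma_gen (gK i) \<ominus>\<^bsub>V.C\<^esub> verma_gen (gKb i)) else \<zero>\<^bsub>V.C\<^esub>)"
  by (rule verma_eqI; cases "i = j"; simp add: V.C_app V.C_minus_app verma_app verma_mem e_op_f_op del: verma_gen.simps)

text \<open>E_k commutes with every F_l for l \<noteq> k, and its commutator with F_k is a multiple
  of the difference of two toral operators of inverse weights. This is the situation of
  \<open>skew_commutes_x\<close> for k = i and of \<open>skew_commutes_y\<close> for k = j.\<close>

lemma verma_E_skew_F:
  assumes "serre_pair i j"
  shows "verma_gen (gE k) \<otimes>\<^bsub>V.C\<^esub> skew V.C (verma_gen (gF i)) (verma_gen (gF j))
      (\<lambda>k. qi P i powi cartan P i j * (qi P i powi cartan P i i) ^ k) (nat (1 - cartan P i j)) =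
    skew V.C (verma_gen (gF i)) (verma_gen (gF j))
      (\<lambda>k. qi P i powi cartan P i j * (qi P i powi cartan P i i) ^ k) (nat (1 - cartan P i j)) \<otimes>\<^bsub>V.C\<^esub> verma_gen (gE k)"
proof -
  note par = serre_pair_params[OF assms]
  note [simp del] = verma_gen.simps
  have z: "qi P j powi cartan P j i = qi P i powi cartan P i j" using qi_powi_sym par by simp
  note EF = verma_EF[of k i] verma_EF[of k j]
  consider "k = i" | "k = j" | "k \<noteq> i" "k \<noteq> j" by blast
  then show ?thesis
  proof cases
    case 1
    show ?thesis
      by (rule V.C.skew_commutes_x[OF _ _ verma_qcomm(3) _ verma_qcomm(4)])
        (use 1 EF par verma_qcomm(3)[of j i] verma_qcomm(4)[of j i] in \<open>simp_all add: z\<close>)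
  next
    case 2
    show ?thesis
      by (rule V.C.skew_commutes_y[OF _ _ verma_qcomm(3) verma_qcomm(4)])
        (use 2 EF par in \<open>simp_all\<close>)
  next
    case 3
    then show ?thesis using EF by (intro V.C.skew_commutes) simp_all
  qed
qed

text \<open>The mirror image: in the commutator of F_k with E_k the two toral operators change
  places, which compensates for the opposite weights of the E_i.\<close>

lemma verma_F_skew_E:
  assumes "serre_pair i j"
  shows "verma_gen (gF k) \<otimes>\<^bsub>V.C\<^esub> skew V.C (verma_gen (gE i)) (verma_gen (gE j))
      (\<lambda>k. qi P i powi cartan P i j * (qi P i powi cartan P i i) ^ k) (nat (1 - cartan P i j)) =
    skew V.C (verma_gen (gE i)) (verma_gen (gE j))
      (\<lambda>k. qi P i powi cartan P i j * (qi P i powi cartan P i i) ^ k) (nat (1 - cartan P i j)) \<otimes>\<^bsub>V.C\<^esub> verma_gen (gF k)"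
proof -
  note par = serre_pair_params[OF assms]
  note [simp del] = verma_gen.simps
  have z: "qi P j powi cartan P j i = qi P i powi cartan P i j" using qi_powi_sym par by simp
  have FE: "verma_gen (gF j) \<otimes>\<^bsub>V.C\<^esub> verma_gen (gE i) = verma_gen (gE i) \<otimes>\<^bsub>V.C\<^esub> verma_gen (gF j) \<oplus>\<^bsub>V.C\<^esub>
     (if i = j then inverse (qi P i - inverse (qi P i)) \<odot>\<^bsub>V.C\<^esub> (verma_gen (gKb i) \<ominus>\<^bsub>V.C\<^esub> verma_gen (gK i)) else \<zero>\<^bsub>V.C\<^esub>)" for i j
    by (rule verma_eqI; cases "i = j"; simp add: V.C_app V.C_minus_app verma_app verma_mem e_op_f_op algebra_simps)
  note EF = FE[of k i] FE[of k j]
  consider "k = i" | "k = j" | "k \<noteq> i" "k \<noteq> j" by blast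
  then show ?thesis
  proof cases
    case 1
    show ?thesis
      by (rule V.C.skew_commutes_x[OF _ _ verma_qcomm(2) _ verma_qcomm(1)])
        (use 1 EF par verma_qcomm(1)[of j i] verma_qcomm(2)[of j i] in \<open>simp_all add: z\<close>)
  next
    case 2
    show ?thesis
      by (rule V.C.skew_commutes_y[OF _ _ verma_qcomm(2) verma_qcomm(1)])
        (use 2 EF par in \<open>simp_all\<close>)
  next
    case 3
    then show ?thesis using EF by (intro V.C.skew_commutes) simp_all
  qed
qed

text \<open>Values at longer words are reached by letting the E_k strip off letters, which is
  possible because they commute with the Serre element. At the empty word every F_i gives 0, and
  hence so does each stage of the iterated commutator.\<close>

lemma verma_skew_F:
  assumes "serre_pair i j"
  shows "skew V.C (verma_gen (gF i)) (verma_gen (gF j))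
      (\<lambda>k. qi P i powi cartan P i j * (qi P i powi cartan P i i) ^ k) (nat (1 - cartan P i j)) = \<zero>\<^bsub>V.C\<^esub>"
    (is "?s = _")
proof -
  have nil: "skew V.C (verma_gen (gF i)) (verma_gen (gF j)) l n \<phi> [] = 0" if "\<phi> \<in> verma" for l n \<phi>
    using that
  proof (induction n arbitrary: \<phi>)
    case 0
    then show ?case by (simp add: f_op_def)
  next
    case (Suc n)
    let ?t = "skew V.C (verma_gen (gF i)) (verma_gen (gF j)) l n"
    have t: "?t \<in> carrier V.C" by (simp del: verma_gen.simps)
    have "skew V.C (verma_gen (gF i)) (verma_gen (gF j)) l (Suc n) \<phi> =
        (\<lambda>w. f_op i (?t \<phi>) w + - l n * ?t (f_op i \<phi>) w)"
      using Suc(2) V.C_mem[OF t Suc(2)]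
      by (simp only: skew.simps V.C_app verma_app verma.f_op)
    moreover have "f_op i \<psi> [] = 0" for \<psi> by (simp add: f_op_def)
    ultimately show ?case
      using Suc(1)[OF verma.f_op[OF Suc(2)]] by (simp only: mult_zero_right add_0_right)
  qed
  have s: "?s \<in> carrier V.C" by (simp del: verma_gen.simps)
  have "?s \<phi> w = 0" if "\<phi> \<in> verma" for \<phi> w
    using that
  proof (induction w arbitrary: \<phi>)
    case (Cons k w)
    have "?s \<phi> (k # w) = (verma_gen (gE k) \<otimes>\<^bsub>V.C\<^esub> ?s) \<phi> w"
      using Cons V.C_mem[OF s Cons(2)] by (simp only: V.C_app verma_app e_op_def)
    also have "\<dots> = ?s (e_op k \<phi>) w"
      unfolding verma_E_skew_F[OF assms] using Cons by (simp only: V.C_app verma_app)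
    finally show ?case using Cons e_op_verma by (simp only:)
  qed (rule nil)
  then show ?thesis using s by (intro verma_eqI) (simp_all add: V.C_app fun_eq_iff V.C_closed del: verma_gen.simps skew.simps)
qed

text \<open>Both terms of each stage annihilate \<open>vac\<close>: one by the induction hypothesis,
  the other because E_i already annihilates \<open>vac\<close>.\<close>

lemma verma_skew_E:
  assumes "serre_pair i j"
  shows "skew V.C (verma_gen (gE i)) (verma_gen (gE j))
      (\<lambda>k. qi P i powi cartan P i j * (qi P i powi cartan P i i) ^ k) (nat (1 - cartan P i j)) = \<zero>\<^bsub>V.C\<^esub>"
    (is "?s = _")
proof -
  have ev: "verma_gen (gE k) vac = (\<lambda>w. 0)" for k using op_vac(3) verma.vac by simp
  have vac0: "skew V.C (verma_gen (gE i)) (verma_gen (gE j)) l n vac = (\<lambda>w. 0)" for l n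
  proof (induction n)
    case (Suc n)
    have c: "skew V.C (verma_gen (gE i)) (verma_gen (gE j)) l n \<in> carrier V.C" by (simp del: verma_gen.simps)
    show ?case
      by (simp only: skew.simps V.C_app verma.vac ev Suc V.C_zero_app[OF c] V.C_zero_app[OF verma_gen_closed]
          mult_zero_right add_0_right)
  qed (simp add: ev del: verma_gen.simps)
  have s: "?s \<in> carrier V.C" by (simp del: verma_gen.simps)
  have "?s \<phi> = (\<lambda>w. 0)" if "\<phi> \<in> verma" for \<phi>
    using that
  proof (induction rule: verma.induct)
    case (f_op \<phi> k)
    have "?s (f_op k \<phi>) = (?s \<otimes>\<^bsub>V.C\<^esub> verma_gen (gF k)) \<phi>" using f_op by (simp only: V.C_app verma_app)
    also have "\<dots> = verma_gen (gF k) (?s \<phi>)"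
      unfolding verma_F_skew_E[OF assms, symmetric] using f_op by (simp only: V.C_app)
    also have "\<dots> = (\<lambda>w. 0)"
      unfolding f_op(2) by (rule V.C_zero_app[OF verma_gen_closed])
    finally show ?case .
  qed (simp_all only: vac0 V.C_linear[OF s] mult_zero_right add_0_right)
  then show ?thesis using s by (intro verma_eqI) (simp_all only: V.C_app V.C_closed)
qed

lemma wU_rels_verma: "(2 :: 'k) \<noteq> 0 \<Longrightarrow> wU_rels P V.C verma_gen"
proof -
  assume two: "(2 :: 'k) \<noteq> 0"
  note [simp del] = verma_gen.simps
  have J [simp]: "verma_gen gJ = \<one>\<^bsub>V.C\<^esub>" "verma_gen (gD i) = \<one>\<^bsub>V.C\<^esub>" "verma_gen (gDb i) = \<one>\<^bsub>V.C\<^esub>" for i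
    by (simp_all add: verma_gen.simps)
  have KK: "verma_gen (gK i) \<otimes>\<^bsub>V.C\<^esub> verma_gen (gKb i) = \<one>\<^bsub>V.C\<^esub>" for i
    by (rule verma_eqI; simp add: V.C_app verma_app verma_mem)
      (simp add: k_op_def kb_op_def \<kappa>_neq_0[OF two] mult.assoc[symmetric])
  have KK': "verma_gen x \<otimes>\<^bsub>V.C\<^esub> verma_gen y = verma_gen y \<otimes>\<^bsub>V.C\<^esub> verma_gen x"
    if "x \<in> {gJ} \<union> toral_gens (idx P)" "y \<in> {gJ} \<union> toral_gens (idx P)" for x y
  proof -
    have *: "verma_gen a \<otimes>\<^bsub>V.C\<^esub> verma_gen b = verma_gen b \<otimes>\<^bsub>V.C\<^esub> verma_gen a"
      if "a \<in> {gK i, gKb i}" "b \<in> {gK j, gKb j}" for a b i j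
      using that by (elim insertE emptyE; hypsubst; intro verma_eqI;
        simp add: V.C_app verma_app verma_mem; simp add: k_op_def kb_op_def mult.left_commute)
    have cases: "verma_gen z = \<one>\<^bsub>V.C\<^esub> \<or> (\<exists>i. z \<in> {gK i, gKb i})" if "z \<in> {gJ} \<union> toral_gens (idx P)" for z
      using that unfolding toral_gens_def by (elim UnE imageE singletonE) simp_all
    from cases[OF that(1)] cases[OF that(2)] show ?thesis
    proof (elim disjE exE)
      fix i j assume "x \<in> {gK i, gKb i}" "y \<in> {gK j, gKb j}"
      then show ?thesis by (rule *)
    qed simp_all
  qed
  have J_rels: "J_rels P V.C verma_gen"
    unfolding J_rels_def Let_def using KK KK' by simp
  have type_rels: "type_rels P V.C verma_gen"
    unfolding type_rels_def Let_def power_int_minus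
    by (intro ballI conjI impI verma_qcomm; rule V.C.qcomm_conj[OF verma_qcomm(1)] V.C.qcomm_conj[OF verma_qcomm(3)]; simp add: KK)
  have minus: "x \<ominus>\<^bsub>V.C\<^esub> y = d" if "x = y \<oplus>\<^bsub>V.C\<^esub> d" "y \<in> carrier V.C" "d \<in> carrier V.C" for x y d
  proof -
    have "x = d \<oplus>\<^bsub>V.C\<^esub> y" using that V.C.a_comm by metis
    then show ?thesis using that by (simp add: V.C.minus_eq V.C.a_assoc V.C.r_neg)
  qed
  have EF_rels: "EF_rels P V.C verma_gen"
    unfolding EF_rels_def by (intro ballI minus[OF verma_EF]) (simp_all split: if_split)
  have serre_rels: "serre_rels P V.C verma_gen"
    unfolding serre_rels_def
  proof (intro ballI impI)
    fix X i j assume X: "X \<in> {gE, gF}" and "i \<in> idx P" "j \<in> idx P" "i \<noteq> j \<and> (cartan P i i = 2 \<or> cartan P i j = 0)"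
    then have "serre_pair i j" by (simp add: serre_pair_def)
    then show "skew V.C (verma_gen (X i)) (verma_gen (X j)) (\<lambda>k. qi P i powi cartan P i j * (qi P i powi cartan P i i) ^ k)
       (nat (1 - cartan P i j)) = \<zero>\<^bsub>V.C\<^esub>"
      using X verma_skew_E verma_skew_F by (elim insertE emptyE) (simp_all only:)
  qed
  show ?thesis
    unfolding wU_rels_def using J_rels type_rels EF_rels serre_rels by simp
qed

text \<open>Applied to \<open>vac\<close> and evaluated at the empty word, the two operators give 2
  and 1/2.\<close>

lemma K_neq_Kb:
  assumes two: "(2 :: 'k) * 2 \<noteq> 1" "(2 :: 'k) \<noteq> 0"
  shows "W (gK 1) \<noteq> W (gKb 1)"
proof
  assume eq: "W (gK 1) = W (gKb 1)"
  obtain F where F: "\<forall>g\<in>gens (idx P). F (W g) = verma_gen g"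
    using wU_hom_exists[OF V.C.kalg_axioms wU_rels_verma[OF two(2)]] by blast
  have "verma_gen (gK 1) = verma_gen (gKb 1)"
    using F eq one_in_idx by (metis gensI(4,5))
  then have "k_op 1 vac [] = kb_op 1 vac []" using verma_app(3,4)[OF verma.vac, of 1] by simp
  then have "2 = inverse (2 :: 'k)" by (simp add: k_op_def kb_op_def vac_def)
  then show False using two by (metis right_inverse)
qed

lemma c_neq_0: "i \<in> idx P \<Longrightarrow> inverse (qi P i - inverse (qi P i)) \<noteq> 0"
  using qi_neq by simp

lemma EF_not_commute:
  assumes "(2 :: 'k) * 2 \<noteq> 1" "(2 :: 'k) \<noteq> 0"
  shows "W (gE 1) \<otimes>\<^bsub>A\<^esub> W (gF 1) \<noteq> W (gF 1) \<otimes>\<^bsub>A\<^esub> W (gE 1)"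
proof
  let ?c = "inverse (qi P 1 - inverse (qi P 1))"
  assume *: "W (gE 1) \<otimes>\<^bsub>A\<^esub> W (gF 1) = W (gF 1) \<otimes>\<^bsub>A\<^esub> W (gE 1)"
  have EF: "W (gE 1) \<otimes>\<^bsub>A\<^esub> W (gF 1) = W (gF 1) \<otimes>\<^bsub>A\<^esub> W (gE 1) \<oplus>\<^bsub>A\<^esub> ?c \<odot>\<^bsub>A\<^esub> (W (gK 1) \<ominus>\<^bsub>A\<^esub> W (gKb 1))"
    using F.EF[OF one_in_idx one_in_idx] by simp
  have Kc: "W (gK 1) \<ominus>\<^bsub>A\<^esub> W (gKb 1) \<in> carrier A" using one_in_idx by simp
  have zero: "d = \<zero>\<^bsub>A\<^esub>" if "x = x \<oplus>\<^bsub>A\<^esub> d" "x \<in> carrier A" "d \<in> carrier A" for x d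
    by (rule iffD1[OF A.add.l_cancel_one'[OF that(2,3)] that(1)])
  have "?c \<odot>\<^bsub>A\<^esub> (W (gK 1) \<ominus>\<^bsub>A\<^esub> W (gKb 1)) = \<zero>\<^bsub>A\<^esub>"
    by (rule zero[OF EF[unfolded *]]) (use one_in_idx Kc in simp_all)
  then have "?c \<odot>\<^bsub>A\<^esub> (W (gK 1) \<ominus>\<^bsub>A\<^esub> W (gKb 1)) = ?c \<odot>\<^bsub>A\<^esub> \<zero>\<^bsub>A\<^esub>"
    by (simp only: A.smult_zero)
  then have "W (gK 1) \<ominus>\<^bsub>A\<^esub> W (gKb 1) = \<zero>\<^bsub>A\<^esub>"
    by (rule A.smult_cancel[OF c_neq_0[OF one_in_idx] Kc A.zero_closed])
  then show False using K_neq_Kb[OF assms] A.smult_diff_eq_iff one_in_idx by simp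
qed

subsection \<open>A module on which \<open>J\<close> has order \<open>m - 1\<close>\<close>

text \<open>A model of the functions on the cyclic group of order m - 1. There J^(m-1) acts as the
  identity, so the K_i and D_i can be represented by 1.\<close>

definition periodic :: "(nat \<Rightarrow> 'k) set" where
  "periodic = {\<phi>. \<forall>x. \<phi> (x + (Jexp P - 1)) = \<phi> x}"

sublocale Per: fun_rep periodic
  by unfold_locales (simp add: fun_space_def periodic_def)

definition shift :: "(nat \<Rightarrow> 'k) \<Rightarrow> nat \<Rightarrow> 'k" where
  "shift = (\<lambda>\<phi>\<in>periodic. \<lambda>x. \<phi> (Suc x))"

fun per_gen :: "gen \<Rightarrow> (nat \<Rightarrow> 'k) \<Rightarrow> nat \<Rightarrow> 'k" where
  "per_gen gJ = shift"
| "per_gen (gE i) = \<zero>\<^bsub>Per.C\<^esub>"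
| "per_gen (gF i) = \<zero>\<^bsub>Per.C\<^esub>"
| "per_gen g = \<one>\<^bsub>Per.C\<^esub>"

lemma shift_carrier [simp]: "shift \<in> carrier Per.C"
  unfolding shift_def by (rule Per.restrict_carrier) (auto simp: fun_linear_def periodic_def simp del: add_Suc simp flip: add_Suc)

lemma shift_pow: "\<phi> \<in> periodic \<Longrightarrow> (shift [^]\<^bsub>Per.C\<^esub> (n::nat)) \<phi> = (\<lambda>x. \<phi> (x + n))"
proof (induction n arbitrary: \<phi>)
  case (Suc n)
  have "shift \<phi> \<in> periodic" by (rule Per.C_mem[OF shift_carrier Suc(2)])
  with Suc show ?case by (simp add: Per.C_app) (simp add: shift_def)
qed (simp add: Per.C_app)

lemma shift_order: "shift [^]\<^bsub>Per.C\<^esub> (Jexp P - 1) = \<one>\<^bsub>Per.C\<^esub>"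
proof (rule Per.C_eqI)
  fix \<phi> assume \<phi>: "\<phi> \<in> periodic"
  then show "(shift [^]\<^bsub>Per.C\<^esub> (Jexp P - 1)) \<phi> = \<one>\<^bsub>Per.C\<^esub> \<phi>"
    by (simp only: shift_pow Per.C_app) (simp add: periodic_def)
qed (rule Per.C_carrier_ext, simp add: Per.C_closed)+

lemma wU_rels_per: "wU_rels P Per.C per_gen"
proof -
  have m: "shift [^]\<^bsub>Per.C\<^esub> Jexp P = shift"
  proof -
    have "Jexp P = Suc (Jexp P - 1)" using Jexp_ge_2 by simp
    then have "shift [^]\<^bsub>Per.C\<^esub> Jexp P = shift [^]\<^bsub>Per.C\<^esub> (Jexp P - 1) \<otimes>\<^bsub>Per.C\<^esub> shift"
      by (metis Per.C.nat_pow_Suc)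
    then show ?thesis by (simp only: shift_order Per.C.l_one shift_carrier)
  qed
  have cl: "per_gen g \<in> carrier Per.C" for g by (cases g) simp_all
  have toral: "per_gen x = \<one>\<^bsub>Per.C\<^esub>" if "x \<in> toral_gens (idx P)" for x
    using that unfolding toral_gens_def by (elim UnE imageE) simp_all
  have J: "J_rels P Per.C per_gen"
    unfolding J_rels_def Let_def per_gen.simps shift_order m
  proof (intro conjI ballI)
    fix x y assume "x \<in> {gJ} \<union> toral_gens (idx P)" "y \<in> {gJ} \<union> toral_gens (idx P)"
    then show "per_gen x \<otimes>\<^bsub>Per.C\<^esub> per_gen y = per_gen y \<otimes>\<^bsub>Per.C\<^esub> per_gen x"
      by (elim UnE singletonE) (simp_all add: toral)
  qed (simp_all add: toral)
  show ?thesis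
    unfolding wU_rels_def
  proof (intro conjI J)
    show "serre_rels P Per.C per_gen"
      unfolding serre_rels_def
    proof (intro ballI impI)
      fix X i j assume "X \<in> {gE, gF}"
      then have "per_gen (X i) = \<zero>\<^bsub>Per.C\<^esub>" "per_gen (X j) = \<zero>\<^bsub>Per.C\<^esub>" by (elim insertE emptyE; simp)+
      then show "skew Per.C (per_gen (X i)) (per_gen (X j)) (\<lambda>k. qi P i powi cartan P i j * (qi P i powi cartan P i i) ^ k)
       (nat (1 - cartan P i j)) = \<zero>\<^bsub>Per.C\<^esub>"
        by (simp add: Per.C.skew_zero_right)
    qed
  qed (simp_all add: cl type_rels_def EF_rels_def qcomm_def Per.C.minus_eq Per.C.r_neg)
qed

lemma J_cube_neq:
  assumes "Jexp P \<noteq> 2" "Jexp P \<noteq> 3"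
  shows "W gJ [^]\<^bsub>A\<^esub> (3::nat) \<noteq> W gJ"
proof
  assume eq: "W gJ [^]\<^bsub>A\<^esub> (3::nat) = W gJ"
  obtain F where F: "alg_hom A Per.C F" "\<forall>g\<in>gens (idx P). F (W g) = per_gen g"
    using wU_hom_exists[OF Per.C.kalg_axioms wU_rels_per] by blast
  have "F (W gJ [^]\<^bsub>A\<^esub> (3::nat)) = shift [^]\<^bsub>Per.C\<^esub> (3::nat)"
    using F by (subst alg_hom_pow[OF A.kalg_axioms Per.C.kalg_axioms F(1)]) simp_all
  then have s: "shift [^]\<^bsub>Per.C\<^esub> (3::nat) = shift"
    unfolding eq using F by simp
  \<comment> \<open>The indicator of the residue class 1 modulo m - 1. Comparing the cube of the
    shift with the shift at the point 0 compares its values at 3 and at 1.\<close>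
  define \<phi> :: "nat \<Rightarrow> 'k" where "\<phi> = (\<lambda>x. if x mod (Jexp P - 1) = 1 then 1 else 0)"
  have p: "\<phi> \<in> periodic" by (simp add: \<phi>_def periodic_def)
  have "\<phi> 3 = \<phi> 1"
    using shift_pow[OF p, of 3] p unfolding s by (simp add: shift_def fun_eq_iff)
  moreover have m: "Jexp P - 1 \<ge> 3" using assms Jexp_ge_2 by simp
  ultimately have "3 mod (Jexp P - 1) = 1" by (simp add: \<phi>_def split: if_splits)
  \<comment> \<open>As m - 1 \<ge> 3, the residue of 3 is 0 or 3 and never 1.\<close>
  moreover have "3 mod (Jexp P - 1) = (if Jexp P - 1 = 3 then 0 else 3)" using m by auto
  ultimately show False by (simp split: if_splits)
qed

end

section \<open>Bijectivity, non-commutativity and the antipode\<close>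

context wU_setup
begin

text \<open>The value that the normalisation in \<open>wU_anti\<close> forces for \<mu> =
  -1.\<close>

abbreviation "\<nu>0 \<equiv> \<lambda>i. - inverse (qi P i powi cartan P i i)"

lemma wU_anti_zero: "wU_anti P (\<lambda>i. - 1) \<nu>0 \<zero>\<^bsub>A\<^esub>"
  by unfold_locales (use qi_neq in simp_all)

lemma wU_anti_\<rho>:
  assumes "\<And>i. i \<in> idx P \<Longrightarrow> \<mu> i * \<nu> i * qi P i powi cartan P i i = 1"
  shows "wU_anti P \<mu> \<nu> \<rho>"
  by unfold_locales (use assms \<rho>_central \<rho>_e in simp_all)

text \<open>Each map exchanges the toral generators with their partners. On E_i the composite is
  \<mu>_i \<mu>'_i q_i^(a_ii) in e A, the power of q_i being the weight of conjugation by K_i, and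
  the identity in \<rho> A; F_i behaves alike with \<nu>.\<close>

lemma anti_comp:
  assumes 1: "wU_anti P \<mu> \<nu> \<rho>" and 2: "wU_anti P \<mu>' \<nu>' \<rho>"
    and c: "\<And>i. i \<in> idx P \<Longrightarrow> \<mu> i * \<mu>' i * qi P i powi cartan P i i = 1"
      "\<And>i. i \<in> idx P \<Longrightarrow> \<nu> i * \<nu>' i * qi P i powi cartan P i i = 1"
    and x: "x \<in> carrier A"
  shows "wU_anti.anti P \<mu>' \<nu>' \<rho> (wU_anti.anti P \<mu> \<nu> \<rho> x) = x"
proof -
  interpret X: wU_anti P \<mu> \<nu> \<rho> by (rule 1)
  interpret Y: wU_anti P \<mu>' \<nu>' \<rho> by (rule 2)
  note hom = X.anti_simps Y.anti_simps
  have Ye: "Y.anti e = e"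
    unfolding J_idem_def by (subst alg_hom_pow[OF A.kalg_axioms A.kalg_op Y.anti(2)]) (simp_all add: Y.anti(3))
  have lin: "k_linear A A Y.anti" using alg_homD(1)[OF Y.anti(2)] by (simp add: k_linear_def)
  have "Y.anti (\<one>\<^bsub>A\<^esub> \<ominus>\<^bsub>A\<^esub> e) = \<one>\<^bsub>A\<^esub> \<ominus>\<^bsub>A\<^esub> e"
    using k_linear_diff(1)[OF A.kalg_axioms A.kalg_axioms lin A.one_closed F.e_closed]
    by (simp add: Ye Y.anti_simps(6))
  then have Y\<rho>: "Y.anti \<rho> = \<rho>" by (simp only: \<rho>_def[symmetric])
  have "alg_hom A A (\<lambda>x. Y.anti (X.anti x))"
    by (rule alg_homI) (simp_all add: k_linear_def hom)
  from this alg_hom_id show ?thesis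
  proof (rule wU_hom_unique[OF A.kalg_axioms _ _ _ x])
    fix g assume "g \<in> gens (idx P)"
    then show "Y.anti (X.anti (W g)) = W g"
    proof (cases rule: gens_cases)
      case 1
      then show ?thesis
        unfolding toral_gens_def by (elim UnE imageE singletonE) (simp_all add: X.anti(3) Y.anti(3))
    next
      case (2 i)
      let ?E = "W (gE i)" and ?K = "W (gK i)" and ?Kb = "W (gKb i)" and ?q = "qi P i powi cartan P i i"
      have [simp]: "?E \<in> carrier A" "?K \<in> carrier A" "?Kb \<in> carrier A" using 2 by simp_all
      have KEKb: "?K \<otimes>\<^bsub>A\<^esub> (?E \<otimes>\<^bsub>A\<^esub> ?Kb) = ?q \<odot>\<^bsub>A\<^esub> (e \<otimes>\<^bsub>A\<^esub> ?E)"
      proof -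
        have "?K \<otimes>\<^bsub>A\<^esub> (?E \<otimes>\<^bsub>A\<^esub> ?Kb) = (?K \<otimes>\<^bsub>A\<^esub> ?E) \<otimes>\<^bsub>A\<^esub> ?Kb" by (simp add: A.m_assoc)
        also have "\<dots> = ?q \<odot>\<^bsub>A\<^esub> (?E \<otimes>\<^bsub>A\<^esub> e)"
          using F.K_E[of i i] 2 by (simp add: qcomm_def A.m_assoc F.KKb)
        finally show ?thesis using 2 by (simp add: F.e_E)
      qed
      have "Y.anti (X.anti ?E) = \<mu> i \<odot>\<^bsub>A\<^esub> (?K \<otimes>\<^bsub>A\<^esub> (\<mu>' i \<odot>\<^bsub>A\<^esub> (?E \<otimes>\<^bsub>A\<^esub> ?Kb) \<oplus>\<^bsub>A\<^esub> \<rho> \<otimes>\<^bsub>A\<^esub> ?E)) \<oplus>\<^bsub>A\<^esub>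
          (\<mu>' i \<odot>\<^bsub>A\<^esub> (?E \<otimes>\<^bsub>A\<^esub> ?Kb) \<oplus>\<^bsub>A\<^esub> \<rho> \<otimes>\<^bsub>A\<^esub> ?E) \<otimes>\<^bsub>A\<^esub> \<rho>"
        using 2 by (simp add: X.anti(3) hom Y\<rho>) (simp add: Y.anti(3))
      also have "\<dots> = (\<mu> i * \<mu>' i * ?q) \<odot>\<^bsub>A\<^esub> (e \<otimes>\<^bsub>A\<^esub> ?E) \<oplus>\<^bsub>A\<^esub> \<rho> \<otimes>\<^bsub>A\<^esub> ?E"
      proof -
        have "?K \<otimes>\<^bsub>A\<^esub> (\<rho> \<otimes>\<^bsub>A\<^esub> ?E) = \<zero>\<^bsub>A\<^esub>"
          using 2 Y.toral_r[of "gK i"] by (simp flip: A.m_assoc)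
        moreover have "?E \<otimes>\<^bsub>A\<^esub> ?Kb \<otimes>\<^bsub>A\<^esub> \<rho> = \<zero>\<^bsub>A\<^esub>"
          using 2 Y.toral_r[of "gKb i"] by (simp add: A.m_assoc)
        moreover have "\<rho> \<otimes>\<^bsub>A\<^esub> ?E \<otimes>\<^bsub>A\<^esub> \<rho> = \<rho> \<otimes>\<^bsub>A\<^esub> ?E"
        proof -
          note c = \<rho>_central[OF \<open>?E \<in> carrier A\<close>]
          have "\<rho> \<otimes>\<^bsub>A\<^esub> ?E \<otimes>\<^bsub>A\<^esub> \<rho> = ?E \<otimes>\<^bsub>A\<^esub> \<rho> \<otimes>\<^bsub>A\<^esub> \<rho>" by (simp only: c)
          also have "\<dots> = ?E \<otimes>\<^bsub>A\<^esub> \<rho>" by (simp add: A.m_assoc \<rho>_idem)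
          finally show ?thesis by (simp only: c)
        qed
        ultimately show ?thesis by (simp add: A.r_distr A.l_distr KEKb mult.assoc)
      qed
      also have "\<dots> = ?E" using 2 c(1)[of i] by (simp add: \<rho>_mult A.minus_eq A.a_lcomm A.r_neg)
      finally show ?thesis using 2 by simp
    next
      case (3 i)
      let ?F = "W (gF i)" and ?K = "W (gK i)" and ?Kb = "W (gKb i)" and ?q = "qi P i powi cartan P i i"
      have [simp]: "?F \<in> carrier A" "?K \<in> carrier A" "?Kb \<in> carrier A" using 3 by simp_all
      have KFKb: "?Kb \<otimes>\<^bsub>A\<^esub> (?F \<otimes>\<^bsub>A\<^esub> ?K) = ?q \<odot>\<^bsub>A\<^esub> (e \<otimes>\<^bsub>A\<^esub> ?F)"
      proof -
        have "?Kb \<otimes>\<^bsub>A\<^esub> (?F \<otimes>\<^bsub>A\<^esub> ?K) = (?Kb \<otimes>\<^bsub>A\<^esub> ?F) \<otimes>\<^bsub>A\<^esub> ?K" by (simp add: A.m_assoc)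
        also have "\<dots> = ?q \<odot>\<^bsub>A\<^esub> (?F \<otimes>\<^bsub>A\<^esub> e)"
          using F.Kb_F[of i i] 3 by (simp add: qcomm_def A.m_assoc F.KbK)
        finally show ?thesis using 3 by (simp add: F.e_F)
      qed
      have "Y.anti (X.anti ?F) = \<nu> i \<odot>\<^bsub>A\<^esub> (?Kb \<otimes>\<^bsub>A\<^esub> (\<nu>' i \<odot>\<^bsub>A\<^esub> (?F \<otimes>\<^bsub>A\<^esub> ?K) \<oplus>\<^bsub>A\<^esub> \<rho> \<otimes>\<^bsub>A\<^esub> ?F)) \<oplus>\<^bsub>A\<^esub>
          (\<nu>' i \<odot>\<^bsub>A\<^esub> (?F \<otimes>\<^bsub>A\<^esub> ?K) \<oplus>\<^bsub>A\<^esub> \<rho> \<otimes>\<^bsub>A\<^esub> ?F) \<otimes>\<^bsub>A\<^esub> \<rho>"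
        using 3 by (simp add: X.anti(3) hom Y\<rho>) (simp add: Y.anti(3))
      also have "\<dots> = (\<nu> i * \<nu>' i * ?q) \<odot>\<^bsub>A\<^esub> (e \<otimes>\<^bsub>A\<^esub> ?F) \<oplus>\<^bsub>A\<^esub> \<rho> \<otimes>\<^bsub>A\<^esub> ?F"
      proof -
        have "?Kb \<otimes>\<^bsub>A\<^esub> (\<rho> \<otimes>\<^bsub>A\<^esub> ?F) = \<zero>\<^bsub>A\<^esub>"
          using 3 Y.toral_r[of "gKb i"] by (simp flip: A.m_assoc)
        moreover have "?F \<otimes>\<^bsub>A\<^esub> ?K \<otimes>\<^bsub>A\<^esub> \<rho> = \<zero>\<^bsub>A\<^esub>"
          using 3 Y.toral_r[of "gK i"] by (simp add: A.m_assoc)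
        moreover have "\<rho> \<otimes>\<^bsub>A\<^esub> ?F \<otimes>\<^bsub>A\<^esub> \<rho> = \<rho> \<otimes>\<^bsub>A\<^esub> ?F"
        proof -
          note c = \<rho>_central[OF \<open>?F \<in> carrier A\<close>]
          have "\<rho> \<otimes>\<^bsub>A\<^esub> ?F \<otimes>\<^bsub>A\<^esub> \<rho> = ?F \<otimes>\<^bsub>A\<^esub> \<rho> \<otimes>\<^bsub>A\<^esub> \<rho>" by (simp only: c)
          also have "\<dots> = ?F \<otimes>\<^bsub>A\<^esub> \<rho>" by (simp add: A.m_assoc \<rho>_idem)
          finally show ?thesis by (simp only: c)
        qed
        ultimately show ?thesis by (simp add: A.r_distr A.l_distr KFKb mult.assoc)
      qed
      also have "\<dots> = ?F" using 3 c(2)[of i] by (simp add: \<rho>_mult A.minus_eq A.a_lcomm A.r_neg)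
      finally show ?thesis using 3 by simp
    qed
  qed
qed

text \<open>The inverse is the member of the family with \<mu> and \<nu> exchanged, because -1 times
  \<open>\<nu>0 i\<close> is the inverse of q_i^(a_ii).\<close>

lemma bij_anti_\<rho>: "bij_betw (wU_anti.anti P (\<lambda>i. - 1) \<nu>0 \<rho>) (carrier A) (carrier A)"
proof -
  have 1: "wU_anti P (\<lambda>i. - 1) \<nu>0 \<rho>" and 2: "wU_anti P \<nu>0 (\<lambda>i. - 1) \<rho>"
    by (rule wU_anti_\<rho>; use qi_neq in simp)+
  interpret X: wU_anti P "\<lambda>i. - 1" \<nu>0 \<rho> by (rule 1)
  interpret Y: wU_anti P \<nu>0 "\<lambda>i. - 1" \<rho> by (rule 2)
  show ?thesis
    by (rule bij_betwI[of _ _ _ Y.anti])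
      (use X.anti_simps(2) Y.anti_simps(2) anti_comp[OF 1 2] anti_comp[OF 2 1] qi_neq in auto)
qed

text \<open>The conditions on \<open>r\<close> remove the second summand of \<open>anti_gen\<close>.
  They hold for r = 0, and also for r = \<rho> if all generators are of type zero, which makes
  \<open>wT\<close> bijective in that case.\<close>

lemma wT_eq_anti:
  assumes "wU_anti P (\<lambda>i. - 1) \<nu>0 r"
    and "\<And>i. i \<in> idx P \<Longrightarrow> r \<otimes>\<^bsub>A\<^esub> W (gE i) = \<zero>\<^bsub>A\<^esub>" "\<And>i. i \<in> idx P \<Longrightarrow> r \<otimes>\<^bsub>A\<^esub> W (gF i) = \<zero>\<^bsub>A\<^esub>"
  shows "wT P = wU_anti.anti P (\<lambda>i. - 1) \<nu>0 r"
proof -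
  interpret X: wU_anti P "\<lambda>i. - 1" \<nu>0 r by (rule assms(1))
  have "X.T g = T_gen P g" if "g \<in> gens (idx P)" for g
    using that
  proof (cases rule: gens_cases)
    case 1
    then show ?thesis unfolding toral_gens_def by (elim UnE imageE singletonE) simp_all
  next
    case (2 i)
    then show ?thesis by (simp add: assms A.minus_one_smult)
  next
    case (3 i)
    then have "W (gK i) \<otimes>\<^bsub>A\<^esub> W (gF i) = inverse (qi P i powi cartan P i i) \<odot>\<^bsub>A\<^esub> (W (gF i) \<otimes>\<^bsub>A\<^esub> W (gK i))"
      using F.K_F[of i i] by (simp add: qcomm_def)
    then show ?thesis using 3 by (simp add: assms A.minus_one_smult)
  qed
  then show ?thesis
    unfolding wT_def X.anti_def alg_anti_hom_iff_op by (metis (no_types, lifting))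
qed

text \<open>J is group-like and fixed by the map, so the triple convolution at J is the product J J
  J.\<close>

lemma J_cube_of_weak_antipode:
  assumes "weak_antipode H (wT P)"
  shows "W gJ [^]\<^bsub>A\<^esub> (3::nat) = W gJ"
proof -
  interpret X: wU_anti P "\<lambda>i. - 1" \<nu>0 "\<zero>\<^bsub>A\<^esub>" by (rule wU_anti_zero)
  have T: "wT P = X.anti" by (rule wT_eq_anti[OF wU_anti_zero]) simp_all
  have lin: "k_linear A A X.anti" using alg_homD(1)[OF X.anti(2)] by (simp add: k_linear_def)
  have J: "\<Delta> (W gJ) = pt2 (W gJ) (W gJ)" by (rule \<Delta>_grouplike) simp
  have "W gJ = conv (conv (\<lambda>x. x) X.anti) (\<lambda>x. x) (W gJ)"
    using assms W_closed[of gJ] unfolding weak_antipode_def T by (simp add: id_def)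
  also have "\<dots> = conv (\<lambda>x. x) X.anti (W gJ) \<otimes>\<^bsub>A\<^esub> W gJ"
    by (subst J, subst conv_lift(2)[OF conv_linear[OF k_linear_id lin] k_linear_id]) simp_all
  also have "conv (\<lambda>x. x) X.anti (W gJ) = W gJ \<otimes>\<^bsub>A\<^esub> W gJ"
    by (subst J, subst conv_lift(2)[OF k_linear_id lin]) (simp_all add: X.anti(3))
  finally show ?thesis by (simp add: numeral_3_eq_3)
qed

lemma not_commutative:
  assumes "(2 :: 'k) * 2 \<noteq> 1" "(2 :: 'k) \<noteq> 0"
  shows "\<not> commutative_alg H"
  using EF_not_commute[OF assms] one_in_idx by (auto simp: commutative_alg_def)

text \<open>K_i and its partner have the same value, as \<open>wU_rels_ground\<close> requires, and
  this value differs from that of the unit in the coproduct of E_i.\<close>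

fun sign_gen :: "gen \<Rightarrow> 'k" where
  "sign_gen (gE i) = 0"
| "sign_gen (gF i) = 0"
| "sign_gen (gK i) = - 1"
| "sign_gen (gKb i) = - 1"
| "sign_gen g = 1"

text \<open>The map id \<otimes> \<chi> sends the flipped coproduct of E_1 to E_1 and the coproduct
  itself to - E_1, whatever the type of E_1, since \<chi> maps both possible units to 1. The two
  differ because E_1 = 0 would contradict \<open>EF_not_commute\<close>.\<close>

lemma not_cocommutative:
  assumes "(2 :: 'k) * 2 \<noteq> 1" "(2 :: 'k) \<noteq> 0"
  shows "\<not> cocommutative H"
proof
  assume coc: "cocommutative H"
  let ?E = "W (gE 1)" and ?K = "W (gK 1)"
  note i = one_in_idx and [simp del] = One_nat_def
  have [simp]: "?E \<in> carrier A" "?K \<in> carrier A" using i by simp_all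
  have "wU_rels P (ground :: ('k, 'k) module) sign_gen"
    by (rule wU_rels_ground) (auto simp: toral_gens_def)
  then obtain \<chi> where \<chi>: "alg_hom A ground \<chi>" "\<forall>g\<in>gens (idx P). \<chi> (W g) = sign_gen g"
    using wU_hom_exists[OF kalg_ground] by blast
  have \<chi>g: "\<chi> ?E = 0" "\<chi> ?K = - 1" "\<chi> (W gJ) = 1" using \<chi>(2) i by auto
  have "\<chi> e = 1"
    unfolding J_idem_def by (subst alg_hom_pow[OF A.kalg_axioms kalg_ground \<chi>(1)]) (simp_all add: \<chi>g pow_ground)
  then have \<chi>u: "\<chi> (uE 1) = 1"
    using type_unit_cases[of "type_E P 1"] alg_homD(6)[OF \<chi>(1)] by auto
  let ?flip = "tensor_lift A A T2 (\<lambda>a b. pt2 b a)"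
  have bflip: "bilin A A T2 (\<lambda>a b. pt2 b a)"
    by (auto simp: bilin_def k_linear_def AA.pt_add_l AA.pt_add_r AA.pt_smult_l AA.pt_smult_r)
  note fl = AA.tensor_lift[OF AA.T.kalg_axioms bflip]
  have "?flip (\<Delta> ?E) = \<Delta> ?E"
    using coc i unfolding cocommutative_def by simp
  then have eq: "pt2 ?E (uE 1) \<oplus>\<^bsub>T2\<^esub> pt2 ?K ?E = pt2 (uE 1) ?E \<oplus>\<^bsub>T2\<^esub> pt2 ?E ?K"
    using i by (simp add: \<Delta>_EF k_linearD[OF fl(1)] fl(2))
  let ?L = "tensor_lift A A A (\<lambda>a b. \<chi> b \<odot>\<^bsub>A\<^esub> a)"
  note L = AA.tensor_lift[OF A.kalg_axioms A.bilin_smult'[OF alg_homD(1)[OF \<chi>(1)]]]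
  have "?L (pt2 ?E (uE 1) \<oplus>\<^bsub>T2\<^esub> pt2 ?K ?E) = ?E"
    by (simp add: k_linearD[OF L(1)] L(2) \<chi>u \<chi>g)
  moreover have "?L (pt2 (uE 1) ?E \<oplus>\<^bsub>T2\<^esub> pt2 ?E ?K) = (- 1) \<odot>\<^bsub>A\<^esub> ?E"
    by (simp add: k_linearD[OF L(1)] L(2) \<chi>g)
  ultimately have E: "?E = (- 1) \<odot>\<^bsub>A\<^esub> ?E" using eq by simp
  have "2 \<odot>\<^bsub>A\<^esub> ?E = 1 \<odot>\<^bsub>A\<^esub> ?E \<oplus>\<^bsub>A\<^esub> 1 \<odot>\<^bsub>A\<^esub> ?E"
    by (simp only: A.smult_l_distr[symmetric] one_add_one \<open>?E \<in> carrier A\<close>)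
  also have "\<dots> = 1 \<odot>\<^bsub>A\<^esub> ?E \<oplus>\<^bsub>A\<^esub> (- 1) \<odot>\<^bsub>A\<^esub> ?E"
    unfolding E[symmetric] by simp
  also have "\<dots> = 2 \<odot>\<^bsub>A\<^esub> \<zero>\<^bsub>A\<^esub>" by (simp add: A.uminus_smult A.r_neg)
  finally have *: "2 \<odot>\<^bsub>A\<^esub> ?E = 2 \<odot>\<^bsub>A\<^esub> \<zero>\<^bsub>A\<^esub>" .
  have "?E = \<zero>\<^bsub>A\<^esub>" by (rule A.smult_cancel[OF assms(2) _ _ *]) simp_all
  then show False using EF_not_commute[OF assms] i by simp
qed

lemma not_hopf: "\<not> hopf_algebra H"
proof
  assume "hopf_algebra H"
  then obtain S where S: "k_linear A A S" "\<And>x. x \<in> carrier A \<Longrightarrow> conv S (\<lambda>x. x) x = \<epsilon> x \<odot>\<^bsub>A\<^esub> \<one>\<^bsub>A\<^esub>"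
    by (auto simp: hopf_algebra_def id_def)
  have "wU_rels P (ground :: ('k, 'k) module) (\<lambda>g. 0)"
    by (rule wU_rels_ground) (use Jexp_ge_2 in auto)
  then obtain \<chi> where \<chi>: "alg_hom A ground \<chi>" "\<forall>g\<in>gens (idx P). \<chi> (W g) = 0"
    using wU_hom_exists[OF kalg_ground] by blast
  have J: "\<Delta> (W gJ) = pt2 (W gJ) (W gJ)" by (rule \<Delta>_grouplike) simp
  have "\<one>\<^bsub>A\<^esub> = conv S (\<lambda>x. x) (W gJ)"
    using S(2)[of "W gJ"] \<epsilon>_grouplike[of gJ] by simp
  also have "\<dots> = S (W gJ) \<otimes>\<^bsub>A\<^esub> W gJ"
    by (subst J, subst conv_lift(2)[OF S(1) k_linear_id]) simp_all
  finally have "\<chi> \<one>\<^bsub>A\<^esub> = \<chi> (S (W gJ)) * \<chi> (W gJ)"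
    using alg_homD(5)[OF \<chi>(1)] k_linearD(1)[OF S(1), of "W gJ"] by simp
  then show False using \<chi> alg_homD(6)[OF \<chi>(1)] by simp
qed

end

theorem mainTheorem1:
  fixes P :: "'k::field_char_0 wU_data"
  assumes "wU_datum P"
  shows "(bialgebra (wU P) \<and> weak_antipode (wU P) (wT P) \<longleftrightarrow> Jexp P = 2 \<or> Jexp P = 3) \<and>
    (Jexp P = 2 \<or> Jexp P = 3 \<longrightarrow>
      \<not> commutative_alg (wU P) \<and>
      \<not> cocommutative (wU P) \<and>
      weak_hopf_algebra (wU P) \<and>
      weak_antipode (wU P) (wT P) \<and>
      ((\<forall>i\<in>idx P. type_E P i = 0 \<and> type_F P i = 0) \<longrightarrow>
        bij_betw (wT P) (carrier (wU P)) (carrier (wU P))) \<and>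
      \<not> hopf_algebra (wU P))"
proof -
  interpret wU_setup P by unfold_locales (rule assms)
  \<comment> \<open>What the module and the sign character need from characteristic 0: 2 can be
    cancelled and differs from its inverse.\<close>
  have c: "(2 :: 'k) * 2 \<noteq> 1" "(2 :: 'k) \<noteq> 0" by simp_all
  have anti_\<rho>: "wU_anti P (\<lambda>i. - 1) \<nu>0 \<rho>" by (rule wU_anti_\<rho>) (use qi_neq in simp)
  have weak: "weak_antipode (wU P) (wT P)" and hopf: "weak_hopf_algebra (wU P)" if m: "Jexp P = 2 \<or> Jexp P = 3"
  proof -
    \<comment> \<open>The choice r = 0 is \<open>wT\<close>; the choice r = \<rho> is the bijective
      weak antipode.\<close>
    have 1: "wU_weak P (\<lambda>i. - 1) \<nu>0 \<zero>\<^bsub>wU_alg P\<^esub>" and 2: "wU_weak P (\<lambda>i. - 1) \<nu>0 \<rho>"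
      using wU_anti_zero anti_\<rho> m by (simp_all add: wU_weak_def wU_weak_axioms_def)
    have "wT P = wU_anti.anti P (\<lambda>i. - 1) \<nu>0 \<zero>\<^bsub>wU_alg P\<^esub>"
      by (rule wT_eq_anti[OF wU_anti_zero]) simp_all
    then show "weak_antipode (wU P) (wT P)" using wU_weak.weak_antipode_S[OF 1] by simp
    show "weak_hopf_algebra (wU P)"
      unfolding weak_hopf_algebra_def
      using bialgebra_wU wU_weak.weak_antipode_S[OF 2] bij_anti_\<rho> by auto
  qed
  \<comment> \<open>If all types are zero, \<rho> annihilates every E_i and F_i, so
    \<open>wT\<close> coincides with the member for r = \<rho>, whose bijectivity is known.\<close>
  have bij: "bij_betw (wT P) (carrier (wU P)) (carrier (wU P))"
    if "\<forall>i\<in>idx P. type_E P i = 0 \<and> type_F P i = 0"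
    using wT_eq_anti[OF anti_\<rho>] that bij_anti_\<rho> by (simp add: \<rho>_type_zero)
  have "Jexp P = 2 \<or> Jexp P = 3" if "weak_antipode (wU P) (wT P)"
    using J_cube_of_weak_antipode[OF that] J_cube_neq by blast
  then show ?thesis
    using bialgebra_wU weak hopf bij not_commutative[OF c] not_cocommutative[OF c] not_hopf by blast
qed

end
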